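(* Let $g\ge 0$, $n^+,n^-\ge1$, $n=n^++n^-$, with $2g-2+n\ge 2$. For all $L=(L^+,L^-)\in\Lambda_{n^+,n^-}$, $$\begin{aligned} (2g-2+n)V_{g,n^+,n^-}(L^+|L^-)=&\ \tfrac12\sum_{i\ne j}(L_i^++L_j^+)\,V_{g,n^+-1,n^-}(L_i^++L_j^+,L^+_{\{i,j\}^c}|L^-)\\ &+\sum_{i}\sum_{j}[L_i^+-L_j^-]_+\,V_{g,n^+,n^--1}([L_i^+-L_j^-]_+,L^+_{\{i\}^c}|L^-_{\{j\}^c})\\ &+\tfrac12\sum_i\int_0^{L_i^+}V_{g-1,n^++1,n^-}(x,L_i^+-x,L^+_{\{i\}^c}|L^-)\,x(L_i^+-x)\,dx\\ &+\tfrac12\sum_i\ \sum_{\substack{g_1+g_2=g\\ I_1^\pm\sqcup I_2^\pm=I^\pm}}{}^{'}\ x_1x_2\,V_{g_1,n_1^++1,n_1^-}(x_1,L^+_{I_1^+}|L^-_{I_1^-})\,V_{g_2,n_2^++1,n_2^-}(x_2,L^+_{I_2^+}|L^-_{I_2^-}), \end{aligned}$$ where in the last line $I^+=\{1,\dots,n^+\}\setminus\{i\}$, $I^-=\{1,\dots,n^-\}$, the sum is over ordered decompositions, $n_l^\pm=\#I_l^\pm$, and $x_l=\sum_{j\in I_l^-}L_j^--\sum_{j\in I_l^+}L_j^+$ for $l=1,2$. The sums over $i\neq j$ are over ordered pairs of distinct indices in $\{1,\dots,n^+\}$; in the second line $i\in\{1,\dots,n^+\}$, $j\in\{1,\dots,n^-\}$.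 The prime means that only stable triples, $2g_l-2+(n_l^++1)+n_l^->0$ for $l=1,2$, are included.
   Context: A ribbon graph $R$ is a finite set $XR$ (half-edges) with permutations $s_0,s_1,s_2$ of $XR$ such that $s_1$ is an involution without fixed points and $s_2s_1s_0=\mathrm{id}$. The sets $X_0R,X_1R,X_2R$ of orbits of $s_0,s_1,s_2$ are the vertices, edges and boundary components of $R$; $[e]_i$ is the orbit of $e\in XR$ under $s_i$; the degree of a vertex is its number of half-edges. $R$ is connected if $\langle s_0,s_1,s_2\rangle$ acts transitively on $XR$, and then its genus $g$ is defined by $2-2g=\#X_0R-\#X_1R+\#X_2R$. A direction is a map $\epsilon:XR\to\{\pm1\}$ with $\epsilon\circ s_2=\epsilon$ and $\epsilon\circ s_1=-\epsilon$; a directed ribbon graph is $R^\circ=(R,\epsilon)$. As $\epsilon$ is constant on boundary components, these split into positive and negative ones. $R^\circ$ is of type $(g,n^+,n^-)$ if it is connected of genus $g$ with $n^+$ positive boundary components labelled $1,\dots,n^+$ and $n^-$ negative ones labelled $1,\dots,n^-$; isomorphisms are bijections of half-edges commuting with all $s_i$ and preserving $\epsilon$ and the labels, and $\mathrm{Aut}(R^\circ)$ is the corresponding automorphism group. A metric is a map $m:X_1R\to\mathbb R_{>0}$; the length of $\beta\in X_2R$ is $\sum_{e\in XR,\,[e]_2=\beta}m_{[e]_1}$. Let $\Lambda_{n^+,n^-}=\{(L^+,L^-)\in\mathbb R_{>0}^{n^+}\times\mathbb R_{>0}^{n^-}:\sum_iL_i^+=\sum_jL_j^-\}$. For $L\in\Lambda_{n^+,n^-}$,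 $\mathrm{Met}(R^\circ,L)$ is the set of metrics whose positive (negative) boundary lengths are $L^+$ (resp. $L^-$). It lies in an affine space directed by the kernel $K_R\subset\mathbb R^{X_1R}$ of the linear boundary-length map $\mathbb R^{X_1R}\to\mathbb R^{X_2R}$, and it carries the Lebesgue measure for which $K_R\cap\mathbb Z^{X_1R}$ has covolume one (counting measure if $K_R=0$). For $g\ge0$, $n^\pm\ge1$, $2g-2+n^++n^->0$, $$V_{g,n^+,n^-}(L^+|L^-)=\sum_{R^\circ}\frac{1}{\#\mathrm{Aut}(R^\circ)}\mathrm{vol}(\mathrm{Met}(R^\circ,L)),$$ the sum being over isomorphism classes of directed ribbon graphs of type $(g,n^+,n^-)$ all of whose vertices have degree $4$. (One has $V_{0,2,1}=V_{0,1,2}=1$, the initial conditions of the recursion.) Conventions: $[x]_+=\max(x,0)$; $L_J=(L_j)_{j\in J}$ and $L_{J^c}$ is the vector of the entries with index not in $J$. A term is $0$ if it involves a volume with negative genus or without a positive or negative boundary component, or if one of the arguments $[L_i^+-L_j^-]_+$, $x_1$, $x_2$ is not strictly positive. *)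

theory Defs
  imports
    "HOL-Analysis.Analysis"
    "HOL-Algebra.Bij"
    "HOL-Algebra.Generated_Groups"
    "HOL-Combinatorics.Permutations"
    "HOL-Combinatorics.Orbits"
begin

section \<open>Ribbon graphs\<close>

record 'h ribbon_graph =
  halfedges :: "'h set"
  perm0 :: "'h \<Rightarrow> 'h"
  perm1 :: "'h \<Rightarrow> 'h"
  perm2 :: "'h \<Rightarrow> 'h"

text \<open>A permutation of the set of half-edges is the identity outside that set
  (\<^const>\<open>permutes\<close>), so the relation below is an equation between total functions.\<close>

definition is_ribbon_graph :: "('h, 'x) ribbon_graph_scheme \<Rightarrow> bool" where
  "is_ribbon_graph R \<longleftrightarrow>
     finite (halfedges R) \<and>
     perm0 R permutes halfedges R \<and>
     perm1 R permutes halfedges R \<and>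
     perm2 R permutes halfedges R \<and>
     (\<forall>e \<in> halfedges R. perm1 R (perm1 R e) = e \<and> perm1 R e \<noteq> e) \<and>
     perm2 R \<circ> perm1 R \<circ> perm0 R = id"

definition vertices :: "('h, 'x) ribbon_graph_scheme \<Rightarrow> 'h set set" where
  "vertices R = orbit (perm0 R) ` halfedges R"

definition edges :: "('h, 'x) ribbon_graph_scheme \<Rightarrow> 'h set set" where
  "edges R = orbit (perm1 R) ` halfedges R"

definition boundaries :: "('h, 'x) ribbon_graph_scheme \<Rightarrow> 'h set set" where
  "boundaries R = orbit (perm2 R) ` halfedges R"

definition four_valent :: "('h, 'x) ribbon_graph_scheme \<Rightarrow> bool" where
  "four_valent R \<longleftrightarrow> (\<forall>v \<in> vertices R. card v = 4)"

definition connected_rg :: "('h, 'x) ribbon_graph_scheme \<Rightarrow> bool" where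
  "connected_rg R \<longleftrightarrow>
     (\<forall>x \<in> halfedges R. \<forall>y \<in> halfedges R.
        \<exists>h \<in> generate (BijGroup (halfedges R))
                ((\<lambda>s. restrict s (halfedges R)) ` {perm0 R, perm1 R, perm2 R}).
          h x = y)"

definition has_genus :: "('h, 'x) ribbon_graph_scheme \<Rightarrow> int \<Rightarrow> bool" where
  "has_genus R g \<longleftrightarrow>
     2 - 2 * g = int (card (vertices R)) - int (card (edges R)) + int (card (boundaries R))"

section \<open>Directed ribbon graphs with labelled boundary components\<close>

text \<open>The labels of the positive (negative) boundary components run from \<open>0\<close> to \<open>np - 1\<close>
  (from \<open>0\<close> to \<open>nm - 1\<close>), in accordance with the indexing of lists. A single label map serves
  both signs, and the two kinds of components are numbered independently. The values of the
  direction outside the half-edges and of the label outside the boundary components are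
  irrelevant.\<close>

record 'h directed_ribbon_graph = "'h ribbon_graph" +
  direction :: "'h \<Rightarrow> int"
  label :: "'h set \<Rightarrow> nat"

definition is_direction :: "('h, 'x) ribbon_graph_scheme \<Rightarrow> ('h \<Rightarrow> int) \<Rightarrow> bool" where
  "is_direction R \<epsilon> \<longleftrightarrow>
     (\<forall>e \<in> halfedges R. \<epsilon> e \<in> {1, -1} \<and> \<epsilon> (perm2 R e) = \<epsilon> e \<and> \<epsilon> (perm1 R e) = - \<epsilon> e)"

definition signed_boundaries :: "'h directed_ribbon_graph \<Rightarrow> int \<Rightarrow> 'h set set" where
  "signed_boundaries R s = {\<beta> \<in> boundaries R. \<forall>e \<in> \<beta>. direction R e = s}"

definition is_directed_rg :: "int \<Rightarrow> nat \<Rightarrow> nat \<Rightarrow> 'h directed_ribbon_graph \<Rightarrow> bool" where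
  "is_directed_rg g np nm R \<longleftrightarrow>
     is_ribbon_graph R \<and> is_direction R (direction R) \<and>
     connected_rg R \<and> has_genus R g \<and>
     bij_betw (label R) (signed_boundaries R 1) {..<np} \<and>
     bij_betw (label R) (signed_boundaries R (-1)) {..<nm}"

text \<open>Isomorphisms are made extensional so that automorphisms can be counted.\<close>

definition isos :: "'h directed_ribbon_graph \<Rightarrow> 'k directed_ribbon_graph \<Rightarrow> ('h \<Rightarrow> 'k) set" where
  "isos R R' =
     {f \<in> extensional (halfedges R). bij_betw f (halfedges R) (halfedges R') \<and>
        (\<forall>e \<in> halfedges R.
           f (perm0 R e) = perm0 R' (f e) \<and>
           f (perm1 R e) = perm1 R' (f e) \<and>
           f (perm2 R e) = perm2 R' (f e) \<and>
           direction R' (f e) = direction R e) \<and>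
        (\<forall>\<beta> \<in> boundaries R. label R' (f ` \<beta>) = label R \<beta>)}"

abbreviation auts :: "'h directed_ribbon_graph \<Rightarrow> ('h \<Rightarrow> 'h) set" where
  "auts R \<equiv> isos R R"

text \<open>Half-edge sets are finite, so every isomorphism class has a representative whose half-edges
  are natural numbers.\<close>

definition four_valent_graphs :: "int \<Rightarrow> nat \<Rightarrow> nat \<Rightarrow> nat directed_ribbon_graph set" where
  "four_valent_graphs g np nm = {R. is_directed_rg g np nm R \<and> four_valent R}"

definition iso_classes :: "int \<Rightarrow> nat \<Rightarrow> nat \<Rightarrow> nat directed_ribbon_graph set set" where
  "iso_classes g np nm =
     four_valent_graphs g np nm //
       {(R, R'). R \<in> four_valent_graphs g np nm \<and> R' \<in> four_valent_graphs g np nm \<and> isos R R' \<noteq> {}}"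

section \<open>Metrics and volumes\<close>

text \<open>The space of real functions on the set of edges is realised as the space of functions on
  sets of half-edges that vanish outside the set of edges.\<close>

definition edge_functions :: "('h, 'x) ribbon_graph_scheme \<Rightarrow> ('h set \<Rightarrow> real) set" where
  "edge_functions R = {m. \<forall>a. a \<notin> edges R \<longrightarrow> m a = 0}"

definition boundary_length :: "('h, 'x) ribbon_graph_scheme \<Rightarrow> ('h set \<Rightarrow> real) \<Rightarrow> 'h set \<Rightarrow> real" where
  "boundary_length R m \<beta> =
     (\<Sum>e | e \<in> halfedges R \<and> orbit (perm2 R) e = \<beta>. m (orbit (perm1 R) e))"

definition Met :: "'h directed_ribbon_graph \<Rightarrow> real list \<Rightarrow> real list \<Rightarrow> ('h set \<Rightarrow> real) set" where
  "Met R Lp Lm =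
     {m \<in> edge_functions R. (\<forall>a \<in> edges R. m a > 0) \<and>
        (\<forall>\<beta> \<in> signed_boundaries R 1. boundary_length R m \<beta> = Lp ! label R \<beta>) \<and>
        (\<forall>\<beta> \<in> signed_boundaries R (-1). boundary_length R m \<beta> = Lm ! label R \<beta>)}"

definition kernel_space :: "('h, 'x) ribbon_graph_scheme \<Rightarrow> ('h set \<Rightarrow> real) set" where
  "kernel_space R = {m \<in> edge_functions R. \<forall>\<beta> \<in> boundaries R. boundary_length R m \<beta> = 0}"

definition kernel_lattice :: "('h, 'x) ribbon_graph_scheme \<Rightarrow> ('h set \<Rightarrow> real) set" where
  "kernel_lattice R = {m \<in> kernel_space R. \<forall>a. m a \<in> \<int>}"

definition is_int_basis :: "('a \<Rightarrow> real) set \<Rightarrow> ('a \<Rightarrow> real) set \<Rightarrow> bool" where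
  "is_int_basis B \<Lambda> \<longleftrightarrow> finite B \<and> B \<subseteq> \<Lambda> \<and>
     (\<forall>v \<in> \<Lambda>. \<exists>!c. c \<in> B \<rightarrow>\<^sub>E (UNIV :: int set) \<and> v = (\<lambda>a. \<Sum>b\<in>B. of_int (c b) * b a))"

text \<open>Coordinates with respect to a basis \<open>B\<close> of the lattice of integer points in the kernel identify
  the affine space through \<open>m0\<close> with the space of real functions on \<open>B\<close>, and the lattice with
  the integer-valued ones. So the Lebesgue measure for which the lattice has covolume one is the
  product Lebesgue measure in these coordinates. It does not depend on \<open>B\<close> and \<open>m0\<close>. If the
  kernel is zero, then \<open>B\<close> is empty and the product measure is the counting measure on a point.\<close>

definition vol_Met :: "'h directed_ribbon_graph \<Rightarrow> real list \<Rightarrow> real list \<Rightarrow> real" where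
  "vol_Met R Lp Lm =
     (let B = (SOME B. is_int_basis B (kernel_lattice R));
          m0 = (SOME m. m \<in> Met R Lp Lm)
      in measure (\<Pi>\<^sub>M b\<in>B. lborel)
           {t \<in> B \<rightarrow>\<^sub>E UNIV. (\<lambda>a. m0 a + (\<Sum>b\<in>B. t b * b a)) \<in> Met R Lp Lm})"

definition Lambda :: "nat \<Rightarrow> nat \<Rightarrow> (real list \<times> real list) set" where
  "Lambda np nm =
     {(Lp, Lm). length Lp = np \<and> length Lm = nm \<and>
        (\<forall>x \<in> set Lp. x > 0) \<and> (\<forall>x \<in> set Lm. x > 0) \<and> sum_list Lp = sum_list Lm}"

text \<open>The numbers of boundary components are the lengths of the lists of arguments. The function
  is extended by zero outside its domain of definition: negative genus, no positive or no negative
  boundary component, unstable type, or arguments that are not in \<open>Lambda\<close> (for instance because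
  one of them is not strictly positive).\<close>

definition V :: "int \<Rightarrow> real list \<Rightarrow> real list \<Rightarrow> real" where
  "V g Lp Lm =
     (if g \<ge> 0 \<and> length Lp \<ge> 1 \<and> length Lm \<ge> 1 \<and>
         2 * g - 2 + int (length Lp) + int (length Lm) > 0 \<and>
         (Lp, Lm) \<in> Lambda (length Lp) (length Lm)
      then \<Sum>C \<in> iso_classes g (length Lp) (length Lm).
             let R = (SOME R. R \<in> C) in 1 / real (card (auts R)) * vol_Met R Lp Lm
      else 0)"

section \<open>Auxiliary notation for the recursion\<close>

definition pos_part :: "real \<Rightarrow> real" where
  "pos_part x = max x 0"

definition gap :: "real list \<Rightarrow> real list \<Rightarrow> nat set \<Rightarrow> nat set \<Rightarrow> real" where
  "gap Lp Lm Jp Jm = (\<Sum>j\<in>Jm. Lm ! j) - (\<Sum>j\<in>Jp. Lp ! j)"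

text \<open>Ordered decompositions \<open>(g1, g2, I1p, I2p, I1m, I2m)\<close> of the genus and of the index sets
  \<open>{..<np} - {i}\<close> and \<open>{..<nm}\<close> into two stable types.\<close>

definition stable_splittings ::
  "nat \<Rightarrow> nat \<Rightarrow> nat \<Rightarrow> nat \<Rightarrow> (nat \<times> nat \<times> nat set \<times> nat set \<times> nat set \<times> nat set) set" where
  "stable_splittings g np nm i =
     {(g1, g2, I1p, I2p, I1m, I2m).
        g1 + g2 = g \<and>
        I1p \<union> I2p = {..<np} - {i} \<and> I1p \<inter> I2p = {} \<and>
        I1m \<union> I2m = {..<nm} \<and> I1m \<inter> I2m = {} \<and>
        2 * int g1 - 2 + (int (card I1p) + 1) + int (card I1m) > 0 \<and>
        2 * int g2 - 2 + (int (card I2p) + 1) + int (card I2m) > 0}"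

end

theory Submission
 imports Defs
begin

text \<open>Record a four-valent directed ribbon graph on the set of its positive half-edges: \<open>sg\<close> is the
boundary permutation \<open>s\<^sub>2\<close>, and the two-cycles of an involution \<open>tu\<close> are the vertices. The cycles of \<open>sg\<close> and
of \<open>sg o tu\<close> are then the positive and the negative boundary components. Multiplying by the number of vertices
marks a vertex, that is, a pair \<open>a\<close>, \<open>b\<close> with \<open>tu a = b\<close>. Resolve it into two marked points by composing \<open>sg\<close> and
\<open>tu\<close> with the transposition of \<open>a\<close> and \<open>b\<close>. If \<open>a\<close> and \<open>b\<close> lie on different positive components, these are merged
(first line of the recursion). If they lie on the same one, it is cut into two, and either the graph stays connected
(the integral, over the length of one part) or it falls into two pieces (last line), one of which may be a circle
without vertices (second line). Each step changes the lattice of integer kernel vectors by a unimodular change of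
coordinates, so that the volumes follow from Fubini's theorem. The genera of the pieces are determined by their
numbers of vertices.\<close>

text \<open>Edges carry names: \<open>W\<close> sums over structures on a fixed edge set, where a
  graph with N vertices, hence 2N edges, occurs (2N)!/#Aut times. So V is \<open>Wn (2N)\<close>
  divided by (2N)!, symmetries never enter the surgeries, and the marked vertex can be taken to be
  the one through edge 0, whose second edge is one of 2N-1 others. Dividing (2N)! by (2N-1)(2N-2)!
  leaves 2N: this is the factor 2g-2+n on the left together with the halves on the right. The line
  with [L_i-L_j]_+ has no half because the circle can be either of the two pieces. The weights
  L_i+L_j, x(L_i-x) and x_1 x_2 arise from forgetting marked points: the positions of such a point
  fill its component. In a merger the second point stands at a prescribed distance from the first,
  so only one factor appears. In a cut, balance of lengths forces x_1 and x_2 if the graph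
  separates; otherwise an integer vector moving one unit of length between the two parts makes x a
  coordinate of the lattice. Everything is computed in \<open>ennreal\<close>, so that integrability
  matters only when returning to real numbers; finiteness then comes from the left-hand
  side.\<close>

section \<open>Lebesgue measure on finite powers of the line; translations and unimodular
  maps\<close>

abbreviation PL :: "'i set => ('i => real) measure" where
 "PL J \<equiv> Pi\<^sub>M J (%_. lborel)"

interpretation PL: product_sigma_finite "%_::'i. lborel :: real measure"
 by standard

lemma emeasure_lborel_translate:
 fixes A :: "real set"
 assumes "A \<in> sets borel"
 shows "emeasure lborel ((%x. x + c) -` A) = emeasure lborel A"
proof -
 have "emeasure lborel A = emeasure (distr lborel borel ((+) c)) A"
  by (simp add: lborel_distr_plus)
 also have "... = emeasure lborel ((+) c -` A Int space lborel)"
  using assms by (intro emeasure_distr) auto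
 also have "(+) c -` A Int space lborel = (%x. x + c) -` A"
  by (auto simp: add.commute)
 finally show ?thesis by simp
qed

lemma PL_translate:
 assumes "finite J"
 shows "distr (PL J) (PL J) (%t. \<lambda>j\<in>J. t j + s j) = PL J"
proof (rule PL.PiM_eqI[OF assms])
 show "sets (distr (PL J) (PL J) (%t. \<lambda>j\<in>J. t j + s j)) = sets (PL J)" by simp
 fix A :: "'a => real set" assume A: "!!i. i \<in> J ==> A i \<in> sets lborel"
 have meas: "(%t. \<lambda>j\<in>J. t j + s j) \<in> PL J \<rightarrow>\<^sub>M PL J"
  by measurable
 have "emeasure (distr (PL J) (PL J) (%t. \<lambda>j\<in>J. t j + s j)) (Pi\<^sub>E J A) =
  emeasure (PL J) ((%t. \<lambda>j\<in>J. t j + s j) -` (Pi\<^sub>E J A) Int space (PL J))"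
  by (rule emeasure_distr[OF meas]) (use A assms in \<open>auto intro!: sets_PiM_I_finite\<close>)
 also have "(%t. \<lambda>j\<in>J. t j + s j) -` (Pi\<^sub>E J A) Int space (PL J) = Pi\<^sub>E J (%j. (%x. x + s j) -` A j)"
  by (auto simp: space_PiM PiE_iff extensional_def)
 also have "emeasure (PL J) ... = (\<Prod>j\<in>J. emeasure lborel ((%x. x + s j) -` A j))"
 proof (rule PL.emeasure_PiM[OF assms])
  fix i assume "i \<in> J"
  then have "A i \<in> sets borel" using A by simp
  then have "(%x. x + s i) -` A i Int space borel \<in> sets borel"
   by (intro measurable_sets[where A=borel]) auto
  then show "(%x. x + s i) -` A i \<in> sets lborel" by simp
 qed
 also have "... = (\<Prod>j\<in>J. emeasure lborel (A j))"
  using A by (intro prod.cong refl emeasure_lborel_translate) simp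
 finally show "emeasure (distr (PL J) (PL J) (%t. \<lambda>j\<in>J. t j + s j)) (Pi\<^sub>E J A) = (\<Prod>j\<in>J. emeasure lborel (A j))" .
qed

lemma nn_integral_PL_translate:
 assumes "finite J" and f: "f \<in> borel_measurable (PL J)"
 shows "(\<integral>\<^sup>+t. f (\<lambda>j\<in>J. t j + s j) \<partial>PL J) = (\<integral>\<^sup>+t. f t \<partial>PL J)"
proof -
 have meas: "(%t. \<lambda>j\<in>J. t j + s j) \<in> PL J \<rightarrow>\<^sub>M PL J" by measurable
 have "(\<integral>\<^sup>+t. f t \<partial>PL J) = (\<integral>\<^sup>+t. f t \<partial>distr (PL J) (PL J) (%t. \<lambda>j\<in>J. t j + s j))"
  by (simp add: PL_translate[OF assms(1)])
 also have "... = (\<integral>\<^sup>+t. f (\<lambda>j\<in>J. t j + s j) \<partial>PL J)"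
  using f by (intro nn_integral_distr[OF meas]) simp
 finally show ?thesis by simp
qed

text \<open>The half-open cube: its integer translates tile the space exactly, with no null sets to
  discard.\<close>

definition ucube :: "'i set => ('i => real) set" where
 "ucube J = Pi\<^sub>E J (%_. {0..<1})"

lemma ucube_sets [measurable]: "finite J ==> ucube J \<in> sets (PL J)"
 unfolding ucube_def by (intro sets_PiM_I_finite) auto

lemma emeasure_ucube: "finite J ==> emeasure (PL J) (ucube J) = 1"
 unfolding ucube_def by (subst PL.emeasure_PiM) auto

definition itrans :: "'i set => ('i => int) set" where
 "itrans J = J \<rightarrow>\<^sub>E UNIV"

lemma countable_itrans: "finite J ==> countable (itrans J)"
 unfolding itrans_def by (intro countable_PiE) auto

text \<open>Only the translation by minus the coordinatewise floor brings \<open>t\<close> into the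
  cube. The count is written as an integral over the lattice so that it can be exchanged with an
  integral over \<open>t\<close>.\<close>

lemma ucube_tiling:
 assumes "t \<in> space (PL J)"
 shows "(\<integral>\<^sup>+k. indicator (ucube J) (\<lambda>j\<in>J. t j + of_int (k j)) \<partial>count_space (itrans J)) = (1::ennreal)"
proof -
 define k0 where "k0 = (\<lambda>j\<in>J. - \<lfloor>t j\<rfloor>)"
 have "(\<lambda>j\<in>J. t j + of_int (k j)) \<in> ucube J \<longleftrightarrow> k = k0" if "k \<in> itrans J" for k
 proof -
  have "(\<lambda>j\<in>J. t j + of_int (k j)) \<in> ucube J \<longleftrightarrow> (\<forall>j\<in>J. 0 \<le> t j + of_int (k j) & t j + of_int (k j) < 1)"
   by (auto simp: ucube_def PiE_iff)
  also have "... \<longleftrightarrow> (\<forall>j\<in>J. k j = k0 j)"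
  proof (intro ball_cong refl)
   fix j assume "j \<in> J"
   then show "(0 \<le> t j + of_int (k j) & t j + of_int (k j) < 1) = (k j = k0 j)"
    unfolding k0_def by simp linarith
  qed
  also have "... \<longleftrightarrow> k = k0"
   using that by (auto simp: itrans_def k0_def PiE_iff extensional_def fun_eq_iff)
  finally show ?thesis .
 qed
 then have "(\<integral>\<^sup>+k. indicator (ucube J) (\<lambda>j\<in>J. t j + of_int (k j)) \<partial>count_space (itrans J)) =
  (\<integral>\<^sup>+k. indicator {k0} k \<partial>count_space (itrans J) :: ennreal)"
  by (intro nn_integral_cong) (auto simp: indicator_def)
 also have "... = emeasure (count_space (itrans J)) {k0}"
  by (subst nn_integral_indicator) (auto simp: itrans_def k0_def)
 also have "... = 1"
  by (subst emeasure_count_space) (auto simp: itrans_def k0_def)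
 finally show ?thesis .
qed

text \<open>Uniqueness of Haar measure by the usual Fubini argument; the constant is fixed by comparing two
 fundamental domains of the integer lattice.\<close>

lemma nn_integral_PL_unimodular:
 fixes A :: "'i => 'j => real" and B :: "'j => 'i => real"
 assumes fin: "finite I" "finite J"
  and Aint: "!!i j. i \<in> I ==> j \<in> J ==> A i j \<in> \<int>"
  and Bint: "!!i j. i \<in> I ==> j \<in> J ==> B j i \<in> \<int>"
  and AB: "!!i i'. i \<in> I ==> i' \<in> I ==> (\<Sum>j\<in>J. A i j * B j i') = (if i = i' then 1 else 0)"
  and BA: "!!j j'. j \<in> J ==> j' \<in> J ==> (\<Sum>i\<in>I. B j i * A i j') = (if j = j' then 1 else 0)"
  and f [measurable]: "f \<in> borel_measurable (PL J)"
 shows "(\<integral>\<^sup>+t. f (\<lambda>j\<in>J. \<Sum>i\<in>I. t i * A i j) \<partial>PL I) = (\<integral>\<^sup>+t. f t \<partial>PL J)"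
proof -
 define T where "T t = (\<lambda>j\<in>J. \<Sum>i\<in>I. t i * A i j)" for t
 define S where "S x = (\<lambda>i\<in>I. \<Sum>j\<in>J. x j * B j i)" for x
 have [measurable]: "T \<in> PL I \<rightarrow>\<^sub>M PL J" unfolding T_def using fin by measurable
 have Tj [measurable]: "(%t. T t j) \<in> borel_measurable (Pi\<^sub>M I (%_. borel))" if "j \<in> J" for j
  unfolding T_def using that by simp measurable
 have [measurable]: "S \<in> PL J \<rightarrow>\<^sub>M PL I" unfolding S_def using fin by measurable
 interpret P1: sigma_finite_measure "PL I" using PL.sigma_finite[OF fin(1)] .
 interpret P2: sigma_finite_measure "PL J" using PL.sigma_finite[OF fin(2)] .
 interpret P12: pair_sigma_finite "PL I" "PL J" ..
 have TS: "T (S x) j = x j" if "j \<in> J" for x j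
 proof -
  have "T (S x) j = (\<Sum>i\<in>I. (\<Sum>k\<in>J. x k * B k i) * A i j)"
   using that by (simp add: T_def S_def cong: sum.cong)
  also have "... = (\<Sum>i\<in>I. \<Sum>k\<in>J. x k * (B k i * A i j))"
   by (simp add: sum_distrib_right mult.assoc)
  also have "... = (\<Sum>k\<in>J. x k * (\<Sum>i\<in>I. B k i * A i j))"
   by (subst sum.swap) (simp add: sum_distrib_left)
  also have "... = (\<Sum>k\<in>J. x k * (if k = j then 1 else 0))"
   using that by (simp add: BA cong: sum.cong)
  also have "... = x j" using that fin by (simp add: if_distrib cong: if_cong)
  finally show ?thesis .
 qed
 have ST: "S (T x) j = x j" if "j \<in> I" for x j
 proof -
  have "S (T x) j = (\<Sum>i\<in>J. (\<Sum>k\<in>I. x k * A k i) * B i j)"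
   using that by (simp add: T_def S_def cong: sum.cong)
  also have "... = (\<Sum>i\<in>J. \<Sum>k\<in>I. x k * (A k i * B i j))"
   by (simp add: sum_distrib_right mult.assoc)
  also have "... = (\<Sum>k\<in>I. x k * (\<Sum>i\<in>J. A k i * B i j))"
   by (subst sum.swap) (simp add: sum_distrib_left)
  also have "... = (\<Sum>k\<in>I. x k * (if k = j then 1 else 0))"
   using that by (simp add: AB cong: sum.cong)
  also have "... = x j" using that fin by (simp add: if_distrib cong: if_cong)
  finally show ?thesis .
 qed
 have Tadd: "T (\<lambda>i\<in>I. t i + s i) = (\<lambda>j\<in>J. T t j + T s j)" for t s
  by (auto simp: T_def fun_eq_iff sum.distrib algebra_simps cong: sum.cong)
 \<comment> \<open>\<open>g\<close> is the test function of the uniqueness argument. Being the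
   indicator of a unit cube it has integral 1, also after a reflection and a translation
   (\<open>neg\<close>).\<close>
 define g :: "('j => real) => ennreal" where "g = indicator (ucube J)"
 have [measurable]: "g \<in> borel_measurable (PL J)" unfolding g_def using fin by measurable
 have intg: "(\<integral>\<^sup>+x. g x \<partial>PL J) = 1"
  unfolding g_def using emeasure_ucube[OF fin(2)] fin by (simp add: nn_integral_indicator)
 \<comment> \<open>The constant relating the two measures is the measure of the preimage of the cube
   under \<open>T\<close>. It is 1: \<open>T\<close> maps the integer lattice onto the integer
   lattice, so this preimage and the cube in the coordinates \<open>I\<close> are both fundamental
   domains, and cutting each by the translates of the other exchanges them.\<close>
 have gT: "(\<integral>\<^sup>+t. g (T t) \<partial>PL I) = 1"
 proof -
  let ?C = "indicator (ucube I) :: _ => ennreal"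
  have [measurable]: "?C \<in> borel_measurable (PL I)" using fin by measurable
  define K where "K = itrans I"
  interpret CK: sigma_finite_measure "count_space K"
   unfolding K_def by (rule sigma_finite_measure_count_space_countable[OF countable_itrans[OF fin(1)]])
  interpret PK: pair_sigma_finite "PL I" "count_space K" ..
  have KI: "countable K" unfolding K_def by (rule countable_itrans[OF fin(1)])
  have m1: "(%t. \<lambda>i\<in>I. t i + of_int (k i)) \<in> PL I \<rightarrow>\<^sub>M PL I" for k :: "'i => int" by measurable
  have tile2: "(\<integral>\<^sup>+k. g (T (\<lambda>i\<in>I. t i + of_int (k i))) \<partial>count_space K) = 1" if t: "t \<in> space (PL I)" for t
  proof -
   \<comment> \<open>\<open>ph\<close> and \<open>ps\<close> are \<open>T\<close> and
     \<open>S\<close> on integer vectors; the floors only convert integral reals to the type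
     \<open>int\<close>.\<close>
   define ph where "ph k = (\<lambda>j\<in>J. \<lfloor>\<Sum>i\<in>I. of_int (k i) * A i j\<rfloor>)" for k :: "'i => int"
   define ps where "ps k = (\<lambda>i\<in>I. \<lfloor>\<Sum>j\<in>J. of_int (k j) * B j i\<rfloor>)" for k :: "'j => int"
   have ph: "of_int (ph k j) = T (%i. of_int (k i)) j" if "j \<in> J" for j k
   proof -
    have "(\<Sum>i\<in>I. of_int (k i) * A i j) \<in> \<int>" using Aint that by (intro Ints_sum Ints_mult) auto
    then show ?thesis using that by (simp add: ph_def T_def)
   qed
   have ps: "of_int (ps k j) = S (%i. of_int (k i)) j" if "j \<in> I" for j k
   proof -
    have "(\<Sum>i\<in>J. of_int (k i) * B i j) \<in> \<int>" using Bint that by (intro Ints_sum Ints_mult) auto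
    then show ?thesis using that by (simp add: ps_def S_def)
   qed
   have Tc: "T x = T y" if "!!i. i \<in> I ==> x i = y i" for x y
    using that by (auto simp: T_def fun_eq_iff intro!: sum.cong)
   have Sc: "S x = S y" if "!!i. i \<in> J ==> x i = y i" for x y
    using that by (auto simp: S_def fun_eq_iff intro!: sum.cong)
   have bij: "bij_betw ph K (itrans J)"
   proof (rule bij_betw_byWitness[where f'=ps])
    show "\<forall>a\<in>K. ps (ph a) = a"
    proof
     fix a assume a: "a \<in> K"
     show "ps (ph a) = a"
     proof
      fix i show "ps (ph a) i = a i"
      proof (cases "i \<in> I")
       case True
       have "real_of_int (ps (ph a) i) = S (T (%i. of_int (a i))) i"
        using True by (simp add: ps ph cong: Sc)
       also have "... = of_int (a i)" using True by (rule ST)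
       finally show ?thesis by simp
      next
       case False
       then show ?thesis using a by (simp add: K_def itrans_def ps_def PiE_iff extensional_def)
      qed
     qed
    qed
    show "\<forall>a'\<in>itrans J. ph (ps a') = a'"
    proof
     fix a assume a: "a \<in> itrans J"
     show "ph (ps a) = a"
     proof
      fix i show "ph (ps a) i = a i"
      proof (cases "i \<in> J")
       case True
       have "real_of_int (ph (ps a) i) = T (S (%i. of_int (a i))) i"
        using True by (simp add: ps ph cong: Tc)
       also have "... = of_int (a i)" using True by (rule TS)
       finally show ?thesis by simp
      next
       case False
       then show ?thesis using a by (simp add: itrans_def ph_def PiE_iff extensional_def)
      qed
     qed
    qed
    show "ph ` K \<subseteq> itrans J" by (auto simp: ph_def itrans_def)
    show "ps ` itrans J \<subseteq> K" by (auto simp: ps_def itrans_def K_def)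
   qed
   have "(\<integral>\<^sup>+k. g (T (\<lambda>i\<in>I. t i + of_int (k i))) \<partial>count_space K) =
      (\<integral>\<^sup>+k. g (\<lambda>j\<in>J. T t j + of_int (ph k j)) \<partial>count_space K)"
    by (intro nn_integral_cong arg_cong[where f=g]) (auto simp: ph Tadd)
   also have "... = (\<integral>\<^sup>+k. g (\<lambda>j\<in>J. T t j + of_int (k j)) \<partial>count_space (itrans J))"
    using nn_integral_bij_count_space[OF bij, of "%k. g (\<lambda>j\<in>J. T t j + of_int (k j))"] by simp
   also have "... = 1"
    unfolding g_def by (rule ucube_tiling) (simp add: T_def space_PiM PiE_iff extensional_def)
   finally show ?thesis .
  qed
  \<comment> \<open>The substitution in \<open>t\<close> turns the lattice variable \<open>k\<close>
    into \<open>- k\<close>; a sum over the whole lattice does not see the sign.\<close>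
  have flip: "(\<integral>\<^sup>+k. g (T (\<lambda>j\<in>I. t j + of_int (- k j))) \<partial>count_space K) =
    (\<integral>\<^sup>+k. g (T (\<lambda>j\<in>I. t j + of_int (k j))) \<partial>count_space K)" for t
  proof -
   have bij: "bij_betw (%k. \<lambda>i\<in>I. - k i) K K"
    by (rule bij_betw_byWitness[where f'="%k. \<lambda>i\<in>I. - k i"])
     (auto simp: K_def itrans_def PiE_iff extensional_def fun_eq_iff)
   have "(\<integral>\<^sup>+k. g (T (\<lambda>j\<in>I. t j + of_int (k j))) \<partial>count_space K) =
      (\<integral>\<^sup>+k. g (T (\<lambda>j\<in>I. t j + of_int ((\<lambda>i\<in>I. - k i) j))) \<partial>count_space K)"
    using nn_integral_bij_count_space[OF bij, of "%k. g (T (\<lambda>j\<in>I. t j + of_int (k j)))"] by simp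
   also have "... = (\<integral>\<^sup>+k. g (T (\<lambda>j\<in>I. t j + of_int (- k j))) \<partial>count_space K)"
    by (intro nn_integral_cong arg_cong[where f="%x. g (T x)"]) auto
   finally show "(\<integral>\<^sup>+k. g (T (\<lambda>j\<in>I. t j + of_int (- k j))) \<partial>count_space K) =
    (\<integral>\<^sup>+k. g (T (\<lambda>j\<in>I. t j + of_int (k j))) \<partial>count_space K)" by simp
  qed
  have "(\<integral>\<^sup>+t. g (T t) \<partial>PL I) = (\<integral>\<^sup>+t. g (T t) * (\<integral>\<^sup>+k. ?C (\<lambda>j\<in>I. t j + of_int (k j)) \<partial>count_space K) \<partial>PL I)"
   unfolding K_def by (intro nn_integral_cong) (simp add: ucube_tiling)
  also have "... = (\<integral>\<^sup>+t. (\<integral>\<^sup>+k. g (T t) * ?C (\<lambda>j\<in>I. t j + of_int (k j)) \<partial>count_space K) \<partial>PL I)"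
   by (intro nn_integral_cong nn_integral_cmult[symmetric]) auto
  also have "... = (\<integral>\<^sup>+k. (\<integral>\<^sup>+t. g (T t) * ?C (\<lambda>j\<in>I. t j + of_int (k j)) \<partial>PL I) \<partial>count_space K)"
  proof (rule PK.Fubini'[symmetric])
   show "(%(t, k). g (T t) * ?C (\<lambda>j\<in>I. t j + of_int (k j))) \<in> borel_measurable (PL I \<Otimes>\<^sub>M count_space K)"
   proof (subst measurable_pair_swap_iff, rule measurable_pair_measure_countable1[OF KI])
    fix k assume "k \<in> K"
    show "(%y. (%(x, y). (%(t, k). g (T t) * ?C (\<lambda>j\<in>I. t j + of_int (k j))) (y, x)) (k, y)) \<in> borel_measurable (PL I)"
     using measurable_compose[OF m1[of k], of ?C] by simp
   qed
  qed
  also have "... = (\<integral>\<^sup>+k. (\<integral>\<^sup>+t. g (T (\<lambda>j\<in>I. t j + of_int (- k j))) * ?C t \<partial>PL I) \<partial>count_space K)"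
  proof (rule nn_integral_cong)
   fix k assume "k \<in> space (count_space K)"
   have m2: "(%t. g (T (\<lambda>j\<in>I. t j + of_int (- k j))) * ?C t) \<in> borel_measurable (PL I)"
    using m1[of "%i. - k i"] by measurable
   have "(\<integral>\<^sup>+t. g (T t) * ?C (\<lambda>j\<in>I. t j + of_int (k j)) \<partial>PL I) =
    (\<integral>\<^sup>+t. g (T (\<lambda>i\<in>I. (\<lambda>j\<in>I. t j + of_int (k j)) i + of_int (- k i))) * ?C (\<lambda>j\<in>I. t j + of_int (k j)) \<partial>PL I)"
    by (intro nn_integral_cong) (auto simp: T_def cong: restrict_cong sum.cong)
   also have "... = (\<integral>\<^sup>+t. g (T (\<lambda>j\<in>I. t j + of_int (- k j))) * ?C t \<partial>PL I)"
    by (rule nn_integral_PL_translate[OF fin(1) m2])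
   finally show "(\<integral>\<^sup>+t. g (T t) * ?C (\<lambda>j\<in>I. t j + of_int (k j)) \<partial>PL I) =
    (\<integral>\<^sup>+t. g (T (\<lambda>j\<in>I. t j + of_int (- k j))) * ?C t \<partial>PL I)" .
  qed
  also have "... = (\<integral>\<^sup>+t. (\<integral>\<^sup>+k. g (T (\<lambda>j\<in>I. t j + of_int (- k j))) * ?C t \<partial>count_space K) \<partial>PL I)"
  proof (rule PK.Fubini')
   show "(%(t, k). g (T (\<lambda>j\<in>I. t j + of_int (- k j))) * ?C t) \<in> borel_measurable (PL I \<Otimes>\<^sub>M count_space K)"
   proof (subst measurable_pair_swap_iff, rule measurable_pair_measure_countable1[OF KI])
    fix k assume "k \<in> K"
    show "(%y. (%(x, y). (%(t, k). g (T (\<lambda>j\<in>I. t j + of_int (- k j))) * ?C t) (y, x)) (k, y)) \<in> borel_measurable (PL I)"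
     using m1[of "%i. - k i"] by simp
   qed
  qed
  also have "... = (\<integral>\<^sup>+t. (\<integral>\<^sup>+k. g (T (\<lambda>j\<in>I. t j + of_int (- k j))) \<partial>count_space K) * ?C t \<partial>PL I)"
   by (intro nn_integral_cong nn_integral_multc) auto
  also have "... = (\<integral>\<^sup>+t. (\<integral>\<^sup>+k. g (T (\<lambda>j\<in>I. t j + of_int (k j))) \<partial>count_space K) * ?C t \<partial>PL I)"
   by (simp only: flip)
  also have "... = (\<integral>\<^sup>+t. ?C t \<partial>PL I)"
   by (intro nn_integral_cong) (simp add: tile2)
  also have "... = 1" using emeasure_ucube[OF fin(1)] fin by (simp add: nn_integral_indicator)
  finally show ?thesis .
 qed
 have neg: "(\<integral>\<^sup>+x. g (\<lambda>j\<in>J. y j - x j) \<partial>PL J) = 1" if y: "y \<in> space (PL J)" for y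
 proof -
  have "(\<integral>\<^sup>+x. g (\<lambda>j\<in>J. y j - x j) \<partial>PL J) = (\<integral>\<^sup>+x. indicator (Pi\<^sub>E J (%j. {y j - 1 <.. y j})) x \<partial>PL J)"
  proof (rule nn_integral_cong)
   fix x assume "x \<in> space (PL J)"
   then show "g (\<lambda>j\<in>J. y j - x j) = indicator (Pi\<^sub>E J (%j. {y j - 1 <.. y j})) x"
    unfolding g_def ucube_def indicator_def by (auto simp: space_PiM PiE_iff) force+
  qed
  also have "... = emeasure (PL J) (Pi\<^sub>E J (%j. {y j - 1 <.. y j}))"
   using fin by (intro nn_integral_indicator sets_PiM_I_finite) auto
  also have "... = 1"
   using fin by (subst PL.emeasure_PiM) auto
  finally show ?thesis .
 qed
 \<comment> \<open>Fubini with two substitutions: \<open>x\<close> is shifted by \<open>T t\<close>,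
   then \<open>t\<close> by minus \<open>S x\<close>. This moves the dependence on \<open>x\<close>
   from \<open>f\<close> into \<open>g\<close>, whose integral over \<open>x\<close> is 1 by
   \<open>neg\<close>.\<close>
 have "(\<integral>\<^sup>+x. f x \<partial>PL J) = (\<integral>\<^sup>+t. g (T t) \<partial>PL I) * (\<integral>\<^sup>+x. f x \<partial>PL J)"
  by (simp add: gT)
 also have "... = (\<integral>\<^sup>+t. g (T t) * (\<integral>\<^sup>+x. f x \<partial>PL J) \<partial>PL I)"
  by (rule nn_integral_multc[symmetric]) measurable
 also have "... = (\<integral>\<^sup>+t. (\<integral>\<^sup>+x. g (T t) * f (\<lambda>j\<in>J. x j + T t j) \<partial>PL J) \<partial>PL I)"
  by (intro nn_integral_cong, subst nn_integral_PL_translate[symmetric, OF fin(2) f])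
   (rule nn_integral_cmult[symmetric], measurable)
 also have "... = (\<integral>\<^sup>+x. (\<integral>\<^sup>+t. g (T t) * f (\<lambda>j\<in>J. x j + T t j) \<partial>PL I) \<partial>PL J)"
  by (rule P12.Fubini'[symmetric]) measurable
 also have "... = (\<integral>\<^sup>+x. (\<integral>\<^sup>+t. g (\<lambda>j\<in>J. T t j - x j) * f (T t) \<partial>PL I) \<partial>PL J)"
 proof (rule nn_integral_cong)
  fix x assume x: "x \<in> space (PL J)"
  have m: "(%t. g (T t) * f (\<lambda>j\<in>J. x j + T t j)) \<in> borel_measurable (PL I)"
   using x by measurable
  have "(\<integral>\<^sup>+t. g (T t) * f (\<lambda>j\<in>J. x j + T t j) \<partial>PL I) =
   (\<integral>\<^sup>+t. g (T (\<lambda>i\<in>I. t i + - S x i)) * f (\<lambda>j\<in>J. x j + T (\<lambda>i\<in>I. t i + - S x i) j) \<partial>PL I)"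
   by (rule nn_integral_PL_translate[OF fin(1) m, symmetric])
  also have "... = (\<integral>\<^sup>+t. g (\<lambda>j\<in>J. T t j - x j) * f (T t) \<partial>PL I)"
  proof (rule nn_integral_cong)
   fix t
   have 1: "T (%i. - S x i) j = - x j" if "j \<in> J" for j
    using TS[OF that, of x] that by (simp add: T_def sum_negf)
   have 2: "T (\<lambda>i\<in>I. t i + - S x i) = (\<lambda>j\<in>J. T t j - x j)"
    unfolding Tadd by (auto simp: 1 fun_eq_iff)
   have 3: "(\<lambda>j\<in>J. x j + (\<lambda>j\<in>J. T t j - x j) j) = T t"
    by (auto simp: fun_eq_iff T_def)
   show "g (T (\<lambda>i\<in>I. t i + - S x i)) * f (\<lambda>j\<in>J. x j + T (\<lambda>i\<in>I. t i + - S x i) j) =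
    g (\<lambda>j\<in>J. T t j - x j) * f (T t)" unfolding 2 3 ..
  qed
  finally show "(\<integral>\<^sup>+t. g (T t) * f (\<lambda>j\<in>J. x j + T t j) \<partial>PL I) =
   (\<integral>\<^sup>+t. g (\<lambda>j\<in>J. T t j - x j) * f (T t) \<partial>PL I)" .
 qed
 also have "... = (\<integral>\<^sup>+t. (\<integral>\<^sup>+x. g (\<lambda>j\<in>J. T t j - x j) * f (T t) \<partial>PL J) \<partial>PL I)"
  by (rule P12.Fubini') measurable
 also have "... = (\<integral>\<^sup>+t. (\<integral>\<^sup>+x. g (\<lambda>j\<in>J. T t j - x j) \<partial>PL J) * f (T t) \<partial>PL I)"
  by (intro nn_integral_cong nn_integral_multc) measurable
 also have "... = (\<integral>\<^sup>+t. f (T t) \<partial>PL I)"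
  by (intro nn_integral_cong) (simp add: neg T_def space_PiM PiE_iff extensional_def)
 finally show ?thesis unfolding T_def ..
qed

subsection \<open>Lattice coordinates\<close>

abbreviation FM :: "('e => real) measure" where
 "FM \<equiv> Pi\<^sub>M UNIV (%_. borel)"

text \<open>The integral of \<open>f\<close> over the affine space through \<open>m0\<close> with
  direction spanned by \<open>v\<close>, in the coordinates given by \<open>v\<close>. If
  \<open>v\<close> is a basis of the integer points of the direction, this is the integral
  normalised to covolume one.\<close>

definition vint :: "'j set => ('j => 'e => real) => ('e => real) => (('e => real) => ennreal) => ennreal" where
 "vint J v m0 f = (\<integral>\<^sup>+t. f (%x. m0 x + (\<Sum>j\<in>J. t j * v j x)) \<partial>PL J)"

text \<open>\<open>v\<close> is a basis of the real space \<open>K\<close> and of its lattice of integer points; the integer vectors \<open>d\<close>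
 represent the coordinate functionals.\<close>

definition ubasis :: "'e set => ('e => real) set => 'j set => ('j => 'e => real) => ('j => 'e => real) => bool" where
 "ubasis E K J v d \<longleftrightarrow> finite E & finite J &
  (\<forall>j\<in>J. v j \<in> K & (\<forall>x. v j x \<in> \<int>) & (\<forall>e\<in>E. d j e \<in> \<int>)) &
  (\<forall>j\<in>J. \<forall>k\<in>J. (\<Sum>e\<in>E. d j e * v k e) = (if j = k then 1 else 0)) &
  (\<forall>m\<in>K. \<forall>x. m x = (\<Sum>j\<in>J. (\<Sum>e\<in>E. d j e * m e) * v j x))"

lemma vcomb_measurable [measurable]:
 "finite J ==> (%t x. m0 x + (\<Sum>j\<in>J. t j * v j x)) \<in> PL J \<rightarrow>\<^sub>M FM"
 by (rule measurable_PiM_single') (auto simp: space_PiM)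

lemma vint_cong:
 assumes "!!m. (\<exists>t. \<forall>x. m x = m0 x + (\<Sum>j\<in>J. t j * v j x)) ==> f m = f' m"
 shows "vint J v m0 f = vint J v m0 f'"
 unfolding vint_def by (rule nn_integral_cong, rule assms) auto

text \<open>The transition matrices between two such bases have integer entries, because vectors and
  coordinate functionals are integral, and they are inverse to each other; so the change of
  coordinates preserves Lebesgue measure. A change of base point only adds the translation
  \<open>c\<close>.\<close>

lemma vint_ubasis_eq:
 assumes u: "ubasis E K J v d" and u': "ubasis E K J' v' d'"
  and K: "(%x. m0 x - m0' x) \<in> K" and f [measurable]: "f \<in> borel_measurable FM"
 shows "vint J v m0 f = vint J' v' m0' f"
proof -
 note U = u[unfolded ubasis_def] and U' = u'[unfolded ubasis_def]
 have fin [simp]: "finite E" "finite J" "finite J'" using U U' by auto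
 have D: "(\<Sum>e\<in>E. d j e * v k e) = (if j = k then 1 else 0)" if "j \<in> J" "k \<in> J" for j k using U that by auto
 have D': "(\<Sum>e\<in>E. d' j e * v' k e) = (if j = k then 1 else 0)" if "j \<in> J'" "k \<in> J'" for j k using U' that by auto
 define A where "A i j = (\<Sum>e\<in>E. d' j e * v i e)" for i j
 define B where "B j i = (\<Sum>e\<in>E. d i e * v' j e)" for i j
 define c where "c j = (\<Sum>e\<in>E. d' j e * (m0 e - m0' e))" for j
 have vA: "v i x = (\<Sum>j\<in>J'. A i j * v' j x)" if "i \<in> J" for i x
  using U U' that unfolding A_def by blast
 have vB: "v' j x = (\<Sum>i\<in>J. B j i * v i x)" if "j \<in> J'" for j x
  using U U' that unfolding B_def by blast
 have mc: "m0 x = m0' x + (\<Sum>j\<in>J'. c j * v' j x)" for x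
 proof -
  have "m0 x - m0' x = (\<Sum>j\<in>J'. c j * v' j x)" using U' K unfolding c_def by fast
  then show ?thesis by simp
 qed
 have AB: "(\<Sum>j\<in>J'. A i j * B j i') = (if i = i' then 1 else 0)" if "i \<in> J" "i' \<in> J" for i i'
 proof -
  have "(\<Sum>j\<in>J'. A i j * B j i') = (\<Sum>j\<in>J'. \<Sum>e\<in>E. d i' e * (A i j * v' j e))"
   unfolding B_def by (simp add: sum_distrib_left mult_ac)
  also have "... = (\<Sum>e\<in>E. d i' e * v i e)"
   by (subst sum.swap) (simp add: vA[OF that(1)] sum_distrib_left)
  also have "... = (if i = i' then 1 else 0)" using D[OF that(2,1)] by auto
  finally show ?thesis .
 qed
 have BA: "(\<Sum>i\<in>J. B j i * A i j') = (if j = j' then 1 else 0)" if "j \<in> J'" "j' \<in> J'" for j j'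
 proof -
  have "(\<Sum>i\<in>J. B j i * A i j') = (\<Sum>i\<in>J. \<Sum>e\<in>E. d' j' e * (B j i * v i e))"
   unfolding A_def by (simp add: sum_distrib_left mult_ac)
  also have "... = (\<Sum>e\<in>E. d' j' e * v' j e)"
   by (subst sum.swap) (simp add: vB[OF that(1)] sum_distrib_left)
  also have "... = (if j = j' then 1 else 0)" using D'[OF that(2,1)] by auto
  finally show ?thesis .
 qed
 have Aint: "A i j \<in> \<int>" if "i \<in> J" "j \<in> J'" for i j
  unfolding A_def using U U' that by (intro Ints_sum Ints_mult) auto
 have Bint: "B j i \<in> \<int>" if "i \<in> J" "j \<in> J'" for i j
  unfolding B_def using U U' that by (intro Ints_sum Ints_mult) auto
 define G where "G t = f (%x. m0' x + (\<Sum>j\<in>J'. t j * v' j x))" for t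
 have Gm [measurable]: "G \<in> borel_measurable (PL J')"
  unfolding G_def using measurable_compose[OF vcomb_measurable f] by simp
 have Gc: "G s = G t" if "!!j. j \<in> J' ==> s j = t j" for s t
  unfolding G_def using that by (simp cong: sum.cong)
 have "vint J v m0 f = (\<integral>\<^sup>+t. G (\<lambda>j\<in>J'. (\<lambda>j\<in>J'. \<Sum>i\<in>J. t i * A i j) j + c j) \<partial>PL J)"
  unfolding vint_def G_def
 proof (intro nn_integral_cong arg_cong[where f=f] ext)
  fix t x
  have "(\<Sum>j\<in>J. t j * v j x) = (\<Sum>j\<in>J. \<Sum>i\<in>J'. t j * A j i * v' i x)"
   by (simp add: vA sum_distrib_left mult.assoc cong: sum.cong)
  also have "... = (\<Sum>i\<in>J'. (\<Sum>j\<in>J. t j * A j i) * v' i x)"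
   by (subst sum.swap) (simp add: sum_distrib_right)
  finally show "m0 x + (\<Sum>j\<in>J. t j * v j x) =
   m0' x + (\<Sum>j\<in>J'. (\<lambda>j\<in>J'. (\<lambda>j\<in>J'. \<Sum>i\<in>J. t i * A i j) j + c j) j * v' j x)"
   by (simp add: mc[of x] distrib_right sum.distrib)
 qed
 also have "... = (\<integral>\<^sup>+t. G (\<lambda>j\<in>J'. t j + c j) \<partial>PL J')"
  by (rule nn_integral_PL_unimodular[where B=B]) (simp_all add: AB BA Aint Bint)
 also have "... = (\<integral>\<^sup>+t. G t \<partial>PL J')"
  by (rule nn_integral_PL_translate) auto
 finally show ?thesis unfolding vint_def G_def .
qed

text \<open>The bases meant by \<open>vol_Met\<close> come without coordinate functionals. These are
  found by expanding the \<open>v j\<close> in \<open>B\<close> with integer coefficients and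
  combining the functionals \<open>d j\<close> accordingly; that they are dual to \<open>B\<close>
  follows from the uniqueness of expansions.\<close>

lemma is_int_basis_ubasis:
 assumes u: "ubasis E K J v d" and B: "is_int_basis B {m \<in> K. \<forall>x. m x \<in> \<int>}"
 shows "\<exists>d'. ubasis E K B (%b. b) d'"
proof -
 note U = u[unfolded ubasis_def]
 have fin [simp]: "finite E" "finite J" "finite B" using U B by (auto simp: is_int_basis_def)
 have Bsub: "b \<in> K" "b x \<in> \<int>" if "b \<in> B" for b x using B that by (auto simp: is_int_basis_def)
 have ex: "\<exists>c. c \<in> B \<rightarrow>\<^sub>E (UNIV :: int set) & v j = (%a. \<Sum>b\<in>B. of_int (c b) * b a)" if "j \<in> J" for j
 proof -
  have "v j \<in> {m \<in> K. \<forall>x. m x \<in> \<int>}" using U that by auto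
  then have "\<exists>!c. c \<in> B \<rightarrow>\<^sub>E (UNIV :: int set) & v j = (%a. \<Sum>b\<in>B. of_int (c b) * b a)"
   using B unfolding is_int_basis_def by blast
  then show ?thesis by blast
 qed
 then obtain c where c: "!!j. j \<in> J ==> v j = (%a. \<Sum>b\<in>B. of_int (c j b) * b a)" by metis
 define d' where "d' b e = (\<Sum>j\<in>J. of_int (c j b) * d j e)" for b e
 have exp: "m x = (\<Sum>b\<in>B. (\<Sum>e\<in>E. d' b e * m e) * b x)" if "m \<in> K" for m x
 proof -
  have "m x = (\<Sum>j\<in>J. (\<Sum>e\<in>E. d j e * m e) * v j x)" using U that by auto
  also have "... = (\<Sum>j\<in>J. \<Sum>b\<in>B. \<Sum>e\<in>E. of_int (c j b) * d j e * m e * b x)"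
   by (intro sum.cong refl) (simp add: c sum_distrib_left sum_distrib_right mult_ac)
  also have "... = (\<Sum>b\<in>B. \<Sum>j\<in>J. \<Sum>e\<in>E. of_int (c j b) * d j e * m e * b x)"
   by (rule sum.swap)
  also have "... = (\<Sum>b\<in>B. \<Sum>e\<in>E. \<Sum>j\<in>J. of_int (c j b) * d j e * m e * b x)"
   by (intro sum.cong refl sum.swap)
  also have "... = (\<Sum>b\<in>B. (\<Sum>e\<in>E. d' b e * m e) * b x)"
   by (simp add: d'_def sum_distrib_left sum_distrib_right mult_ac)
  finally show ?thesis .
 qed
 have d'int: "d' b e \<in> \<int>" if "e \<in> E" for b e
  unfolding d'_def using U that by (intro Ints_sum Ints_mult) auto
 have dual: "(\<Sum>e\<in>E. d' b e * b' e) = (if b = b' then 1 else 0)" if b: "b \<in> B" "b' \<in> B" for b b'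
 proof -
  \<comment> \<open>Two integer expansions of \<open>b'\<close>: the one given by the functionals
    and the trivial one. Uniqueness identifies them, and this is the duality.\<close>
  define C1 where "C1 = (\<lambda>b\<in>B. \<lfloor>\<Sum>e\<in>E. d' b e * b' e\<rfloor>)"
  define C2 where "C2 = (\<lambda>b\<in>B. if b = b' then 1 else 0 :: int)"
  have i: "of_int \<lfloor>\<Sum>e\<in>E. d' b e * b' e\<rfloor> = (\<Sum>e\<in>E. d' b e * b' e)" for b
  proof -
   have "(\<Sum>e\<in>E. d' b e * b' e) \<in> \<int>" using d'int Bsub(2)[OF b(2)] by (intro Ints_sum Ints_mult) auto
   then show ?thesis by simp
  qed
  have "b' \<in> {m \<in> K. \<forall>x. m x \<in> \<int>}" using Bsub b by auto
  then have "\<exists>!c. c \<in> B \<rightarrow>\<^sub>E (UNIV :: int set) & b' = (%a. \<Sum>b\<in>B. of_int (c b) * b a)"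
   using B unfolding is_int_basis_def by blast
  moreover have "C1 \<in> B \<rightarrow>\<^sub>E (UNIV :: int set) & b' = (%a. \<Sum>b\<in>B. of_int (C1 b) * b a)"
  proof (intro conjI ext)
   fix x
   have "b' x = (\<Sum>b\<in>B. (\<Sum>e\<in>E. d' b e * b' e) * b x)" by (rule exp[OF Bsub(1)[OF b(2)]])
   also have "... = (\<Sum>b\<in>B. of_int (C1 b) * b x)" by (simp add: C1_def i)
   finally show "b' x = (\<Sum>b\<in>B. of_int (C1 b) * b x)" .
  qed (simp add: C1_def)
  moreover have "C2 \<in> B \<rightarrow>\<^sub>E (UNIV :: int set) & b' = (%a. \<Sum>b\<in>B. of_int (C2 b) * b a)"
  proof (intro conjI ext)
   fix x
   have "(\<Sum>b\<in>B. of_int (C2 b) * b x) = (\<Sum>b\<in>B. if b = b' then b' x else 0)"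
    by (intro sum.cong) (auto simp: C2_def)
   then show "b' x = (\<Sum>b\<in>B. of_int (C2 b) * b x)" using b by simp
  qed (simp add: C2_def)
  ultimately have "C1 = C2" by blast
  then have "real_of_int (C1 b) = real_of_int (C2 b)" by simp
  then show ?thesis using b by (simp add: C1_def C2_def i)
 qed
 have "ubasis E K B (%b. b) d'"
  unfolding ubasis_def
 proof (intro conjI ballI allI)
  fix m x assume "m \<in> K"
  then show "m x = (\<Sum>j\<in>B. (\<Sum>e\<in>E. d' j e * m e) * j x)" by (rule exp)
 qed (simp_all add: dual d'int Bsub)
 then show ?thesis by blast
qed

text \<open>Ensures that the choice of a lattice basis by \<open>SOME\<close> in
  \<open>vol_Met\<close> is the choice of an actual basis.\<close>

lemma ubasis_is_int_basis:
 assumes u: "ubasis E K J v d"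
  and K: "!!c. (%x. \<Sum>j\<in>J. c j * v j x) \<in> K"
 shows "\<exists>B. is_int_basis B {m \<in> K. \<forall>x. m x \<in> \<int>}"
proof -
 note U = u[unfolded ubasis_def]
 have fin [simp]: "finite E" "finite J" using U by auto
 have D: "(\<Sum>e\<in>E. d j e * v k e) = (if j = k then 1 else 0)" if "j \<in> J" "k \<in> J" for j k using U that by auto
 have inj: "inj_on v J"
 proof (rule inj_onI)
  fix i j assume ij: "i \<in> J" "j \<in> J" "v i = v j"
  then show "i = j" using D[OF ij(1) ij(1)] D[OF ij(1) ij(2)] by (auto split: if_splits)
 qed
 define g where "g = the_inv_into J v"
 have g: "g (v j) = j" if "j \<in> J" for j unfolding g_def by (rule the_inv_into_f_f[OF inj that])
 have "is_int_basis (v ` J) {m \<in> K. \<forall>x. m x \<in> \<int>}"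
  unfolding is_int_basis_def
 proof (intro conjI ballI)
  show "v ` J \<subseteq> {m \<in> K. \<forall>x. m x \<in> \<int>}" using U by auto
  fix m assume "m \<in> {m \<in> K. \<forall>x. m x \<in> \<int>}"
  then have m: "m \<in> K" "!!x. m x \<in> \<int>" by auto
  define c where "c = (\<lambda>b\<in>v ` J. \<lfloor>\<Sum>e\<in>E. d (g b) e * m e\<rfloor>)"
  have i: "of_int \<lfloor>\<Sum>e\<in>E. d j e * m e\<rfloor> = (\<Sum>e\<in>E. d j e * m e)" if "j \<in> J" for j
  proof -
   have "(\<Sum>e\<in>E. d j e * m e) \<in> \<int>" using U m(2) that by (intro Ints_sum Ints_mult) auto
   then show ?thesis by simp
  qed
  show "\<exists>!c. c \<in> v ` J \<rightarrow>\<^sub>E (UNIV :: int set) & m = (%a. \<Sum>b\<in>v ` J. of_int (c b) * b a)"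
  proof (rule ex1I[of _ c])
   have "m x = (\<Sum>b\<in>v ` J. of_int (c b) * b x)" for x
   proof -
    have "(\<Sum>b\<in>v ` J. of_int (c b) * b x) = (\<Sum>j\<in>J. (\<Sum>e\<in>E. d j e * m e) * v j x)"
     by (simp add: sum.reindex[OF inj] c_def g i cong: sum.cong)
    then show ?thesis using U m(1) by auto
   qed
   then have "m = (%a. \<Sum>b\<in>v ` J. of_int (c b) * b a)" by (rule ext)
   moreover have "c \<in> v ` J \<rightarrow>\<^sub>E UNIV" by (simp add: c_def)
   ultimately show "c \<in> v ` J \<rightarrow>\<^sub>E UNIV & m = (%a. \<Sum>b\<in>v ` J. of_int (c b) * b a)"
    by (rule conjI[rotated])
   fix c' assume c': "c' \<in> v ` J \<rightarrow>\<^sub>E UNIV & m = (%a. \<Sum>b\<in>v ` J. real_of_int (c' b) * b a)"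
   show "c' = c"
   proof
    fix b show "c' b = c b"
    proof (cases "b \<in> v ` J")
     case True
     then obtain k where k: "k \<in> J" "b = v k" by auto
     have mx: "m x = (\<Sum>j\<in>J. of_int (c' (v j)) * v j x)" for x
     proof -
      have "m x = (\<Sum>b\<in>v ` J. real_of_int (c' b) * b x)" using c' by meson
      also have "... = (\<Sum>j\<in>J. of_int (c' (v j)) * v j x)" by (simp add: sum.reindex[OF inj])
      finally show ?thesis .
     qed
     have "(\<Sum>e\<in>E. d k e * m e) = (\<Sum>e\<in>E. \<Sum>j\<in>J. of_int (c' (v j)) * (d k e * v j e))"
      by (simp add: mx sum_distrib_left mult_ac)
     also have "... = (\<Sum>j\<in>J. of_int (c' (v j)) * (\<Sum>e\<in>E. d k e * v j e))"
      by (subst sum.swap) (simp add: sum_distrib_left)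
     also have "... = of_int (c' (v k))"
      using k by (simp add: D if_distrib if_distribR cong: if_cong sum.cong)
     finally show ?thesis using k by (simp add: c_def g)
    next
     case False
     have "c' \<in> extensional (v ` J)" using c' unfolding PiE_iff by blast
     then show ?thesis using False by (auto simp: c_def extensional_def)
    qed
   qed
  qed
 qed simp
 then show ?thesis by blast
qed

section \<open>Integer bases of the solution spaces of linear equations\<close>

definition lsol :: "'e set => ('e => real) set => ('e => real) set" where
 "lsol E C = {m. (\<forall>x. x ~: E --> m x = 0) & (\<forall>c\<in>C. (\<Sum>e\<in>E. c e * m e) = 0)}"

lemma lsol_add: "m \<in> lsol E C ==> m' \<in> lsol E C ==> (%x. m x + r * m' x) \<in> lsol E C"
proof -
 assume a: "m \<in> lsol E C" "m' \<in> lsol E C"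
 have "(\<Sum>e\<in>E. c e * (m e + r * m' e)) = 0" if "c \<in> C" for c
 proof -
  have "(\<Sum>e\<in>E. c e * (m e + r * m' e)) = (\<Sum>e\<in>E. c e * m e) + r * (\<Sum>e\<in>E. c e * m' e)"
   by (simp add: algebra_simps sum.distrib sum_distrib_left)
  then show ?thesis using a that by (simp add: lsol_def)
 qed
 then show ?thesis using a by (simp add: lsol_def)
qed

lemma lsol_zero: "(%x. 0) \<in> lsol E C" by (simp add: lsol_def)

lemma lsol_sum: "finite J ==> (!!j. j \<in> J ==> v j \<in> lsol E C) ==> (%x. \<Sum>j\<in>J. c j * v j x) \<in> lsol E C"
proof (induction J rule: finite_induct)
 case (insert a J)
 have "(%x. (\<Sum>j\<in>J. c j * v j x) + c a * v a x) \<in> lsol E C"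
  using insert by (intro lsol_add) auto
 then show ?case using insert by (simp add: add.commute)
qed (simp add: lsol_zero)

text \<open>Euclid's algorithm on the values of an integer form at the basis vectors.\<close>

lemma ubasis_cut:
 fixes J :: "'j set"
 assumes "ubasis E (lsol E C) J v d" and "!!e. e \<in> E ==> c e \<in> \<int>"
 shows "\<exists>J' v' d'. J' \<subseteq> J & ubasis E (lsol E (insert c C)) J' v' d'"
 using assms(1)
proof (induction "\<Sum>j\<in>J. nat \<bar>\<lfloor>\<Sum>e\<in>E. c e * v j e\<rfloor>\<bar>" arbitrary: v d rule: less_induct)
 case (less v d)
 note U = less.prems[unfolded ubasis_def]
 define fi where "fi m = (\<Sum>e\<in>E. c e * m e)" for m :: "'a => real"
 have fin [simp]: "finite E" "finite J" using U by auto
 have D: "(\<Sum>e\<in>E. d j e * v k e) = (if j = k then 1 else 0)" if "j \<in> J" "k \<in> J" for j k using U that by auto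
 have Uv: "v j \<in> lsol E C & (\<forall>x. v j x \<in> \<int>) & (\<forall>e\<in>E. d j e \<in> \<int>)" if "j \<in> J" for j using U that by blast
 have Ue: "\<forall>m\<in>lsol E C. \<forall>x. m x = (\<Sum>j\<in>J. (\<Sum>e\<in>E. d j e * m e) * v j x)" using U by blast
 have int: "fi (v j) \<in> \<int>" if "j \<in> J" for j
  unfolding fi_def using U assms(2) that by (intro Ints_sum Ints_mult) auto
 have fim: "fi m = (\<Sum>j\<in>J. (\<Sum>e\<in>E. d j e * m e) * fi (v j))" if "m \<in> lsol E C" for m
 proof -
  have "fi m = (\<Sum>e\<in>E. \<Sum>j\<in>J. (\<Sum>e\<in>E. d j e * m e) * (c e * v j e))"
  proof -
   have m: "m x = (\<Sum>j\<in>J. (\<Sum>e\<in>E. d j e * m e) * v j x)" for x using U that by auto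
   have "c x * m x = (\<Sum>j\<in>J. (\<Sum>e\<in>E. d j e * m e) * (c x * v j x))" for x
   proof -
    have "c x * m x = c x * (\<Sum>j\<in>J. (\<Sum>e\<in>E. d j e * m e) * v j x)" by (rule arg_cong[OF m])
    also have "... = (\<Sum>j\<in>J. (\<Sum>e\<in>E. d j e * m e) * (c x * v j x))"
     by (simp only: sum_distrib_left mult.left_commute)
    finally show ?thesis .
   qed
   then show ?thesis unfolding fi_def by simp
  qed
  also have "... = (\<Sum>j\<in>J. (\<Sum>e\<in>E. d j e * m e) * fi (v j))"
   unfolding fi_def by (subst sum.swap) (simp add: sum_distrib_left)
  finally show ?thesis .
 qed
 have ins: "m \<in> lsol E (insert c C) \<longleftrightarrow> m \<in> lsol E C & fi m = 0" for m
  by (auto simp: lsol_def fi_def)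
 show ?case
 proof (cases "\<exists>j\<in>J. \<exists>k\<in>J. j ~= k & fi (v j) ~= 0 & fi (v k) ~= 0")
  case False
  \<comment> \<open>At most one basis vector has a non-zero value. Evaluating the form on a solution
    of the new equation shows that its coordinate along this vector vanishes, so the remaining
    vectors form a basis.\<close>
  define J' where "J' = {j\<in>J. fi (v j) = 0}"
  have "(\<Sum>e\<in>E. d j e * m e) * v j x = 0" if m: "m \<in> lsol E (insert c C)" and j: "j \<in> J" "j ~: J'" for m j x
  proof -
   have "0 = (\<Sum>k\<in>J. (\<Sum>e\<in>E. d k e * m e) * fi (v k))" using m fim ins by auto
   also have "... = (\<Sum>k\<in>J. if k = j then (\<Sum>e\<in>E. d j e * m e) * fi (v j) else 0)"
    using False j by (intro sum.cong refl) (auto simp: J'_def)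
   also have "... = (\<Sum>e\<in>E. d j e * m e) * fi (v j)" using j by simp
   finally show ?thesis using j by (auto simp: J'_def)
  qed
  then have red: "(\<Sum>j\<in>J. (\<Sum>e\<in>E. d j e * m e) * v j x) = (\<Sum>j\<in>J'. (\<Sum>e\<in>E. d j e * m e) * v j x)"
   if "m \<in> lsol E (insert c C)" for m x
   using that by (intro sum.mono_neutral_right) (auto simp: J'_def)
  have "m x = (\<Sum>j\<in>J'. (\<Sum>e\<in>E. d j e * m e) * v j x)" if "m \<in> lsol E (insert c C)" for m x
  proof -
   have "m x = (\<Sum>j\<in>J. (\<Sum>e\<in>E. d j e * m e) * v j x)" using Ue that ins by blast
   also note red[OF that]
   finally show ?thesis .
  qed
  then have "ubasis E (lsol E (insert c C)) J' v d"
   using Uv D unfolding ubasis_def by (simp add: ins J'_def)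
  then show ?thesis by (intro exI[of _ J'] exI[of _ v] exI[of _ d]) (auto simp: J'_def)
 next
  case True
  then obtain j k where jk: "j \<in> J" "k \<in> J" "j ~= k" "fi (v j) ~= 0" "fi (v k) ~= 0" "\<bar>fi (v k)\<bar> \<le> \<bar>fi (v j)\<bar>"
   by (metis linear)
  \<comment> \<open>Subtracting \<open>v k\<close>, with the sign that gives the two values the same
    direction, brings the value at \<open>j\<close> closer to 0 because it is the larger one. To
    keep duality \<open>d k\<close> must receive \<open>s\<close> times \<open>d j\<close>.\<close>
  define s where "s = sgn (fi (v j)) * sgn (fi (v k))"
  have s: "s \<in> \<int>" unfolding s_def by (auto simp: sgn_if)
  define v' where "v' = v(j := (%x. v j x + (- s) * v k x))"
  define d' where "d' = d(k := (%x. d k x + s * d j x))"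
  have fiv: "fi (v' j) = fi (v j) - s * fi (v k)"
   unfolding fi_def v'_def by (simp add: algebra_simps sum_subtractf sum_distrib_left)
  have lt: "\<bar>fi (v' j)\<bar> < \<bar>fi (v j)\<bar>"
   unfolding fiv s_def using jk by (auto simp: sgn_if split: if_splits)
  have "v' i \<in> lsol E C" if "i \<in> J" for i
   unfolding v'_def using Uv jk that lsol_add[of "v j" E C "v k" "- s"] by auto
  moreover have "v' i x \<in> \<int>" if "i \<in> J" for i x
   unfolding v'_def using Uv jk that s by auto
  moreover have "d' i e \<in> \<int>" if "i \<in> J" "e \<in> E" for i e
   unfolding d'_def using Uv jk that s by auto
  moreover have "(\<Sum>e\<in>E. d' i e * v' l e) = (if i = l then 1 else 0)" if il: "i \<in> J" "l \<in> J" for i l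
  proof -
   have 1: "(\<Sum>e\<in>E. d i e * v' l e) = (if i = l then 1 else 0) - (if l = j & i = k then s else 0)" if "i \<in> J" for i
   proof (cases "l = j")
    case True
    then have "(\<Sum>e\<in>E. d i e * v' l e) = (\<Sum>e\<in>E. d i e * v j e) - s * (\<Sum>e\<in>E. d i e * v k e)"
     by (simp add: v'_def algebra_simps sum_subtractf sum_distrib_left)
    then show ?thesis using D[OF that jk(1)] D[OF that jk(2)] True jk by auto
   next
    case False
    then show ?thesis using D[OF that il(2)] by (simp add: v'_def)
   qed
   show ?thesis
   proof (cases "i = k")
    case True
    then have "(\<Sum>e\<in>E. d' i e * v' l e) = (\<Sum>e\<in>E. d k e * v' l e) + s * (\<Sum>e\<in>E. d j e * v' l e)"
     by (simp add: d'_def algebra_simps sum.distrib sum_distrib_left)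
    then show ?thesis using 1[OF jk(1)] 1[OF jk(2)] True jk by auto
   next
    case False
    then show ?thesis using 1[OF il(1)] by (simp add: d'_def)
   qed
  qed
  moreover have "m x = (\<Sum>i\<in>J. (\<Sum>e\<in>E. d' i e * m e) * v' i x)" if m: "m \<in> lsol E C" for m x
  proof -
   define a where "a i = (\<Sum>e\<in>E. d i e * m e)" for i
   have a': "(\<Sum>e\<in>E. d' i e * m e) = a i + (if i = k then s * a j else 0)" for i
    by (simp add: d'_def a_def algebra_simps sum.distrib sum_distrib_left)
   have v'x: "v' i x = v i x - (if i = j then s * v k x else 0)" for i
    by (simp add: v'_def)
   have "(\<Sum>i\<in>J. (\<Sum>e\<in>E. d' i e * m e) * v' i x) =
    (\<Sum>i\<in>J. a i * v i x + (if i = k then s * a j * v k x else 0) - (if i = j then s * a j * v k x else 0))"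
    unfolding a' v'x using jk by (intro sum.cong refl) (auto simp: algebra_simps)
   also have "... = (\<Sum>i\<in>J. a i * v i x)" using jk by (simp add: sum.distrib sum_subtractf)
   also have "... = m x"
   proof -
    have "m x = (\<Sum>i\<in>J. a i * v i x)" using U m unfolding a_def by blast
    then show ?thesis ..
   qed
   finally show ?thesis ..
  qed
  ultimately have u': "ubasis E (lsol E C) J v' d'" unfolding ubasis_def by simp
  have "(\<Sum>j\<in>J. nat \<bar>\<lfloor>\<Sum>e\<in>E. c e * v' j e\<rfloor>\<bar>) < (\<Sum>j\<in>J. nat \<bar>\<lfloor>\<Sum>e\<in>E. c e * v j e\<rfloor>\<bar>)"
   unfolding fi_def[symmetric]
  proof (rule sum_strict_mono_ex1)
   have lt': "nat \<bar>\<lfloor>fi (v' j)\<rfloor>\<bar> < nat \<bar>\<lfloor>fi (v j)\<rfloor>\<bar>"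
   proof -
    have "fi (v' j) \<in> \<int>" unfolding fiv using int jk s by auto
    then show ?thesis using lt int[OF jk(1)] by (auto elim!: Ints_cases)
   qed
   then show "\<forall>x\<in>J. nat \<bar>\<lfloor>fi (v' x)\<rfloor>\<bar> \<le> nat \<bar>\<lfloor>fi (v x)\<rfloor>\<bar>"
    by (auto simp: v'_def less_imp_le_nat)
   show "\<exists>a\<in>J. nat \<bar>\<lfloor>fi (v' a)\<rfloor>\<bar> < nat \<bar>\<lfloor>fi (v a)\<rfloor>\<bar>" using lt' jk by blast
  qed simp
  from less.hyps[OF this u'] show ?thesis .
 qed
qed

text \<open>The equations are imposed one at a time, starting from the standard basis. The bound
  \<open>J \<subseteq> E\<close> makes a point outside \<open>E\<close> a fresh index when a basis
  vector has to be added, and gives disjoint index sets for disjoint edge sets.\<close>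

lemma ubasis_exists:
 assumes "finite E" "finite C" "!!c e. c \<in> C ==> e \<in> E ==> c e \<in> \<int>"
 shows "\<exists>J v d. J \<subseteq> E & ubasis E (lsol E C) J v d"
 using assms(2,3)
proof (induction C rule: finite_induct)
 case empty
 have "ubasis E (lsol E {}) E (%j x. if x = j then 1 else 0) (%j x. if x = j then 1 else 0)"
  unfolding ubasis_def
 proof (intro conjI ballI allI)
  fix m :: "'a => real" and x assume "m \<in> lsol E {}"
  then show "m x = (\<Sum>j\<in>E. (\<Sum>e\<in>E. (if e = j then 1 else 0) * m e) * (if x = j then 1 else 0))"
   using assms(1) by (cases "x \<in> E") (simp_all add: lsol_def if_distrib if_distribR cong: if_cong)
 next
  fix j k assume "j \<in> E" "k \<in> E"
  then show "(\<Sum>e\<in>E. (if e = j then 1 else 0) * (if e = k then 1 else 0)) = (if j = k then 1 else (0::real))"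
  proof -
   have "(\<Sum>e\<in>E. (if e = j then 1 else 0) * (if e = k then 1 else 0)) = (\<Sum>e\<in>E. if e = j then (if j = k then 1 else 0) else (0::real))"
    by (intro sum.cong) auto
   then show ?thesis using assms(1) \<open>j \<in> E\<close> by simp
  qed
 qed (use assms(1) in \<open>simp_all add: lsol_def\<close>)
 then show ?case by blast
next
 case (insert c C)
 then obtain J v d where J: "J \<subseteq> E" and u: "ubasis E (lsol E C) J v d" by blast
 obtain J' v' d' where "J' \<subseteq> J" "ubasis E (lsol E (insert c C)) J' v' d'"
  using ubasis_cut[OF u, of c] insert.prems by blast
 then show ?case using J by blast
qed

text \<open>Integrate first over a coordinate \<open>k\<close> with non-zero coefficient: for fixed
  other coordinates the zero set is a single point.\<close>

lemma PL_affine_null: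
 assumes fin: "finite J" and k: "k \<in> J" "c k ~= (0::real)"
 shows "(\<integral>\<^sup>+t. indicator {0} (c0 + (\<Sum>j\<in>J. t j * c j)) \<partial>PL J) = 0"
proof -
 define J' where "J' = J - {k}"
 have J: "J = insert k J'" "k ~: J'" "finite J'" using assms by (auto simp: J'_def)
 have "(\<integral>\<^sup>+t. indicator {0} (c0 + (\<Sum>j\<in>J. t j * c j)) \<partial>PL J) =
  (\<integral>\<^sup>+t. (\<integral>\<^sup>+y. indicator {0} (c0 + (\<Sum>j\<in>J. (t(k := y)) j * c j)) \<partial>lborel) \<partial>PL J')"
  unfolding J(1) using J fin
  by (intro PL.product_nn_integral_insert) (simp_all del: sum.insert)
 also have "... = (\<integral>\<^sup>+t. 0 \<partial>PL J')"
 proof (rule nn_integral_cong)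
  fix t
  have "(\<Sum>j\<in>J. (t(k := y)) j * c j) = y * c k + (\<Sum>j\<in>J'. t j * c j)" for y
  proof -
   have "(\<Sum>j\<in>J'. (t(k := y)) j * c j) = (\<Sum>j\<in>J'. t j * c j)" using J by (intro sum.cong) auto
   then show ?thesis using J by simp
  qed
  then have "(\<integral>\<^sup>+y. indicator {0} (c0 + (\<Sum>j\<in>J. (t(k := y)) j * c j)) \<partial>lborel) =
   (\<integral>\<^sup>+y. indicator {- (c0 + (\<Sum>j\<in>J'. t j * c j)) / c k} y \<partial>lborel)"
   using k by (intro nn_integral_cong) (auto simp: indicator_def field_simps)
  also have "... = 0" by simp
  finally show "(\<integral>\<^sup>+y. indicator {0} (c0 + (\<Sum>j\<in>J. (t(k := y)) j * c j)) \<partial>lborel) = (0::ennreal)" .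
 qed
 finally show ?thesis by simp
qed

subsection \<open>Volumes of bipartite systems of length equations\<close>

text \<open>An edge \<open>e\<close> joins the positive component \<open>p e\<close> to the negative component \<open>q e\<close>.\<close>

definition bsum :: "'e set => ('e => 'l) => ('e => real) => 'l => real" where
 "bsum E p m i = (\<Sum>e\<in>{e \<in> E. p e = i}. m e)"

definition bker :: "'e set => ('e => 'l) => ('e => 'l) => ('e => real) set" where
 "bker E p q = {m. (\<forall>x. x ~: E --> m x = 0) & (\<forall>e\<in>E. bsum E p m (p e) = 0) & (\<forall>e\<in>E. bsum E q m (q e) = 0)}"

definition bsol :: "'e set => ('e => 'l) => ('e => 'l) => ('l => real) => ('l => real) => ('e => real) set" where
 "bsol E p q Lp Lq = {m. (\<forall>x. x ~: E --> m x = 0) &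
  (\<forall>e\<in>E. bsum E p m (p e) = Lp (p e)) & (\<forall>e\<in>E. bsum E q m (q e) = Lq (q e))}"

definition posi :: "'e set => ('e => real) => ennreal" where
 "posi E m = (if \<forall>e\<in>E. 0 < m e then 1 else 0)"

text \<open>The choices do not matter by \<open>vol_eq\<close>. The basis is indexed by edges, which
  \<open>ubasis_exists\<close> makes possible, in order to fix one type for the choice.\<close>

definition vol :: "'e set => ('e => 'l) => ('e => 'l) => ('l => real) => ('l => real) => ennreal" where
 "vol E p q Lp Lq =
  (if bsol E p q Lp Lq = {} then 0
   else let m0 = (SOME m. m \<in> bsol E p q Lp Lq);
       (J :: 'e set, v, d) = (SOME (J, v, d). ubasis E (bker E p q) J v d)
     in vint J v m0 (posi E))"

lemma posi_measurable [measurable]: "finite E ==> posi E \<in> borel_measurable FM"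
proof -
 assume [simp]: "finite E"
 have "(%m. if \<forall>e\<in>E. 0 < m e then 1 else 0 :: ennreal) \<in> borel_measurable FM" by measurable
 then show ?thesis by (simp add: posi_def[abs_def])
qed

lemma bsum_outside: "i ~: p ` E ==> bsum E p m i = 0"
proof -
 assume "i ~: p ` E"
 then have "{e \<in> E. p e = i} = {}" by auto
 then show ?thesis unfolding bsum_def by (simp only: sum.empty)
qed

lemma bsum_lin: "bsum E p (%x. m x + r * m' x) i = bsum E p m i + r * bsum E p m' i"
 by (simp add: bsum_def sum.distrib sum_distrib_left)

lemma bsum_diff: "bsum E p (%x. m x - m' x) i = bsum E p m i - bsum E p m' i"
 by (simp add: bsum_def sum_subtractf)

lemma bsum_add: "bsum E p (%x. m x + m' x) i = bsum E p m i + bsum E p m' i"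
 by (simp add: bsum_def sum.distrib)

lemma sum_bsum: "finite E ==> (\<Sum>i\<in>p ` E. bsum E p m i) = (\<Sum>e\<in>E. m e)"
 unfolding bsum_def by (rule sum.image_gen[symmetric])

lemma bker_lsol:
 "finite E ==> bker E p q = lsol E ((%i e. if p e = i then 1 else 0) ` p ` E Un (%i e. if q e = i then 1 else 0) ` q ` E)"
proof -
 assume "finite E"
 then have "(\<Sum>e\<in>E. (if r e = i then 1 else 0) * m e) = bsum E r m i" for m i and r :: "'a => 'b"
  unfolding bsum_def by (subst sum.inter_filter) (auto intro!: sum.cong)
 then show ?thesis unfolding bker_def lsol_def by (simp add: ball_Un)
qed

text \<open>A label that no edge carries has an empty sum, so the equations may be demanded at all
  labels.\<close>

lemma bker_all: "m \<in> bker E p q \<longleftrightarrow> (\<forall>x. x ~: E --> m x = 0) & (\<forall>i. bsum E p m i = 0) & (\<forall>i. bsum E q m i = 0)"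
proof -
 have "(\<forall>e\<in>E. bsum E r m (r e) = 0) \<longleftrightarrow> (\<forall>i. bsum E r m i = 0)" for r :: "'a => 'b"
  by (metis bsum_outside image_iff)
 then show ?thesis unfolding bker_def by simp
qed

lemma bker_add: "m \<in> bker E p q ==> m' \<in> bker E p q ==> (%x. m x + r * m' x) \<in> bker E p q"
 by (simp add: bker_all bsum_lin)

lemma bker_sum: "finite E ==> finite J ==> (!!j. j \<in> J ==> v j \<in> bker E p q) ==> (%x. \<Sum>j\<in>J. c j * v j x) \<in> bker E p q"
 by (simp add: bker_lsol lsol_sum)

lemma bsol_diff: "m \<in> bsol E p q Lp Lq ==> m' \<in> bsol E p q Lp Lq ==> (%x. m x - m' x) \<in> bker E p q"
 by (simp add: bsol_def bker_def bsum_diff)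

lemma bsol_add: "m \<in> bsol E p q Lp Lq ==> m' \<in> bker E p q ==> (%x. m x + m' x) \<in> bsol E p q Lp Lq"
 by (simp add: bsol_def bker_def bsum_add)

lemma ubasis_bker_exists: "finite E ==> \<exists>J v d. J \<subseteq> E & ubasis E (bker E p q) J v d"
 unfolding bker_lsol by (rule ubasis_exists) auto

lemma ubasisD:
 assumes "ubasis E K J v d"
 shows "finite E" "finite J" "!!j. j \<in> J ==> v j \<in> K" "!!j x. j \<in> J ==> v j x \<in> \<int>" "!!j e. j \<in> J ==> e \<in> E ==> d j e \<in> \<int>"
  "!!j k. j \<in> J ==> k \<in> J ==> (\<Sum>e\<in>E. d j e * v k e) = (if j = k then 1 else 0)"
  "!!m x. m \<in> K ==> m x = (\<Sum>j\<in>J. (\<Sum>e\<in>E. d j e * m e) * v j x)"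
 using assms unfolding ubasis_def by blast+

lemma vol_eq:
 assumes u: "ubasis E (bker E p q) J v d" and m0: "m0 \<in> bsol E p q Lp Lq"
 shows "vol E p q Lp Lq = vint J v m0 (posi E)"
proof -
 have fin: "finite E" using ubasisD(1)[OF u] .
 define m1 where "m1 = (SOME m. m \<in> bsol E p q Lp Lq)"
 have m1: "m1 \<in> bsol E p q Lp Lq" unfolding m1_def by (rule someI[where P="%m. m \<in> bsol E p q Lp Lq", OF m0])
 define X where "X = (SOME (J :: 'a set, v, d). ubasis E (bker E p q) J v d)"
 obtain J0 v0 d0 where "ubasis E (bker E p q) (J0 :: 'a set) v0 d0" using ubasis_bker_exists[OF fin] by blast
 then have "case (J0, v0, d0) of (J, v, d) => ubasis E (bker E p q) J v d" by simp
 then have "case X of (J, v, d) => ubasis E (bker E p q) J v d"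
  unfolding X_def by (rule someI)
 then obtain J' v' d' where X: "X = (J', v', d')" and u': "ubasis E (bker E p q) J' v' d'" by (cases X) auto
 have "vol E p q Lp Lq = vint J' v' m1 (posi E)"
  using m0 unfolding vol_def m1_def[symmetric] X_def[symmetric] X by auto
 also have "... = vint J v m0 (posi E)"
  by (rule vint_ubasis_eq[OF u' u bsol_diff[OF m1 m0] posi_measurable[OF fin]])
 finally show ?thesis .
qed

lemma vol_empty: "bsol E p q Lp Lq = {} ==> vol E p q Lp Lq = 0"
 by (simp add: vol_def)

lemma vint_bsol_cong:
 assumes u: "ubasis E (bker E p q) J v d" and m0: "m0 \<in> bsol E p q Lp Lq"
  and f: "!!m. m \<in> bsol E p q Lp Lq ==> f m = f' m"
 shows "vint J v m0 f = vint J v m0 f'"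
proof (rule vint_cong)
 fix m assume "\<exists>t. \<forall>x. m x = m0 x + (\<Sum>j\<in>J. t j * v j x)"
 then obtain t where "!!x. m x = m0 x + (\<Sum>j\<in>J. t j * v j x)" by blast
 then have m: "m = (%x. m0 x + (\<Sum>j\<in>J. t j * v j x))" by blast
 have "m \<in> bsol E p q Lp Lq"
  unfolding m using ubasisD[OF u] by (intro bsol_add[OF m0] bker_sum) auto
 then show "f m = f' m" by (rule f)
qed

lemma vint_zero: "vint J v m0 (%_. 0) = 0"
 by (simp add: vint_def)

lemma vol_nonzeroD:
 assumes fin: "finite E" and nz: "vol E p q Lp Lq ~= 0"
 shows "\<exists>m\<in>bsol E p q Lp Lq. \<forall>e\<in>E. 0 < m e"
proof (rule ccontr)
 assume a: "\<not> ?thesis"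
 obtain m0 where m0: "m0 \<in> bsol E p q Lp Lq" using nz vol_empty by blast
 obtain J v d where u: "ubasis E (bker E p q) (J :: 'a set) v d" using ubasis_bker_exists[OF fin] by blast
 have "vol E p q Lp Lq = vint J v m0 (%_. 0)"
  unfolding vol_eq[OF u m0] by (rule vint_bsol_cong[OF u m0]) (use a in \<open>auto simp: posi_def\<close>)
 then show False using nz by (simp add: vint_zero)
qed

text \<open>A positive metric has positive sums at all labels, and its total length is the same
  whether computed through \<open>p\<close> or through \<open>q\<close>. Hence \<open>vol\<close>
  vanishes by itself for lengths that \<open>V\<close> excludes by convention.\<close>

lemma vol_nonzero_pos:
 assumes fin: "finite E" and nz: "vol E p q Lp Lq ~= 0"
 shows "e \<in> E ==> 0 < Lp (p e)" "e \<in> E ==> 0 < Lq (q e)"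
  "(\<Sum>i\<in>p ` E. Lp i) = (\<Sum>i\<in>q ` E. Lq i)"
proof -
 obtain m where m: "m \<in> bsol E p q Lp Lq" "\<forall>e\<in>E. 0 < m e" using vol_nonzeroD[OF assms] by blast
 have pos: "0 < bsum E r m (r e)" if "e \<in> E" for e and r :: "'a => 'b"
  unfolding bsum_def using that m fin by (intro sum_pos) auto
 show "0 < Lp (p e)" "0 < Lq (q e)" if "e \<in> E"
  using pos[OF that, of p] pos[OF that, of q] m(1) that by (auto simp: bsol_def)
 have "(\<Sum>i\<in>p ` E. Lp i) = (\<Sum>i\<in>p ` E. bsum E p m i)" using m(1) by (auto simp: bsol_def intro!: sum.cong)
 also have "... = (\<Sum>i\<in>q ` E. bsum E q m i)" by (simp add: sum_bsum fin)
 also have "... = (\<Sum>i\<in>q ` E. Lq i)" using m(1) by (auto simp: bsol_def intro!: sum.cong)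
 finally show "(\<Sum>i\<in>p ` E. Lp i) = (\<Sum>i\<in>q ` E. Lq i)" .
qed

text \<open>The coordinates are combinations of edge lengths through \<open>d\<close>, and each edge
  of a positive metric is at most as long as its positive component; so the domain of integration
  lies in a box.\<close>

lemma vol_finite:
 assumes fin: "finite E"
 shows "vol E p q Lp Lq < \<infinity>"
proof (cases "bsol E p q Lp Lq = {}")
 case True then show ?thesis by (simp add: vol_empty)
next
 case False
 then obtain m0 where m0: "m0 \<in> bsol E p q Lp Lq" by blast
 obtain J v d where u: "ubasis E (bker E p q) (J :: 'a set) v d" using ubasis_bker_exists[OF fin] by blast
 note U = ubasisD[OF u]
 define C where "C j = (\<Sum>e\<in>E. \<bar>d j e\<bar> * (\<bar>Lp (p e)\<bar> + \<bar>m0 e\<bar>))" for j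
 have "vol E p q Lp Lq = vint J v m0 (posi E)" by (rule vol_eq[OF u m0])
 also have "... \<le> (\<integral>\<^sup>+t. indicator (Pi\<^sub>E J (%j. {- C j..C j})) t \<partial>PL J)"
  unfolding vint_def
 proof (rule nn_integral_mono)
  fix t assume t: "t \<in> space (PL J)"
  define m where "m = (%x. m0 x + (\<Sum>j\<in>J. t j * v j x))"
  have k: "(%x. \<Sum>j\<in>J. t j * v j x) \<in> bker E p q" using U by (intro bker_sum) auto
  have ms: "m \<in> bsol E p q Lp Lq" unfolding m_def by (rule bsol_add[OF m0 k])
  have tj: "t j = (\<Sum>e\<in>E. d j e * (m e - m0 e))" if j: "j \<in> J" for j
  proof -
   have "(\<Sum>e\<in>E. d j e * (m e - m0 e)) = (\<Sum>e\<in>E. \<Sum>k\<in>J. t k * (d j e * v k e))"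
    by (simp add: m_def sum_distrib_left mult_ac)
   also have "... = (\<Sum>k\<in>J. t k * (\<Sum>e\<in>E. d j e * v k e))"
    by (subst sum.swap) (simp add: sum_distrib_left)
   also have "... = (\<Sum>k\<in>J. if k = j then t j else 0)"
    using U(6)[OF j] by (intro sum.cong) auto
   also have "... = t j" using j U(2) by simp
   finally show ?thesis ..
  qed
  have "posi E m \<le> indicator (Pi\<^sub>E J (%j. {- C j..C j})) t"
  proof (cases "\<forall>e\<in>E. 0 < m e")
   case True
   have me: "m e \<le> Lp (p e)" if e: "e \<in> E" for e
   proof -
    have "m e \<le> bsum E p m (p e)" unfolding bsum_def
     using fin e True by (intro member_le_sum) (auto intro: less_imp_le)
    then show ?thesis using ms e by (auto simp: bsol_def)
   qed
   have "\<bar>t j\<bar> \<le> C j" if j: "j \<in> J" for j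
   proof -
    have "\<bar>t j\<bar> \<le> (\<Sum>e\<in>E. \<bar>d j e * (m e - m0 e)\<bar>)" unfolding tj[OF j] by (rule sum_abs)
    also have "... \<le> C j" unfolding C_def
    proof (rule sum_mono)
     fix e assume e: "e \<in> E"
     have "\<bar>m e - m0 e\<bar> \<le> \<bar>Lp (p e)\<bar> + \<bar>m0 e\<bar>" using me[OF e] True e by fastforce
     then show "\<bar>d j e * (m e - m0 e)\<bar> \<le> \<bar>d j e\<bar> * (\<bar>Lp (p e)\<bar> + \<bar>m0 e\<bar>)"
      by (simp add: abs_mult mult_left_mono)
    qed
    finally show ?thesis .
   qed
   then have "t \<in> Pi\<^sub>E J (%j. {- C j..C j})" using t by (force simp: space_PiM PiE_iff abs_le_iff)
   then show ?thesis by (simp add: posi_def)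
  qed (auto simp: posi_def)
  then show "posi E (%x. m0 x + (\<Sum>j\<in>J. t j * v j x)) \<le> indicator (Pi\<^sub>E J (%j. {- C j..C j})) t"
   unfolding m_def .
 qed
 also have "... = emeasure (PL J) (Pi\<^sub>E J (%j. {- C j..C j}))"
  using U by (intro nn_integral_indicator sets_PiM_I_finite) auto
 also have "... = (\<Prod>j\<in>J. emeasure lborel {- C j..C j})"
  using U by (intro PL.emeasure_PiM) auto
 also have "... < \<infinity>"
  by (simp add: less_top[symmetric] ennreal_prod_eq_top emeasure_lborel_Icc_eq)
 finally show ?thesis .
qed

subsection \<open>Operations on systems\<close>

text \<open>A basis is carried along an isomorphism of kernels that is integral in both directions.
  The map \<open>PH\<close> is given by an integer matrix \<open>M\<close> because the coordinate
  functionals are pulled back through it.\<close>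

lemma ubasis_iso:
 assumes u: "ubasis E K J v d" and fin: "finite E'"
  and M: "!!e x. e \<in> E ==> x \<in> E' ==> M e x \<in> \<int>"
  and PH: "!!m e. m \<in> K' ==> e \<in> E ==> (\<Sum>x\<in>E'. M e x * m x) = PH m e"
  and PHK: "!!m. m \<in> K' ==> PH m \<in> K"
  and PSK: "!!m. m \<in> K ==> PS m \<in> K'"
  and PSint: "!!m x. m \<in> K ==> (!!x. m x \<in> \<int>) ==> PS m x \<in> \<int>"
  and PSlin: "!!t x. PS (%x. \<Sum>j\<in>J. t j * v j x) x = (\<Sum>j\<in>J. t j * PS (v j) x)"
  and PHPS: "!!m. m \<in> K ==> PH (PS m) = m"
  and PSPH: "!!m. m \<in> K' ==> PS (PH m) = m"
 shows "\<exists>d'. ubasis E' K' J (%j. PS (v j)) d'"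
proof -
 note U = ubasisD[OF u]
 define d' where "d' j x = (\<Sum>e\<in>E. d j e * M e x)" for j x
 have d': "(\<Sum>x\<in>E'. d' j x * m x) = (\<Sum>e\<in>E. d j e * PH m e)" if "m \<in> K'" for j m
 proof -
  have "(\<Sum>x\<in>E'. d' j x * m x) = (\<Sum>x\<in>E'. \<Sum>e\<in>E. d j e * (M e x * m x))"
   by (simp add: d'_def sum_distrib_right mult.assoc)
  also have "... = (\<Sum>e\<in>E. d j e * (\<Sum>x\<in>E'. M e x * m x))"
   by (subst sum.swap) (simp add: sum_distrib_left)
  also have "... = (\<Sum>e\<in>E. d j e * PH m e)" using PH[OF that] by simp
  finally show ?thesis .
 qed
 have "ubasis E' K' J (%j. PS (v j)) d'"
  unfolding ubasis_def
 proof (intro conjI ballI allI)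
  fix j k assume jk: "j \<in> J" "k \<in> J"
  show "(\<Sum>e\<in>E'. d' j e * PS (v k) e) = (if j = k then 1 else 0)"
   using d'[OF PSK[OF U(3)[OF jk(2)]], of j] U(6)[OF jk] PHPS[OF U(3)[OF jk(2)]] by simp
 next
  fix j x assume "j \<in> J"
  then show "PS (v j) x \<in> \<int>" using PSint U by blast
 next
  fix j e assume "j \<in> J" "e \<in> E'"
  then show "d' j e \<in> \<int>" unfolding d'_def using U M by (intro Ints_sum Ints_mult) auto
 next
  fix m x assume m: "m \<in> K'"
  have "PH m = (%x. \<Sum>j\<in>J. (\<Sum>e\<in>E. d j e * PH m e) * v j x)"
   using U(7)[OF PHK[OF m]] by (rule ext)
  then have "m x = PS (%x. \<Sum>j\<in>J. (\<Sum>e\<in>E. d j e * PH m e) * v j x) x"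
   using PSPH[OF m] by metis
  then show "m x = (\<Sum>j\<in>J. (\<Sum>e\<in>E'. d' j e * m e) * PS (v j) x)"
   unfolding PSlin d'[OF m] .
 qed (use fin U PSK in auto)
 then show ?thesis by blast
qed

text \<open>\<open>K\<close> is the direct sum of \<open>K'\<close> and the line of
  \<open>w\<close>, and the integer functional \<open>c\<close> projects onto the latter. As
  \<open>c\<close> takes the value 1 at \<open>w\<close>, the decomposition also holds for integer
  points; the old functionals are corrected so as to vanish on \<open>w\<close>.\<close>

lemma ubasis_extend:
 assumes u: "ubasis E K' J v d" and sub: "K' \<subseteq> K" and w: "w \<in> K" "!!x. w x \<in> \<int>"
  and c: "!!e. e \<in> E ==> c e \<in> \<int>" "(\<Sum>e\<in>E. c e * w e) = 1" "!!j. j \<in> J ==> (\<Sum>e\<in>E. c e * v j e) = 0"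
  and dec: "!!m. m \<in> K ==> (%x. m x - (\<Sum>e\<in>E. c e * m e) * w x) \<in> K'"
  and j0: "j0 ~: J"
 shows "\<exists>d'. ubasis E K (insert j0 J) (v(j0 := w)) d'"
proof -
 note U = ubasisD[OF u]
 define d' where "d' = (%j e. if j = j0 then c e else d j e - (\<Sum>e\<in>E. d j e * w e) * c e)"
 have d'0: "d' j0 = c" by (simp add: d'_def)
 have d'j: "(\<Sum>e\<in>E. d' j e * m e) = (\<Sum>e\<in>E. d j e * (m e - (\<Sum>e\<in>E. c e * m e) * w e))" if "j \<in> J" for j m
 proof -
  define D C where "D = (\<Sum>e\<in>E. d j e * w e)" and "C = (\<Sum>e\<in>E. c e * m e)"
  have "d' j e = d j e - D * c e" for e using that j0 by (auto simp: d'_def D_def)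
  then have "(\<Sum>e\<in>E. d' j e * m e) = (\<Sum>e\<in>E. d j e * m e) - D * C"
   by (simp add: left_diff_distrib sum_subtractf sum_distrib_left mult.assoc C_def)
  also have "D * C = (\<Sum>e\<in>E. d j e * (C * w e))"
   by (simp add: D_def sum_distrib_left mult_ac)
  finally show ?thesis by (simp add: right_diff_distrib sum_subtractf C_def)
 qed
 have "ubasis E K (insert j0 J) (v(j0 := w)) d'"
  unfolding ubasis_def
 proof (intro conjI ballI allI)
  fix j k assume "j \<in> insert j0 J" "k \<in> insert j0 J"
  then show "(\<Sum>e\<in>E. d' j e * (v(j0 := w)) k e) = (if j = k then 1 else 0)"
   using U(6) c j0 by (auto simp: d'0 d'j)
 next
  fix m x assume m: "m \<in> K"
  have "m x - (\<Sum>e\<in>E. c e * m e) * w x = (\<Sum>j\<in>J. (\<Sum>e\<in>E. d' j e * m e) * v j x)"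
   using U(7)[OF dec[OF m], of x] by (simp add: d'j)
  moreover have "(\<Sum>j\<in>J. (\<Sum>e\<in>E. d' j e * m e) * (v(j0 := w)) j x) = (\<Sum>j\<in>J. (\<Sum>e\<in>E. d' j e * m e) * v j x)"
   using j0 by (intro sum.cong) auto
  ultimately show "m x = (\<Sum>j\<in>insert j0 J. (\<Sum>e\<in>E. d' j e * m e) * (v(j0 := w)) j x)"
   using U(2) j0 by (simp add: d'0)
 next
  fix j e assume "j \<in> insert j0 J" "e \<in> E"
  then show "d' j e \<in> \<int>"
   unfolding d'_def using U c w by (auto intro!: Ints_diff Ints_mult Ints_sum)
 qed (use U w sub in \<open>auto simp: j0\<close>)
 then show ?thesis by blast
qed

text \<open>Both orders of integration occur: the new coordinate \<open>s\<close> is innermost when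
  a point moves on an edge, and outermost when it is the length of a part of a split
  component.\<close>

lemma vint_insert:
 assumes "finite J" "j0 ~: J" and f [measurable]: "f \<in> borel_measurable FM"
 shows "vint (insert j0 J) (v(j0 := w)) m0 f =
     (\<integral>\<^sup>+t. (\<integral>\<^sup>+s. f (%x. m0 x + (\<Sum>j\<in>J. t j * v j x) + s * w x) \<partial>lborel) \<partial>PL J)" (is ?A)
  and "vint (insert j0 J) (v(j0 := w)) m0 f = (\<integral>\<^sup>+s. vint J v (%x. m0 x + s * w x) f \<partial>lborel)" (is ?B)
proof -
 have m: "(%t. f (%x. m0 x + (\<Sum>j\<in>insert j0 J. t j * (v(j0 := w)) j x))) \<in> borel_measurable (PL (insert j0 J))"
  by (rule measurable_compose[OF vcomb_measurable f]) (use assms in simp)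
 have eq: "(\<Sum>j\<in>insert j0 J. (t(j0 := s)) j * (v(j0 := w)) j x) = (\<Sum>j\<in>J. t j * v j x) + s * w x" for t s x
 proof -
  have "(\<Sum>j\<in>J. (t(j0 := s)) j * (v(j0 := w)) j x) = (\<Sum>j\<in>J. t j * v j x)"
   using assms by (intro sum.cong) auto
  then show ?thesis using assms by simp
 qed
 show ?A unfolding vint_def
  by (subst PL.product_nn_integral_insert[OF assms(1,2) m]) (simp only: eq add.assoc)
 show ?B unfolding vint_def
  by (subst PL.product_nn_integral_insert_rev[OF assms(1,2) m]) (simp only: eq add.assoc add.commute add.left_commute)
qed

text \<open>Renaming edges permutes the coordinates of a metric and preserves integrality, so a
  basis is carried to a basis and positivity to positivity. Injectivity of the label maps keeps
  distinct equations distinct.\<close>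

lemma vol_reindex:
 fixes p q :: "'e => 'l" and p' q' :: "'f => 'k"
 assumes fin: "finite E" and bij: "bij_betw fi E E'"
  and p: "!!e. e \<in> E ==> p' (fi e) = h (p e)" "inj_on h (p ` E)" "!!e. e \<in> E ==> Lp' (h (p e)) = Lp (p e)"
  and q: "!!e. e \<in> E ==> q' (fi e) = k (q e)" "inj_on k (q ` E)" "!!e. e \<in> E ==> Lq' (k (q e)) = Lq (q e)"
 shows "vol E p q Lp Lq = vol E' p' q' Lp' Lq'"
proof -
 have fin': "finite E'" using bij fin by (simp add: bij_betw_finite)
 define ki where "ki = inv_into E fi"
 have ki: "!!x. x \<in> E' ==> ki x \<in> E" "!!x. x \<in> E' ==> fi (ki x) = x" "!!x. x \<in> E ==> ki (fi x) = x"
  unfolding ki_def using bij by (auto simp: bij_betw_def inv_into_into f_inv_into_f)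
 have fiE: "x \<in> E ==> fi x \<in> E'" for x using bij by (auto simp: bij_betw_def)
 define F where "F m = (%x. if x \<in> E' then m (ki x) else 0)" for m :: "'e => real"
 define G where "G m = (%x. if x \<in> E then m (fi x) else 0)" for m :: "'f => real"
 have gen: "bsum E' r' m' (r' (fi e)) = bsum E r m (r e)"
  if "e \<in> E" "!!e. e \<in> E ==> r' (fi e) = h (r e)" "inj_on h (r ` E)" "!!e. e \<in> E ==> m' (fi e) = m e"
  for r :: "'e => 'l" and r' :: "'f => 'k" and h m m' e
  unfolding bsum_def
 proof (rule sum.reindex_bij_witness[where i=fi and j=ki])
  fix a assume a: "a \<in> {f \<in> E'. r' f = r' (fi e)}"
  then have "r' (fi (ki a)) = r' (fi e)" using ki by auto
  then have "h (r (ki a)) = h (r e)" using a ki(1)[of a] that(2)[of "ki a"] that(2)[OF that(1)] by simp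
  then have "r (ki a) = r e" using a ki that(1,3) by (auto dest: inj_onD)
  then show "ki a \<in> {ea \<in> E. r ea = r e}" "fi (ki a) = a" using a ki by auto
  show "m (ki a) = m' a" using a ki that(4)[of "ki a"] by auto
 next
  fix b assume "b \<in> {f \<in> E. r f = r e}"
  then show "fi b \<in> {ea \<in> E'. r' ea = r' (fi e)}" "ki (fi b) = b" using ki fiE that by auto
 qed
 have im: "(\<forall>x\<in>E'. P x) \<longleftrightarrow> (\<forall>e\<in>E. P (fi e))" for P using ki fiE by metis
 have Feq: "F m (fi e) = m e" if "e \<in> E" for e m using that by (simp add: F_def ki fiE)
 have Geq: "m (fi e) = G m e" if "e \<in> E" for e m using that by (simp add: G_def)
 have Fp: "bsum E' p' (F m) (p' (fi e)) = bsum E p m (p e)" if "e \<in> E" for m e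
  by (rule gen[where h=h]) (use that p Feq in auto)
 have Fq: "bsum E' q' (F m) (q' (fi e)) = bsum E q m (q e)" if "e \<in> E" for m e
  by (rule gen[where h=k]) (use that q Feq in auto)
 have Gp: "bsum E' p' m (p' (fi e)) = bsum E p (G m) (p e)" if "e \<in> E" for m e
  by (rule gen[where h=h]) (use that p Geq in auto)
 have Gq: "bsum E' q' m (q' (fi e)) = bsum E q (G m) (q e)" if "e \<in> E" for m e
  by (rule gen[where h=k]) (use that q Geq in auto)
 have p1: "Lp' (p' (fi e)) = Lp (p e)" if "e \<in> E" for e using p that by auto
 have q1: "Lq' (q' (fi e)) = Lq (q e)" if "e \<in> E" for e using q that by auto
 have F0: "x ~: E' ==> F m x = 0" for m x by (simp add: F_def)
 have G0: "x ~: E ==> G m x = 0" for m x by (simp add: G_def)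
 have sF: "F m \<in> bsol E' p' q' Lp' Lq'" if "m \<in> bsol E p q Lp Lq" for m
  using that unfolding bsol_def by (simp add: im Fp Fq p1 q1 F0)
 have kF: "F m \<in> bker E' p' q'" if "m \<in> bker E p q" for m
  using that unfolding bker_def by (simp add: im Fp Fq F0)
 have sG: "G m \<in> bsol E p q Lp Lq" if "m \<in> bsol E' p' q' Lp' Lq'" for m
  using that unfolding bsol_def by (simp add: im Gp Gq p1 q1 G0)
 have kG: "G m \<in> bker E p q" if "m \<in> bker E' p' q'" for m
  using that unfolding bker_def by (simp add: im Gp Gq G0)
 show ?thesis
 proof (cases "bsol E p q Lp Lq = {}")
  case True
  then have "bsol E' p' q' Lp' Lq' = {}" using sG by blast
  then show ?thesis using True by (simp add: vol_empty)
 next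
  case False
  then obtain m0 where m0: "m0 \<in> bsol E p q Lp Lq" by blast
  obtain J v d where u: "ubasis E (bker E p q) (J :: 'e set) v d" using ubasis_bker_exists[OF fin] by blast
  have "\<exists>d'. ubasis E' (bker E' p' q') J (%j. F (v j)) d'"
  proof (rule ubasis_iso[OF u fin', where M="%e x. if x = fi e then 1 else 0" and PH=G])
   fix m e assume "m \<in> bker E' p' q'" "e \<in> E"
   have "(\<Sum>x\<in>E'. (if x = fi e then 1 else 0) * m x) = (\<Sum>x\<in>E'. if x = fi e then m x else 0)"
    by (intro sum.cong) auto
   then show "(\<Sum>x\<in>E'. (if x = fi e then 1 else 0) * m x) = G m e"
    using fin' fiE \<open>e \<in> E\<close> by (simp add: G_def)
  next
   fix m assume "m \<in> bker E p q"
   then show "G (F m) = m" using ki fiE by (auto simp: fun_eq_iff bker_def G_def F_def)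
  next
   fix m assume "m \<in> bker E' p' q'"
   then show "F (G m) = m" using ki fiE by (auto simp: fun_eq_iff bker_def G_def F_def)
  qed ((rule kF kG, assumption) | (auto simp: F_def; fail))+
  then obtain d' where u': "ubasis E' (bker E' p' q') J (%j. F (v j)) d'" by blast
  have m0': "F m0 \<in> bsol E' p' q' Lp' Lq'" by (rule sF[OF m0])
  have "vol E' p' q' Lp' Lq' = vint J (%j. F (v j)) (F m0) (posi E')" by (rule vol_eq[OF u' m0'])
  also have "... = vint J v m0 (posi E)"
   unfolding vint_def
   by (intro nn_integral_cong) (simp add: posi_def im F_def fiE ki)
  also have "... = vol E p q Lp Lq" by (rule vol_eq[OF u m0, symmetric])
  finally show ?thesis ..
 qed
qed

lemma vol_cong:
 assumes "finite E" "!!e. e \<in> E ==> p e = p' e" "!!e. e \<in> E ==> q e = q' e"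
  "!!e. e \<in> E ==> Lp (p e) = Lp' (p e)" "!!e. e \<in> E ==> Lq (q e) = Lq' (q e)"
 shows "vol E p q Lp Lq = vol E p' q' Lp' Lq'"
 by (rule vol_reindex[where fi=id and h=id and k=id]) (use assms in auto)

text \<open>The kernel is zero and its basis empty; the product measure over the empty set is a unit
  point mass.\<close>

lemma vol_singleton:
 fixes p q :: "'b => 'c"
 assumes "0 < Lp (p a)" "Lp (p a) = Lq (q a)"
 shows "vol {a} p q Lp Lq = 1"
proof -
 have "ubasis {a} (bker {a} p q) ({} :: 'b set) (%_ _. 0) (%_ _. 0)"
  unfolding ubasis_def
 proof (intro conjI ballI allI)
  fix m x assume "m \<in> bker {a} p q"
  moreover have "{e. e = a & p e = p a} = {a}" by auto
  ultimately have "m x = 0" by (cases "x = a") (auto simp: bker_def bsum_def)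
  then show "m x = (\<Sum>j\<in>{}. (\<Sum>e\<in>{a}. 0 * m e) * 0)" by simp
 qed auto
 moreover have "(%x. if x = a then Lp (p a) else 0) \<in> bsol {a} p q Lp Lq"
 proof -
  have "{e. e = a & r e = r a} = {a}" for r :: "'b => 'c" by auto
  then show ?thesis using assms by (auto simp: bsol_def bsum_def)
 qed
 ultimately have "vol {a} p q Lp Lq = vint ({} :: 'b set) (%_ _. 0) (%x. if x = a then Lp (p a) else 0) (posi {a})"
  by (rule vol_eq)
 also have "... = 1" using assms by (simp add: vint_def posi_def space_PiM_empty)
 finally show ?thesis .
qed

section \<open>Insertion of a point, splitting of a component, disjoint union, slicing\<close>

lemma bsum_insert:
 assumes "finite E" "a ~: E"
 shows "bsum (insert a E) (p(a := i)) m l = (if l = i then m a else 0) + bsum E p m l"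
proof -
 have "{e \<in> insert a E. (p(a := i)) e = l} = (if l = i then {a} else {}) Un {e \<in> E. p e = l}"
  using assms by auto
 then show ?thesis unfolding bsum_def using assms by auto
qed

lemma bsum_upd_in:
 assumes "finite E" "e \<in> E"
 shows "bsum E p (m(e := m e + r)) l = bsum E p m l + (if p e = l then r else 0)"
proof -
 have "bsum E p (m(e := m e + r)) l = (\<Sum>x\<in>{x \<in> E. p x = l}. m x + (if x = e then r else 0))"
  unfolding bsum_def by (intro sum.cong) auto
 then show ?thesis using assms by (simp add: sum.distrib bsum_def)
qed

lemma bsum_upd_out: "e ~: E ==> bsum E p (m(e := r)) l = bsum E p m l"
 unfolding bsum_def by (intro sum.cong) auto

lemma bsum_cong: "(!!x. x \<in> E ==> p x = p' x) ==> (!!x. x \<in> E ==> m x = m' x) ==> bsum E p m l = bsum E p' m' l"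
 unfolding bsum_def by (rule sum.cong) auto

lemma ubasis_enlarge:
 assumes u: "ubasis E K J v d" and E1: "E \<subseteq> E1" "finite E1" and K: "!!m x. m \<in> K ==> x ~: E ==> m x = 0"
 shows "ubasis E1 K J v (%j e. if e \<in> E then d j e else 0)"
proof -
 note U = ubasisD[OF u]
 have s: "(\<Sum>e\<in>E1. (if e \<in> E then d j e else 0) * m e) = (\<Sum>e\<in>E. d j e * m e)" for j m
 proof -
  have "(\<Sum>e\<in>E. d j e * m e) = (\<Sum>e\<in>E. (if e \<in> E then d j e else 0) * m e)" by (rule sum.cong) auto
  also have "... = (\<Sum>e\<in>E1. (if e \<in> E then d j e else 0) * m e)"
   using E1 by (intro sum.mono_neutral_left) auto
  finally show ?thesis ..
 qed
 show ?thesis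
  unfolding ubasis_def s
 proof (intro conjI ballI allI)
  fix m x assume "m \<in> K" then show "m x = (\<Sum>j\<in>J. (\<Sum>e\<in>E. d j e * m e) * v j x)" by (rule U(7))
 qed (use U E1 in simp_all)
qed

lemma vint_sum:
 assumes "finite J" "!!a. a \<in> A ==> f a \<in> borel_measurable FM"
 shows "(\<Sum>a\<in>A. vint J v m0 (f a)) = vint J v m0 (%m. \<Sum>a\<in>A. f a m)"
 unfolding vint_def
 by (rule nn_integral_sum[symmetric]) (use assms measurable_compose[OF vcomb_measurable] in auto)

lemma vint_cmult:
 assumes "finite J" "f \<in> borel_measurable FM"
 shows "vint J v m0 (%m. c * f m) = c * vint J v m0 f"
 unfolding vint_def
 by (rule nn_integral_cmult) (use assms measurable_compose[OF vcomb_measurable] in auto)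

text \<open>Integration over the position of a new point on the edge \<open>e\<close>.\<close>

lemma vol_insert:
 assumes fin: "finite E" and a: "a ~: E" and e: "e \<in> E"
  and J: "J \<subseteq> E" and u: "ubasis E (bker E p q) J v d" and m0: "m0 \<in> bsol E p q Lp Lq"
 shows "vol (insert a E) (p(a := p e)) (q(a := q e)) Lp Lq = vint J v m0 (%m. posi E m * ennreal (m e))"
proof -
 note U = ubasisD[OF u]
 define p1 q1 where "p1 = p(a := p e)" and "q1 = q(a := q e)"
 have ae: "a ~= e" using a e by auto
 \<comment> \<open>\<open>w\<close> moves one unit of length from \<open>e\<close> to the new edge
   \<open>a\<close>. It spans a complement of the old kernel, and the value at \<open>a\<close> is
   the corresponding coordinate functional.\<close>
 define w where "w = (%_. 0 :: real)(e := -1, a := 1)"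
 have bw: "bsum (insert a E) (r(a := r e)) w l = 0" for r :: "'a => 'b" and l
  using bsum_upd_in[OF fin e, of r "%_. 0" "-1" l]
  unfolding w_def bsum_insert[OF fin a] bsum_upd_out[OF a] by (auto simp: bsum_def)
 have wK: "w \<in> bker (insert a E) p1 q1"
  unfolding bker_all p1_def q1_def by (simp add: bw) (use e in \<open>auto simp: w_def\<close>)
 have sub: "bker E p q \<subseteq> bker (insert a E) p1 q1"
  unfolding p1_def q1_def bker_all subset_iff using a fin by (simp add: bsum_insert)
 have ms: "m0 \<in> bsol (insert a E) p1 q1 Lp Lq"
  using m0 a e fin unfolding bsol_def p1_def q1_def by (auto simp: bsum_insert)
 have u1: "ubasis (insert a E) (bker E p q) J v (%j x. if x \<in> E then d j x else 0)"
  by (rule ubasis_enlarge[OF u]) (use fin in \<open>auto simp: bker_def\<close>)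
 have ca: "(\<Sum>x\<in>insert a E. (if x = a then 1 else 0) * m x) = m a" for m :: "'a => real"
 proof -
  have "(\<Sum>x\<in>insert a E. (if x = a then 1 else 0) * m x) = (\<Sum>x\<in>insert a E. if x = a then m x else 0)"
   by (rule sum.cong) auto
  then show ?thesis using fin by simp
 qed
 have dec: "(%x. m x - (\<Sum>x\<in>insert a E. (if x = a then 1 else 0) * m x) * w x) \<in> bker E p q"
  if m: "m \<in> bker (insert a E) p1 q1" for m
  unfolding ca
 proof -
  have eq: "(%x. m x - m a * w x) = (m(e := m e + m a))(a := 0)"
   using ae by (auto simp: w_def)
  have z: "bsum E r (%x. m x - m a * w x) l = 0"
   if "!!l. bsum (insert a E) (r(a := r e)) m l = 0" for r :: "'a => 'b" and l
   using that[of l] unfolding eq bsum_upd_out[OF a] bsum_upd_in[OF fin e] bsum_insert[OF fin a] by auto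
  have "bsum E p (%x. m x - m a * w x) l = 0" "bsum E q (%x. m x - m a * w x) l = 0" for l
   using m unfolding bker_all p1_def q1_def by (auto intro!: z)
  then show "(%x. m x - m a * w x) \<in> bker E p q"
   using m ae e unfolding bker_all by (auto simp: w_def)
 qed
 have aJ: "a ~: J" using J a by auto
 obtain d' where u2: "ubasis (insert a E) (bker (insert a E) p1 q1) (insert a J) (v(a := w)) d'"
 proof -
  have "\<exists>d'. ubasis (insert a E) (bker (insert a E) p1 q1) (insert a J) (v(a := w)) d'"
  proof (rule ubasis_extend[OF u1 sub wK _ _ _ _ dec aJ])
   show "(\<Sum>x\<in>insert a E. (if x = a then 1 else 0) * w x) = 1" unfolding ca by (simp add: w_def)
   show "(\<Sum>x\<in>insert a E. (if x = a then 1 else 0) * v j x) = 0" if "j \<in> J" for j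
    unfolding ca using U(3)[OF that] a by (simp add: bker_def)
  qed (auto simp: w_def)
  then show ?thesis using that by blast
 qed
 have "vol (insert a E) p1 q1 Lp Lq = vint (insert a J) (v(a := w)) m0 (posi (insert a E))"
  by (rule vol_eq[OF u2 ms])
 also have "... = (\<integral>\<^sup>+t. (\<integral>\<^sup>+s. posi (insert a E) (%x. m0 x + (\<Sum>j\<in>J. t j * v j x) + s * w x) \<partial>lborel) \<partial>PL J)"
  by (rule vint_insert(1)) (use U aJ fin in auto)
 also have "... = vint J v m0 (%m. posi E m * ennreal (m e))"
  unfolding vint_def
 proof (rule nn_integral_cong)
  fix t assume "t \<in> space (PL J)"
  define m where "m = (%x. m0 x + (\<Sum>j\<in>J. t j * v j x))"
  have ma: "m a = 0"
   using a m0 U(3) unfolding m_def bsol_def bker_def by (simp cong: sum.cong)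
  \<comment> \<open>As \<open>m a = 0\<close>, the edge \<open>a\<close> gets length
    \<open>s\<close> and \<open>e\<close> keeps \<open>m e - s\<close>; positivity cuts out the
    interval from 0 to \<open>m e\<close>.\<close>
  have "(\<integral>\<^sup>+s. posi (insert a E) (%x. m x + s * w x) \<partial>lborel) =
   (\<integral>\<^sup>+s. (if \<forall>x\<in>E-{e}. 0 < m x then 1 else 0) * indicator {0<..<m e} s \<partial>lborel)"
  proof (rule nn_integral_cong)
   fix s :: real
   have "(\<forall>x\<in>insert a E. 0 < m x + s * w x) \<longleftrightarrow> (\<forall>x\<in>E-{e}. 0 < m x) & s \<in> {0<..<m e}"
    using ma a e ae by (auto simp: w_def)
   then show "posi (insert a E) (%x. m x + s * w x) = (if \<forall>x\<in>E-{e}. 0 < m x then 1 else 0) * indicator {0<..<m e} s"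
    by (simp add: posi_def indicator_def)
  qed
  also have "... = (if \<forall>x\<in>E-{e}. 0 < m x then 1 else 0) * emeasure lborel {0<..<m e}"
   by (simp add: nn_integral_cmult_indicator)
  also have "... = posi E m * ennreal (m e)"
  proof (cases "0 < m e")
   case True
   then have "(\<forall>x\<in>E. 0 < m x) = (\<forall>x\<in>E-{e}. 0 < m x)" by auto
   then show ?thesis using True by (simp add: posi_def)
  next
   case False
   then show ?thesis using e by (auto simp: posi_def ennreal_neg)
  qed
  finally show "(\<integral>\<^sup>+s. posi (insert a E) (%x. m0 x + (\<Sum>j\<in>J. t j * v j x) + s * w x) \<partial>lborel) =
   posi E (%x. m0 x + (\<Sum>j\<in>J. t j * v j x)) * ennreal (m0 e + (\<Sum>j\<in>J. t j * v j e))"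
   unfolding m_def .
 qed
 finally show ?thesis unfolding p1_def q1_def .
qed

text \<open>Each edge on component \<open>i\<close> contributes the integral of its length by
  \<open>vol_insert\<close>, and on the solution space these lengths add up to the constant
  \<open>Lp i\<close>.\<close>

lemma vol_insert_sum:
 assumes fin: "finite E" and a: "a ~: E" and i: "i \<in> p ` E"
 shows "(\<Sum>e\<in>{e\<in>E. p e = i}. vol (insert a E) (p(a := i)) (q(a := q e)) Lp Lq) = ennreal (Lp i) * vol E p q Lp Lq"
proof (cases "bsol E p q Lp Lq = {}")
 case True
 have "bsol (insert a E) (p(a := i)) (q(a := q e)) Lp Lq = {}" if e: "e \<in> E" "p e = i" for e
 proof (rule ccontr)
  assume "\<not> ?thesis"
  then obtain m where m: "m \<in> bsol (insert a E) (p(a := i)) (q(a := q e)) Lp Lq" by blast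
  have x: "x ~= a" if "x \<in> E" for x using that a by auto
  \<comment> \<open>If the system with the additional point had a solution, merging the two parts of
    \<open>e\<close> would solve the original one.\<close>
  have B: "bsum E r (m(e := m e + m a, a := 0)) l = bsum (insert a E) (r(a := r e)) m l" for r :: "'a => 'b" and l
   by (auto simp: bsum_upd_out[OF a] bsum_upd_in[OF fin e(1)] bsum_insert[OF fin a])
  have "m(e := m e + m a, a := 0) \<in> bsol E p q Lp Lq"
   using m x e(1) unfolding bsol_def e(2)[symmetric] by (auto simp: B)
  then show False using True by blast
 qed
 then show ?thesis using True by (simp add: vol_empty)
next
 case False
 then obtain m0 where m0: "m0 \<in> bsol E p q Lp Lq" by blast
 obtain J v d where J: "J \<subseteq> E" and u: "ubasis E (bker E p q) J v d" using ubasis_bker_exists[OF fin] by blast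
 have "(\<Sum>e\<in>{e\<in>E. p e = i}. vol (insert a E) (p(a := i)) (q(a := q e)) Lp Lq) =
  (\<Sum>e\<in>{e\<in>E. p e = i}. vint J v m0 (%m. posi E m * ennreal (m e)))"
  using vol_insert[OF fin a _ J u m0] by (intro sum.cong) auto
 also have "... = vint J v m0 (%m. \<Sum>e\<in>{e\<in>E. p e = i}. posi E m * ennreal (m e))"
  using ubasisD[OF u] fin by (intro vint_sum) auto
 also have "... = vint J v m0 (%m. ennreal (Lp i) * posi E m)"
 proof (rule vint_bsol_cong[OF u m0])
  fix m assume m: "m \<in> bsol E p q Lp Lq"
  show "(\<Sum>e\<in>{e\<in>E. p e = i}. posi E m * ennreal (m e)) = ennreal (Lp i) * posi E m"
  proof (cases "\<forall>e\<in>E. 0 < m e")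
   case True
   have "(\<Sum>e\<in>{e\<in>E. p e = i}. ennreal (m e)) = ennreal (bsum E p m i)"
    unfolding bsum_def using True by (intro sum_ennreal) (auto intro: less_imp_le)
   also have "bsum E p m i = Lp i" using m i by (auto simp: bsol_def)
   finally show ?thesis using True by (simp add: posi_def)
  qed (simp only: posi_def if_False mult_zero_left mult_zero_right sum.neutral_const)
 qed
 also have "... = ennreal (Lp i) * vol E p q Lp Lq"
  using ubasisD[OF u] fin by (simp add: vint_cmult vol_eq[OF u m0])
 finally show ?thesis .
qed

text \<open>Integration over the length \<open>x\<close> of one of the two parts of a split component.\<close>

lemma vol_split:
 fixes p' q :: "'e => 'l"
 assumes fin: "finite E" and ik: "i ~= k" "i \<in> p' ` E" "k \<in> p' ` E"
  and p: "!!x. x \<in> E ==> p x = (if p' x = k then i else p' x)"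
  and w: "!!x. x ~: E ==> w x = 0" "!!x. w x \<in> \<int>" "!!l. bsum E p' w l = (if l = i then 1 else if l = k then -1 else 0)"
   "!!l. bsum E q w l = 0"
 shows "(%x. vol E p' q (Lp(i := x, k := Lp i - x)) Lq) \<in> borel_measurable borel"
  and "vol E p q Lp Lq = (\<integral>\<^sup>+x. vol E p' q (Lp(i := x, k := Lp i - x)) Lq \<partial>lborel)"
proof -
 have bs: "bsum E p m l = (if l = k then 0 else if l = i then bsum E p' m i + bsum E p' m k else bsum E p' m l)" for m l
 proof -
  have "{x \<in> E. p x = i} = {x \<in> E. p' x = i} Un {x \<in> E. p' x = k}" using p ik by auto
  then have 1: "bsum E p m i = bsum E p' m i + bsum E p' m k"
   unfolding bsum_def using fin ik by (simp add: sum.union_disjoint disjoint_iff)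
  have "{x \<in> E. p x = k} = {}" using p ik by auto
  then have 2: "bsum E p m k = 0" unfolding bsum_def by (simp only: sum.empty)
  have "{x \<in> E. p x = l} = {x \<in> E. p' x = l}" if "l ~= i" "l ~= k" using p that by auto
  then have 3: "bsum E p m l = bsum E p' m l" if "l ~= i" "l ~= k" unfolding bsum_def using that by simp
  show ?thesis using 1 2 3 by auto
 qed
 have imp: "p ` E = p' ` E - {k}"
 proof
  show "p ` E \<subseteq> p' ` E - {k}" using p ik by auto
  show "p' ` E - {k} \<subseteq> p ` E"
  proof
   fix l assume "l \<in> p' ` E - {k}"
   then obtain x where "x \<in> E" "p' x = l" "l ~= k" by auto
   then have "p x = l" "x \<in> E" using p by auto
   then show "l \<in> p ` E" by auto
  qed
 qed
 have solp: "m \<in> bsol E r q L Lq \<longleftrightarrow> (\<forall>x. x ~: E --> m x = 0) & (\<forall>l\<in>r ` E. bsum E r m l = L l) & (\<forall>e\<in>E. bsum E q m (q e) = Lq (q e))"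
  for m r L unfolding bsol_def by auto
 have sol: "m \<in> bsol E p q Lp Lq \<longleftrightarrow> m \<in> bsol E p' q (Lp(i := bsum E p' m i, k := Lp i - bsum E p' m i)) Lq" for m
  unfolding solp imp using ik by (auto simp: bs)
 have sol2: "bsum E p' m i = x" if "m \<in> bsol E p' q (Lp(i := x, k := Lp i - x)) Lq" for m x
  using that ik unfolding solp by auto
 have sub: "bker E p' q \<subseteq> bker E p q" unfolding bker_all subset_iff by (auto simp: bs)
 have wK: "w \<in> bker E p q" unfolding bker_all using w ik by (auto simp: bs)
 show "(%x. vol E p' q (Lp(i := x, k := Lp i - x)) Lq) \<in> borel_measurable borel"
  and "vol E p q Lp Lq = (\<integral>\<^sup>+x. vol E p' q (Lp(i := x, k := Lp i - x)) Lq \<partial>lborel)"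
 proof (atomize (full), cases "bsol E p q Lp Lq = {}")
  case True
  then have "bsol E p' q (Lp(i := x, k := Lp i - x)) Lq = {}" for x
   using sol sol2 by blast
  then show "((%x. vol E p' q (Lp(i := x, k := Lp i - x)) Lq) \<in> borel_measurable borel) &
   vol E p q Lp Lq = (\<integral>\<^sup>+x. vol E p' q (Lp(i := x, k := Lp i - x)) Lq \<partial>lborel)"
   using True by (simp add: vol_empty)
 next
  case False
  then obtain m1 where m1: "m1 \<in> bsol E p q Lp Lq" by blast
  obtain J0 v0 d0 where u0: "ubasis E (bker E p' q) (J0 :: 'e set) v0 d0" using ubasis_bker_exists[OF fin] by blast
  \<comment> \<open>Reindexing by options provides \<open>None\<close> as a fresh index for the
    vector \<open>w\<close>, even if \<open>J0\<close> exhausts its type.\<close>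
  define J v d where "J = Some ` J0" and "v = (%j. v0 (the j))" and "d = (%j. d0 (the j))"
  have u: "ubasis E (bker E p' q) J v d"
   using ubasisD[OF u0] unfolding ubasis_def J_def v_def d_def
   by (simp add: sum.reindex ball_simps) 
  note U = ubasisD[OF u]
  have N: "None ~: J" by (auto simp: J_def)
  \<comment> \<open>The base point is moved along \<open>w\<close> to have sum 0 at
    \<open>i\<close>; then the coordinate along \<open>w\<close> is the length \<open>x\<close> of
    the part \<open>i\<close> itself.\<close>
  define m0 where "m0 = (%x. m1 x + (- bsum E p' m1 i) * w x)"
  have m0x: "(%e. m0 e + x * w e) \<in> bsol E p' q (Lp(i := x, k := Lp i - x)) Lq" for x
  proof -
   have b: "bsum E r (%e. m0 e + x * w e) l = bsum E r m1 l + (x - bsum E p' m1 i) * bsum E r w l" for r :: "'e => 'l" and l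
    unfolding m0_def bsum_lin by (simp add: algebra_simps)
   show ?thesis
    using m1 unfolding sol unfolding solp b w(3,4) using ik w(1) by (auto simp: m0_def)
  qed
  have m0p: "m0 \<in> bsol E p q Lp Lq" unfolding m0_def
   using bsol_add[OF m1, of "%x. - bsum E p' m1 i * w x"] bker_add[OF _ wK, of "%_. 0" "- bsum E p' m1 i"]
   by (simp add: bker_def bsum_def)
  have v: "vol E p' q (Lp(i := x, k := Lp i - x)) Lq = vint J v (%e. m0 e + x * w e) (posi E)" for x
   by (rule vol_eq[OF u m0x])
  have ci: "(\<Sum>e\<in>E. (if p' e = i then 1 else 0) * m e) = bsum E p' m i" for m
   unfolding bsum_def sum.inter_filter[OF fin] by (rule sum.cong) auto
  have dec: "(%x. m x - (\<Sum>e\<in>E. (if p' e = i then 1 else 0) * m e) * w x) \<in> bker E p' q" if m: "m \<in> bker E p q" for m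
  proof -
   have eq: "(%x. m x - bsum E p' m i * w x) = (%x. m x + (- bsum E p' m i) * w x)" by auto
   have "bsum E p m l = 0" for l using m by (simp add: bker_all)
   from this[of i] this[unfolded bs] have "bsum E p' m i + bsum E p' m k = 0" "!!l. l ~= i ==> l ~= k ==> bsum E p' m l = 0"
    using ik by (auto simp: bs split: if_splits) metis
   then show ?thesis using m w unfolding ci eq bker_all bsum_lin by auto
  qed
  obtain d' where u2: "ubasis E (bker E p q) (insert None J) (v(None := w)) d'"
  proof -
   have "\<exists>d'. ubasis E (bker E p q) (insert None J) (v(None := w)) d'"
   proof (rule ubasis_extend[OF u sub wK w(2) _ _ _ dec N])
    show "(\<Sum>e\<in>E. (if p' e = i then 1 else 0) * w e) = 1" unfolding ci w(3) by simp
    show "(\<Sum>e\<in>E. (if p' e = i then 1 else 0) * v j e) = 0" if "j \<in> J" for j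
     unfolding ci using U(3)[OF that] by (simp add: bker_all)
   qed auto
   then show ?thesis using that by blast
  qed
  have "vol E p q Lp Lq = (\<integral>\<^sup>+x. vol E p' q (Lp(i := x, k := Lp i - x)) Lq \<partial>lborel)"
   unfolding vol_eq[OF u2 m0p] v by (rule vint_insert(2)) (use U N fin in auto)
  moreover have "(%x. vol E p' q (Lp(i := x, k := Lp i - x)) Lq) \<in> borel_measurable borel"
  proof -
   interpret P: sigma_finite_measure "PL J" using PL.sigma_finite U(2) by blast
   have m1: "(%(x, t). %e. m0 e + x * w e + (\<Sum>j\<in>J. t j * v j e)) \<in> borel \<Otimes>\<^sub>M PL J \<rightarrow>\<^sub>M FM"
    by (rule measurable_PiM_single') (auto simp: space_PiM split_def)
   have "(%(x, t). posi E (%e. m0 e + x * w e + (\<Sum>j\<in>J. t j * v j e))) \<in> borel_measurable (borel \<Otimes>\<^sub>M PL J)"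
    using measurable_compose[OF m1 posi_measurable[OF fin]] by (simp add: split_def)
   then show ?thesis unfolding v vint_def by (rule P.borel_measurable_nn_integral)
  qed
  ultimately show "((%x. vol E p' q (Lp(i := x, k := Lp i - x)) Lq) \<in> borel_measurable borel) &
   vol E p q Lp Lq = (\<integral>\<^sup>+x. vol E p' q (Lp(i := x, k := Lp i - x)) Lq \<partial>lborel)" by blast
 qed
qed

lemma bsol_zero: "bsol E p q (%_. 0) (%_. 0) = bker E p q"
 by (simp add: bsol_def bker_def)

text \<open>All labels of \<open>E1\<close> except \<open>i\<close> belong to \<open>E1\<close>
  alone, so their equations survive the restriction. The sum at \<open>i\<close> is then forced,
  since the total lengths on both sides agree.\<close>

lemma bsol_restrict:
 fixes p q :: "'e => 'l"
 assumes fin: "finite E1" "finite E2" and dis: "E1 Int E2 = {}"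
  and p: "!!x y. x \<in> E1 ==> y \<in> E2 ==> p x = p y ==> p x = i" and i: "i \<in> p ` E1"
  and q: "q ` E1 Int q ` E2 = {}" and m: "m \<in> bsol (E1 Un E2) p q Lp Lq"
 shows "(%x. if x \<in> E1 then m x else 0) \<in> bsol E1 p q (Lp(i := (\<Sum>l\<in>q ` E1. Lq l) - (\<Sum>l\<in>p ` E1 - {i}. Lp l))) Lq"
proof -
 define m1 where "m1 = (%x. if x \<in> E1 then m x else 0)"
 have q1: "bsum E1 q m1 l = Lq l" if "l \<in> q ` E1" for l
 proof -
  have "{e \<in> E1 Un E2. q e = l} = {e \<in> E1. q e = l}" using q that by auto
  then have "bsum (E1 Un E2) q m l = bsum E1 q m1 l" unfolding bsum_def by (auto simp: m1_def intro!: sum.cong)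
  then show ?thesis using m that by (auto simp: bsol_def)
 qed
 have p1: "bsum E1 p m1 l = Lp l" if "l \<in> p ` E1 - {i}" for l
 proof -
  have "{e \<in> E1 Un E2. p e = l} = {e \<in> E1. p e = l}" using p that by auto
  then have "bsum (E1 Un E2) p m l = bsum E1 p m1 l" unfolding bsum_def by (auto simp: m1_def intro!: sum.cong)
  then show ?thesis using m that by (auto simp: bsol_def)
 qed
 have "bsum E1 p m1 i + (\<Sum>l\<in>p ` E1 - {i}. bsum E1 p m1 l) = (\<Sum>l\<in>p ` E1. bsum E1 p m1 l)"
  using i fin by (subst sum.remove[of _ i]) auto
 also have "... = (\<Sum>l\<in>q ` E1. bsum E1 q m1 l)" by (simp add: sum_bsum fin)
 finally have "bsum E1 p m1 i = (\<Sum>l\<in>q ` E1. Lq l) - (\<Sum>l\<in>p ` E1 - {i}. Lp l)"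
  by (simp add: p1 q1)
 then show ?thesis unfolding m1_def[symmetric] bsol_def using p1 q1 by (auto simp: m1_def)
qed

text \<open>By \<open>bsol_restrict\<close> the shares of the two parts in the common component
  \<open>i\<close> are constant on the solution space. The joint equation at \<open>i\<close>
  therefore decouples into one equation for each part, and solutions, integer kernel vectors and
  positivity all become products.\<close>

lemma vol_disjoint:
 fixes p q :: "'e => 'l"
 assumes fin: "finite E1" "finite E2" and dis: "E1 Int E2 = {}"
  and p: "!!x y. x \<in> E1 ==> y \<in> E2 ==> p x = p y ==> p x = i" and i: "i \<in> p ` E1" "i \<in> p ` E2"
  and q: "q ` E1 Int q ` E2 = {}"
  and x1: "x1 = (\<Sum>l\<in>q ` E1. Lq l) - (\<Sum>l\<in>p ` E1 - {i}. Lp l)"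
  and x2: "x2 = (\<Sum>l\<in>q ` E2. Lq l) - (\<Sum>l\<in>p ` E2 - {i}. Lp l)"
  and Li: "Lp i = x1 + x2"
 shows "vol (E1 Un E2) p q Lp Lq = vol E1 p q (Lp(i := x1)) Lq * vol E2 p q (Lp(i := x2)) Lq"
proof -
 define r1 r2 where "r1 = (%m x. if x \<in> E1 then m x else (0::real))" and "r2 = (%m x. if x \<in> E2 then m x else (0::real))"
 have p': "!!x y. x \<in> E2 ==> y \<in> E1 ==> p x = p y ==> p x = i" using p by metis
 have dis': "E2 Int E1 = {}" and q': "q ` E2 Int q ` E1 = {}" using dis q by auto
 have b1: "r1 m \<in> bsol E1 p q (Lp(i := x1)) Lq" if "m \<in> bsol (E1 Un E2) p q Lp Lq" for m
  unfolding r1_def x1 by (rule bsol_restrict[OF fin dis p i(1) q that])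
 have b2: "r2 m \<in> bsol E2 p q (Lp(i := x2)) Lq" if "m \<in> bsol (E1 Un E2) p q Lp Lq" for m
  unfolding r2_def x2 by (rule bsol_restrict[OF fin(2,1) dis' p' i(2) q']) (use that in \<open>simp_all add: Un_commute\<close>)
 have k1: "r1 m \<in> bker E1 p q" if "m \<in> bker (E1 Un E2) p q" for m
  using bsol_restrict[OF fin dis p i(1) q that[folded bsol_zero]] by (simp add: r1_def bsol_zero fun_upd_idem)
 have k2: "r2 m \<in> bker E2 p q" if "m \<in> bker (E1 Un E2) p q" for m
 proof -
  have "m \<in> bsol (E2 Un E1) p q (%_. 0) (%_. 0)" using that by (simp add: bsol_zero Un_commute)
  from bsol_restrict[OF fin(2,1) dis' p' i(2) q' this] show ?thesis
   by (simp add: r2_def bsol_zero fun_upd_idem)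
 qed
 have bU: "bsum (E1 Un E2) r (%x. m1 x + m2 x) l = bsum E1 r m1 l + bsum E2 r m2 l"
  if "!!x. x ~: E1 ==> m1 x = 0" "!!x. x ~: E2 ==> m2 x = 0" for r :: "'e => 'l" and l and m1 m2 :: "'e => real"
 proof -
  have "{e \<in> E1 Un E2. r e = l} = {e \<in> E1. r e = l} Un {e \<in> E2. r e = l}" by auto
  moreover have "{e \<in> E1. r e = l} Int {e \<in> E2. r e = l} = {}" using dis by auto
  ultimately have "bsum (E1 Un E2) r (%x. m1 x + m2 x) l = bsum E1 r (%x. m1 x + m2 x) l + bsum E2 r (%x. m1 x + m2 x) l"
   unfolding bsum_def using fin by (simp add: sum.union_disjoint)
  also have "bsum E1 r (%x. m1 x + m2 x) l = bsum E1 r m1 l"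
   using dis that by (intro bsum_cong refl) auto
  also have "bsum E2 r (%x. m1 x + m2 x) l = bsum E2 r m2 l"
   using dis that by (intro bsum_cong refl) auto
  finally show ?thesis .
 qed
 have comb: "(%x. m1 x + m2 x) \<in> bsol (E1 Un E2) p q Lp Lq"
  if m1: "m1 \<in> bsol E1 p q (Lp(i := x1)) Lq" and m2: "m2 \<in> bsol E2 p q (Lp(i := x2)) Lq" for m1 m2
 proof -
  have z: "!!x. x ~: E1 ==> m1 x = 0" "!!x. x ~: E2 ==> m2 x = 0" using m1 m2 by (auto simp: bsol_def)
  have sq: "bsum (E1 Un E2) q (%x. m1 x + m2 x) (q e) = Lq (q e)" if "e \<in> E1 Un E2" for e
  proof (cases "e \<in> E1")
   case True
   then have "q e ~: q ` E2" using q by auto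
   then show ?thesis using True m1 by (simp add: bU[OF z] bsum_outside bsol_def)
  next
   case False
   then have "q e ~: q ` E1" "e \<in> E2" using q that by auto
   then show ?thesis using m2 by (simp add: bU[OF z] bsum_outside bsol_def)
  qed
  have i1: "bsum E1 p m1 i = x1" "bsum E2 p m2 i = x2" using m1 m2 i by (auto simp: bsol_def)
  have sp: "bsum (E1 Un E2) p (%x. m1 x + m2 x) (p e) = Lp (p e)" if e: "e \<in> E1 Un E2" for e
  proof (cases "p e = i")
   case True
   then show ?thesis using i1 Li by (simp add: bU[OF z])
  next
   case ni: False
   show ?thesis
   proof (cases "e \<in> E1")
    case True
    then have "p e ~: p ` E2" using p ni by auto
    then show ?thesis using True ni m1 by (simp add: bU[OF z] bsum_outside bsol_def)
   next
    case False
    then have "p e ~: p ` E1" "e \<in> E2" using p' ni e by auto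
    then show ?thesis using ni m2 by (simp add: bU[OF z] bsum_outside bsol_def)
   qed
  qed
  show ?thesis using sp sq z by (auto simp: bsol_def)
 qed
 show ?thesis
 proof (cases "bsol E1 p q (Lp(i := x1)) Lq = {} \<or> bsol E2 p q (Lp(i := x2)) Lq = {}")
  case True
  then have "bsol (E1 Un E2) p q Lp Lq = {}" using b1 b2 by blast
  then show ?thesis using True by (auto simp: vol_empty)
 next
  case False
  then obtain m1 m2 where m1: "m1 \<in> bsol E1 p q (Lp(i := x1)) Lq" and m2: "m2 \<in> bsol E2 p q (Lp(i := x2)) Lq" by blast
  obtain J1 v1 d1 where J1: "J1 \<subseteq> E1" and u1: "ubasis E1 (bker E1 p q) J1 v1 d1" using ubasis_bker_exists[OF fin(1)] by blast
  obtain J2 v2 d2 where J2: "J2 \<subseteq> E2" and u2: "ubasis E2 (bker E2 p q) J2 v2 d2" using ubasis_bker_exists[OF fin(2)] by blast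
  note U1 = ubasisD[OF u1] and U2 = ubasisD[OF u2]
  have JJ: "J1 Int J2 = {}" using J1 J2 dis by auto
  define v where "v = (%j. if j \<in> J1 then v1 j else v2 j)"
  define d where "d = (%j e. if j \<in> J1 then (if e \<in> E1 then d1 j e else 0) else (if e \<in> E2 then d2 j e else 0))"
  have d1: "(\<Sum>e\<in>E1 Un E2. d j e * m e) = (\<Sum>e\<in>E1. d1 j e * m e)" if "j \<in> J1" for j m
   by (rule sum.mono_neutral_cong_right) (use fin that in \<open>auto simp: d_def\<close>)
  have d2: "(\<Sum>e\<in>E1 Un E2. d j e * m e) = (\<Sum>e\<in>E2. d2 j e * m e)" if "j \<in> J2" for j m
  proof -
   have "j ~: J1" using that JJ by auto
   then show ?thesis by (intro sum.mono_neutral_cong_right) (use fin in \<open>auto simp: d_def\<close>)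
  qed
  have v1z: "v1 j e = 0" if "j \<in> J1" "e ~: E1" for j e using U1(3)[OF that(1)] that by (auto simp: bker_def)
  have v2z: "v2 j e = 0" if "j \<in> J2" "e ~: E2" for j e using U2(3)[OF that(1)] that by (auto simp: bker_def)
  have sumJ: "(\<Sum>j\<in>J1 Un J2. c j * v j x) = (\<Sum>j\<in>J1. c j * v1 j x) + (\<Sum>j\<in>J2. c j * v2 j x)" for c x
  proof -
   have "(\<Sum>j\<in>J1 Un J2. c j * v j x) = (\<Sum>j\<in>J1. c j * v j x) + (\<Sum>j\<in>J2. c j * v j x)"
    using U1 U2 JJ by (intro sum.union_disjoint) auto
   moreover have "(\<Sum>j\<in>J1. c j * v j x) = (\<Sum>j\<in>J1. c j * v1 j x)" by (rule sum.cong) (auto simp: v_def)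
   moreover have "(\<Sum>j\<in>J2. c j * v j x) = (\<Sum>j\<in>J2. c j * v2 j x)" using JJ by (intro sum.cong) (auto simp: v_def)
   ultimately show ?thesis by simp
  qed
  have vK: "v j \<in> bker (E1 Un E2) p q" if "j \<in> J1 Un J2" for j
  proof (cases "j \<in> J1")
   case True
   then have "v1 j \<in> bker E1 p q" using U1 by auto
   then show ?thesis using True bU[of "v1 j" "%_. 0"] unfolding bker_all by (auto simp: v_def bsum_def)
  next
   case False
   then have "v2 j \<in> bker E2 p q" using U2 that by auto
   then show ?thesis using False bU[of "%_. 0" "v2 j"] unfolding bker_all by (auto simp: v_def bsum_def)
  qed
  have u: "ubasis (E1 Un E2) (bker (E1 Un E2) p q) (J1 Un J2) v d"
   unfolding ubasis_def
  proof (intro conjI ballI allI)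
   fix j x assume "j \<in> J1 Un J2" then show "v j x \<in> \<int>" using U1 U2 by (auto simp: v_def)
  next
   fix j e assume "j \<in> J1 Un J2" then show "d j e \<in> \<int>" using U1 U2 by (auto simp: d_def)
  next
   fix j k assume jk: "j \<in> J1 Un J2" "k \<in> J1 Un J2"
   have c1: "(\<Sum>e\<in>E1. d1 j e * v2 k e) = 0" if "k \<in> J2" for j k
    using v2z[OF that] dis by (intro sum.neutral) auto
   have c2: "(\<Sum>e\<in>E2. d2 j e * v1 k e) = 0" if "k \<in> J1" for j k
    using v1z[OF that] dis by (intro sum.neutral) auto
   show "(\<Sum>e\<in>E1 Un E2. d j e * v k e) = (if j = k then 1 else 0)"
    using jk JJ U1(6) U2(6) by (auto simp: d1 d2 v_def c1 c2)
  next
   fix m x assume m: "m \<in> bker (E1 Un E2) p q"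
   have "(\<Sum>j\<in>J1 Un J2. (\<Sum>e\<in>E1 Un E2. d j e * m e) * v j x) =
    (\<Sum>j\<in>J1. (\<Sum>e\<in>E1. d1 j e * r1 m e) * v1 j x) + (\<Sum>j\<in>J2. (\<Sum>e\<in>E2. d2 j e * r2 m e) * v2 j x)"
    unfolding sumJ by (simp add: d1 d2 r1_def r2_def)
   also have "... = r1 m x + r2 m x"
    using U1(7)[OF k1[OF m], of x] U2(7)[OF k2[OF m], of x] by simp
   also have "... = m x" using m dis by (auto simp: r1_def r2_def bker_def)
   finally show "m x = (\<Sum>j\<in>J1 Un J2. (\<Sum>e\<in>E1 Un E2. d j e * m e) * v j x)" ..
  qed (use fin U1 U2 vK in auto)
  define m0 where "m0 = (%x. m1 x + m2 x)"
  have m0: "m0 \<in> bsol (E1 Un E2) p q Lp Lq" unfolding m0_def by (rule comb[OF m1 m2])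
  define g1 where "g1 t = posi E1 (%x. m1 x + (\<Sum>j\<in>J1. t j * v1 j x))" for t
  define g2 where "g2 t = posi E2 (%x. m2 x + (\<Sum>j\<in>J2. t j * v2 j x))" for t
  have [measurable]: "g1 \<in> borel_measurable (PL J1)" "g2 \<in> borel_measurable (PL J2)"
   unfolding g1_def g2_def using U1 U2 fin by (auto intro!: measurable_compose[OF vcomb_measurable posi_measurable])
  have "vol (E1 Un E2) p q Lp Lq = vint (J1 Un J2) v m0 (posi (E1 Un E2))" by (rule vol_eq[OF u m0])
  also have "... = (\<integral>\<^sup>+t. (\<integral>\<^sup>+s. posi (E1 Un E2) (%x. m0 x + (\<Sum>j\<in>J1 Un J2. merge J1 J2 (t, s) j * v j x)) \<partial>PL J2) \<partial>PL J1)"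
   unfolding vint_def using U1 U2 fin
   by (intro PL.product_nn_integral_fold[OF JJ]) (auto intro!: measurable_compose[OF vcomb_measurable posi_measurable])
  also have "... = (\<integral>\<^sup>+t. (\<integral>\<^sup>+s. g1 t * g2 s \<partial>PL J2) \<partial>PL J1)"
  proof (intro nn_integral_cong)
   fix t s
   have s: "(\<Sum>j\<in>J1 Un J2. merge J1 J2 (t, s) j * v j x) = (\<Sum>j\<in>J1. t j * v1 j x) + (\<Sum>j\<in>J2. s j * v2 j x)" for x
    unfolding sumJ using JJ by (intro arg_cong2[where f="(+)"] sum.cong) (auto simp: merge_def)
   have e1: "m0 x + (\<Sum>j\<in>J1 Un J2. merge J1 J2 (t, s) j * v j x) = m1 x + (\<Sum>j\<in>J1. t j * v1 j x)" if "x \<in> E1" for x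
   proof -
    have "x ~: E2" using that dis by auto
    then have "m2 x = 0" "(\<Sum>j\<in>J2. s j * v2 j x) = 0" using m2 v2z by (auto simp: bsol_def)
    then show ?thesis unfolding s m0_def by simp
   qed
   have e2: "m0 x + (\<Sum>j\<in>J1 Un J2. merge J1 J2 (t, s) j * v j x) = m2 x + (\<Sum>j\<in>J2. s j * v2 j x)" if "x \<in> E2" for x
   proof -
    have "x ~: E1" using that dis by auto
    then have "m1 x = 0" "(\<Sum>j\<in>J1. t j * v1 j x) = 0" using m1 v1z by (auto simp: bsol_def)
    then show ?thesis unfolding s m0_def by simp
   qed
   show "posi (E1 Un E2) (%x. m0 x + (\<Sum>j\<in>J1 Un J2. merge J1 J2 (t, s) j * v j x)) = g1 t * g2 s"
    unfolding posi_def g1_def g2_def ball_Un by (auto simp: e1 e2)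
  qed
  also have "... = (\<integral>\<^sup>+t. g1 t \<partial>PL J1) * (\<integral>\<^sup>+s. g2 s \<partial>PL J2)"
   by (simp add: nn_integral_cmult nn_integral_multc)
  also have "... = vol E1 p q (Lp(i := x1)) Lq * vol E2 p q (Lp(i := x2)) Lq"
   unfolding vol_eq[OF u1 m1] vol_eq[OF u2 m2] vint_def g1_def g2_def ..
  finally show ?thesis .
 qed
qed

text \<open>The partial sums in the order of \<open>rk\<close> divide the total length into
  consecutive intervals. A value that is none of the division points lies in the interior of exactly
  one of them: the first whose upper end exceeds it.\<close>

lemma slice_unique:
 fixes m :: "'e => real" and rk :: "'e => nat"
 assumes X: "finite X" "inj_on rk X" and a: "a \<in> X" "!!x. x \<in> X ==> rk x \<le> rk a"
  and m: "!!x. x \<in> X ==> 0 < m x" and c: "0 < c" "c < (\<Sum>x\<in>X. m x)"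
  and gen: "!!x. x \<in> X ==> (\<Sum>y\<in>{y\<in>X. rk y < rk x}. m y) ~= c"
 shows "\<exists>e0\<in>X. \<forall>e\<in>X. (\<Sum>y\<in>{y\<in>X. rk y < rk e}. m y) < c & c < (\<Sum>y\<in>{y\<in>X. rk y < rk e}. m y) + m e \<longleftrightarrow> e = e0"
proof -
 define S where "S x = (\<Sum>y\<in>{y\<in>X. rk y < rk x}. m y)" for x
 have T: "S x + m x = (\<Sum>y\<in>{y\<in>X. rk y \<le> rk x}. m y)" if "x \<in> X" for x
 proof -
  have "{y\<in>X. rk y \<le> rk x} = insert x {y\<in>X. rk y < rk x}" using that X(2) by (auto simp: le_less inj_on_def)
  then show ?thesis using X by (simp add: S_def)
 qed
 have mono: "S x + m x \<le> S y" if "x \<in> X" "y \<in> X" "rk x < rk y" for x y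
  unfolding T[OF that(1)] unfolding S_def using X that m by (intro sum_mono2) (auto intro: less_imp_le)
 define Y where "Y = {x\<in>X. c < S x + m x}"
 have "a \<in> Y"
 proof -
  have "{y\<in>X. rk y \<le> rk a} = X" using a by auto
  then show ?thesis using a c T[OF a(1)] by (simp add: Y_def)
 qed
 then obtain e0 where e0: "e0 \<in> Y" "!!y. y \<in> Y ==> rk e0 \<le> rk y"
  using ex_has_least_nat[of "%x. x \<in> Y" a rk] by auto
 have e0X: "e0 \<in> X" using e0 by (auto simp: Y_def)
 have "S e0 < c"
 proof (rule ccontr)
  assume "\<not> S e0 < c"
  then have gt: "c < S e0" using gen[OF e0X] by (simp add: S_def)
  define Z where "Z = {y\<in>X. rk y < rk e0}"
  have "Z ~= {}"
  proof
   assume "Z = {}"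
   then have "S e0 = 0" unfolding S_def Z_def by (simp only: sum.empty)
   then show False using gt c by simp
  qed
  moreover have "finite Z" using X by (simp add: Z_def)
  ultimately have "Max (rk ` Z) \<in> rk ` Z" by (intro Max_in) auto
  then obtain y where y: "y \<in> Z" "rk y = Max (rk ` Z)" by auto
  have y2: "rk z \<le> rk y" if "z \<in> Z" for z
   unfolding y(2) using that \<open>finite Z\<close> by (intro Max_ge) auto
  have "{z\<in>X. rk z \<le> rk y} = Z" using y(1) y2 unfolding Z_def by fastforce
  then have "S y + m y = S e0" using T[of y] y by (simp add: Z_def S_def)
  then have "y \<in> Y" using gt y by (auto simp: Y_def Z_def)
  then show False using e0(2)[of y] y by (auto simp: Z_def)
 qed
 then have main: "S e < c & c < S e + m e \<longleftrightarrow> e = e0" if "e \<in> X" for e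
 proof (cases "rk e" "rk e0" rule: linorder_cases)
  case less
  then show ?thesis using mono[OF that e0X less] \<open>S e0 < c\<close> e0(2)[of e] that by (auto simp: Y_def)
 next
  case equal
  then have "e = e0" using X that e0X by (auto dest: inj_onD)
  then show ?thesis using \<open>S e0 < c\<close> e0 by (auto simp: Y_def)
 next
  case greater
  have "c < S e0 + m e0" using e0 by (auto simp: Y_def)
  then show ?thesis using mono[OF e0X that greater] greater by auto
 qed
 show ?thesis by (rule bexI[OF _ e0X]) (use main in \<open>auto simp: S_def\<close>)
qed

text \<open>The point at distance \<open>Lp j\<close> before the marked point falls into the interior of exactly one of the
 edges, except for a null set of metrics: the length of an initial proper part of the boundary
 component is not constant because the marked point can be moved.\<close>

lemma vol_slices:
 fixes p1 q1 :: "'e => 'l" and rk :: "'e => nat"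
 assumes fin: "finite E" and b: "b ~: E" and X: "X = {x\<in>E. p1 x = i}" and rk: "inj_on rk X"
  and ij: "i ~= j" "j ~: p1 ` E"
  and a: "a \<in> X" "!!x. x \<in> X ==> rk x \<le> rk a"
  and f: "f \<in> X" "!!x. x \<in> X ==> rk f \<le> rk x"
  and q: "q1 a = q1 f" and L: "0 < Lp i" "0 < Lp j"
 shows "(\<Sum>e\<in>X. vol (insert b E) (%x. if x = b \<or> (x \<in> X & rk x < rk e) then j else p1 x) (q1(b := q1 e)) Lp Lq)
     = vol E p1 q1 (Lp(i := Lp i + Lp j)) Lq"
proof -
 define pe where "pe e = (%x. if x = b \<or> (x \<in> X & rk x < rk e) then j else p1 x)" for e
 define qe where "qe e = q1(b := q1 e)" for e
 \<comment> \<open>\<open>S e m\<close> is the length of the edges before \<open>e\<close>.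
   \<open>PH\<close> forgets the point \<open>b\<close> on the edge \<open>e\<close>;
   \<open>PS\<close> puts it back at the position where \<open>b\<close> together with the edges
   before \<open>e\<close> has length \<open>c\<close>. For \<open>c = 0\<close> this is the linear
   part, acting on kernel vectors.\<close>
 define S where "S e m = (\<Sum>x\<in>{x\<in>X. rk x < rk e}. m x)" for e and m :: "'e => real"
 define PS where "PS c e m = m(b := c - S e m, e := m e - (c - S e m))" for c e m
 define PH where "PH e m = m(b := 0, e := m e + m b)" for e and m :: "'e => real"
 have XE: "X \<subseteq> E" "finite X" and bX: "b ~: X" using X fin b by auto
 have eb: "e ~= b" if "e \<in> X" for e using that bX by auto
 have eE: "e \<in> E" "p1 e = i" if "e \<in> X" for e using that X by auto
 have SPH: "S e (PH e m) = S e m" for e m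
  unfolding S_def PH_def using bX by (intro sum.cong) auto
 have SPS: "S e (PS c e m) = S e m" for c e m
  unfolding S_def PS_def using bX by (intro sum.cong) auto
 have bq: "bsum (insert b E) (qe e) m l = bsum E q1 (PH e m) l" if e: "e \<in> X" for e m l
 proof -
  have "PH e m = (m(e := m e + m b))(b := 0)" using eb[OF e] by (auto simp: PH_def)
  then show ?thesis unfolding qe_def
   by (simp add: bsum_insert[OF fin b] bsum_upd_out[OF b] bsum_upd_in[OF fin eE(1)[OF e]])
 qed
 have bpj: "bsum (insert b E) (pe e) m j = m b + S e m" for e m
 proof -
  have "{x \<in> insert b E. pe e x = j} = insert b {x\<in>X. rk x < rk e}"
   using ij XE by (auto simp: pe_def)
  then show ?thesis unfolding bsum_def S_def using XE bX by simp
 qed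
 have bpo: "bsum (insert b E) (pe e) m l = bsum E p1 (PH e m) l" if e: "e \<in> X" and l: "l ~= i" "l ~= j" for e m l
  unfolding bsum_def
 proof (rule sum.cong)
  show "{x \<in> insert b E. pe e x = l} = {x \<in> E. p1 x = l}"
   using l X b by (auto simp: pe_def)
  fix x assume x: "x \<in> {x \<in> E. p1 x = l}"
  then have "x ~= b" "x ~= e" using b l e X by auto
  then show "m x = PH e m x" by (simp add: PH_def)
 qed
 have bpi: "bsum (insert b E) (pe e) m i + (m b + S e m) = bsum E p1 (PH e m) i" if e: "e \<in> X" for e m
 proof -
  have "{x \<in> insert b E. pe e x = i} = {x\<in>X. \<not> rk x < rk e}"
   using ij X b by (auto simp: pe_def)
  then have 1: "bsum (insert b E) (pe e) m i = (\<Sum>x\<in>{x\<in>X. \<not> rk x < rk e}. m x)" by (simp add: bsum_def)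
  have "X = {x\<in>X. \<not> rk x < rk e} Un {x\<in>X. rk x < rk e}" by auto
  then have "(\<Sum>x\<in>X. m x) = (\<Sum>x\<in>{x\<in>X. \<not> rk x < rk e} Un {x\<in>X. rk x < rk e}. m x)" by simp
  also have "... = (\<Sum>x\<in>{x\<in>X. \<not> rk x < rk e}. m x) + S e m"
   unfolding S_def using XE by (intro sum.union_disjoint) auto
  finally have 2: "bsum E p1 m i = bsum (insert b E) (pe e) m i + S e m" unfolding 1 by (simp add: bsum_def X)
  have "PH e m = (m(e := m e + m b))(b := 0)" using eb[OF e] by (auto simp: PH_def)
  then have "bsum E p1 (PH e m) i = bsum E p1 m i + m b"
   by (simp add: bsum_upd_out[OF b] bsum_upd_in[OF fin eE(1)[OF e]] eE(2)[OF e])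
  then show ?thesis using 2 by simp
 qed
 have ipE: "i \<in> p1 ` E" using a X by auto
 \<comment> \<open>Solutions with \<open>b\<close> on \<open>e\<close> correspond to solutions of
   the merged system, the length of \<open>b\<close> being determined. The right-hand sides are
   arbitrary so that zero lengths cover the kernel.\<close>
 have sol: "m \<in> bsol (insert b E) (pe e) (qe e) M Lq' \<longleftrightarrow>
   (\<forall>x. x ~: insert b E --> m x = 0) & PH e m \<in> bsol E p1 q1 (M(i := M i + M j)) Lq' & m b = M j - S e (PH e m)"
  if e: "e \<in> X" for e m M Lq'
 proof -
  have imp: "pe e ` insert b E = insert j (p1 ` E)"
  proof
   show "pe e ` insert b E \<subseteq> insert j (p1 ` E)" by (auto simp: pe_def)
   have "p1 x \<in> pe e ` insert b E" if "x \<in> E" for x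
   proof (cases "p1 x = i")
    case True
    have "pe e e = i" using eb[OF e] eE[OF e] by (simp add: pe_def)
    then show ?thesis using True eE[OF e] by (metis imageI insertCI)
   next
    case False
    then have "pe e x = p1 x" using that b X by (auto simp: pe_def)
    then show ?thesis using that by (metis imageI insertCI)
   qed
   moreover have "j \<in> pe e ` insert b E" by (auto simp: pe_def)
   ultimately show "insert j (p1 ` E) \<subseteq> pe e ` insert b E" by auto
  qed
  have imq: "qe e ` insert b E = q1 ` E" using eE[OF e] b by (auto simp: qe_def)
  have s0: "m \<in> bsol E' p' q' M L' \<longleftrightarrow> (\<forall>x. x ~: E' --> m x = 0) & (\<forall>l\<in>p' ` E'. bsum E' p' m l = M l) & (\<forall>l\<in>q' ` E'. bsum E' q' m l = L' l)"
   for m E' M L' and p' q' :: "'e => 'l" unfolding bsol_def by auto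
  have z: "(\<forall>x. x ~: E --> PH e m x = 0) \<longleftrightarrow> (\<forall>x. x ~: insert b E --> m x = 0)"
   using eE[OF e] eb[OF e] by (auto simp: PH_def)
  have P: "(\<forall>l\<in>insert j (p1 ` E). bsum (insert b E) (pe e) m l = M l) \<longleftrightarrow>
   m b = M j - S e (PH e m) & (\<forall>l\<in>p1 ` E. bsum E p1 (PH e m) l = (M(i := M i + M j)) l)"
  proof -
   have "(\<forall>l\<in>insert j (p1 ` E). bsum (insert b E) (pe e) m l = M l) \<longleftrightarrow>
    bsum (insert b E) (pe e) m j = M j & bsum (insert b E) (pe e) m i = M i & (\<forall>l\<in>p1 ` E - {i}. bsum (insert b E) (pe e) m l = M l)"
    using ipE ij by auto
   also have "... \<longleftrightarrow> m b = M j - S e (PH e m) & bsum E p1 (PH e m) i = M i + M j & (\<forall>l\<in>p1 ` E - {i}. bsum E p1 (PH e m) l = M l)"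
   proof -
    have "bsum (insert b E) (pe e) m l = bsum E p1 (PH e m) l" if "l \<in> p1 ` E - {i}" for l
     using that ij by (intro bpo[OF e]) auto
    then show ?thesis using bpi[OF e, of m] by (auto simp: bpj SPH)
   qed
   also have "... \<longleftrightarrow> m b = M j - S e (PH e m) & (\<forall>l\<in>p1 ` E. bsum E p1 (PH e m) l = (M(i := M i + M j)) l)"
    using ipE by auto
   finally show ?thesis .
  qed
  show ?thesis unfolding s0 imp imq P z bq[OF e] by auto
 qed
 have ker: "m \<in> bker (insert b E) (pe e) (qe e) \<longleftrightarrow>
   (\<forall>x. x ~: insert b E --> m x = 0) & PH e m \<in> bker E p1 q1 & m b = - S e (PH e m)"
  if e: "e \<in> X" for e m
  using sol[OF e, of m "%_. 0" "%_. 0"] by (simp add: bsol_zero fun_upd_idem)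
 have PHPS: "PH e (PS c e m) = m" if "e \<in> X" "m b = 0" for c e m
  using that eb[OF that(1)] by (auto simp: PH_def PS_def)
 have PSPH: "PS c e (PH e m) = m" if "e \<in> X" "m b = c - S e m" for c e m
  using that eb[OF that(1)] SPH[of e m] by (auto simp: PH_def PS_def)
 define L1 where "L1 = Lp(i := Lp i + Lp j)"
 have mPS: "PS (Lp j) e m \<in> bsol (insert b E) (pe e) (qe e) Lp Lq" if e: "e \<in> X" and m: "m \<in> bsol E p1 q1 L1 Lq" for e m
 proof -
  have "m b = 0" using m b by (simp add: bsol_def)
  then show ?thesis using m eE[OF e] eb[OF e] unfolding sol[OF e] by (simp add: PHPS[OF e] L1_def) (auto simp: PS_def bsol_def)
 qed
 have "(\<Sum>e\<in>X. vol (insert b E) (pe e) (qe e) Lp Lq) = vol E p1 q1 L1 Lq"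
 proof (cases "bsol E p1 q1 L1 Lq = {}")
  case True
  then have "bsol (insert b E) (pe e) (qe e) Lp Lq = {}" if "e \<in> X" for e
   using sol[OF that] unfolding L1_def by blast
  then show ?thesis using True by (simp add: vol_empty)
 next
  case False
  then obtain m0 where m0: "m0 \<in> bsol E p1 q1 L1 Lq" by blast
  obtain J v d where u: "ubasis E (bker E p1 q1) (J :: 'e set) v d" using ubasis_bker_exists[OF fin] by blast
  note U = ubasisD[OF u]
  have Slin: "S e (%x. m x + (\<Sum>j\<in>J. t j * v j x)) = S e m + (\<Sum>j\<in>J. t j * S e (v j))" for e t m
   unfolding S_def by (simp add: sum.distrib sum_distrib_left) (rule sum.swap)
  have PSlin: "PS c e (%x. m x + (\<Sum>j\<in>J. t j * v j x)) = (%x. PS c e m x + (\<Sum>j\<in>J. t j * PS 0 e (v j) x))"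
   if "e \<in> X" for c e t m
   using eb[OF that] unfolding PS_def Slin
   by (auto simp: fun_eq_iff sum.distrib sum_subtractf sum_negf algebra_simps)
  \<comment> \<open>In matching bases all these systems have the same coordinates, so each summand
    integrates its own positivity condition over one common space.\<close>
  have ve: "vol (insert b E) (pe e) (qe e) Lp Lq = vint J v m0 (%m. posi (insert b E) (PS (Lp j) e m))" if e: "e \<in> X" for e
  proof -
   have "\<exists>d'. ubasis (insert b E) (bker (insert b E) (pe e) (qe e)) J (%j. PS 0 e (v j)) d'"
   proof (rule ubasis_iso[OF u, where PH="PH e" and M="%y x. if x = y then 1 else if y = e & x = b then 1 else 0"])
    fix m y assume m: "m \<in> bker (insert b E) (pe e) (qe e)" and y: "y \<in> E"
    have "(\<Sum>x\<in>insert b E. (if x = y then 1 else if y = e & x = b then 1 else 0) * m x)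
     = (\<Sum>x\<in>insert b E. (if x = y then m y else 0) + (if x = b then if y = e then m b else 0 else 0))"
     using y b by (intro sum.cong) auto
    also have "... = PH e m y"
    proof -
     have "y ~= b" using y b by auto
     then show ?thesis using y b fin by (auto simp: sum.distrib PH_def)
    qed
    finally show "(\<Sum>x\<in>insert b E. (if x = y then 1 else if y = e & x = b then 1 else 0) * m x) = PH e m y" .
   next
    fix m assume m: "m \<in> bker E p1 q1"
    then have mb: "m b = 0" using b by (simp add: bker_def)
    show "PH e (PS 0 e m) = m" using PHPS[of e m 0, OF e] mb by blast
    show "PS 0 e m \<in> bker (insert b E) (pe e) (qe e)"
     unfolding ker[OF e] using PHPS[of e m 0, OF e mb] m eE[OF e] eb[OF e] by (auto simp: PS_def bker_def)
   next
    fix m assume m: "m \<in> bker (insert b E) (pe e) (qe e)"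
    then show "PH e m \<in> bker E p1 q1" "PS 0 e (PH e m) = m" unfolding ker[OF e] by (auto simp: SPH intro!: PSPH[OF e])
   next
    fix m x assume "m \<in> bker E p1 q1" "!!x. m x \<in> \<int>"
    then show "PS 0 e m x \<in> \<int>" by (auto simp: PS_def S_def intro!: Ints_sum Ints_add Ints_minus)
   next
    fix t x
    show "PS 0 e (%x. \<Sum>j\<in>J. t j * v j x) x = (\<Sum>j\<in>J. t j * PS 0 e (v j) x)"
     using PSlin[OF e, of 0 "%_. 0" t] by (simp add: PS_def S_def fun_eq_iff)
   qed (use fin in auto)
   then obtain d' where u': "ubasis (insert b E) (bker (insert b E) (pe e) (qe e)) J (%j. PS 0 e (v j)) d'" by blast
   show ?thesis unfolding vol_eq[OF u' mPS[OF e m0]] unfolding vint_def PSlin[OF e] ..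
  qed
  have meas: "(%m. posi (insert b E) (PS c e m)) \<in> borel_measurable FM" for c e
  proof (rule measurable_compose[of "PS c e" FM FM])
   show "PS c e \<in> FM \<rightarrow>\<^sub>M FM"
   proof (rule measurable_PiM_single')
    fix i
    have "(%m. sum m {x \<in> X. rk x < rk e}) \<in> borel_measurable FM" by measurable
    then have [measurable]: "S e \<in> borel_measurable FM" by (simp add: S_def[abs_def])
    show "(%m. PS c e m i) \<in> borel_measurable FM"
     by (cases "i = e"; cases "i = b") (simp_all add: PS_def)
   qed (auto simp: space_PiM)
  qed (use fin in auto)
  have "(\<Sum>e\<in>X. vol (insert b E) (pe e) (qe e) Lp Lq) = vint J v m0 (%m. \<Sum>e\<in>X. posi (insert b E) (PS (Lp j) e m))"
   using meas U(2) by (simp add: ve vint_sum)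
  also have "... = vint J v m0 (posi E)"
   unfolding vint_def
  proof (rule nn_integral_cong_AE)
   \<comment> \<open>\<open>dl\<close> moves one unit of length from the first edge \<open>f\<close>
     to the last edge \<open>a\<close>. Both carry the same labels, so this is a kernel vector, and
     it lowers \<open>S e\<close> by one for every \<open>e\<close> other than \<open>f\<close>:
     this is why \<open>S e\<close> is not constant.\<close>
   define dl where "dl = (if a = f then (%_. 0) else (%_. 0 :: real)(f := -1, a := 1))"
   have dlK: "dl \<in> bker E p1 q1"
   proof (cases "a = f")
    case True then show ?thesis by (simp add: dl_def bker_def bsum_def)
   next
    case False
    have "bsum E r dl l = (if r f = l then -1 else 0) + (if r a = l then 1 else 0)" for r :: "'e => 'l" and l
    proof -
     have "bsum E r dl l = (\<Sum>x\<in>{x\<in>E. r x = l}. (if x = f then -1 else 0) + (if x = a then 1 else 0))"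
      unfolding bsum_def using False by (intro sum.cong) (auto simp: dl_def)
     then show ?thesis using fin eE[OF a(1)] eE[OF f(1)] by (simp add: sum.distrib)
    qed
    then show ?thesis using eE[OF a(1)] eE[OF f(1)] q unfolding bker_all by (auto simp: dl_def)
   qed
   have ae: "AE t in PL J. S e (%x. m0 x + (\<Sum>j\<in>J. t j * v j x)) ~= Lp j" if e: "e \<in> X" for e
   proof (cases "e = f")
    case True
    have "{x\<in>X. rk x < rk e} = {}" using f True by fastforce
    then have "S e m = 0" for m unfolding S_def by (simp only: sum.empty)
    then show ?thesis using L by simp
   next
    case False
    have fe: "rk f < rk e" using f(2)[OF e] False rk e f by (metis inj_onD le_neq_implies_less)
    have af: "a ~= f" using fe a(2)[OF e] by auto
    have "S e dl = (\<Sum>x\<in>{x\<in>X. rk x < rk e}. if x = f then -1 else 0)"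
     unfolding S_def using af a(2)[OF e] by (intro sum.cong) (auto simp: dl_def)
    then have Sd: "S e dl = -1" using XE f fe by simp
    have "\<exists>k\<in>J. S e (v k) ~= 0"
    proof (rule ccontr)
     assume a0: "\<not> ?thesis"
     have "dl x = 0 + (\<Sum>j\<in>J. (\<Sum>e\<in>E. d j e * dl e) * v j x)" for x
      unfolding add_0 by (rule U(7)[OF dlK])
     then have "dl = (%x. 0 + (\<Sum>j\<in>J. (\<Sum>e\<in>E. d j e * dl e) * v j x))" by (rule ext)
     then have "S e dl = S e (%x. 0 + (\<Sum>j\<in>J. (\<Sum>e\<in>E. d j e * dl e) * v j x))" by (rule arg_cong)
     also have "... = S e (%_. 0) + (\<Sum>j\<in>J. (\<Sum>e\<in>E. d j e * dl e) * S e (v j))" by (rule Slin)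
     finally have "S e dl = S e (%_. 0) + (\<Sum>j\<in>J. (\<Sum>e\<in>E. d j e * dl e) * S e (v j))" .
     then show False using a0 Sd by (simp add: S_def)
    qed
    then obtain k where k: "k \<in> J" "S e (v k) ~= 0" by blast
    have "(\<integral>\<^sup>+t. indicator {0::real} ((S e m0 - Lp j) + (\<Sum>j\<in>J. t j * S e (v j))) \<partial>PL J) = 0"
     using U(2) k by (intro PL_affine_null)
    then have "AE t in PL J. indicator {0::real} ((S e m0 - Lp j) + (\<Sum>j\<in>J. t j * S e (v j))) = (0::ennreal)"
     by (subst (asm) nn_integral_0_iff_AE) auto
    then show ?thesis unfolding Slin by eventually_elim (auto simp: indicator_def split: if_splits)
   qed
   have "AE t in PL J. \<forall>e\<in>X. S e (%x. m0 x + (\<Sum>j\<in>J. t j * v j x)) ~= Lp j"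
    using XE ae by (intro AE_finite_allI) auto
   then show "AE t in PL J. (\<Sum>e\<in>X. posi (insert b E) (PS (Lp j) e (%x. m0 x + (\<Sum>j\<in>J. t j * v j x)))) = posi E (%x. m0 x + (\<Sum>j\<in>J. t j * v j x))"
   proof eventually_elim
    case (elim t)
    define m where "m = (%x. m0 x + (\<Sum>j\<in>J. t j * v j x))"
    have k: "(%x. \<Sum>j\<in>J. t j * v j x) \<in> bker E p1 q1" using U by (intro bker_sum) auto
    have m: "m \<in> bsol E p1 q1 L1 Lq" unfolding m_def by (rule bsol_add[OF m0 k])
    have gen: "S e m ~= Lp j" if "e \<in> X" for e using elim that unfolding m_def by blast
    \<comment> \<open>Positivity after the insertion of \<open>b\<close> on \<open>e\<close> means
      that \<open>Lp j\<close> falls strictly between the two ends of \<open>e\<close>; for positive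
      and generic \<open>m\<close> this happens for exactly one \<open>e\<close>.\<close>
    have cond: "posi (insert b E) (PS (Lp j) e m) = (if (\<forall>x\<in>E-{e}. 0 < m x) & S e m < Lp j & Lp j < S e m + m e then 1 else 0)"
     if e: "e \<in> X" for e
    proof -
     have "(\<forall>x\<in>insert b E. 0 < PS (Lp j) e m x) \<longleftrightarrow> (\<forall>x\<in>E-{e}. 0 < m x) & S e m < Lp j & Lp j < S e m + m e"
      using eb[OF e] eE[OF e] b by (auto simp: PS_def)
     then show ?thesis by (simp add: posi_def)
    qed
    have "(\<Sum>e\<in>X. posi (insert b E) (PS (Lp j) e m)) = posi E m"
    proof (cases "\<forall>x\<in>E. 0 < m x")
     case True
     have "(\<Sum>x\<in>X. m x) = L1 i" using m ipE unfolding bsol_def X bsum_def by auto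
     then have "Lp j < (\<Sum>x\<in>X. m x)" using L by (simp add: L1_def)
     then obtain e0 where e0: "e0 \<in> X" "!!e. e \<in> X ==> S e m < Lp j & Lp j < S e m + m e \<longleftrightarrow> e = e0"
      using slice_unique[OF XE(2) rk a, of m "Lp j"] True XE L gen unfolding S_def by blast
     have "(\<Sum>e\<in>X. posi (insert b E) (PS (Lp j) e m)) = (\<Sum>e\<in>X. if e = e0 then 1 else 0)"
      using True e0(2) by (intro sum.cong refl) (simp add: cond)
     then show ?thesis using True e0(1) XE by (simp add: posi_def)
    next
     case False
     have "posi (insert b E) (PS (Lp j) e m) = 0" if e: "e \<in> X" for e
     proof -
      have "\<not> ((\<forall>x\<in>E-{e}. 0 < m x) & S e m < Lp j & Lp j < S e m + m e)"
      proof
       assume "(\<forall>x\<in>E-{e}. 0 < m x) & S e m < Lp j & Lp j < S e m + m e"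
       then have "0 < m x" if "x \<in> E" for x using that by (cases "x = e") auto
       then show False using False by blast
      qed
      then show ?thesis unfolding cond[OF e] by (rule if_not_P)
     qed
     then show ?thesis using False by (auto simp: posi_def)
    qed
    then show ?case unfolding m_def .
   qed
  qed
  also have "... = vol E p1 q1 L1 Lq" by (rule vol_eq[OF u m0, symmetric])
  finally show ?thesis .
 qed
 then show ?thesis unfolding pe_def qe_def L1_def .
qed

subsection \<open>Permutations with labelled cycles\<close>

abbreviation swp :: "'e => 'e => 'e => 'e" where
 "swp \<equiv> Transposition.transpose"

text \<open>The last clause says that the fibres of \<open>p\<close> are single cycles, not unions
  of cycles, without mentioning orbits: an invariant set that meets a fibre contains it.
  Extensionality makes labellings equal as functions when they agree on \<open>E\<close>.\<close>

definition cyc_label :: "'e set => ('e => 'e) => ('e => 'l) => 'l set => bool" where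
 "cyc_label E pm p I \<longleftrightarrow> pm permutes E & p \<in> extensional E & p ` E = I & (\<forall>x\<in>E. p (pm x) = p x) &
  (\<forall>S x y. S \<subseteq> E --> pm ` S \<subseteq> S --> x \<in> S --> y \<in> E --> p y = p x --> y \<in> S)"

lemma cyc_labelD:
 assumes "cyc_label E pm p I"
 shows "pm permutes E" "p \<in> extensional E" "p ` E = I" "!!x. x \<in> E ==> p (pm x) = p x" "!!x. x \<in> E ==> pm x \<in> E"
  "!!x. x \<in> E ==> p x \<in> I"
 using assms unfolding cyc_label_def by (auto simp: permutes_in_image)

lemma cyc_label_inv:
 assumes "cyc_label E pm p I" "S \<subseteq> E" "!!z. z \<in> S ==> pm z \<in> S" "x \<in> S" "y \<in> E" "p y = p x"
 shows "y \<in> S"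
 using assms unfolding cyc_label_def by (metis image_subsetI)

text \<open>Lets a reconstructed labelling be checked at one point of each cycle, since the fibres
  of any labelling are the cycles of the permutation.\<close>

lemma cyc_label_same:
 assumes "cyc_label E pm p I" "cyc_label E pm p2 I2" "x \<in> E" "y \<in> E" "p x = p y"
 shows "p2 x = p2 y"
proof -
 have "y \<in> {z\<in>E. p2 z = p2 x}"
  by (rule cyc_label_inv[OF assms(1), where x=x]) (use assms cyc_labelD(4,5)[OF assms(2)] in auto)
 then show ?thesis by simp
qed

text \<open>The transposition on the left sends the predecessor of \<open>e\<close> to
  \<open>a\<close> and \<open>a\<close> to \<open>e\<close>; so \<open>a\<close> is inserted into
  the cycle just before \<open>e\<close>.\<close>

lemma cyc_label_insert:
 assumes c: "cyc_label E pm p I" and a: "a ~: E" and e: "e \<in> E"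
 shows "cyc_label (insert a E) (swp a e o pm) (p(a := p e)) I"
proof -
 note C = cyc_labelD[OF c]
 let ?pm = "swp a e o pm"
 have pa: "pm a = a" using C(1) a by (simp add: permutes_not_in)
 have ae: "a ~= e" using a e by auto
 have v: "?pm x = (if x = a then e else if pm x = e then a else pm x)" if "x \<in> insert a E" for x
 proof (cases "x = a")
  case False
  then have "pm x ~= a" using that C(5)[of x] a by auto
  then show ?thesis using False by (auto simp: Transposition.transpose_def)
 qed (auto simp: pa)
 obtain z0 where z0: "z0 \<in> E" "pm z0 = e" using C(1) e by (metis permutes_in_image permutes_surj surjD)
 show ?thesis
  unfolding cyc_label_def
 proof (intro conjI allI impI ballI)
  show "?pm permutes insert a E"
   using C(1) e by (intro permutes_compose permutes_swap_id) (auto intro: permutes_subset)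
  show "p(a := p e) \<in> extensional (insert a E)" using C(2) by (auto simp: extensional_def)
  show "(p(a := p e)) ` insert a E = I" using C(3) e a by auto
  show "(p(a := p e)) (?pm x) = (p(a := p e)) x" if "x \<in> insert a E" for x
   using v[OF that] that C(4)[of x] ae C(5)[of x] a by auto
  fix S x y assume S: "S \<subseteq> insert a E" "?pm ` S \<subseteq> S" "x \<in> S" "y \<in> insert a E" "(p(a := p e)) y = (p(a := p e)) x"
  have Sv: "?pm z \<in> S" if "z \<in> S" for z using S(2) that by blast
  have T: "pm z \<in> S Int E" if "z \<in> S Int E" for z
  proof (cases "pm z = e")
   case True
   then have "?pm z = a" using v[of z] that a by auto
   then have "a \<in> S" using Sv[of z] that by simp
   then show ?thesis using Sv[of a] v[of a] True e by simp
  next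
   case False
   have "z ~= a" using that a by auto
   then have "?pm z = pm z" using v[of z] that False by simp
   then show ?thesis using Sv[of z] that C(5)[of z] by auto
  qed
  obtain x' where x': "x' \<in> S Int E" "p x' = (p(a := p e)) y"
  proof (cases "x = a")
   case True
   then have "e \<in> S" using Sv[of a] v[of a] S(3) by simp
   then show ?thesis using that[of e] e S True by auto
  next
   case False
   then show ?thesis using that[of x] S by auto
  qed
  have inS: "w \<in> S" if "w \<in> E" "p w = p x'" for w
   using cyc_label_inv[OF c, of "S Int E" x' w] T x' that by blast
  show "y \<in> S"
  proof (cases "y = a")
   case True
   have "p z0 = p e" using C(4)[of z0] z0 by simp
   then have "z0 \<in> S" using inS[of z0] z0 x' True by simp
   then show ?thesis using Sv[of z0] v[of z0] z0 True a by auto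
  next
   case False
   then show ?thesis using inS[of y] S x' by auto
  qed
 qed
qed

text \<open>The same left factor takes \<open>a\<close> out again. That \<open>a\<close> is not a
  fixed point keeps its cycle, and hence its label, from disappearing.\<close>

lemma cyc_label_delete:
 assumes c: "cyc_label (insert a E) pm p I" and a: "a ~: E" and e: "pm a = e" "e ~= a"
 shows "cyc_label E (swp a e o pm) (restrict p E) I" and "e \<in> E" and "p a = p e"
proof -
 note C = cyc_labelD[OF c]
 let ?pm = "swp a e o pm"
 show eE: "e \<in> E" using C(5)[of a] e by auto
 show pae: "p a = p e" using C(4)[of a] e by auto
 have inj: "pm x = e ==> x = a" for x using e C(1) by (metis permutes_inj injD)
 have v: "?pm x = (if pm x = a then e else pm x)" if "x \<in> E" for x
  using inj[of x] that a by (auto simp: Transposition.transpose_def)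
 show "cyc_label E ?pm (restrict p E) I"
  unfolding cyc_label_def
 proof (intro conjI allI impI ballI)
  have "?pm permutes insert a E"
   using C(1) eE by (intro permutes_compose permutes_swap_id) auto
  moreover have "?pm a = a" using e by simp
  ultimately show "?pm permutes E"
   using a by (metis insertE permutes_superset Diff_iff)
  show "restrict p E ` E = I" using C(3) eE pae by auto
  have in_E: "?pm x \<in> E" if "x \<in> E" for x using v[OF that] C(5)[of x] that eE by auto
  show "restrict p E (?pm x) = restrict p E x" if "x \<in> E" for x
   using v[OF that] in_E[OF that] that C(4)[of x] pae by (auto split: if_splits)
  fix S x y assume S: "S \<subseteq> E" "?pm ` S \<subseteq> S" "x \<in> S" "y \<in> E" "restrict p E y = restrict p E x"
  define T where "T = (if e \<in> S then insert a S else S)"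
  have "pm z \<in> T" if "z \<in> T" for z
  proof (cases "z = a")
   case True
   then show ?thesis using that e a S by (auto simp: T_def split: if_splits)
  next
   case False
   then have z: "z \<in> S" using that by (auto simp: T_def split: if_splits)
   then have "?pm z \<in> S" using S by blast
   then show ?thesis using v[of z] z S by (auto simp: T_def split: if_splits)
  qed
  moreover have "p y = p x" using S by auto
  ultimately have "y \<in> T" using S by (intro cyc_label_inv[OF c, of T x y]) (auto simp: T_def)
  then show "y \<in> S" using S a by (auto simp: T_def split: if_splits)
 qed auto
qed

text \<open>The transposition on the right exchanges the successors of \<open>a\<close> and
  \<open>b\<close>, so that a walk along either cycle continues on the other one.\<close>

lemma cyc_label_join:
 assumes c: "cyc_label E pm p' I" and ab: "a \<in> E" "b \<in> E" and i: "p' a = i" "p' b = k" "i ~= k"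
 shows "cyc_label E (pm o swp a b) (\<lambda>x\<in>E. if p' x = k then i else p' x) (I - {k})"
proof -
 note C = cyc_labelD[OF c]
 let ?pm = "pm o swp a b"
 have anb: "a ~= b" using i by auto
 have v: "?pm a = pm b" "?pm b = pm a" "!!x. x ~= a ==> x ~= b ==> ?pm x = pm x" by (auto simp: Transposition.transpose_def)
 have perm: "?pm permutes E" using C(1) ab by (intro permutes_compose permutes_swap_id)
 show ?thesis
  unfolding cyc_label_def
 proof (intro conjI allI impI ballI)
  show "?pm permutes E" by (rule perm)
  show "(\<lambda>x\<in>E. if p' x = k then i else p' x) ` E = I - {k}"
   using C(3) i ab by force
  show "(\<lambda>x\<in>E. if p' x = k then i else p' x) (?pm x) = (\<lambda>x\<in>E. if p' x = k then i else p' x) x" if "x \<in> E" for x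
   using v C(4,5) ab that i by (cases "x = a"; cases "x = b") auto
  fix S x y assume S: "S \<subseteq> E" "?pm ` S \<subseteq> S" "x \<in> S" "y \<in> E"
   "(\<lambda>x\<in>E. if p' x = k then i else p' x) y = (\<lambda>x\<in>E. if p' x = k then i else p' x) x"
  have xE: "x \<in> E" using S by auto
  have Sv: "?pm z \<in> S" if "z \<in> S" for z using S(2) that by blast
  have cl: "{z\<in>E. p' z = l} \<subseteq> S" if z: "z \<in> S" "p' z = l" and ok: "!!w. w \<in> S ==> p' w = l ==> pm w \<in> S" for z l
  proof
   fix w assume w: "w \<in> {z\<in>E. p' z = l}"
   have "w \<in> {u\<in>S. p' u = l}"
    by (rule cyc_label_inv[OF c, where x=z]) (use w z ok S C(4) in auto)
   then show "w \<in> S" by simp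
  qed
  have A: "a \<in> S" if "z \<in> S" "p' z = i" for z
  proof (rule ccontr)
   assume n: "a ~: S"
   have "{z\<in>E. p' z = i} \<subseteq> S"
   proof (rule cl[OF that])
    fix w assume "w \<in> S" "p' w = i"
    then have "w ~= a" "w ~= b" using n i by auto
    then show "pm w \<in> S" using v(3)[of w] Sv[OF \<open>w \<in> S\<close>] by simp
   qed
   then show False using n ab i by auto
  qed
  have B: "b \<in> S" if "z \<in> S" "p' z = k" for z
  proof (rule ccontr)
   assume n: "b ~: S"
   have "{z\<in>E. p' z = k} \<subseteq> S"
   proof (rule cl[OF that])
    fix w assume "w \<in> S" "p' w = k"
    then have "w ~= a" "w ~= b" using n i by auto
    then show "pm w \<in> S" using v(3)[of w] Sv[OF \<open>w \<in> S\<close>] by simp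
   qed
   then show False using n ab i by auto
  qed
  \<comment> \<open>The new successor of \<open>a\<close> lies on the old cycle of \<open>b\<close>
    and conversely, so an invariant set that contains one of the two points contains the
    other.\<close>
  have AB: "a \<in> S \<longleftrightarrow> b \<in> S"
  proof
   assume "a \<in> S" then show "b \<in> S" using Sv[of a] v(1) B[of "pm b"] C(4) ab i by auto
  next
   assume "b \<in> S" then show "a \<in> S" using Sv[of b] v(2) A[of "pm a"] C(4) ab i by auto
  qed
  show "y \<in> S"
  proof (cases "p' x = i \<or> p' x = k")
   case True
   then have ab': "a \<in> S" "b \<in> S" using A[of x] B[of x] AB S by auto
   have inv: "pm w \<in> S" if "w \<in> S" for w
    using v Sv[OF that] Sv[OF ab'(1)] Sv[OF ab'(2)] by (cases "w = a"; cases "w = b") auto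
   have "{z\<in>E. p' z = i} \<subseteq> S" "{z\<in>E. p' z = k} \<subseteq> S"
    using cl[OF ab'(1) i(1)] cl[OF ab'(2) i(2)] inv by auto
   moreover have "p' y = i \<or> p' y = k" using S True xE by (auto split: if_splits)
   ultimately show ?thesis using S by auto
  next
   case False
   then have "p' y = p' x" using S xE by (auto split: if_splits)
   moreover have "{z\<in>E. p' z = p' x} \<subseteq> S"
   proof (rule cl[OF S(3) refl])
    fix w assume "w \<in> S" "p' w = p' x"
    then have "w ~= a" "w ~= b" using False i by auto
    then show "pm w \<in> S" using v(3)[of w] Sv[OF \<open>w \<in> S\<close>] by simp
   qed
   ultimately show ?thesis using S by auto
  qed
 qed auto
qed

text \<open>The cycle through \<open>a\<close>, cut after \<open>a\<close>, is linearly ordered by \<open>rk\<close>.\<close>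

definition cyc_rank :: "'e set => ('e => 'e) => 'e => ('e => nat) => bool" where
 "cyc_rank X pm a rk \<longleftrightarrow> a \<in> X & inj_on rk X & (\<forall>x\<in>X. rk x \<le> rk a & rk (pm a) \<le> rk x) &
  (\<forall>x\<in>X. x ~= a --> rk x < rk (pm x) & (\<forall>y\<in>X. rk x < rk y --> rk (pm x) \<le> rk y))"

text \<open>The rank counts the steps from the successor of \<open>a\<close>; thus \<open>a\<close>
  comes last and every other step raises the rank by one.\<close>

lemma cyc_rank_exists:
 assumes c: "cyc_label E pm p I" and a: "a \<in> E"
 shows "\<exists>rk. cyc_rank {x\<in>E. p x = p a} pm a rk & rk (pm a) = 0 & (\<forall>x\<in>E. p x = p a --> x ~= a --> rk (pm x) = Suc (rk x))"
proof -
 note C = cyc_labelD[OF c]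
 define X where "X = {x\<in>E. p x = p a}"
 define rk where "rk x = (LEAST n. (pm ^^ Suc n) a = x)" for x
 have pw: "(pm ^^ n) a \<in> X" for n
  by (induction n) (use a C(4,5) in \<open>auto simp: X_def\<close>)
 have reach: "\<exists>n. (pm ^^ Suc n) a = x" if "x \<in> X" for x
 proof -
  have "x \<in> range (%n. (pm ^^ Suc n) a)"
  proof (rule cyc_label_inv[OF c, where x="pm a"])
   show "range (%n. (pm ^^ Suc n) a) \<subseteq> E" using pw unfolding X_def by blast
   show "pm z \<in> range (%n. (pm ^^ Suc n) a)" if "z \<in> range (%n. (pm ^^ Suc n) a)" for z
   proof -
    obtain n where "z = (pm ^^ Suc n) a" using \<open>z \<in> _\<close> by blast
    then have "pm z = (pm ^^ Suc (Suc n)) a" by simp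
    then show ?thesis by blast
   qed
   show "pm a \<in> range (%n. (pm ^^ Suc n) a)" by (rule range_eqI[of _ _ 0]) simp
  qed (use that C(4) a in \<open>auto simp: X_def\<close>)
  then show ?thesis by blast
 qed
 have rk: "(pm ^^ Suc (rk x)) a = x" if "x \<in> X" for x
  unfolding rk_def using reach[OF that] by (rule LeastI_ex)
 have least: "rk x \<le> n" if "(pm ^^ Suc n) a = x" for x n
  unfolding rk_def using that by (rule Least_le)
 have injp: "x = y" if "pm x = pm y" for x y using C(1) that by (metis permutes_inj injD)
 have r0: "rk (pm a) = 0" using least[of 0 "pm a"] by simp
 have rS: "rk (pm x) = Suc (rk x)" if x: "x \<in> X" "x ~= a" for x
 proof (rule antisym)
  show "rk (pm x) \<le> Suc (rk x)" using rk[OF x(1)] by (intro least) simp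
  have "pm x \<in> X" using x C(4,5) by (auto simp: X_def)
  then have "(pm ^^ Suc (rk (pm x))) a = pm x" by (rule rk)
  then have e: "(pm ^^ rk (pm x)) a = x" using injp by simp
  then obtain m where "rk (pm x) = Suc m" using x by (cases "rk (pm x)") auto
  then show "Suc (rk x) \<le> rk (pm x)" using least[of m x] e by simp
 qed
 have inj: "inj_on rk X" by (rule inj_onI) (metis rk)
 have aX: "a \<in> X" using a by (simp add: X_def)
 have le_a: "rk x \<le> rk a" if x: "x \<in> X" for x
 proof (rule ccontr)
  assume n: "\<not> rk x \<le> rk a"
  define m where "m = rk x - Suc (rk a)"
  have m: "Suc (rk x) = Suc m + Suc (rk a)" using n by (simp add: m_def)
  have "x = (pm ^^ (Suc m + Suc (rk a))) a" using rk[OF x] m by simp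
  also have "... = (pm ^^ Suc m) ((pm ^^ Suc (rk a)) a)" by (simp only: funpow_add o_apply)
  also have "... = (pm ^^ Suc m) a" using rk[OF aX] by simp
  finally have "rk x \<le> m" by (intro least) simp
  then show False using m by simp
 qed
 have "cyc_rank X pm a rk"
  unfolding cyc_rank_def using aX inj le_a r0 rS by (auto simp: Suc_le_eq)
 then show ?thesis using r0 rS unfolding X_def by (intro exI[of _ rk]) auto
qed

text \<open>Exchanging the successors of two points of one cycle cuts it into the arc from the
  successor of \<open>a\<close> to \<open>b\<close>, which consists of the ranks up to that of
  \<open>b\<close>, and the arc from the successor of \<open>b\<close> to \<open>a\<close>.\<close>

lemma cyc_label_split:
 assumes c: "cyc_label E pm p I" and ab: "a \<in> E" "b \<in> E" "a ~= b" and i: "p a = i" "p b = i" and k: "k ~: I"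
  and rk: "cyc_rank {x\<in>E. p x = i} pm a rk"
 shows "cyc_label E (pm o swp a b) (\<lambda>x\<in>E. if p x = i & rk x \<le> rk b then k else p x) (insert k I)"
  and "rk b < rk a"
proof -
 note C = cyc_labelD[OF c]
 let ?pm = "pm o swp a b"
 define X where "X = {x\<in>E. p x = i}"
 have v: "?pm a = pm b" "?pm b = pm a" "!!x. x ~= a ==> x ~= b ==> ?pm x = pm x" by (auto simp: Transposition.transpose_def)
 have R: "inj_on rk X" "!!x. x \<in> X ==> rk x \<le> rk a" "!!x. x \<in> X ==> rk (pm a) \<le> rk x"
  "!!x. x \<in> X ==> x ~= a ==> rk x < rk (pm x)" "!!x y. x \<in> X ==> x ~= a ==> y \<in> X ==> rk x < rk y ==> rk (pm x) \<le> rk y"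
  using rk unfolding cyc_rank_def X_def by auto
 have abX: "a \<in> X" "b \<in> X" using ab i by (auto simp: X_def)
 have pmX: "pm x \<in> X" if "x \<in> X" for x using that C(4,5) by (auto simp: X_def)
 show ba: "rk b < rk a" using R(1,2) abX ab by (metis inj_onD le_neq_implies_less)
 have ik: "i ~= k" using k C(6) ab i by metis
 define Ck Ci where "Ck = {x\<in>X. rk x \<le> rk b}" and "Ci = {x\<in>X. rk b < rk x}"
 have XU: "X = Ck Un Ci" by (auto simp: Ck_def Ci_def)
 have Ck1: "pm z \<in> Ck" if "z \<in> Ck" "z ~= b" for z
 proof -
  have "rk z ~= rk b" using that R(1) abX by (auto simp: Ck_def dest: inj_onD)
  moreover have "z ~= a" using that ba by (auto simp: Ck_def)
  ultimately show ?thesis using that R(5)[of z b] abX ba pmX by (auto simp: Ck_def)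
 qed
 have Ck2: "pm b \<in> Ci" using R(4)[of b] abX ab pmX by (auto simp: Ci_def)
 have Ci1: "pm z \<in> Ci" if "z \<in> Ci" "z ~= a" for z
  using R(4)[of z] that pmX by (auto simp: Ci_def)
 have Ci2: "pm a \<in> Ck" using R(3)[of b] abX pmX by (auto simp: Ck_def)
 have abC: "a \<in> Ci" "b \<in> Ck" "a ~: Ck" "b ~: Ci" using abX ba by (auto simp: Ci_def Ck_def)
 \<comment> \<open>Applied twice for each arc: to the part of \<open>S\<close> on the arc, to see
   that \<open>S\<close> contains the end of the arc, and then to this part together with the whole
   other arc, which is now invariant under the old permutation.\<close>
 have whole: "T = X" if T: "T \<subseteq> X" "T ~= {}" "!!z. z \<in> T ==> pm z \<in> T" for T
 proof -
  obtain x where x: "x \<in> T" using T by auto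
  have "y \<in> T" if "y \<in> X" for y
  proof (rule cyc_label_inv[OF c _ T(3) x])
   have "x \<in> X" using x T by auto
   then show "T \<subseteq> E" "y \<in> E" "p y = p x" using T that by (auto simp: X_def)
  qed
  then show ?thesis using T by auto
 qed
 let ?p = "\<lambda>x\<in>E. if p x = i & rk x \<le> rk b then k else p x"
 have pv: "?p x = (if x \<in> Ck then k else p x)" if "x \<in> E" for x
  using that by (auto simp: Ck_def X_def)
 have pi: "p x = i" if "x \<in> X" for x using that by (simp add: X_def)
 have CE: "Ck \<subseteq> E" "Ci \<subseteq> E" "Ck Int Ci = {}" by (auto simp: Ck_def Ci_def X_def)
 show "cyc_label E ?pm ?p (insert k I)"
  unfolding cyc_label_def
 proof (intro conjI allI impI ballI)
  show perm: "?pm permutes E" using C(1) ab by (intro permutes_compose permutes_swap_id)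
  show "?p ` E = insert k I"
  proof
   show "?p ` E \<subseteq> insert k I" using C(6) by auto
   show "insert k I \<subseteq> ?p ` E"
   proof
    fix l assume l: "l \<in> insert k I"
    consider "l = k" | "l = i" | "l \<in> I" "l ~= i" using l by auto
    then show "l \<in> ?p ` E"
    proof cases
     case 1 then show ?thesis using pv[OF ab(2)] abC ab by (metis (no_types, lifting) image_eqI)
    next
     case 2 then show ?thesis using pv[OF ab(1)] abC ab i by (metis (no_types, lifting) image_eqI)
    next
     case 3
     then obtain x where "x \<in> E" "p x = l" using C(3) by auto
     then show ?thesis using 3 by (intro image_eqI[of _ _ x]) auto
    qed
   qed
  qed
  show "?p (?pm x) = ?p x" if x: "x \<in> E" for x
  proof -
   have xE: "?pm x \<in> E" using perm x by (simp add: permutes_in_image del: comp_apply)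
   consider "x = a" | "x = b" | "x ~= a" "x ~= b" by blast
   then show ?thesis
   proof cases
    case 1
    have "pm b ~: Ck" "p (pm b) = i" using Ck2 CE C(4) ab i by auto
    then show ?thesis using 1 v(1) pv[OF x] pv[OF xE] abC i by simp
   next
    case 2
    then show ?thesis using v(2) pv[OF x] pv[OF xE] abC Ci2 by simp
   next
    case 3
    have "pm x \<in> Ck \<longleftrightarrow> x \<in> Ck"
    proof
     assume "pm x \<in> Ck"
     then have "pm x \<in> X" by (simp add: Ck_def)
     then have "x \<in> X" using C(4)[OF x] x by (auto simp: X_def)
     then show "x \<in> Ck" using XU Ci1[of x] 3 CE \<open>pm x \<in> Ck\<close> by auto
    qed (use Ck1 3 in auto)
    then show ?thesis using v(3)[OF 3] pv[OF x] pv[OF xE] C(4)[OF x] by simp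
   qed
  qed
  fix S x y assume S: "S \<subseteq> E" "?pm ` S \<subseteq> S" "x \<in> S" "y \<in> E" "?p y = ?p x"
  have xE: "x \<in> E" using S by auto
  have Sv: "?pm z \<in> S" if "z \<in> S" for z using S(2) that by blast
  have Sv3: "pm z \<in> S" if "z \<in> S" "z ~= a" "z ~= b" for z using Sv[OF that(1)] v(3)[OF that(2,3)] by simp
  show "y \<in> S"
  proof (cases "x \<in> X")
   case False
   then have px: "?p x = p x" using XU pv[OF xE] by auto
   have "p x ~= k" using C(6)[OF xE] k by auto
   then have "p y = p x" using S(5) pv[OF S(4)] px by (auto split: if_splits)
   have "y \<in> {z\<in>S. p z = p x}"
   proof (rule cyc_label_inv[OF c, where x=x])
    fix z assume z: "z \<in> {z\<in>S. p z = p x}"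
    then have "z ~= a" "z ~= b" using False xE i by (auto simp: X_def)
    then show "pm z \<in> {z\<in>S. p z = p x}" using Sv3[of z] C(4) z S by auto
   qed (use S \<open>p y = p x\<close> in auto)
   then show ?thesis by simp
  next
   case True
   show ?thesis
   proof (cases "x \<in> Ck")
    case xk: True
    then have "y \<in> Ck" using S(5) pv[OF xE] pv[OF S(4)] C(6)[OF S(4)] k by (auto split: if_splits)
    have "b \<in> S"
    proof (rule ccontr)
     assume n: "b ~: S"
     have "S Int Ck = X"
     proof (rule whole)
      fix z assume z: "z \<in> S Int Ck"
      then have "z ~= a" "z ~= b" using n abC by auto
      then show "pm z \<in> S Int Ck" using Sv3[of z] Ck1[of z] z by auto
     qed (use xk S XU in auto)
     then show False using n abX by auto
    qed
    have "(S Int Ck) Un Ci = X"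
    proof (rule whole)
     fix z assume z: "z \<in> S Int Ck Un Ci"
     consider "z = a" | "z = b" | "z ~= a" "z ~= b" by blast
     then show "pm z \<in> S Int Ck Un Ci"
     proof cases
      case 1 then show ?thesis using Ci2 Sv[OF \<open>b \<in> S\<close>] v by simp
     next
      case 2 then show ?thesis using Ck2 by simp
     next
      case 3 then show ?thesis using z Sv3[of z] Ck1[of z] Ci1[of z] by auto
     qed
    qed (use abC XU in auto)
    then show ?thesis using \<open>y \<in> Ck\<close> CE XU by auto
   next
    case xk: False
    then have xi: "x \<in> Ci" using True XU by auto
    have "p y = i" "y ~: Ck" using S(5) pv[OF xE] pv[OF S(4)] xk pi[OF True] ik by (auto split: if_splits)
    then have yi: "y \<in> Ci" using S XU by (auto simp: X_def)
    have "a \<in> S"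
    proof (rule ccontr)
     assume n: "a ~: S"
     have "S Int Ci = X"
     proof (rule whole)
      fix z assume z: "z \<in> S Int Ci"
      then have "z ~= a" "z ~= b" using n abC by auto
      then show "pm z \<in> S Int Ci" using Sv3[of z] Ci1[of z] z by auto
     qed (use xi S XU in auto)
     then show False using n abX by auto
    qed
    have "(S Int Ci) Un Ck = X"
    proof (rule whole)
     fix z assume z: "z \<in> S Int Ci Un Ck"
     consider "z = a" | "z = b" | "z ~= a" "z ~= b" by blast
     then show "pm z \<in> S Int Ci Un Ck"
     proof cases
      case 1 then show ?thesis using Ci2 by simp
     next
      case 2 then show ?thesis using Ck2 Sv[OF \<open>a \<in> S\<close>] v by simp
     next
      case 3 then show ?thesis using z Sv3[of z] Ck1[of z] Ci1[of z] by auto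
     qed
    qed (use abC XU in auto)
    then show ?thesis using yi CE XU by auto
   qed
  qed
 qed auto
qed

subsection \<open>Ribbon graphs as pairs of permutations of the edges\<close>

text \<open>For permutations of a finite set this is transitivity of the generated group. The form
  with invariant sets passes easily through the surgeries, which change the permutations at two
  points only.\<close>

definition conn :: "'e set => ('e => 'e) => ('e => 'e) => bool" where
 "conn E sg tu \<longleftrightarrow> (\<forall>S. S \<subseteq> E --> S ~= {} --> sg ` S \<subseteq> S --> tu ` S \<subseteq> S --> S = E)"

lemma connD: "conn E sg tu ==> S \<subseteq> E ==> S ~= {} ==> (!!x. x \<in> S ==> sg x \<in> S) ==> (!!x. x \<in> S ==> tu x \<in> S) ==> S = E"
 unfolding conn_def by (metis image_subsetI)

lemma connI: "(!!S. S \<subseteq> E ==> S ~= {} ==> (!!x. x \<in> S ==> sg x \<in> S) ==> (!!x. x \<in> S ==> tu x \<in> S) ==> S = E) ==> conn E sg tu"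
 unfolding conn_def by (simp add: image_subset_iff)

text \<open>The cycles of \<open>sg\<close> and of \<open>sg o tu\<close> are the positive and the negative boundary components. A
 two-cycle of \<open>tu\<close> is a vertex of degree 4, a fixed point of \<open>tu\<close> a marked point (a vertex of degree 2).\<close>

type_synonym ('e, 'l) rstruct = "('e => 'e) \<times> ('e => 'e) \<times> ('e => 'l) \<times> ('e => 'l)"

definition strs :: "'e set => 'e set => 'l set => 'l set => ('e, 'l) rstruct set" where
 "strs E F Ip Iq = {(sg, tu, p, q). cyc_label E sg p Ip & cyc_label E (sg o tu) q Iq &
  tu permutes E & tu o tu = id & {x\<in>E. tu x = x} = F & conn E sg tu}"

definition svol :: "'e set => ('l => real) => ('l => real) => ('e, 'l) rstruct => ennreal" where
 "svol E Lp Lq = (%(sg, tu, p, q). vol E p q Lp Lq)"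

text \<open>The edges are named, so an isomorphism class of graphs contributes once for each naming
  up to automorphism; \<open>card_strs_iso\<close> makes this exact.\<close>

definition W :: "'e set => 'e set => 'l set => 'l set => ('l => real) => ('l => real) => ennreal" where
 "W E F Ip Iq Lp Lq = (\<Sum>s\<in>strs E F Ip Iq. svol E Lp Lq s)"

lemma strsI:
 assumes "cyc_label E sg p Ip" "cyc_label E (sg o tu) q Iq" "tu permutes E" "!!x. x \<in> E ==> tu (tu x) = x"
  "{x\<in>E. tu x = x} = F" "conn E sg tu"
 shows "(sg, tu, p, q) \<in> strs E F Ip Iq"
proof -
 have "tu (tu x) = x" for x using assms(3,4) by (cases "x \<in> E") (auto simp: permutes_not_in)
 then show ?thesis using assms by (simp add: strs_def fun_eq_iff)
qed

lemma strsD: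
 assumes "(sg, tu, p, q) \<in> strs E F Ip Iq"
 shows "cyc_label E sg p Ip" "cyc_label E (sg o tu) q Iq" "tu permutes E" "!!x. tu (tu x) = x"
  "{x\<in>E. tu x = x} = F" "conn E sg tu" "!!x. x \<in> E ==> tu x \<in> E" "inj tu"
 using assms by (auto simp: strs_def fun_eq_iff permutes_in_image permutes_inj)

lemma finite_strs: "finite E ==> finite (strs E F Ip Iq)"
proof -
 assume fin: "finite E"
 show ?thesis
 proof (cases "finite Ip & finite Iq")
  case True
  have "strs E F Ip Iq \<subseteq> {pm. pm permutes E} \<times> {pm. pm permutes E} \<times> (E \<rightarrow>\<^sub>E Ip) \<times> (E \<rightarrow>\<^sub>E Iq)"
  proof
   fix s assume "s \<in> strs E F Ip Iq"
   then obtain sg tu p q where s: "s = (sg, tu, p, q)" "(sg, tu, p, q) \<in> strs E F Ip Iq" by (cases s) auto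
   note C = cyc_labelD[OF strsD(1)[OF s(2)]] and D = cyc_labelD[OF strsD(2)[OF s(2)]]
   have "p \<in> E \<rightarrow>\<^sub>E Ip" "q \<in> E \<rightarrow>\<^sub>E Iq" using C(2,6) D(2,6) by (simp_all add: PiE_iff)
   then show "s \<in> {pm. pm permutes E} \<times> {pm. pm permutes E} \<times> (E \<rightarrow>\<^sub>E Ip) \<times> (E \<rightarrow>\<^sub>E Iq)"
    using C(1) strsD(3)[OF s(2)] by (simp add: s(1))
  qed
  moreover have "finite ({pm. pm permutes E} \<times> {pm. pm permutes E} \<times> (E \<rightarrow>\<^sub>E Ip) \<times> (E \<rightarrow>\<^sub>E Iq))"
   using True fin by (intro finite_cartesian_product finite_permutations finite_PiE) auto
  ultimately show ?thesis by (rule finite_subset)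
 next
  case False
  have "s ~: strs E F Ip Iq" for s
  proof
   assume "s \<in> strs E F Ip Iq"
   then obtain sg tu p q where s: "(sg, tu, p, q) \<in> strs E F Ip Iq" by (cases s) auto
   show False using cyc_labelD(3)[OF strsD(1)[OF s]] cyc_labelD(3)[OF strsD(2)[OF s]] False fin by blast
  qed
  then have "strs E F Ip Iq = {}" by blast
  then show ?thesis by simp
 qed
qed

section \<open>Resolving a vertex, inserting and forgetting marked points\<close>

lemma swp_conj:
 assumes "inj tu" "tu a = b & tu b = a \<or> tu a = a & tu b = b"
 shows "swp a b o tu o swp a b = tu"
proof
 fix x
 have "x ~= a ==> x ~= b ==> tu x ~= a & tu x ~= b" using assms by (metis injD)
 then show "(swp a b o tu o swp a b) x = tu x"
  using assms(2) by (cases "x = a"; cases "x = b") (auto simp: Transposition.transpose_def)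
qed

lemma swp_swp: "f o swp a b o swp a b = f" "swp a b o (swp a b o f) = f"
 by (simp_all add: fun_eq_iff)

text \<open>The transposition of a two-cycle, or of two fixed points, commutes with
  \<open>tu\<close>. Multiplying both \<open>sg\<close> and \<open>tu\<close> by it therefore leaves
  \<open>sg o tu\<close> unchanged: resolving or restoring a vertex alters positive boundary
  components but none of the negative ones.\<close>

lemma swp_involution:
 assumes "tu permutes E" "!!x. tu (tu x) = x" "a \<in> E" "b \<in> E" "tu a = b & tu b = a \<or> tu a = a & tu b = b"
 shows "tu o swp a b permutes E" "!!x. (tu o swp a b) ((tu o swp a b) x) = x"
  "!!sg. (sg o swp a b) o (tu o swp a b) = sg o tu"
proof -
 have c: "swp a b o tu o swp a b = tu" using assms by (intro swp_conj) (auto intro: permutes_inj)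
 show "tu o swp a b permutes E" using assms by (intro permutes_compose permutes_swap_id)
 show "(tu o swp a b) ((tu o swp a b) x) = x" for x
  using fun_cong[OF c, of x] assms(2)[of x] by simp
 show "(sg o swp a b) o (tu o swp a b) = sg o tu" for sg
  using c by (simp add: comp_assoc)
qed

text \<open>Inserting a marked point \<open>a\<close> before the edge \<open>e\<close>.\<close>

lemma strs_insert:
 assumes s: "(sg, tu, p, q) \<in> strs E F Ip Iq" and a: "a ~: E" and e: "e \<in> E"
 shows "(swp a e o sg, tu, p(a := p e), q(a := q e)) \<in> strs (insert a E) (insert a F) Ip Iq"
proof -
 note S = strsD[OF s] and C = cyc_labelD[OF strsD(1)[OF s]]
 have tua: "tu a = a" using S(3) a by (simp add: permutes_not_in)
 have sga: "sg a = a" using C(1) a by (simp add: permutes_not_in)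
 have v: "(swp a e o sg) x = (if sg x = e then a else sg x)" if "x \<in> E" for x
  using C(5)[OF that] a by (auto simp: Transposition.transpose_def)
 obtain z0 where z0: "z0 \<in> E" "sg z0 = e" using C(1) e by (metis permutes_in_image permutes_surj surjD)
 show ?thesis
 proof (rule strsI)
  show "cyc_label (insert a E) (swp a e o sg) (p(a := p e)) Ip" by (rule cyc_label_insert[OF S(1) a e])
  show "cyc_label (insert a E) (swp a e o sg o tu) (q(a := q e)) Iq"
   unfolding comp_assoc by (rule cyc_label_insert[OF S(2) a e])
  show "tu permutes insert a E" using S(3) by (rule permutes_subset) auto
  show "{x \<in> insert a E. tu x = x} = insert a F" using S(5) tua by auto
  show "conn (insert a E) (swp a e o sg) tu"
  proof (rule connI)
   fix S' assume S': "S' \<subseteq> insert a E" "S' ~= {}" and i1: "!!x. x \<in> S' ==> (swp a e o sg) x \<in> S'"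
    and i2: "!!x. x \<in> S' ==> tu x \<in> S'"
   have ea: "e \<in> S'" if "a \<in> S'" using i1[OF that] sga by simp
   have "S' Int E = E"
   proof (rule connD[OF S(6)])
    show "S' Int E ~= {}" using S' ea e by auto
    show "sg x \<in> S' Int E" if "x \<in> S' Int E" for x
     using i1[of x] v[of x] that ea C(5)[of x] e by (auto split: if_splits)
    show "tu x \<in> S' Int E" if "x \<in> S' Int E" for x using i2 that S(7) by auto
   qed auto
   then have "E \<subseteq> S'" by auto
   moreover have "a \<in> S'" using i1[of z0] v[of z0] z0 \<open>E \<subseteq> S'\<close> by auto
   ultimately show "S' = insert a E" using S' by auto
  qed
 qed (use S in auto)
qed

text \<open>If \<open>a\<close> were fixed by \<open>sg\<close> as well as by \<open>tu\<close>, it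
  would be a connected component by itself, which the presence of further edges excludes; so it can
  be taken out of both its cycles.\<close>

lemma strs_delete:
 assumes s: "(sg, tu, p, q) \<in> strs (insert a E) F Ip Iq" and a: "a ~: E" and E: "E ~= {}" and tua: "tu a = a"
 shows "sg a \<in> E" "p a = p (sg a)" "q a = q (sg a)"
  "(swp a (sg a) o sg, tu, restrict p E, restrict q E) \<in> strs E (F - {a}) Ip Iq"
proof -
 note S = strsD[OF s] and C = cyc_labelD[OF strsD(1)[OF s]]
 define e where "e = sg a"
 have ea: "e ~= a"
 proof
  assume "e = a"
  then have "{a} = insert a E" using tua by (intro connD[OF S(6)]) (auto simp: e_def)
  then show False using E a by auto
 qed
 have sgtua: "(sg o tu) a = e" by (simp add: tua e_def)
 note D1 = cyc_label_delete[OF S(1) a e_def[symmetric] ea]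
 note D2 = cyc_label_delete[OF S(2) a sgtua ea]
 show "sg a \<in> E" "p a = p (sg a)" "q a = q (sg a)" using D1 D2 by (auto simp: e_def)
 have inj: "sg x = e ==> x = a" for x using e_def C(1) by (metis permutes_inj injD)
 have v: "(swp a e o sg) x = (if sg x = a then e else sg x)" if "x \<in> E" for x
  using inj[of x] that a by (auto simp: Transposition.transpose_def)
 show "(swp a (sg a) o sg, tu, restrict p E, restrict q E) \<in> strs E (F - {a}) Ip Iq"
  unfolding e_def[symmetric]
 proof (rule strsI)
  show "cyc_label E (swp a e o sg) (restrict p E) Ip" by (rule D1)
  show "cyc_label E (swp a e o sg o tu) (restrict q E) Iq" unfolding comp_assoc by (rule D2(1))
  show "tu permutes E" using S(3) tua by (metis insertE permutes_superset Diff_iff)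
  show "{x \<in> E. tu x = x} = F - {a}" using S(5) a by auto
  show "conn E (swp a e o sg) tu"
  proof (rule connI)
   fix S' assume S': "S' \<subseteq> E" "S' ~= {}" and i1: "!!x. x \<in> S' ==> (swp a e o sg) x \<in> S'"
    and i2: "!!x. x \<in> S' ==> tu x \<in> S'"
   define T where "T = (if e \<in> S' then insert a S' else S')"
   have "T = insert a E"
   proof (rule connD[OF S(6)])
    show "sg x \<in> T" if "x \<in> T" for x
    proof (cases "x = a")
     case True
     then show ?thesis using that a S' by (auto simp: T_def e_def split: if_splits)
    next
     case False
     then have "x \<in> S'" using that by (auto simp: T_def split: if_splits)
     then show ?thesis using i1[of x] v[of x] S' by (auto simp: T_def split: if_splits)
    qed
    show "tu x \<in> T" if "x \<in> T" for x
     using that i2 tua by (auto simp: T_def split: if_splits)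
   qed (use S' in \<open>auto simp: T_def\<close>)
   then show "S' = E" using S' a by (auto simp: T_def split: if_splits)
  qed
 qed (use S in auto)
qed

text \<open>Forgetting the marked point \<open>a\<close> leaves a structure together with the edge
  \<open>sg a\<close> before which it was inserted; \<open>vol_insert_sum\<close> sums over this
  edge. The predicate \<open>Q\<close> carries along a condition on another marked point.\<close>

lemma sum_strs_insert:
 fixes E :: "'e set" and Ip Iq :: "'l set"
 assumes fin: "finite E" and E: "E ~= {}" and a: "a ~: E" "a ~: F" and i: "i \<in> Ip"
 shows "(\<Sum>s\<in>{(sg, tu, p, q)\<in>strs (insert a E) (insert a F) Ip Iq. p a = i & Q (restrict p E)}. svol (insert a E) Lp Lq s)
  = ennreal (Lp i) * (\<Sum>s\<in>{(sg, tu, p, q)\<in>strs E F Ip Iq. Q p}. svol E Lp Lq s)"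
proof -
 let ?T = "{(sg, tu, p, q)\<in>strs E F Ip Iq. Q p}"
 let ?S = "{(sg, tu, p, q)\<in>strs (insert a E) (insert a F) Ip Iq. p a = i & Q (restrict p E)}"
 define X where "X = (%(sg :: 'e => 'e, tu :: 'e => 'e, p :: 'e => 'l, q :: 'e => 'l). {e\<in>E. p e = i})"
 define G where "G = (%((sg, tu, p, q), e). (swp a e o sg, tu, p(a := p e), q(a := q e)) :: ('e, 'l) rstruct)"
 define H where "H = (%(sg, tu, p, q). ((swp a (sg a) o sg, tu, restrict p E, restrict q E), sg a) :: ('e, 'l) rstruct \<times> 'e)"
 have finT: "finite ?T" using finite_strs[OF fin] by (rule finite_subset[rotated]) auto
 have "(\<Sum>s\<in>?S. svol (insert a E) Lp Lq s) = (\<Sum>t\<in>Sigma ?T X. svol (insert a E) Lp Lq (G t))"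
 proof (rule sum.reindex_bij_witness[where i=G and j=H])
  fix s assume "s \<in> ?S"
  then obtain sg tu p q where s: "s = (sg, tu, p, q)" "(sg, tu, p, q) \<in> strs (insert a E) (insert a F) Ip Iq" "p a = i" "Q (restrict p E)" by auto
  have "tu a = a" using strsD(5)[OF s(2)] by auto
  note D = strs_delete[OF s(2) a(1) E this]
  have ext: "p \<in> extensional (insert a E)" "q \<in> extensional (insert a E)"
   using cyc_labelD(2)[OF strsD(1)[OF s(2)]] cyc_labelD(2)[OF strsD(2)[OF s(2)]] by auto
  show "G (H s) = s"
   using D(1-3) ext a unfolding s(1) G_def H_def by (auto simp: swp_swp fun_eq_iff extensional_def)
  then show "svol (insert a E) Lp Lq (G (H s)) = svol (insert a E) Lp Lq s" by simp
  show "H s \<in> Sigma ?T X"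
   using D s a unfolding s(1) H_def X_def by auto
 next
  fix t assume "t \<in> Sigma ?T X"
  then obtain sg tu p q e where t: "t = ((sg, tu, p, q), e)" "(sg, tu, p, q) \<in> strs E F Ip Iq" "Q p" "e \<in> E" "p e = i"
   by (auto simp: X_def)
  have ext: "p \<in> extensional E" "q \<in> extensional E"
   using cyc_labelD(2)[OF strsD(1)[OF t(2)]] cyc_labelD(2)[OF strsD(2)[OF t(2)]] by auto
  have sga: "sg a = a" using cyc_labelD(1)[OF strsD(1)[OF t(2)]] a by (simp add: permutes_not_in)
  have r: "restrict (p(a := p e)) E = p" "restrict (q(a := q e)) E = q"
   using ext a by (auto simp: fun_eq_iff extensional_def restrict_def)
  show "H (G t) = t" unfolding t(1) G_def H_def using sga r by (simp add: swp_swp)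
  show "G t \<in> ?S" using strs_insert[OF t(2) a(1) t(4)] t r unfolding t(1) G_def by auto
 qed
 also have "... = (\<Sum>s\<in>?T. \<Sum>e\<in>X s. svol (insert a E) Lp Lq (G (s, e)))"
  using finT fin by (subst sum.Sigma) (auto simp: X_def)
 also have "... = (\<Sum>s\<in>?T. ennreal (Lp i) * svol E Lp Lq s)"
 proof (rule sum.cong)
  fix s assume "s \<in> ?T"
  then obtain sg tu p q where s: "s = (sg, tu, p, q)" "(sg, tu, p, q) \<in> strs E F Ip Iq" by auto
  have "i \<in> p ` E" using i cyc_labelD(3)[OF strsD(1)[OF s(2)]] by simp
  then have "(\<Sum>e\<in>{e\<in>E. p e = i}. vol (insert a E) (p(a := i)) (q(a := q e)) Lp Lq) = ennreal (Lp i) * vol E p q Lp Lq"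
   by (rule vol_insert_sum[OF fin a(1)])
  moreover have "(\<Sum>e\<in>X s. svol (insert a E) Lp Lq (G (s, e))) = (\<Sum>e\<in>{e\<in>E. p e = i}. vol (insert a E) (p(a := i)) (q(a := q e)) Lp Lq)"
   unfolding s(1) X_def G_def svol_def by (intro sum.cong) auto
  ultimately show "(\<Sum>e\<in>X s. svol (insert a E) Lp Lq (G (s, e))) = ennreal (Lp i) * svol E Lp Lq s"
   by (simp add: s(1) svol_def)
 qed simp
 finally show ?thesis by (simp add: sum_distrib_left)
qed

text \<open>The vertex formed by \<open>a\<close> and \<open>b\<close> is resolved; two positive components are merged.\<close>

lemma strs_merge:
 assumes s: "(sg, tu, p, q) \<in> strs (insert b E) {} Ip Iq" and ab: "a \<in> E" "b ~: E"
  and tu: "tu a = b" and p: "p a = i" "p b = j" "i ~= j"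
 shows "sg a \<in> E" "p (sg a) = i" "q b = q (sg a)"
  "(swp b (sg a) o (sg o swp a b), tu o swp a b, (\<lambda>x\<in>E. if p x = j then i else p x), restrict q E) \<in> strs E {a} (Ip - {j}) Iq"
proof -
 note S = strsD[OF s]
 have tub: "tu b = a" using S(4)[of a] tu by simp
 note I = swp_involution[OF S(3,4), of a b, OF _ _ disjI1, OF _ _ conjI[OF tu tub]]
 have anb: "a ~= b" using ab by auto
 define sg' tu' where "sg' = sg o swp a b" and "tu' = tu o swp a b"
 define p' where "p' = (\<lambda>x\<in>insert b E. if p x = j then i else p x)"
 have c1: "cyc_label (insert b E) sg' p' (Ip - {j})"
  unfolding sg'_def p'_def using ab p by (intro cyc_label_join[OF S(1)]) auto
 have c2: "cyc_label (insert b E) (sg' o tu') q Iq"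
  using S(2) I(3)[of sg] ab by (simp add: sg'_def tu'_def)
 have tu'v: "tu' x = (if x = a \<or> x = b then x else tu x)" for x
  using tu tub by (auto simp: tu'_def Transposition.transpose_def)
 have sg'v: "sg' a = sg b" "sg' b = sg a" "!!x. x ~= a ==> x ~= b ==> sg' x = sg x"
  by (auto simp: sg'_def Transposition.transpose_def)
 \<comment> \<open>After the merger \<open>a\<close> and \<open>b\<close> lie on one cycle, so an
   invariant set contains both or neither, and is then invariant under the old permutations as
   well.\<close>
 have cn: "conn (insert b E) sg' tu'"
 proof (rule connI)
  fix S' assume S': "S' \<subseteq> insert b E" "S' ~= {}" and i1: "!!x. x \<in> S' ==> sg' x \<in> S'" and i2: "!!x. x \<in> S' ==> tu' x \<in> S'"
  have pp: "p' a = p' b" using ab p by (auto simp: p'_def)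
  have iff: "a \<in> S' \<longleftrightarrow> b \<in> S'"
   using cyc_label_inv[OF c1 S'(1) i1, of a b] cyc_label_inv[OF c1 S'(1) i1, of b a] pp ab by auto
  show "S' = insert b E"
  proof (rule connD[OF S(6) S'])
   fix x assume x: "x \<in> S'"
   consider "x = a" "a \<in> S'" "b \<in> S'" | "x = b" "a \<in> S'" "b \<in> S'" | "x ~= a" "x ~= b" using x iff by blast
   then have "sg x \<in> S' & tu x \<in> S'"
   proof cases
    case 1 then show ?thesis using i1[of b] sg'v(2) tu by simp
   next
    case 2 then show ?thesis using i1[of a] sg'v(1) tub by simp
   next
    case 3 then show ?thesis using i1[OF x] sg'v(3)[of x] i2[OF x] tu'v[of x] by simp
   qed
   then show "sg x \<in> S'" "tu x \<in> S'" by auto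
  qed
 qed
 \<comment> \<open>Both \<open>a\<close> and \<open>b\<close> are now marked points. Only
   \<open>a\<close> is kept: the position of \<open>b\<close> is determined by the length of
   component \<open>j\<close>, once the edge on which it falls is recorded.\<close>
 have s': "(sg', tu', p', q) \<in> strs (insert b E) {a, b} (Ip - {j}) Iq"
 proof (rule strsI[OF c1 c2 _ _ _ cn])
  show "tu' permutes insert b E" using I(1) ab by (simp add: tu'_def)
  show "tu' (tu' x) = x" for x using I(2)[of x] ab by (simp add: tu'_def)
  show "{x \<in> insert b E. tu' x = x} = {a, b}" using S(5) ab by (auto simp: tu'v)
 qed
 have ne: "E ~= {}" using ab by auto
 have tu'b: "tu' b = b" by (simp add: tu'v)
 note D = strs_delete[OF s' ab(2) ne tu'b]
 show a1: "sg a \<in> E" using D(1) sg'v by simp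
 show "p (sg a) = i" using cyc_labelD(4)[OF S(1), of a] ab p by simp
 show "q b = q (sg a)" using D(3) sg'v by simp
 have "restrict p' E = (\<lambda>x\<in>E. if p x = j then i else p x)" by (auto simp: p'_def)
 moreover have "{a, b} - {b} = {a}" using anb by auto
 ultimately show "(swp b (sg a) o (sg o swp a b), tu o swp a b, (\<lambda>x\<in>E. if p x = j then i else p x), restrict q E) \<in> strs E {a} (Ip - {j}) Iq"
  using D(4)[unfolded sg'v(2)] by (simp only: sg'_def tu'_def)
qed

definition rank_of :: "'e set => ('e => 'e) => 'e => 'e => nat" where
 "rank_of X pm a = (SOME rk. cyc_rank X pm a rk & rk (pm a) = 0 & (\<forall>x\<in>X. x ~= a --> rk (pm x) = Suc (rk x)))"

lemma rank_of:
 assumes c: "cyc_label E pm p I" and a: "a \<in> E" "p a = i"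
 shows "cyc_rank {x\<in>E. p x = i} pm a (rank_of {x\<in>E. p x = i} pm a)"
  "rank_of {x\<in>E. p x = i} pm a (pm a) = 0"
  "!!x. x \<in> E ==> p x = i ==> x ~= a ==> rank_of {x\<in>E. p x = i} pm a (pm x) = Suc (rank_of {x\<in>E. p x = i} pm a x)"
proof -
 have "\<exists>rk. cyc_rank {x\<in>E. p x = i} pm a rk & rk (pm a) = 0 & (\<forall>x\<in>{x\<in>E. p x = i}. x ~= a --> rk (pm x) = Suc (rk x))"
  using cyc_rank_exists[OF c a(1)] unfolding a(2) by blast
 from someI_ex[OF this, folded rank_of_def]
 show "cyc_rank {x\<in>E. p x = i} pm a (rank_of {x\<in>E. p x = i} pm a)"
  "rank_of {x\<in>E. p x = i} pm a (pm a) = 0"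
  "!!x. x \<in> E ==> p x = i ==> x ~= a ==> rank_of {x\<in>E. p x = i} pm a (pm x) = Suc (rank_of {x\<in>E. p x = i} pm a x)"
  by auto
qed

text \<open>Inverse of \<open>strs_merge\<close>: the point \<open>b\<close> is inserted before
  \<open>e\<close> and the cycle is cut at \<open>a\<close> and \<open>b\<close>. The arc from the
  successor of \<open>a\<close> to \<open>b\<close> receives the label \<open>j\<close>; it consists
  of \<open>b\<close> and the edges of rank below that of \<open>e\<close>.\<close>

lemma strs_unmerge:
 fixes sg :: "'e => 'e"
 assumes s: "(sg, tu, p, q) \<in> strs E {a} I Iq" and ab: "a \<in> E" "b ~: E" and e: "e \<in> E" "p e = i"
  and p: "p a = i" "j ~: I"
 defines "rk \<equiv> rank_of {x\<in>E. p x = i} sg a"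
 shows "(swp b e o sg o swp a b, tu o swp a b, (\<lambda>x\<in>insert b E. if x = b \<or> (p x = i & rk x < rk e) then j else p x), q(b := q e))
  \<in> strs (insert b E) {} (insert j I) Iq"
proof -
 define X where "X = {x\<in>E. p x = i}"
 note S = strsD[OF s] and C = cyc_labelD[OF strsD(1)[OF s]]
 note R = rank_of[OF S(1) ab(1) p(1), folded rk_def]
 have tua: "tu a = a" using S(5) by auto
 have tub: "tu b = b" using S(3) ab by (simp add: permutes_not_in)
 have sgb: "sg b = b" using C(1) ab by (simp add: permutes_not_in)
 define sg' where "sg' = swp b e o sg"
 have s': "(sg', tu, p(b := p e), q(b := q e)) \<in> strs (insert b E) {b, a} I Iq"
  unfolding sg'_def by (rule strs_insert[OF s ab(2) e(1)])
 note S' = strsD[OF s']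
 have anb: "a ~= b" using ab by auto
 have bI: "b \<in> insert b E" "a \<in> insert b E" using ab by auto
 note I = swp_involution[OF S'(3,4) bI(2,1) disjI2[OF conjI[OF tua tub]]]
 have rk0: "cyc_rank X sg a rk" using R(1) by (simp add: X_def)
 \<comment> \<open>The old ranks are doubled and made odd, which leaves room for \<open>b\<close> at
   the even value just below \<open>e\<close>.\<close>
 define rk' where "rk' x = (if x = b then 2 * rk e else 2 * rk x + 1)" for x
 have Xb: "{x\<in>insert b E. (p(b := p e)) x = i} = insert b X" using e ab by (auto simp: X_def)
 have eX: "e \<in> X" "a \<in> X" using e ab p by (auto simp: X_def)
 have bX: "b ~: X" using ab by (auto simp: X_def)
 have K: "inj_on rk X" "!!x. x \<in> X ==> rk x \<le> rk a" using rk0 unfolding cyc_rank_def by auto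
 have sgX: "sg x \<in> X" if "x \<in> X" for x using that C(4,5) by (auto simp: X_def)
 have sg'v: "sg' x = (if sg x = e then b else sg x)" if "x \<in> X" for x
 proof -
  have "sg x ~= b" using sgX[OF that] bX by auto
  then show ?thesis by (auto simp: sg'_def Transposition.transpose_def)
 qed
 have sg'b: "sg' b = e" by (simp add: sg'_def sgb)
 have eb: "e ~= b" using e ab by auto
 have ne: "x ~= b" if "x \<in> X" for x using that bX by auto
 have rS: "rk (sg x) = Suc (rk x)" if "x \<in> X" "x ~= a" for x using R(3)[of x] that by (simp add: X_def)
 have rk'S: "rk' x < rk' (sg' x) & rk' (sg' x) \<le> rk' x + 2 & (rk' (sg' x) = rk' x + 2 --> rk x + 1 ~= rk e)"
  if "x \<in> X" "x ~= a" for x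
 proof (cases "sg x = e")
  case True
  then show ?thesis using rS[OF that] sg'v[OF that(1)] ne[OF that(1)] by (simp add: rk'_def)
 next
  case False
  then have "rk (sg x) ~= rk e" using K(1) sgX[OF that(1)] eX by (auto dest: inj_onD)
  then show ?thesis using rS[OF that] sg'v[OF that(1)] False ne[OF that(1)] ne[OF sgX[OF that(1)]] by (simp add: rk'_def)
 qed
 have "cyc_rank (insert b X) sg' a rk'"
  unfolding cyc_rank_def
 proof (intro conjI ballI impI)
  show "a \<in> insert b X" using eX by simp
  show "inj_on rk' (insert b X)"
  proof (rule inj_onI)
   fix x y assume xy: "x \<in> insert b X" "y \<in> insert b X" "rk' x = rk' y"
   have par: "2 * m ~= 2 * n + 1" "2 * n + 1 ~= 2 * m" for m n :: nat by presburger+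
   show "x = y" using xy K(1) par unfolding rk'_def by (auto split: if_splits dest: inj_onD)
  qed
  fix x assume x: "x \<in> insert b X"
  show "rk' x \<le> rk' a" using x K(2)[of x] K(2)[OF eX(1)] anb by (auto simp: rk'_def)
  show "rk' (sg' a) \<le> rk' x"
  proof (cases "sg a = e")
   case True
   then show ?thesis using R(2) sg'v[OF eX(2)] by (simp add: rk'_def)
  next
   case False
   then have "rk e ~= 0" using inj_onD[OF K(1), of "sg a" e] sgX[OF eX(2)] eX R(2) by auto
   then show ?thesis using R(2) sg'v[OF eX(2)] False ne[OF sgX[OF eX(2)]] by (auto simp: rk'_def)
  qed
 next
  fix x assume x: "x \<in> insert b X" "x ~= a"
  show "rk' x < rk' (sg' x)"
   using rk'S[of x] x sg'b eb by (cases "x = b") (auto simp: rk'_def)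
  fix y assume y: "y \<in> insert b X" "rk' x < rk' y"
  show "rk' (sg' x) \<le> rk' y"
  proof (cases "x = b")
   case True
   then show ?thesis using y sg'b eb by (auto simp: rk'_def split: if_splits)
  next
   case xb: False
   then have xX: "x \<in> X" using x by auto
   show ?thesis
   proof (cases "sg x = e")
    case True
    then have "rk' (sg' x) = rk' x + 1" using rS[OF xX x(2)] sg'v[OF xX] xb by (simp add: rk'_def)
    then show ?thesis using y by simp
   next
    case False
    then have 1: "rk (sg x) ~= rk e" using K(1) sgX[OF xX] eX by (auto dest: inj_onD)
    have 2: "rk' (sg' x) = rk' x + 2" using rS[OF xX x(2)] sg'v[OF xX] False xb ne[OF sgX[OF xX]] by (simp add: rk'_def)
    show ?thesis
    proof (cases "y = b")
     case True
     then show ?thesis using 2 y 1 rS[OF xX x(2)] xb by (simp add: rk'_def)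
    next
     case False
     then show ?thesis using 2 y xb by (simp add: rk'_def)
    qed
   qed
  qed
 qed
 then have rk2: "cyc_rank {x\<in>insert b E. (p(b := p e)) x = i} sg' a rk'" unfolding Xb .
 have pa: "(p(b := p e)) a = i" "(p(b := p e)) b = i" using p e anb by auto
 have c1: "cyc_label (insert b E) (sg' o swp a b)
   (\<lambda>x\<in>insert b E. if (p(b := p e)) x = i & rk' x \<le> rk' b then j else (p(b := p e)) x) (insert j I)"
  by (rule cyc_label_split(1)[OF S'(1) bI(2,1) anb pa p(2) rk2])
 have peq: "(\<lambda>x\<in>insert b E. if (p(b := p e)) x = i & rk' x \<le> rk' b then j else (p(b := p e)) x) =
  (\<lambda>x\<in>insert b E. if x = b \<or> (p x = i & rk x < rk e) then j else p x)"
 proof (rule restrict_ext)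
  fix x
  have "2 * rk x + 1 \<le> 2 * rk e \<longleftrightarrow> rk x < rk e" by presburger
  then show "(if (p(b := p e)) x = i & rk' x \<le> rk' b then j else (p(b := p e)) x) = (if x = b \<or> (p x = i & rk x < rk e) then j else p x)"
   using e by (auto simp: rk'_def)
 qed
 have c2: "cyc_label (insert b E) (sg' o swp a b o (tu o swp a b)) (q(b := q e)) Iq"
  unfolding I(3) by (rule S'(2))
 have tu'v: "(tu o swp a b) x = (if x = a then b else if x = b then a else tu x)" for x
  using tua tub by (auto simp: Transposition.transpose_def)
 have sg''v: "(sg' o swp a b) x = (if x = a then sg' b else if x = b then sg' a else sg' x)" for x
  by (auto simp: Transposition.transpose_def)
 have cn: "conn (insert b E) (sg' o swp a b) (tu o swp a b)"
 proof (rule connI)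
  fix T assume T: "T \<subseteq> insert b E" "T ~= {}" and i1: "!!x. x \<in> T ==> (sg' o swp a b) x \<in> T" and i2: "!!x. x \<in> T ==> (tu o swp a b) x \<in> T"
  have iff: "a \<in> T \<longleftrightarrow> b \<in> T" using i2[of a] i2[of b] tu'v[of a] tu'v[of b] anb by auto
  show "T = insert b E"
  proof (rule connD[OF S'(6) T])
   fix x assume x: "x \<in> T"
   show "sg' x \<in> T" using i1[OF x] sg''v[of x] i1[of a] i1[of b] sg''v[of a] sg''v[of b] iff x anb
    by (cases "x = a"; cases "x = b") (auto simp del: comp_apply)
   show "tu x \<in> T" using i2[OF x] tu'v[of x] tua tub x
    by (cases "x = a"; cases "x = b") (auto simp del: comp_apply)
  qed
 qed
 show ?thesis
  unfolding sg'_def[symmetric]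
 proof (rule strsI[OF _ c2 I(1) I(2) _ cn])
  show "cyc_label (insert b E) (sg' o swp a b) (\<lambda>x\<in>insert b E. if x = b \<or> (p x = i & rk x < rk e) then j else p x) (insert j I)"
   using c1 unfolding peq .
  show "{x \<in> insert b E. (tu o swp a b) x = x} = {}"
   using S(5) anb by (auto simp: tu'v simp del: comp_apply split: if_splits)
 qed
qed

text \<open>A structure in which a vertex joins components \<open>i\<close> and \<open>j\<close>
  amounts to a structure with the merged component and an edge \<open>e\<close> on it where
  \<open>b\<close> falls. For almost every metric exactly one \<open>e\<close> is possible by
  \<open>vol_slices\<close>, so no factor remains from the sum over \<open>e\<close>.\<close>

lemma sum_merge:
 fixes E :: "'e set" and Ip Iq :: "'l set"
 assumes fin: "finite E" and ab: "a \<in> E" "b ~: E" and ij: "i ~= j" "i \<in> Ip" "j \<in> Ip" and L: "0 < Lp i" "0 < Lp j"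
 shows "(\<Sum>s\<in>{(sg, tu, p, q)\<in>strs (insert b E) {} Ip Iq. tu a = b & p a = i & p b = j}. svol (insert b E) Lp Lq s)
  = (\<Sum>s\<in>{(sg, tu, p, q)\<in>strs E {a} (Ip - {j}) Iq. p a = i}. svol E (Lp(i := Lp i + Lp j)) Lq s)"
proof -
 let ?T = "{(sg, tu, p, q)\<in>strs E {a} (Ip - {j}) Iq. p a = i}"
 let ?S = "{(sg, tu, p, q)\<in>strs (insert b E) {} Ip Iq. tu a = b & p a = i & p b = j}"
 define X where "X = (%(sg :: 'e => 'e, tu :: 'e => 'e, p :: 'e => 'l, q :: 'e => 'l). {e\<in>E. p e = i})"
 define pe where "pe sg p e = (\<lambda>x\<in>insert b E. if x = b \<or> (p x = i & rank_of {x\<in>E. p x = i} sg a x < rank_of {x\<in>E. p x = i} sg a e) then j else p x)" for sg p e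
 define G where "G = (%((sg, tu, p, q), e). (swp b e o sg o swp a b, tu o swp a b, pe sg p e, q(b := q e)) :: ('e, 'l) rstruct)"
 define H where "H = (%(sg, tu, p, q). ((swp b (sg a) o (sg o swp a b), tu o swp a b, (\<lambda>x\<in>E. if p x = j then i else p x), restrict q E), sg a) :: ('e, 'l) rstruct \<times> 'e)"
 have finT: "finite ?T" using finite_strs[OF fin] by (rule finite_subset[rotated]) auto
 have anb: "a ~= b" using ab by auto
 have Gprop: "G ((sg, tu, p, q), e) \<in> strs (insert b E) {} Ip Iq & (tu o swp a b) a = b & pe sg p e a = i & pe sg p e b = j"
  if s: "(sg, tu, p, q) \<in> strs E {a} (Ip - {j}) Iq" "p a = i" "e \<in> E" "p e = i" for sg tu p q e
 proof -
  have "\<not> rank_of {x\<in>E. p x = i} sg a a < rank_of {x\<in>E. p x = i} sg a e"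
   using rank_of(1)[OF strsD(1)[OF s(1)] ab(1) s(2)] s(3,4) unfolding cyc_rank_def by (auto simp: not_less)
  then have "pe sg p e a = i" using ab anb s(2) by (simp add: pe_def)
  moreover have "tu b = b" using strsD(3)[OF s(1)] ab by (simp add: permutes_not_in)
  moreover have "pe sg p e b = j" by (simp add: pe_def)
  moreover have "(swp b e o sg o swp a b, tu o swp a b, pe sg p e, q(b := q e)) \<in> strs (insert b E) {} (insert j (Ip - {j})) Iq"
   unfolding pe_def by (rule strs_unmerge[OF s(1) ab s(3,4,2)]) simp
  ultimately show ?thesis by (simp add: G_def insert_absorb[OF ij(3)])
 qed
 have "(\<Sum>s\<in>?S. svol (insert b E) Lp Lq s) = (\<Sum>t\<in>Sigma ?T X. svol (insert b E) Lp Lq (G t))"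
 proof (rule sum.reindex_bij_witness[where i=G and j=H])
  fix s assume "s \<in> ?S"
  then obtain sg tu p q where s: "s = (sg, tu, p, q)" "(sg, tu, p, q) \<in> strs (insert b E) {} Ip Iq" "tu a = b" "p a = i" "p b = j" by auto
  note D = strs_merge[OF s(2) ab s(3,4,5) ij(1)]
  define e where "e = sg a"
  define sg1 p1 q1 where "sg1 = swp b e o (sg o swp a b)" and "p1 = (\<lambda>x\<in>E. if p x = j then i else p x)" and "q1 = restrict q E"
  have Hs: "H s = ((sg1, tu o swp a b, p1, q1), e)" by (simp add: H_def s(1) sg1_def p1_def q1_def e_def)
  have in1: "(sg1, tu o swp a b, p1, q1) \<in> strs E {a} (Ip - {j}) Iq" using D(4) by (simp add: sg1_def p1_def q1_def e_def)
  have e: "e \<in> E" "p1 a = i" "p1 e = i" using D(1,2) ab s ij by (auto simp: p1_def e_def)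
  note Gp = Gprop[OF in1 e(2,1,3)]
  have sgeq: "swp b e o sg1 o swp a b = sg" by (simp add: sg1_def swp_swp fun_eq_iff)
  \<comment> \<open>Both labellings belong to the permutation \<open>sg\<close>. They agree at
    \<open>a\<close> and at \<open>b\<close>, hence on these two cycles, and the other components
    were not touched.\<close>
  have peq: "pe sg1 p1 e = p"
  proof
   fix x
   have c1: "cyc_label (insert b E) sg p Ip" by (rule strsD(1)[OF s(2)])
   have c2: "cyc_label (insert b E) sg (pe sg1 p1 e) Ip"
    using strsD(1)[OF conjunct1[OF Gp, unfolded G_def split_conv]] by (simp only: sgeq)
   show "pe sg1 p1 e x = p x"
   proof (cases "x \<in> insert b E")
    case True
    consider "p x = i" | "p x = j" | "p x ~= i" "p x ~= j" by blast
    then show ?thesis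
    proof cases
     case 1
     then have "pe sg1 p1 e x = pe sg1 p1 e a" using True ab s by (intro cyc_label_same[OF c1 c2]) auto
     then show ?thesis using Gp 1 by simp
    next
     case 2
     then have "pe sg1 p1 e x = pe sg1 p1 e b" using True ab s by (intro cyc_label_same[OF c1 c2]) auto
     then show ?thesis using Gp 2 by simp
    next
     case 3
     then have "x ~= b" using s by auto
     then show ?thesis using 3 True by (auto simp: pe_def p1_def)
    qed
   next
    case False
    then show ?thesis using cyc_labelD(2)[OF c1] cyc_labelD(2)[OF c2] by (simp add: extensional_def)
   qed
  qed
  have qeq: "q1(b := q1 e) = q"
  proof
   fix x
   have "q \<in> extensional (insert b E)" by (rule cyc_labelD(2)[OF strsD(2)[OF s(2)]])
   then show "(q1(b := q1 e)) x = q x" using D(1,3) e by (auto simp: q1_def e_def extensional_def)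
  qed
  show GH: "G (H s) = s" unfolding Hs G_def using sgeq peq qeq by (simp add: s(1) swp_swp)
  then show "svol (insert b E) Lp Lq (G (H s)) = svol (insert b E) Lp Lq s" by simp
  show "H s \<in> Sigma ?T X" unfolding Hs using in1 e by (simp add: X_def)
 next
  fix t assume "t \<in> Sigma ?T X"
  then obtain sg tu p q e where t: "t = ((sg, tu, p, q), e)" "(sg, tu, p, q) \<in> strs E {a} (Ip - {j}) Iq" "p a = i" "e \<in> E" "p e = i"
   by (auto simp: X_def)
  note C = cyc_labelD[OF strsD(1)[OF t(2)]]
  have sgb: "sg b = b" using C(1) ab by (simp add: permutes_not_in)
  have ext: "p \<in> extensional E" "q \<in> extensional E"
   using C(2) cyc_labelD(2)[OF strsD(2)[OF t(2)]] by auto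
  have r: "(\<lambda>x\<in>E. if pe sg p e x = j then i else pe sg p e x) = p"
  proof
   fix x
   have "p x ~= j" "x ~= b" if "x \<in> E" using C(6)[OF that] that ab by auto
   then show "(\<lambda>x\<in>E. if pe sg p e x = j then i else pe sg p e x) x = p x"
    using ext by (auto simp: pe_def extensional_def)
  qed
  have r2: "restrict (q(b := q e)) E = q"
   using ext ab by (auto simp: fun_eq_iff extensional_def restrict_def)
  have e1: "(swp b e o sg o swp a b) a = e" by (simp add: sgb)
  have e2: "swp b e o (swp b e o sg o swp a b o swp a b) = sg" by (simp add: fun_eq_iff)
  show "H (G t) = t" unfolding t(1) G_def H_def split_conv e1 r r2 e2 by (simp add: swp_swp)
  show "G t \<in> ?S" using Gprop[OF t(2-5)] unfolding t(1) G_def by simp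
 qed
 also have "... = (\<Sum>s\<in>?T. \<Sum>e\<in>X s. svol (insert b E) Lp Lq (G (s, e)))"
  using finT fin by (subst sum.Sigma) (auto simp: X_def)
 also have "... = (\<Sum>s\<in>?T. svol E (Lp(i := Lp i + Lp j)) Lq s)"
 proof (rule sum.cong)
  fix s assume "s \<in> ?T"
  then obtain sg tu p q where s: "s = (sg, tu, p, q)" "(sg, tu, p, q) \<in> strs E {a} (Ip - {j}) Iq" "p a = i" by auto
  note C = cyc_labelD[OF strsD(1)[OF s(2)]]
  note R = rank_of[OF strsD(1)[OF s(2)] ab(1) s(3)]
  have tua: "tu a = a" using strsD(5)[OF s(2)] by auto
  let ?X = "{x\<in>E. p x = i}" and ?rk = "rank_of {x\<in>E. p x = i} sg a"
  have "(\<Sum>e\<in>?X. vol (insert b E) (%x. if x = b \<or> (x \<in> ?X & ?rk x < ?rk e) then j else p x) (q(b := q e)) Lp Lq)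
     = vol E p q (Lp(i := Lp i + Lp j)) Lq"
  proof (rule vol_slices[OF fin ab(2) refl _ ij(1)])
   show "j ~: p ` E" using C(6) by auto
   show "inj_on ?rk ?X" "!!x. x \<in> ?X ==> ?rk x \<le> ?rk a" using R(1) unfolding cyc_rank_def by auto
   show "sg a \<in> ?X" using C(4,5) ab s by auto
   show "q a = q (sg a)" using cyc_labelD(4)[OF strsD(2)[OF s(2)], of a] ab tua by simp
  qed (use ab s L R in auto)
  moreover have "(\<Sum>e\<in>X s. svol (insert b E) Lp Lq (G (s, e))) =
   (\<Sum>e\<in>?X. vol (insert b E) (%x. if x = b \<or> (x \<in> ?X & ?rk x < ?rk e) then j else p x) (q(b := q e)) Lp Lq)"
   unfolding s(1) X_def G_def svol_def split_conv
   by (intro sum.cong vol_cong refl) (use fin in \<open>auto simp: pe_def\<close>)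
  ultimately show "(\<Sum>e\<in>X s. svol (insert b E) Lp Lq (G (s, e))) = svol E (Lp(i := Lp i + Lp j)) Lq s"
   by (simp add: s(1) svol_def)
 qed simp
 finally show ?thesis .
qed

text \<open>Structures obtained when the vertex formed by \<open>a\<close> and \<open>b\<close> is resolved and a positive component is
 split; they have at most two connected components.\<close>

definition pres :: "'e set => 'e => 'e => 'l set => 'l set => 'l => 'l => ('e, 'l) rstruct set" where
 "pres E a b Ip Iq i k = {(sg, tu, p, q). cyc_label E sg p (insert k Ip) & cyc_label E (sg o tu) q Iq &
  tu permutes E & tu o tu = id & {x\<in>E. tu x = x} = {a, b} & p a = i & p b = k &
  (\<forall>S. S \<subseteq> E --> S ~= {} --> sg ` S \<subseteq> S --> tu ` S \<subseteq> S --> (a \<in> S \<longleftrightarrow> b \<in> S) --> S = E)}"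

lemma presD:
 assumes "(sg, tu, p, q) \<in> pres E a b Ip Iq i k"
 shows "cyc_label E sg p (insert k Ip)" "cyc_label E (sg o tu) q Iq" "tu permutes E" "!!x. tu (tu x) = x"
  "{x\<in>E. tu x = x} = {a, b}" "p a = i" "p b = k" "!!x. x \<in> E ==> tu x \<in> E" "tu a = a" "tu b = b"
proof -
 show "cyc_label E sg p (insert k Ip)" "cyc_label E (sg o tu) q Iq" "tu permutes E" "!!x. tu (tu x) = x"
  "p a = i" "p b = k" "!!x. x \<in> E ==> tu x \<in> E"
  using assms by (auto simp: pres_def fun_eq_iff permutes_in_image)
 show F: "{x\<in>E. tu x = x} = {a, b}" using assms by (simp add: pres_def)
 show "tu a = a" "tu b = b" using F by auto
qed

lemma pres_conn:
 assumes "(sg, tu, p, q) \<in> pres E a b Ip Iq i k" "S \<subseteq> E" "S ~= {}" "!!x. x \<in> S ==> sg x \<in> S" "!!x. x \<in> S ==> tu x \<in> S" "a \<in> S \<longleftrightarrow> b \<in> S"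
 shows "S = E"
proof -
 have "\<forall>S. S \<subseteq> E --> S ~= {} --> sg ` S \<subseteq> S --> tu ` S \<subseteq> S --> (a \<in> S \<longleftrightarrow> b \<in> S) --> S = E"
  using assms(1) by (simp add: pres_def)
 then show ?thesis using assms(2-6) by (simp add: image_subset_iff)
qed

lemma presI:
 assumes "cyc_label E sg p (insert k Ip)" "cyc_label E (sg o tu) q Iq" "tu permutes E" "!!x. x \<in> E ==> tu (tu x) = x"
  "{x\<in>E. tu x = x} = {a, b}" "p a = i" "p b = k"
  "!!S. S \<subseteq> E ==> S ~= {} ==> (!!x. x \<in> S ==> sg x \<in> S) ==> (!!x. x \<in> S ==> tu x \<in> S) ==> a \<in> S \<longleftrightarrow> b \<in> S ==> S = E"
 shows "(sg, tu, p, q) \<in> pres E a b Ip Iq i k"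
proof -
 have "tu (tu x) = x" for x using assms(3,4) by (cases "x \<in> E") (auto simp: permutes_not_in)
 then show ?thesis using assms by (simp add: pres_def fun_eq_iff image_subset_iff)
qed

text \<open>Returns to the labels before the cut; the lengths of the parts \<open>i\<close> and
  \<open>k\<close> are then added in the equation of component \<open>i\<close>.\<close>

definition relabel :: "'l => 'l => ('e => 'l) => 'e => 'l" where
 "relabel k i p = (%x. if p x = k then i else p x)"

text \<open>Cutting and rejoining are the same multiplication by a transposition, so this is a
  bijection of structures. The edges and their negative labels stay the same; hence the volume is
  that of the old system, expressed by \<open>relabel\<close>.\<close>

lemma sum_resolve:
 fixes E :: "'e set" and Ip Iq :: "'l set"
 assumes fin: "finite E" and ab: "a \<in> E" "b \<in> E" "a ~= b" and i: "i \<in> Ip" and k: "k ~: Ip"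
 shows "(\<Sum>s\<in>{(sg, tu, p, q)\<in>strs E {} Ip Iq. tu a = b & p a = i & p b = i}. svol E Lp Lq s)
  = (\<Sum>(sg, tu, p, q)\<in>pres E a b Ip Iq i k. vol E (relabel k i p) q Lp Lq)"
proof -
 let ?S = "{(sg, tu, p, q)\<in>strs E {} Ip Iq. tu a = b & p a = i & p b = i}"
 define sp where "sp sg p = (\<lambda>x\<in>E. if p x = i & rank_of {x\<in>E. p x = i} sg a x \<le> rank_of {x\<in>E. p x = i} sg a b then k else p x)" for sg :: "'e => 'e" and p
 define G where "G = (%(sg, tu, p, q). (sg o swp a b, tu o swp a b, (\<lambda>x\<in>E. if p x = k then i else p x), q) :: ('e, 'l) rstruct)"
 define H where "H = (%(sg, tu, p, q). (sg o swp a b, tu o swp a b, sp sg p, q) :: ('e, 'l) rstruct)"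
 have ik: "i ~= k" using i k by auto
 have spl: "cyc_label E (sg o swp a b) (sp sg p) (insert k Ip) & sp sg p a = i & sp sg p b = k"
  if c: "cyc_label E sg p Ip" "p a = i" "p b = i" for sg p
 proof -
  note R = rank_of(1)[OF c(1) ab(1) c(2)]
  note Sp = cyc_label_split[OF c(1) ab c(2,3) k R]
  show ?thesis using Sp ab c unfolding sp_def by auto
 qed
 have "(\<Sum>s\<in>?S. svol E Lp Lq s) = (\<Sum>s\<in>pres E a b Ip Iq i k. svol E Lp Lq (G s))"
 proof (rule sum.reindex_bij_witness[where i=G and j=H])
  fix s assume "s \<in> ?S"
  then obtain sg tu p q where s: "s = (sg, tu, p, q)" "(sg, tu, p, q) \<in> strs E {} Ip Iq" "tu a = b" "p a = i" "p b = i" by auto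
  note S = strsD[OF s(2)]
  have tub: "tu b = a" using S(4)[of a] s by simp
  note I = swp_involution[OF S(3,4) ab(1,2) disjI1[OF conjI[OF s(3) tub]]]
  note Sp = spl[OF S(1) s(4,5)]
  have "(\<lambda>x\<in>E. if sp sg p x = k then i else sp sg p x) = p"
  proof
   fix x
   have "p x ~= k" if "x \<in> E" using cyc_labelD(6)[OF S(1) that] k by auto
   then show "(\<lambda>x\<in>E. if sp sg p x = k then i else sp sg p x) x = p x"
    using cyc_labelD(2)[OF S(1)] by (auto simp: sp_def extensional_def)
  qed
  then show GH: "G (H s) = s" by (simp add: G_def H_def s(1) swp_swp)
  then show "svol E Lp Lq (G (H s)) = svol E Lp Lq s" by simp
  have tu'v: "(tu o swp a b) x = (if x = a \<or> x = b then x else tu x)" for x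
   using s(3) tub by (auto simp: Transposition.transpose_def)
  have sg'v: "(sg o swp a b) x = (if x = a then sg b else if x = b then sg a else sg x)" for x
   by (auto simp: Transposition.transpose_def)
  have "(sg o swp a b, tu o swp a b, sp sg p, q) \<in> pres E a b Ip Iq i k"
  proof (rule presI)
   show "cyc_label E (sg o swp a b o (tu o swp a b)) q Iq" using S(2) I(3)[of sg] by simp
   show "{x \<in> E. (tu o swp a b) x = x} = {a, b}" unfolding tu'v using S(5) ab by auto
   fix T assume T: "T \<subseteq> E" "T ~= {}" and i1: "!!x. x \<in> T ==> (sg o swp a b) x \<in> T" and i2: "!!x. x \<in> T ==> (tu o swp a b) x \<in> T"
    and iff: "a \<in> T \<longleftrightarrow> b \<in> T"
   show "T = E"
   proof (rule connD[OF S(6) T])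
    fix x assume x: "x \<in> T"
    consider "x = a" "a \<in> T" "b \<in> T" | "x = b" "a \<in> T" "b \<in> T" | "x ~= a" "x ~= b" using x iff by blast
    then have "sg x \<in> T & tu x \<in> T"
    proof cases
     case 1 then show ?thesis using i1[of b] sg'v[of b] s(3) ab by simp
    next
     case 2 then show ?thesis using i1[of a] sg'v[of a] tub by simp
    next
     case 3 then show ?thesis using i1[OF x] sg'v[of x] i2[OF x] tu'v[of x] by simp
    qed
    then show "sg x \<in> T" "tu x \<in> T" by auto
   qed
  qed (use Sp I in \<open>simp_all del: comp_apply\<close>)
  then show "H s \<in> pres E a b Ip Iq i k" by (simp add: H_def s(1))
 next
  fix t assume "t \<in> pres E a b Ip Iq i k"
  then obtain sg tu p q where t: "t = (sg, tu, p, q)" and tp: "(sg, tu, p, q) \<in> pres E a b Ip Iq i k" by (cases t) auto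
  note S = presD[OF tp]
  note I = swp_involution[OF S(3,4) ab(1,2) disjI2[OF conjI[OF S(9,10)]]]
  define p' where "p' = (\<lambda>x\<in>E. if p x = k then i else p x)"
  have c: "cyc_label E (sg o swp a b) p' Ip"
   using cyc_label_join[OF S(1) ab(1,2) S(6,7) ik] k by (simp add: p'_def)
  have pab: "p' a = i" "p' b = i" using ab S ik by (auto simp: p'_def)
  have Sp: "cyc_label E sg (sp (sg o swp a b) p') (insert k Ip)" "sp (sg o swp a b) p' a = i" "sp (sg o swp a b) p' b = k"
   using spl[OF c pab] by (auto simp: swp_swp)
  have "sp (sg o swp a b) p' = p"
  proof
   fix x
   show "sp (sg o swp a b) p' x = p x"
   proof (cases "x \<in> E")
    case True
    consider "p x = i" | "p x = k" | "p x ~= i" "p x ~= k" by blast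
    then show ?thesis
    proof cases
     case 1
     then have "sp (sg o swp a b) p' x = sp (sg o swp a b) p' a" using True ab S by (intro cyc_label_same[OF S(1) Sp(1)]) auto
     then show ?thesis using Sp 1 by simp
    next
     case 2
     then have "sp (sg o swp a b) p' x = sp (sg o swp a b) p' b" using True ab S by (intro cyc_label_same[OF S(1) Sp(1)]) auto
     then show ?thesis using Sp 2 by simp
    next
     case 3
     then show ?thesis using True by (simp add: sp_def p'_def)
    qed
   next
    case False
    then show ?thesis using cyc_labelD(2)[OF S(1)] by (simp add: sp_def extensional_def)
   qed
  qed
  then show "H (G t) = t" by (simp add: H_def G_def t swp_swp p'_def)
  have tu'v: "(tu o swp a b) x = (if x = a then b else if x = b then a else tu x)" for x
   using S(9,10) by (auto simp: Transposition.transpose_def)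
  have sg'v: "(sg o swp a b) x = (if x = a then sg b else if x = b then sg a else sg x)" for x
   by (auto simp: Transposition.transpose_def)
  have "(sg o swp a b, tu o swp a b, p', q) \<in> strs E {} Ip Iq"
  proof (rule strsI[OF c _ I(1) I(2)])
   show "cyc_label E (sg o swp a b o (tu o swp a b)) q Iq" using S(2) I(3)[of sg] by simp
   show "{x \<in> E. (tu o swp a b) x = x} = {}" unfolding tu'v using S(5) ab by auto
   show "conn E (sg o swp a b) (tu o swp a b)"
   proof (rule connI)
    fix T assume T: "T \<subseteq> E" "T ~= {}" and i1: "!!x. x \<in> T ==> (sg o swp a b) x \<in> T" and i2: "!!x. x \<in> T ==> (tu o swp a b) x \<in> T"
    have iff: "a \<in> T \<longleftrightarrow> b \<in> T" using i2[of a] i2[of b] tu'v[of a] tu'v[of b] ab by auto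
    show "T = E"
    proof (rule pres_conn[OF tp T _ _ iff])
     fix x assume x: "x \<in> T"
     consider "x = a" "a \<in> T" "b \<in> T" | "x = b" "a \<in> T" "b \<in> T" | "x ~= a" "x ~= b" using x iff by blast
     then have "sg x \<in> T & tu x \<in> T"
     proof cases
      case 1 then show ?thesis using i1[of b] sg'v[of b] S(9) ab by simp
     next
      case 2 then show ?thesis using i1[of a] sg'v[of a] S(10) by simp
     next
      case 3 then show ?thesis using i1[OF x] sg'v[of x] i2[OF x] tu'v[of x] by simp
     qed
     then show "sg x \<in> T" "tu x \<in> T" by auto
    qed
   qed
  qed
  then show "G t \<in> ?S" using tu'v[of a] pab by (simp add: G_def t p'_def)
 qed
 also have "... = (\<Sum>(sg, tu, p, q)\<in>pres E a b Ip Iq i k. vol E (relabel k i p) q Lp Lq)"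
  unfolding G_def svol_def
  by (intro sum.cong refl) (use fin in \<open>auto simp: relabel_def intro!: vol_cong\<close>)
 finally show ?thesis .
qed

text \<open>Moving one unit of length along a path of edges.\<close>

lemma conn_path:
 assumes fin: "finite E" and c: "conn E sg tu" "cyc_label E sg p Ip" "cyc_label E (sg o tu) q Iq" and xy: "x \<in> E" "y \<in> E"
  and tu: "!!x. x \<in> E ==> tu x \<in> E"
 shows "\<exists>w :: 'e => real. (\<forall>z. z ~: E --> w z = 0) & (\<forall>z. w z \<in> \<int>) &
  (\<forall>l. bsum E p w l = (if p x = l then 1 else 0) - (if p y = l then 1 else 0)) & (\<forall>l. bsum E q w l = 0)"
proof -
 define P where "P y w \<longleftrightarrow> (\<forall>z. z ~: E --> w z = 0) & (\<forall>z. w z \<in> \<int>) &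
  (\<forall>l. bsum E p w l = (if p x = l then 1 else 0) - (if p y = l then 1 else 0)) & (\<forall>l. bsum E q w l = 0)" for y and w :: "'e => real"
 have "{y\<in>E. \<exists>w. P y w} = E"
 proof (rule connD[OF c(1)])
  have "P x (%_. 0)" by (auto simp: P_def bsum_def)
  then show "{y\<in>E. \<exists>w. P y w} ~= {}" using xy by auto
  fix y assume y: "y \<in> {y\<in>E. \<exists>w. P y w}"
  then obtain w where w: "P y w" and yE: "y \<in> E" by blast
  have sE: "sg z \<in> E" "p (sg z) = p z" if "z \<in> E" for z using cyc_labelD(4,5)[OF c(2) that] by auto
  have "P (sg y) w" using w sE[OF yE] by (simp add: P_def)
  then show "sg y \<in> {y\<in>E. \<exists>w. P y w}" using sE[OF yE] by blast
  \<comment> \<open>The edges \<open>y\<close> and \<open>z\<close> share their negative component,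
    and \<open>z\<close> lies on the positive component of \<open>tu y\<close>. One unit taken from
    \<open>z\<close> and given to \<open>y\<close> therefore moves the end of the path from
    \<open>y\<close> to \<open>tu y\<close> without changing negative lengths.\<close>
  define z where "z = sg (tu y)"
  have z: "z \<in> E" "p z = p (tu y)" "q z = q y"
   using sE[OF tu[OF yE]] cyc_labelD(4)[OF c(3) yE] by (auto simp: z_def)
  define w1 where "w1 = w(y := w y + 1)"
  define w2 where "w2 = w1(z := w1 z + (-1))"
  have "bsum E r w2 l = bsum E r w l + (if r y = l then 1 else 0) + (if r z = l then -1 else 0)" for r :: "'e => 'a" and l
   unfolding w2_def bsum_upd_in[OF fin z(1)] unfolding w1_def bsum_upd_in[OF fin yE] ..
  moreover have "bsum E r w2 l = bsum E r w l + (if r y = l then 1 else 0) + (if r z = l then -1 else 0)" for r :: "'e => 'b" and l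
   unfolding w2_def bsum_upd_in[OF fin z(1)] unfolding w1_def bsum_upd_in[OF fin yE] ..
  moreover have "w2 u = 0" if "u ~: E" for u using that w yE z by (auto simp: w2_def w1_def P_def)
  moreover have "w2 u \<in> \<int>" for u using w by (auto simp: w2_def w1_def P_def)
  ultimately have "P (tu y) w2" using w z by (auto simp: P_def)
  then show "tu y \<in> {y\<in>E. \<exists>w. P y w}" using tu[OF yE] by blast
 qed auto
 then show ?thesis using xy unfolding P_def by blast
qed

text \<open>A path from \<open>a\<close> to \<open>b\<close> in the connected graph gives an integer
  vector that moves one unit of length from the part \<open>k\<close> to the part \<open>i\<close>.
  This makes \<open>x\<close> a primitive coordinate, so that Lebesgue measure in \<open>x\<close>
  has the right normalisation.\<close>

lemma vol_split_conn:
 assumes fin: "finite E" and s: "(sg, tu, p, q) \<in> strs E F (insert k Ip) Iq" and ab: "a \<in> E" "b \<in> E"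
  and p: "p a = i" "p b = k" "i ~= k"
 shows "(%x. vol E p q (Lp(i := x, k := Lp i - x)) Lq) \<in> borel_measurable borel"
  and "vol E (relabel k i p) q Lp Lq = (\<integral>\<^sup>+x. vol E p q (Lp(i := x, k := Lp i - x)) Lq \<partial>lborel)"
proof -
 note S = strsD[OF s]
 obtain w :: "'a => real" where w: "!!z. z ~: E ==> w z = 0" "!!z. w z \<in> \<int>"
  "!!l. bsum E p w l = (if p a = l then 1 else 0) - (if p b = l then 1 else 0)" "!!l. bsum E q w l = 0"
  using conn_path[OF fin S(6,1,2) ab S(7)] by blast
 have w3: "bsum E p w l = (if l = i then 1 else if l = k then -1 else 0)" for l
  unfolding w(3) using p by auto
 have im: "i \<in> p ` E" "k \<in> p ` E" using ab p by force+
 note V = vol_split[OF fin p(3) im _ w(1,2) w3 w(4), where p="relabel k i p" and Lp=Lp and Lq=Lq]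
 show "(%x. vol E p q (Lp(i := x, k := Lp i - x)) Lq) \<in> borel_measurable borel"
  and "vol E (relabel k i p) q Lp Lq = (\<integral>\<^sup>+x. vol E p q (Lp(i := x, k := Lp i - x)) Lq \<partial>lborel)"
  by (rule V; simp add: relabel_def)+
qed

section \<open>Structures that fall into two components\<close>

lemma cyc_label_outside:
 assumes "cyc_label E pm p I" "x ~: E"
 shows "pm x = x & p x = undefined"
 using permutes_not_in[OF cyc_labelD(1)[OF assms(1)] assms(2)] extensional_arb[OF cyc_labelD(2)[OF assms(1)] assms(2)]
 by simp

lemma cyc_label_restrict:
 assumes c: "cyc_label E pm p I" and E1: "E1 \<subseteq> E" "!!x. x \<in> E ==> pm x \<in> E1 \<longleftrightarrow> x \<in> E1"
 shows "cyc_label E1 (%x. if x \<in> E1 then pm x else x) (restrict p E1) (p ` E1)"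
 unfolding cyc_label_def
proof (intro conjI allI impI ballI)
 note C = cyc_labelD[OF c]
 show "(%x. if x \<in> E1 then pm x else x) permutes E1"
 proof (rule bij_imp_permutes)
  show "bij_betw (%x. if x \<in> E1 then pm x else x) E1 E1"
  proof (rule bij_betw_imageI)
   show "inj_on (%x. if x \<in> E1 then pm x else x) E1"
    using C(1) by (auto simp: inj_on_def dest: permutes_inj[THEN injD])
   show "(%x. if x \<in> E1 then pm x else x) ` E1 = E1"
   proof
    show "(%x. if x \<in> E1 then pm x else x) ` E1 \<subseteq> E1" using E1 by auto
    show "E1 \<subseteq> (%x. if x \<in> E1 then pm x else x) ` E1"
    proof
     fix y assume y: "y \<in> E1"
     obtain x where x: "y = pm x" using permutes_surj[OF C(1)] by (metis surjD)
     then have "x \<in> E" using y E1 C(1) by (metis permutes_in_image subsetD)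
     then have "x \<in> E1" using x y E1 by auto
     then show "y \<in> (%x. if x \<in> E1 then pm x else x) ` E1" using x by auto
    qed
   qed
  qed
 qed simp
 show "restrict p E1 (if x \<in> E1 then pm x else x) = restrict p E1 x" if "x \<in> E1" for x
  using C(4)[of x] that E1 by auto
 fix S x y assume S: "S \<subseteq> E1" "(%x. if x \<in> E1 then pm x else x) ` S \<subseteq> S" "x \<in> S" "y \<in> E1" "restrict p E1 y = restrict p E1 x"
 show "y \<in> S"
 proof (rule cyc_label_inv[OF c])
  show "pm z \<in> S" if "z \<in> S" for z using S(1,2) that by (auto simp: image_subset_iff)
 qed (use S E1 in auto)
qed auto

lemma cyc_label_union:
 assumes c1: "cyc_label E1 pm1 p1 I1" and c2: "cyc_label E2 pm2 p2 I2" and dis: "E1 Int E2 = {}" "I1 Int I2 = {}"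
 shows "cyc_label (E1 Un E2) (%x. if x \<in> E1 then pm1 x else pm2 x) (%x. if x \<in> E1 then p1 x else p2 x) (I1 Un I2)"
 unfolding cyc_label_def
proof (intro conjI allI impI ballI)
 note C = cyc_labelD[OF c1] and D = cyc_labelD[OF c2]
 let ?pm = "%x. if x \<in> E1 then pm1 x else pm2 x" and ?p = "%x. if x \<in> E1 then p1 x else p2 x"
 have v2: "?pm x = pm2 x" "?p x = p2 x" "x ~: E1" if "x \<in> E2" for x using that dis by auto
 have eq: "?pm = pm1 o pm2"
 proof
  fix x
  show "?pm x = (pm1 o pm2) x"
  proof (cases "x \<in> E1")
   case True
   then have "pm2 x = x" using D(1) dis by (metis disjoint_iff permutes_not_in)
   then show ?thesis using True by simp
  next
   case False
   then have "pm2 x ~: E1" using D(1,5) dis by (metis disjoint_iff permutes_not_in)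
   then show ?thesis using False C(1) by (simp add: permutes_not_in)
  qed
 qed
 show "?pm permutes (E1 Un E2)" unfolding eq
  using C(1) D(1) by (intro permutes_compose) (auto intro: permutes_subset)
 show "?p \<in> extensional (E1 Un E2)" using C(2) D(2) by (auto simp: extensional_def)
 have i1: "?p ` E1 = I1" unfolding C(3)[symmetric] by (rule image_cong) auto
 have i2: "?p ` E2 = I2" unfolding D(3)[symmetric] by (rule image_cong) (use v2 in auto)
 show "?p ` (E1 Un E2) = I1 Un I2" by (simp only: image_Un i1 i2)
 show "?p (?pm x) = ?p x" if "x \<in> E1 Un E2" for x
  using that C(4,5)[of x] D(4,5)[of x] v2[of x] v2[of "pm2 x"] by auto
 fix S x y assume S: "S \<subseteq> E1 Un E2" "?pm ` S \<subseteq> S" "x \<in> S" "y \<in> E1 Un E2" "?p y = ?p x"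
 have Sv: "?pm z \<in> S" if "z \<in> S" for z using S(2) that by blast
 show "y \<in> S"
 proof (cases "x \<in> E1")
  case True
  then have "p1 x \<in> I1" using C(6) by auto
  have "y \<in> E1"
  proof (rule ccontr)
   assume "y ~: E1"
   then have "p2 y \<in> I2" using S(4) D(6)[of y] by blast
   moreover have "p2 y = p1 x" using S(5) True \<open>y ~: E1\<close> by simp
   ultimately have "p2 y \<in> I2" "p2 y = p1 x" by auto
   then show False using \<open>p1 x \<in> I1\<close> dis by auto
  qed
  have "y \<in> S Int E1"
  proof (rule cyc_label_inv[OF c1, where x=x])
   show "pm1 z \<in> S Int E1" if "z \<in> S Int E1" for z using Sv[of z] that C(5)[of z] by auto
  qed (use S True \<open>y \<in> E1\<close> in auto)
  then show ?thesis by simp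
 next
  case False
  then have xE: "x \<in> E2" using S by auto
  then have "p2 x \<in> I2" using D(6) by auto
  have "y ~: E1"
  proof
   assume "y \<in> E1"
   then have "p1 y \<in> I1" using C(6)[of y] by blast
   moreover have "p1 y = p2 x" using S(5) False \<open>y \<in> E1\<close> by simp
   ultimately have "p1 y \<in> I1" "p1 y = p2 x" by auto
   then show False using \<open>p2 x \<in> I2\<close> dis by auto
  qed
  then have yE: "y \<in> E2" using S by auto
  have "y \<in> S Int E2"
  proof (rule cyc_label_inv[OF c2, where x=x])
   show "pm2 z \<in> S Int E2" if "z \<in> S Int E2" for z using Sv[of z] v2(1)[of z] that D(5)[of z] by auto
  qed (use S xE yE v2[OF xE] v2[OF yE] in auto)
  then show ?thesis by simp
 qed
qed

text \<open>On a finite set an injective map that sends \<open>E1\<close> into itself permutes it,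
  so a closed set of edges is separated from its complement in both directions.\<close>

lemma strs_restrict:
 assumes fin: "finite E" and c: "cyc_label E sg p I" "cyc_label E (sg o tu) q K" and tu: "tu permutes E" "!!x. tu (tu x) = x"
  and E1: "E1 \<subseteq> E" and inv: "sg ` E1 \<subseteq> E1" "tu ` E1 \<subseteq> E1" and conn: "conn E1 sg tu"
 shows "(%x. if x \<in> E1 then sg x else x, %x. if x \<in> E1 then tu x else x, restrict p E1, restrict q E1)
   \<in> strs E1 {x\<in>E1. tu x = x} (p ` E1) (q ` E1)"
  and "!!x y. x \<in> E1 ==> y \<in> E - E1 ==> p x ~= p y & q x ~= q y"
  and "!!x. x \<in> E - E1 ==> sg x \<in> E - E1 & tu x \<in> E - E1"
proof -
 have fin1: "finite E1" by (rule finite_subset[OF E1 fin])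
 note C = cyc_labelD[OF c(1)] and D = cyc_labelD[OF c(2)]
 have tuiff: "tu x \<in> E1 \<longleftrightarrow> x \<in> E1" for x using inv(2) tu(2) by (metis image_subset_iff)
 have sgiff: "sg x \<in> E1 \<longleftrightarrow> x \<in> E1" for x
 proof
  have "sg ` E1 = E1" using inv(1) fin1 C(1) by (intro card_subset_eq) (auto simp: card_image permutes_inj_on)
  moreover assume "sg x \<in> E1"
  ultimately obtain y where "y \<in> E1" "sg x = sg y" by auto
  then show "x \<in> E1" using C(1) by (metis permutes_inj injD)
 qed (use inv in auto)
 let ?sg = "%x. if x \<in> E1 then sg x else x" and ?tu = "%x. if x \<in> E1 then tu x else x"
 show "(?sg, ?tu, restrict p E1, restrict q E1) \<in> strs E1 {x\<in>E1. tu x = x} (p ` E1) (q ` E1)"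
 proof (rule strsI)
  show "cyc_label E1 ?sg (restrict p E1) (p ` E1)" by (rule cyc_label_restrict[OF c(1) E1 sgiff])
  have eq: "?sg o ?tu = (%x. if x \<in> E1 then (sg o tu) x else x)" by (auto simp: tuiff)
  have "cyc_label E1 (%x. if x \<in> E1 then (sg o tu) x else x) (restrict q E1) (q ` E1)"
   by (rule cyc_label_restrict[OF c(2) E1]) (simp add: sgiff tuiff)
  then show "cyc_label E1 (?sg o ?tu) (restrict q E1) (q ` E1)" unfolding eq .
  show "?tu permutes E1"
  proof (rule bij_imp_permutes)
   show "bij_betw ?tu E1 E1" by (rule bij_betw_byWitness[where f'=tu]) (use inv tu in auto)
  qed simp
  show "conn E1 ?sg ?tu"
  proof (rule connI)
   fix S assume S: "S \<subseteq> E1" "S ~= {}" and i1: "!!x. x \<in> S ==> ?sg x \<in> S" and i2: "!!x. x \<in> S ==> ?tu x \<in> S"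
   show "S = E1"
   proof (rule connD[OF conn S])
    fix x assume x: "x \<in> S"
    then have "x \<in> E1" using S by auto
    then show "sg x \<in> S" "tu x \<in> S" using i1[OF x] i2[OF x] by auto
   qed
  qed
 qed (use inv tu in auto)
 show "p x ~= p y & q x ~= q y" if "x \<in> E1" "y \<in> E - E1" for x y
  using cyc_label_inv[OF c(1) E1, of x y] cyc_label_inv[OF c(2) E1, of x y] that by (auto simp: sgiff tuiff)
 show "sg x \<in> E - E1 & tu x \<in> E - E1" if "x \<in> E - E1" for x
  using that sgiff tuiff C(5)[of x] tu(1) by (auto simp: permutes_in_image)
qed

definition reach :: "'e set => ('e => 'e) => ('e => 'e) => 'e => 'e set" where
 "reach E sg tu a = \<Inter>{S. S \<subseteq> E & a \<in> S & sg ` S \<subseteq> S & tu ` S \<subseteq> S}"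

lemma reach:
 assumes "a \<in> E" "sg ` E \<subseteq> E" "tu ` E \<subseteq> E"
 shows "reach E sg tu a \<subseteq> E" "a \<in> reach E sg tu a" "!!x. x \<in> reach E sg tu a ==> sg x \<in> reach E sg tu a"
  "!!x. x \<in> reach E sg tu a ==> tu x \<in> reach E sg tu a"
  "!!S. S \<subseteq> E ==> a \<in> S ==> (!!x. x \<in> S ==> sg x \<in> S) ==> (!!x. x \<in> S ==> tu x \<in> S) ==> reach E sg tu a \<subseteq> S"
proof -
 have "E \<in> {S. S \<subseteq> E & a \<in> S & sg ` S \<subseteq> S & tu ` S \<subseteq> S}" using assms by auto
 then show "reach E sg tu a \<subseteq> E" unfolding reach_def by (rule Inter_lower)
 show "a \<in> reach E sg tu a" unfolding reach_def by auto
 show "!!x. x \<in> reach E sg tu a ==> sg x \<in> reach E sg tu a" "!!x. x \<in> reach E sg tu a ==> tu x \<in> reach E sg tu a"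
  unfolding reach_def by blast+
 fix S assume "S \<subseteq> E" "a \<in> S" "!!x. x \<in> S ==> sg x \<in> S" "!!x. x \<in> S ==> tu x \<in> S"
 then show "reach E sg tu a \<subseteq> S" unfolding reach_def by (intro Inter_lower) auto
qed

text \<open>The component of \<open>a\<close> cannot contain \<open>b\<close>, because invariant
  sets that contain both points or neither are everything. For the same reason its complement has no
  smaller invariant part; so there are exactly two components, one for each marked point.\<close>

lemma pres_split:
 assumes fin: "finite E" and s: "(sg, tu, p, q) \<in> pres E a b Ip Iq i k" and nc: "\<not> conn E sg tu" and ab: "a \<in> E" "b \<in> E"
  and ik: "i \<in> Ip" "k ~: Ip"
 defines "E1 \<equiv> reach E sg tu a"
 shows "E1 \<subseteq> E" "a \<in> E1" "b ~: E1"
  "(%x. if x \<in> E1 then sg x else x, %x. if x \<in> E1 then tu x else x, restrict p E1, restrict q E1) \<in> strs E1 {a} (insert i (p ` E1 - {i})) (q ` E1)"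
  "(%x. if x \<in> E - E1 then sg x else x, %x. if x \<in> E - E1 then tu x else x, restrict p (E - E1), restrict q (E - E1))
   \<in> strs (E - E1) {b} (insert k (Ip - {i} - (p ` E1 - {i}))) (Iq - q ` E1)"
  "p ` E1 - {i} \<subseteq> Ip - {i}" "q ` E1 \<subseteq> Iq"
proof -
 note S = presD[OF s]
 note C = cyc_labelD[OF S(1)] and D = cyc_labelD[OF S(2)]
 have "sg ` E \<subseteq> E" "tu ` E \<subseteq> E" using C(5) S(8) by auto
 note R = reach[OF ab(1) this, folded E1_def]
 show sub: "E1 \<subseteq> E" by (rule R(1))
 show aE1: "a \<in> E1" by (rule R(2))
 have inv2: "sg x \<in> E - T & tu x \<in> E - T" if "x \<in> E - T" "T \<subseteq> E" "!!x. x \<in> T ==> sg x \<in> T" "!!x. x \<in> T ==> tu x \<in> T" for x T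
 proof -
  have fT: "finite T" using fin that(2) by (rule finite_subset[rotated])
  have "sg ` T = T" using that(3) fT C(1) by (intro card_subset_eq) (auto simp: card_image permutes_inj_on)
  then have "sg x ~: T" using that(1) C(1) by (metis DiffD2 imageE injD permutes_inj)
  moreover have "tu x ~: T" using that(4)[of "tu x"] that(1) S(4) by auto
  ultimately show ?thesis using that(1) C(5) S(8) by auto
 qed
 show b: "b ~: E1"
 proof
  assume b: "b \<in> E1"
  have "conn E sg tu"
  proof (rule connI)
   fix T assume T: "T \<subseteq> E" "T ~= {}" and i: "!!x. x \<in> T ==> sg x \<in> T" "!!x. x \<in> T ==> tu x \<in> T"
   show "T = E"
   proof (rule pres_conn[OF s T i])
    show "a \<in> T \<longleftrightarrow> b \<in> T"
    proof
     assume "a \<in> T"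
     then have "E1 \<subseteq> T" by (intro R(5)[OF T(1)] i)
     then show "b \<in> T" using b by auto
    next
     assume bT: "b \<in> T"
     show "a \<in> T"
     proof (rule ccontr)
      assume "a ~: T"
      then have "E1 \<subseteq> E - T" using inv2[of _ T] T(1) i ab by (intro R(5)) auto
      then show False using b bT by auto
     qed
    qed
   qed
  qed
  then show False using nc by simp
 qed
 have conn1: "T = E1" if T: "T \<subseteq> E1" "T ~= {}" "!!x. x \<in> T ==> sg x \<in> T" "!!x. x \<in> T ==> tu x \<in> T" for T
 proof (cases "a \<in> T")
  case True
  have "E1 \<subseteq> T" by (rule R(5)) (use T True sub in auto)
  then show ?thesis using T by auto
 next
  case False
  have "b ~: T" using b T by auto
  have "T = E" by (rule pres_conn[OF s _ T(2-4)]) (use T sub False \<open>b ~: T\<close> in auto)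
  then show ?thesis using False ab by auto
 qed
 have inv1: "sg ` E1 \<subseteq> E1" "tu ` E1 \<subseteq> E1" using R(3,4) by auto
 have c1: "conn E1 sg tu" by (rule connI, rule conn1)
 note R1 = strs_restrict[OF fin S(1,2,3,4) sub inv1 c1]
 have i2: "sg ` (E - E1) \<subseteq> E - E1" "tu ` (E - E1) \<subseteq> E - E1" using R1(3) by auto
 have conn2: "T = E - E1" if T: "T \<subseteq> E - E1" "T ~= {}" "!!x. x \<in> T ==> sg x \<in> T" "!!x. x \<in> T ==> tu x \<in> T" for T
 proof (cases "b \<in> T")
  case True
  have "T Un E1 = E"
   by (rule pres_conn[OF s]) (use T sub True aE1 R in auto)
  then show ?thesis using T by auto
 next
  case False
  have "a ~: T" using aE1 T by auto
  have "T = E" by (rule pres_conn[OF s _ T(2-4)]) (use T sub False \<open>a ~: T\<close> in auto)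
  then show ?thesis using False ab by auto
 qed
 have c2: "conn (E - E1) sg tu" by (rule connI, rule conn2)
 note R2 = strs_restrict[OF fin S(1,2,3,4) Diff_subset i2 c2]
 have F1: "{x\<in>E1. tu x = x} = {a}" and F2: "{x\<in>E - E1. tu x = x} = {b}"
  using S(5) sub aE1 b ab by auto
 have pi: "i \<in> p ` E1" using aE1 S(6) by force
 have sep: "!!x y. x \<in> E1 ==> y \<in> E - E1 ==> p x ~= p y" "!!x y. x \<in> E1 ==> y \<in> E - E1 ==> q x ~= q y" using R1(2) by auto
 have kn: "k ~: p ` E1"
 proof
  assume "k \<in> p ` E1"
  then obtain x where "x \<in> E1" "p x = k" by auto
  then show False using sep(1)[of x b] b ab S(7) by auto
 qed
 have "p ` E1 \<subseteq> insert k Ip" unfolding C(3)[symmetric] by (rule image_mono[OF sub])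
 then show "p ` E1 - {i} \<subseteq> Ip - {i}" using kn by blast
 show "q ` E1 \<subseteq> Iq" unfolding D(3)[symmetric] by (rule image_mono[OF sub])
 have p2: "p ` (E - E1) = insert k (Ip - {i} - (p ` E1 - {i}))"
 proof -
  have "p ` (E - E1) = p ` E - p ` E1" using sep(1) by blast
  then show ?thesis using C(3) kn ik pi by auto
 qed
 have q2: "q ` (E - E1) = Iq - q ` E1"
 proof -
  have "q ` (E - E1) = q ` E - q ` E1" using sep(2) by blast
  then show ?thesis using D(3) by auto
 qed
 show "(%x. if x \<in> E1 then sg x else x, %x. if x \<in> E1 then tu x else x, restrict p E1, restrict q E1) \<in> strs E1 {a} (insert i (p ` E1 - {i})) (q ` E1)"
  using R1(1) pi unfolding F1 by (simp add: insert_absorb)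
 show "(%x. if x \<in> E - E1 then sg x else x, %x. if x \<in> E - E1 then tu x else x, restrict p (E - E1), restrict q (E - E1))
   \<in> strs (E - E1) {b} (insert k (Ip - {i} - (p ` E1 - {i}))) (Iq - q ` E1)"
  using R2(1) unfolding F2 p2 q2 .
qed

text \<open>Inverse of the splitting: since the component of \<open>a\<close> is \<open>E1\<close>
  again, the decomposition can be read off from the union.\<close>

lemma pres_union:
 assumes fin: "finite E" and E1: "E1 \<subseteq> E" "a \<in> E1" "b \<in> E - E1"
  and I: "I1 \<subseteq> Ip - {i}" "J1 \<subseteq> Iq" "i \<in> Ip" "k ~: Ip"
  and s1: "(sg1, tu1, p1, q1) \<in> strs E1 {a} (insert i I1) J1" and pa: "p1 a = i"
  and s2: "(sg2, tu2, p2, q2) \<in> strs (E - E1) {b} (insert k (Ip - {i} - I1)) (Iq - J1)" and pb: "p2 b = k"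
 defines "sg \<equiv> %x. if x \<in> E1 then sg1 x else sg2 x" and "tu \<equiv> %x. if x \<in> E1 then tu1 x else tu2 x"
  and "p \<equiv> %x. if x \<in> E1 then p1 x else p2 x" and "q \<equiv> %x. if x \<in> E1 then q1 x else q2 x"
 shows "(sg, tu, p, q) \<in> pres E a b Ip Iq i k" "\<not> conn E sg tu" "reach E sg tu a = E1"
proof -
 note S1 = strsD[OF s1] and S2 = strsD[OF s2]
 note C1 = cyc_labelD[OF S1(1)] and C2 = cyc_labelD[OF S2(1)]
 have U: "E1 Un (E - E1) = E" using E1 by auto
 have ik: "i ~= k" using I by auto
 have Iu: "insert i I1 Un insert k (Ip - {i} - I1) = insert k Ip" and Id: "insert i I1 Int insert k (Ip - {i} - I1) = {}"
  and Ju: "J1 Un (Iq - J1) = Iq" using I by auto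
 have v1: "sg x = sg1 x" "tu x = tu1 x" "sg x \<in> E1" "tu x \<in> E1" if "x \<in> E1" for x
  using that C1(5) S1(7) by (auto simp: sg_def tu_def)
 have v2: "sg x = sg2 x" "tu x = tu2 x" "sg x \<in> E - E1" "tu x \<in> E - E1" if "x \<in> E - E1" for x
  using that C2(5)[OF that] S2(7)[OF that] by (auto simp: sg_def tu_def)
 have c: "cyc_label E sg p (insert k Ip)"
  using cyc_label_union[OF S1(1) S2(1) _ Id] unfolding Iu U sg_def p_def by auto
 have sgtu: "sg o tu = (%x. if x \<in> E1 then (sg1 o tu1) x else (sg2 o tu2) x)"
 proof
  fix x
  consider "x \<in> E1" | "x \<in> E - E1" | "x ~: E" using E1 by auto
  then show "(sg o tu) x = (if x \<in> E1 then (sg1 o tu1) x else (sg2 o tu2) x)"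
  proof cases
   case 1 then show ?thesis using v1[OF 1] v1[of "tu x"] by simp
  next
   case 2 then show ?thesis using v2[OF 2] v2[of "tu x"] by simp
  next
   case 3
   then have "x ~: E1" "tu2 x = x" using E1 S2(3) by (auto simp: permutes_not_in)
   then show ?thesis by (simp add: sg_def tu_def)
  qed
 qed
 have d: "cyc_label E (sg o tu) q Iq"
  using cyc_label_union[OF S1(2) S2(2)] unfolding Ju U sgtu q_def by auto
 have tuinv: "tu (tu x) = x" if "x \<in> E" for x
  using that v1[of x] v1[of "tu x"] v2[of x] v2[of "tu x"] S1(4) S2(4) by (cases "x \<in> E1") auto
 have tuE: "tu x \<in> E" if "x \<in> E" for x
  using that v1[of x] v2[of x] E1 by (cases "x \<in> E1") auto
 have tuperm: "tu permutes E"
 proof (rule bij_imp_permutes)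
  show "bij_betw tu E E" by (rule bij_betw_byWitness[where f'=tu]) (use tuE tuinv in auto)
  show "tu x = x" if "x ~: E" for x using that E1 S2(3) by (auto simp: tu_def permutes_not_in)
 qed
 have F: "{x\<in>E. tu x = x} = {a, b}"
 proof -
  have "{x\<in>E. tu x = x} = {x\<in>E1. tu x = x} Un {x\<in>E-E1. tu x = x}" using E1 by auto
  also have "{x\<in>E1. tu x = x} = {x\<in>E1. tu1 x = x}" using v1(2) by auto
  also have "{x\<in>E-E1. tu x = x} = {x\<in>E-E1. tu2 x = x}" using v2(2) by (intro Collect_cong) auto
  finally have "{x\<in>E. tu x = x} = {x\<in>E1. tu1 x = x} Un {x\<in>E-E1. tu2 x = x}" .
  then show ?thesis using S1(5) S2(5) by auto
 qed
 have w1: "S Int E1 = {} \<or> E1 \<subseteq> S" if i: "!!x. x \<in> S ==> sg x \<in> S" "!!x. x \<in> S ==> tu x \<in> S" for S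
 proof (rule disjCI)
  assume "\<not> E1 \<subseteq> S"
  show "S Int E1 = {}"
  proof (rule ccontr)
   assume "S Int E1 ~= {}"
   then have "S Int E1 = E1"
   proof (rule connD[OF S1(6), rotated])
    show "sg1 x \<in> S Int E1" "tu1 x \<in> S Int E1" if "x \<in> S Int E1" for x using i[of x] v1[of x] that by auto
   qed auto
   then show False using \<open>\<not> E1 \<subseteq> S\<close> by auto
  qed
 qed
 have w2: "S Int (E - E1) = {} \<or> E - E1 \<subseteq> S" if i: "!!x. x \<in> S ==> sg x \<in> S" "!!x. x \<in> S ==> tu x \<in> S" for S
 proof (rule disjCI)
  assume n: "\<not> E - E1 \<subseteq> S"
  show "S Int (E - E1) = {}"
  proof (rule ccontr)
   assume "S Int (E - E1) ~= {}"
   then have "S Int (E - E1) = E - E1"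
   proof (rule connD[OF S2(6), rotated])
    show "sg2 x \<in> S Int (E - E1)" "tu2 x \<in> S Int (E - E1)" if "x \<in> S Int (E - E1)" for x using i[of x] v2[of x] that by auto
   qed auto
   then show False using n by auto
  qed
 qed
 show "(sg, tu, p, q) \<in> pres E a b Ip Iq i k"
 proof (rule presI[OF c d tuperm tuinv F])
  show "p a = i" "p b = k" using pa pb E1 by (auto simp: p_def)
  fix S assume S: "S \<subseteq> E" "S ~= {}" and inv: "!!x. x \<in> S ==> sg x \<in> S" "!!x. x \<in> S ==> tu x \<in> S" and iff: "a \<in> S \<longleftrightarrow> b \<in> S"
  show "S = E" using w1[OF inv] w2[OF inv] S iff E1 by blast
 qed
 show "\<not> conn E sg tu"
 proof
  assume "conn E sg tu"
  then have "E1 = E" using E1 v1 by (intro connD[of E sg tu E1]) auto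
  then show False using E1 by auto
 qed
 have aE: "a \<in> E" using E1 by auto
 have sE: "sg ` E \<subseteq> E" "tu ` E \<subseteq> E" using cyc_labelD(5)[OF c] tuperm by (auto simp: permutes_in_image)
 note R = reach[OF aE sE]
 show "reach E sg tu a = E1"
 proof
  show "reach E sg tu a \<subseteq> E1" by (rule R(5)) (use E1 v1 in auto)
  show "E1 \<subseteq> reach E sg tu a" using w1[OF R(3,4)] R(2) E1 by blast
 qed
qed

text \<open>The label \<open>k\<close> of the second part is renamed to \<open>i\<close>, so that
  \<open>i\<close> is the only common label and \<open>vol_disjoint\<close> applies. The global
  balance of lengths is what makes the two forced lengths add up to \<open>Lp i\<close>.\<close>

lemma vol_union:
 fixes p1 q1 p2 q2 :: "'e => 'l"
 assumes fin: "finite E" and E1: "E1 \<subseteq> E" "a \<in> E1" "b \<in> E - E1"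
  and I: "I1 \<subseteq> Ip - {i}" "J1 \<subseteq> Iq" "i \<in> Ip" "k ~: Ip" and finI: "finite Ip" "finite Iq"
  and p1: "p1 ` E1 = insert i I1" "q1 ` E1 = J1" and p2: "p2 ` (E - E1) = insert k (Ip - {i} - I1)" "q2 ` (E - E1) = Iq - J1"
  and L: "(\<Sum>l\<in>Ip. Lp l) = (\<Sum>l\<in>Iq. Lq l)"
 shows "vol E (relabel k i (%x. if x \<in> E1 then p1 x else p2 x)) (%x. if x \<in> E1 then q1 x else q2 x) Lp Lq =
  vol E1 p1 q1 (Lp(i := sum Lq J1 - sum Lp I1)) Lq *
  vol (E - E1) p2 q2 (Lp(k := sum Lq (Iq - J1) - sum Lp (Ip - {i} - I1))) Lq"
proof -
 let ?I2 = "Ip - {i} - I1" and ?J2 = "Iq - J1" and ?E2 = "E - E1"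
 define P where "P = relabel k i (%x. if x \<in> E1 then p1 x else p2 x)"
 define Q where "Q = (%x. if x \<in> E1 then q1 x else q2 x)"
 have ik: "i ~= k" using I by auto
 have p1k: "p1 x ~= k" if "x \<in> E1" for x
 proof -
  have "p1 x \<in> insert i I1" unfolding p1(1)[symmetric] using that by (rule imageI)
  then show ?thesis using I ik by blast
 qed
 have p2i: "p2 x ~= i" if "x \<in> ?E2" for x
 proof -
  have "p2 x \<in> insert k ?I2" unfolding p2(1)[symmetric] using that by (rule imageI)
  then show ?thesis using ik by blast
 qed
 have P1: "P x = p1 x" "Q x = q1 x" if "x \<in> E1" for x using that p1k[OF that] by (auto simp: P_def Q_def relabel_def)
 have P2: "P x = (if p2 x = k then i else p2 x)" "Q x = q2 x" if "x \<in> ?E2" for x using that by (auto simp: P_def Q_def relabel_def)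
 have "P ` E1 = p1 ` E1" "Q ` E1 = q1 ` E1" "Q ` ?E2 = q2 ` ?E2" using P1 P2 by (auto intro!: image_cong)
 then have PE1: "P ` E1 = insert i I1" "Q ` E1 = J1" and QE2: "Q ` ?E2 = ?J2" using p1 p2 by auto
 have PE2: "P ` ?E2 = insert i ?I2"
 proof -
  have "P ` ?E2 = (%l. if l = k then i else l) ` p2 ` ?E2" unfolding image_image using P2 by (intro image_cong) auto
  then show ?thesis unfolding p2 using I by auto
 qed
 define x1 where "x1 = sum Lq J1 - sum Lp I1"
 define x2 where "x2 = sum Lq ?J2 - sum Lp ?I2"
 have "vol (E1 Un ?E2) P Q Lp Lq = vol E1 P Q (Lp(i := x1)) Lq * vol ?E2 P Q (Lp(i := x2)) Lq"
 proof (rule vol_disjoint)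
  show "finite E1" "finite ?E2" using fin E1 by (auto intro: finite_subset)
  show "i \<in> P ` E1" "i \<in> P ` ?E2" unfolding PE1 PE2 by auto
  show "Q ` E1 Int Q ` ?E2 = {}" unfolding PE1 QE2 by auto
  show "x1 = (\<Sum>l\<in>Q ` E1. Lq l) - (\<Sum>l\<in>P ` E1 - {i}. Lp l)"
   unfolding PE1 x1_def using I by (auto intro!: arg_cong2[where f=sum])
  show "x2 = (\<Sum>l\<in>Q ` ?E2. Lq l) - (\<Sum>l\<in>P ` ?E2 - {i}. Lp l)"
   unfolding PE2 QE2 x2_def by (auto intro!: arg_cong2[where f=sum])
  have "sum Lp Ip = Lp i + (sum Lp I1 + sum Lp ?I2)"
   using I finI by (simp add: sum.remove[of Ip i] sum.subset_diff[of I1 "Ip - {i}"])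
  moreover have "sum Lq Iq = sum Lq J1 + sum Lq ?J2" using I finI by (simp add: sum.subset_diff[of J1 Iq])
  ultimately show "Lp i = x1 + x2" using L by (simp add: x1_def x2_def)
  fix x y assume xy: "x \<in> E1" "y \<in> ?E2" "P x = P y"
  then have "P x \<in> insert i I1" "P x \<in> insert i ?I2" using PE1 PE2 by blast+
  then show "P x = i" by auto
 qed auto
 also have "E1 Un ?E2 = E" using E1 by auto
 also have "vol E1 P Q (Lp(i := x1)) Lq = vol E1 p1 q1 (Lp(i := x1)) Lq"
  using fin E1 P1 by (intro vol_cong) (auto intro: finite_subset)
 also have "vol ?E2 P Q (Lp(i := x2)) Lq = vol ?E2 p2 q2 (Lp(k := x2)) Lq"
 proof (rule vol_reindex[where fi=id and h="%l. if l = k then i else l" and k=id, symmetric])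
  show "inj_on (%l. if l = k then i else l) (p2 ` ?E2)" unfolding p2 using I ik by (auto simp: inj_on_def)
  show "(Lp(i := x2)) (if p2 e = k then i else p2 e) = (Lp(k := x2)) (p2 e)" if "e \<in> ?E2" for e
   using p2i[OF that] by auto
 qed (use fin P2 in auto)
 finally show ?thesis unfolding P_def Q_def x1_def x2_def .
qed

text \<open>A separated structure is a pair of structures together with a distribution of edges and
  labels between the parts of \<open>a\<close> and of \<open>b\<close>. Distributions that admit no
  pair contribute empty sums.\<close>

lemma sum_pres_disc:
 fixes E :: "'e set" and Ip Iq :: "'l set"
 assumes fin: "finite E" and ab: "a \<in> E" "b \<in> E" "a ~= b" and i: "i \<in> Ip" and k: "k ~: Ip" and finI: "finite Ip" "finite Iq"
  and L: "(\<Sum>l\<in>Ip. Lp l) = (\<Sum>l\<in>Iq. Lq l)"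
 shows "(\<Sum>(sg, tu, p, q)\<in>{(sg, tu, p, q)\<in>pres E a b Ip Iq i k. \<not> conn E sg tu}. vol E (relabel k i p) q Lp Lq) =
  (\<Sum>(E1, I1, J1)\<in>{E1. E1 \<subseteq> E & a \<in> E1 & b ~: E1} \<times> Pow (Ip - {i}) \<times> Pow Iq.
   (\<Sum>s\<in>{(sg, tu, p, q)\<in>strs E1 {a} (insert i I1) J1. p a = i}. svol E1 (Lp(i := sum Lq J1 - sum Lp I1)) Lq s) *
   (\<Sum>s\<in>{(sg, tu, p, q)\<in>strs (E - E1) {b} (insert k (Ip - {i} - I1)) (Iq - J1). p b = k}.
    svol (E - E1) (Lp(k := sum Lq (Iq - J1) - sum Lp (Ip - {i} - I1))) Lq s))"
proof -
 define T where "T = {E1. E1 \<subseteq> E & a \<in> E1 & b ~: E1} \<times> Pow (Ip - {i}) \<times> Pow Iq"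
 define A where "A = (%(E1, I1, J1). {(sg, tu, p, q)\<in>strs E1 {a} (insert i I1) J1. p a = i})"
 define B where "B = (%(E1, I1, J1). {(sg, tu, p, q)\<in>strs (E - E1) {b} (insert k (Ip - {i} - I1)) (Iq - J1). p b = k})"
 define G where "G = (%((E1, I1 :: 'l set, J1 :: 'l set), (sg1, tu1, p1, q1), (sg2, tu2, p2, q2)).
  ((%x. if x \<in> E1 then sg1 x else sg2 x), (%x. if x \<in> E1 then tu1 x else tu2 x),
   (%x. if x \<in> E1 then p1 x else p2 x), (%x. if x \<in> E1 then q1 x else q2 x)) :: ('e, 'l) rstruct)"
 define rs where "rs = (%E1 (sg, tu, p, q). ((%x. if x \<in> E1 then sg x else x), (%x. if x \<in> E1 then tu x else x), restrict p E1, restrict q E1) :: ('e, 'l) rstruct)"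
 define H where "H = (%(sg, tu, p, q). let E1 = reach E sg tu a in
  ((E1, p ` E1 - {i}, q ` E1), rs E1 (sg, tu, p, q), rs (E - E1) (sg, tu, p, q)))"
 define h where "h = (%(sg :: 'e => 'e, tu :: 'e => 'e, p, q). vol E (relabel k i p) q Lp Lq)"
 define l1 l2 where "l1 = (%(E1 :: 'e set, I1, J1). svol E1 (Lp(i := sum Lq J1 - sum Lp I1)) Lq)"
  and "l2 = (%(E1, I1, J1). svol (E - E1) (Lp(k := sum Lq (Iq - J1) - sum Lp (Ip - {i} - I1))) Lq)"
 have finT: "finite T" unfolding T_def using fin finI by auto
 have finA: "finite (A t)" "finite (B t)" if "t \<in> T" for t
 proof -
  obtain E1 I1 J1 where t: "t = (E1, I1, J1)" by (cases t) auto
  have f: "finite E1" "finite (E - E1)" using that fin unfolding t T_def by (auto intro: finite_subset)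
  show "finite (A t)" unfolding t A_def split_conv
   by (rule finite_subset[OF _ finite_strs[OF f(1), of "{a}" "insert i I1" J1]]) auto
  show "finite (B t)" unfolding t B_def split_conv
   by (rule finite_subset[OF _ finite_strs[OF f(2), of "{b}" "insert k (Ip - {i} - I1)" "Iq - J1"]]) auto
 qed
 have "(\<Sum>s\<in>{(sg, tu, p, q)\<in>pres E a b Ip Iq i k. \<not> conn E sg tu}. h s) = (\<Sum>t\<in>Sigma T (%t. A t \<times> B t). h (G t))"
 proof (rule sum.reindex_bij_witness[where i=G and j=H])
  fix s assume "s \<in> {(sg, tu, p, q)\<in>pres E a b Ip Iq i k. \<not> conn E sg tu}"
  then obtain sg tu p q where s: "s = (sg, tu, p, q)" "(sg, tu, p, q) \<in> pres E a b Ip Iq i k" "\<not> conn E sg tu" by auto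
  note D = pres_split[OF fin s(2,3) ab(1,2) i k]
  define E1 where "E1 = reach E sg tu a"
  have Hs: "H s = ((E1, p ` E1 - {i}, q ` E1), rs E1 (sg, tu, p, q), rs (E - E1) (sg, tu, p, q))"
   by (simp add: H_def s(1) E1_def Let_def)
  have ext: "x ~: E ==> sg x = x & tu x = x & p x = undefined & q x = undefined" for x
   using cyc_label_outside[OF presD(1)[OF s(2)]] cyc_label_outside[OF presD(2)[OF s(2)]] presD(3)[OF s(2)] by (simp add: permutes_not_in)
  show GH: "G (H s) = s"
   unfolding Hs unfolding s(1) G_def rs_def using ext by (auto simp: fun_eq_iff)
  then show "h (G (H s)) = h s" by simp
  show "H s \<in> Sigma T (%t. A t \<times> B t)"
   unfolding Hs using D presD(6,7)[OF s(2)] ab unfolding E1_def[symmetric]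
   by (auto simp: T_def A_def B_def rs_def)
 next
  fix t assume tT: "t \<in> Sigma T (%t. A t \<times> B t)"
  obtain E1 I1 J1 u1 u2 where t0: "t = ((E1, I1, J1), u1, u2)" by (metis prod.collapse)
  obtain sg1 tu1 p1 q1 where u1: "u1 = (sg1, tu1, p1, q1)" by (cases u1)
  obtain sg2 tu2 p2 q2 where u2: "u2 = (sg2, tu2, p2, q2)" by (cases u2)
  have t: "t = ((E1, I1, J1), (sg1, tu1, p1, q1), (sg2, tu2, p2, q2))" by (simp only: t0 u1 u2)
  have E1: "E1 \<subseteq> E" "a \<in> E1" "b ~: E1" and I: "I1 \<subseteq> Ip - {i}" "J1 \<subseteq> Iq"
   and s1: "(sg1, tu1, p1, q1) \<in> strs E1 {a} (insert i I1) J1" "p1 a = i"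
   and s2: "(sg2, tu2, p2, q2) \<in> strs (E - E1) {b} (insert k (Ip - {i} - I1)) (Iq - J1)" "p2 b = k"
   using tT unfolding t T_def A_def B_def by simp_all
  have bE: "b \<in> E - E1" using E1 ab by auto
  note U = pres_union[OF fin E1(1,2) bE I i k s1 s2]
  show "G t \<in> {(sg, tu, p, q)\<in>pres E a b Ip Iq i k. \<not> conn E sg tu}" using U(1,2) unfolding t G_def by simp
  have ext1: "x ~: E1 ==> sg1 x = x & tu1 x = x & p1 x = undefined & q1 x = undefined" for x
   using cyc_label_outside[OF strsD(1)[OF s1(1)]] cyc_label_outside[OF strsD(2)[OF s1(1)]] strsD(3)[OF s1(1)] by (simp add: permutes_not_in)
  have ext2: "x ~: E - E1 ==> sg2 x = x & tu2 x = x & p2 x = undefined & q2 x = undefined" for x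
   using cyc_label_outside[OF strsD(1)[OF s2(1)]] cyc_label_outside[OF strsD(2)[OF s2(1)]] strsD(3)[OF s2(1)] by (simp add: permutes_not_in)
  have r1: "rs E1 (G t) = (sg1, tu1, p1, q1)" unfolding t G_def rs_def using ext1 by (auto simp: fun_eq_iff)
  have r2: "rs (E - E1) (G t) = (sg2, tu2, p2, q2)" unfolding t G_def rs_def using ext2 by (auto simp: fun_eq_iff)
  have im: "(%x. if x \<in> E1 then p1 x else p2 x) ` E1 = insert i I1" "(%x. if x \<in> E1 then q1 x else q2 x) ` E1 = J1"
   using cyc_labelD(3)[OF strsD(1)[OF s1(1)]] cyc_labelD(3)[OF strsD(2)[OF s1(1)]] by auto
  have "insert i I1 - {i} = I1" using I by auto
  then show "H (G t) = t"
   using r1 r2 U(3) im unfolding t G_def H_def by (simp add: Let_def)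
 qed
 also have "... = (\<Sum>t\<in>T. \<Sum>s\<in>A t \<times> B t. h (G (t, s)))"
  using finT finA by (subst sum.Sigma) auto
 also have "... = (\<Sum>t\<in>T. (\<Sum>s\<in>A t. l1 t s) * (\<Sum>s\<in>B t. l2 t s))"
 proof (rule sum.cong)
  fix t assume tT: "t \<in> T"
  then obtain E1 I1 J1 where t: "t = (E1, I1, J1)" "E1 \<subseteq> E" "a \<in> E1" "b ~: E1" "I1 \<subseteq> Ip - {i}" "J1 \<subseteq> Iq"
   unfolding T_def by auto
  have bE: "b \<in> E - E1" using t ab by auto
  have "h (G (t, s)) = l1 t (fst s) * l2 t (snd s)" if s: "s \<in> A t \<times> B t" for s
  proof -
   obtain u1 u2 where s0: "s = (u1, u2)" by (cases s)
   obtain sg1 tu1 p1 q1 where u1: "u1 = (sg1, tu1, p1, q1)" by (cases u1)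
   obtain sg2 tu2 p2 q2 where u2: "u2 = (sg2, tu2, p2, q2)" by (cases u2)
   have st: "s = ((sg1, tu1, p1, q1), (sg2, tu2, p2, q2))" by (simp only: s0 u1 u2)
   have s1: "(sg1, tu1, p1, q1) \<in> strs E1 {a} (insert i I1) J1" "p1 a = i"
    and s2: "(sg2, tu2, p2, q2) \<in> strs (E - E1) {b} (insert k (Ip - {i} - I1)) (Iq - J1)" "p2 b = k"
    using s unfolding t st A_def B_def by simp_all
   show ?thesis
    unfolding st t(1) G_def h_def l1_def l2_def svol_def split_conv fst_conv snd_conv
    by (rule vol_union[OF fin t(2,3) bE t(5,6) i k finI _ _ _ _ L])
     (rule cyc_labelD(3)[OF strsD(1)[OF s1(1)]] cyc_labelD(3)[OF strsD(2)[OF s1(1)]]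
      cyc_labelD(3)[OF strsD(1)[OF s2(1)]] cyc_labelD(3)[OF strsD(2)[OF s2(1)]])+
  qed
  then have "(\<Sum>s\<in>A t \<times> B t. h (G (t, s))) = (\<Sum>s\<in>A t \<times> B t. l1 t (fst s) * l2 t (snd s))"
   by (rule sum.cong[OF refl])
  also have "... = (\<Sum>s\<in>A t. l1 t s) * (\<Sum>s\<in>B t. l2 t s)"
   by (simp add: sum_product sum.cartesian_product split_def)
  finally show "(\<Sum>s\<in>A t \<times> B t. h (G (t, s))) = (\<Sum>s\<in>A t. l1 t s) * (\<Sum>s\<in>B t. l2 t s)" .
 qed simp
 finally show ?thesis unfolding h_def T_def A_def B_def l1_def l2_def by (simp add: split_def)
qed

subsection \<open>Transport of structures\<close>

definition conjp :: "'e set => ('e => 'f) => 'f set => ('e => 'e) => 'f => 'f" where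
 "conjp E fi E' pm = (%x. if x \<in> E' then fi (pm (inv_into E fi x)) else x)"

lemma conjp_permutes:
 assumes b: "bij_betw fi E E'" and p: "pm permutes E"
 shows "conjp E fi E' pm permutes E'"
proof (rule bij_imp_permutes)
 have "bij_betw (inv_into E fi) E' E" by (rule bij_betw_inv_into[OF b])
 moreover have "bij_betw pm E E" using p by (rule permutes_imp_bij)
 ultimately have "bij_betw (fi o (pm o inv_into E fi)) E' E'" using b by (metis bij_betw_trans)
 then show "bij_betw (conjp E fi E' pm) E' E'" by (subst bij_betw_cong[where g="fi o (pm o inv_into E fi)"]) (auto simp: conjp_def)
qed (simp add: conjp_def)

lemma conjp_apply: "bij_betw fi E E' ==> e \<in> E ==> conjp E fi E' pm (fi e) = fi (pm e)"
 unfolding conjp_def by (auto simp: bij_betw_def inv_into_f_f)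

lemma bij_betw_ball: "bij_betw fi E E' ==> (\<forall>x\<in>E'. P x) \<longleftrightarrow> (\<forall>e\<in>E. P (fi e))"
 unfolding bij_betw_def by auto

lemma cyc_label_transport:
 assumes b: "bij_betw fi E E'" and c: "cyc_label E pm p I" and h: "inj_on h I"
 shows "cyc_label E' (conjp E fi E' pm) (\<lambda>x\<in>E'. h (p (inv_into E fi x))) (h ` I)"
proof -
 note C = cyc_labelD[OF c]
 let ?p = "\<lambda>x\<in>E'. h (p (inv_into E fi x))"
 have fiE: "fi e \<in> E'" "?p (fi e) = h (p e)" if "e \<in> E" for e
  using b that by (auto simp: bij_betw_def inv_into_f_f)
 show ?thesis
  unfolding cyc_label_def
 proof (intro conjI allI impI)
  show "conjp E fi E' pm permutes E'" by (rule conjp_permutes[OF b C(1)])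
  have "?p ` E' = ?p ` fi ` E" using b by (simp add: bij_betw_def)
  also have "... = h ` p ` E" unfolding image_image using fiE(2) by (rule image_cong[OF refl])
  finally show "?p ` E' = h ` I" by (simp add: C(3))
  show "\<forall>x\<in>E'. ?p (conjp E fi E' pm x) = ?p x"
   unfolding bij_betw_ball[OF b]
  proof
   fix e assume e: "e \<in> E"
   show "?p (conjp E fi E' pm (fi e)) = ?p (fi e)"
    unfolding conjp_apply[OF b e] fiE(2)[OF e] fiE(2)[OF C(5)[OF e]] C(4)[OF e] ..
  qed
  fix S x y assume S: "S \<subseteq> E'" "conjp E fi E' pm ` S \<subseteq> S" "x \<in> S" "y \<in> E'" "?p y = ?p x"
  have im: "E' = fi ` E" using b by (simp add: bij_betw_def)
  obtain u v where u: "x = fi u" "u \<in> E" and v: "y = fi v" "v \<in> E" using S im by auto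
  have "v \<in> {e\<in>E. fi e \<in> S}"
  proof (rule cyc_label_inv[OF c, where x=u])
   fix z assume z: "z \<in> {e\<in>E. fi e \<in> S}"
   then have "conjp E fi E' pm (fi z) \<in> S" using S(2) by auto
   then show "pm z \<in> {e\<in>E. fi e \<in> S}" using z conjp_apply[OF b, of z pm] C(5)[of z] by auto
  next
   have "h (p v) = h (p u)" using S(5) u v fiE(2) by metis
   then show "p v = p u" using h C(6) u v by (auto dest: inj_onD)
  qed (use S u v in auto)
  then show "y \<in> S" using v by simp
 qed auto
qed

definition transp :: "'e set => ('e => 'f) => 'f set => ('l => 'k) => ('l => 'k) => ('e, 'l) rstruct => ('f, 'k) rstruct" where
 "transp E fi E' h k = (%(sg, tu, p, q). (conjp E fi E' sg, conjp E fi E' tu,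
  (\<lambda>x\<in>E'. h (p (inv_into E fi x))), (\<lambda>x\<in>E'. k (q (inv_into E fi x)))))"

lemma strs_transport:
 assumes b: "bij_betw fi E E'" and s: "s \<in> strs E {} Ip Iq" and h: "inj_on h Ip" "inj_on k Iq"
 shows "transp E fi E' h k s \<in> strs E' {} (h ` Ip) (k ` Iq)"
proof -
 obtain sg tu p q where s': "s = (sg, tu, p, q)" "(sg, tu, p, q) \<in> strs E {} Ip Iq" using s by (cases s) auto
 note S = strsD[OF s'(2)]
 have sgtu: "conjp E fi E' sg o conjp E fi E' tu = conjp E fi E' (sg o tu)"
 proof
  fix x
  show "(conjp E fi E' sg o conjp E fi E' tu) x = conjp E fi E' (sg o tu) x"
  proof (cases "x \<in> E'")
   case True
   then obtain e where "e \<in> E" "x = fi e" using b by (auto simp: bij_betw_def)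
   then show ?thesis using S(7) by (simp add: conjp_apply[OF b])
  qed (simp add: conjp_def)
 qed
 have inj: "fi x = fi y \<longleftrightarrow> x = y" if "x \<in> E" "y \<in> E" for x y using b that by (auto simp: bij_betw_def inj_on_def)
 have im: "E' = fi ` E" using b by (simp add: bij_betw_def)
 show ?thesis
  unfolding s'(1) transp_def split_conv
 proof (rule strsI)
  show "cyc_label E' (conjp E fi E' sg) (\<lambda>x\<in>E'. h (p (inv_into E fi x))) (h ` Ip)"
   by (rule cyc_label_transport[OF b S(1) h(1)])
  show "cyc_label E' (conjp E fi E' sg o conjp E fi E' tu) (\<lambda>x\<in>E'. k (q (inv_into E fi x))) (k ` Iq)"
   unfolding sgtu by (rule cyc_label_transport[OF b S(2) h(2)])
  show "conjp E fi E' tu permutes E'" by (rule conjp_permutes[OF b S(3)])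
  show "conjp E fi E' tu (conjp E fi E' tu x) = x" if "x \<in> E'" for x
   using that S(4,7) unfolding im by (auto simp: conjp_apply[OF b, unfolded im])
  show "{x \<in> E'. conjp E fi E' tu x = x} = {}"
  proof -
   have "conjp E fi E' tu (fi e) ~= fi e" if "e \<in> E" for e
    unfolding conjp_apply[OF b that] using S(5,7) that inj by auto
   then show ?thesis using bij_betw_ball[OF b, of "%x. conjp E fi E' tu x ~= x"] by auto
  qed
  show "conn E' (conjp E fi E' sg) (conjp E fi E' tu)"
  proof (rule connI)
   fix T assume T: "T \<subseteq> E'" "T ~= {}" and i: "!!x. x \<in> T ==> conjp E fi E' sg x \<in> T" "!!x. x \<in> T ==> conjp E fi E' tu x \<in> T"
   have "{e\<in>E. fi e \<in> T} = E"
   proof (rule connD[OF S(6)])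
    show "{e\<in>E. fi e \<in> T} ~= {}" using T im by auto
    fix x assume x: "x \<in> {e\<in>E. fi e \<in> T}"
    then show "sg x \<in> {e\<in>E. fi e \<in> T}" "tu x \<in> {e\<in>E. fi e \<in> T}"
     using i[of "fi x"] conjp_apply[OF b, of x] cyc_labelD(5)[OF S(1), of x] S(7)[of x] by auto
   qed auto
   then show "T = E'" using T im by auto
  qed
 qed
qed

lemma transp_inverse:
 fixes fi :: "'e => 'f" and h k :: "'l => 'k"
 assumes b: "bij_betw fi E E'" and s: "s \<in> strs E {} Ip Iq" and h: "inj_on h Ip" "inj_on k Iq"
 shows "transp E' (inv_into E fi) E (inv_into Ip h) (inv_into Iq k) (transp E fi E' h k s) = s"
proof -
 obtain sg tu p q where s': "s = (sg, tu, p, q)" "(sg, tu, p, q) \<in> strs E {} Ip Iq" using s by (cases s) auto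
 note S = strsD[OF s'(2)]
 define ki where "ki = inv_into E fi"
 have b': "bij_betw ki E' E" unfolding ki_def by (rule bij_betw_inv_into[OF b])
 have kifi: "ki (fi e) = e" "fi e \<in> E'" if "e \<in> E" for e using b that by (auto simp: ki_def bij_betw_def inv_into_f_f)
 have inv: "inv_into E' ki e = fi e" if "e \<in> E" for e
  using kifi[OF that] b' by (metis bij_betw_def inv_into_f_f)
 have c: "conjp E' ki E (conjp E fi E' pm) = pm" if "pm permutes E" for pm
 proof
  fix x show "conjp E' ki E (conjp E fi E' pm) x = pm x"
  proof (cases "x \<in> E")
   case True
   then have "pm x \<in> E" using that by (simp add: permutes_in_image)
   then show ?thesis using True kifi by (simp add: conjp_def inv ki_def[symmetric])
  next
   case False
   then show ?thesis using that by (simp add: conjp_def permutes_not_in)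
  qed
 qed
 have l: "(\<lambda>x\<in>E. inv_into I g ((\<lambda>x\<in>E'. g (r (ki x))) (inv_into E' ki x))) = r"
  if "cyc_label E pm r I" "inj_on g I" for pm r I and g :: "'l => 'k"
 proof
  fix x show "(\<lambda>x\<in>E. inv_into I g ((\<lambda>x\<in>E'. g (r (ki x))) (inv_into E' ki x))) x = r x"
  proof (cases "x \<in> E")
   case True
   then show ?thesis using kifi[OF True] cyc_labelD(6)[OF that(1) True] that(2) by (simp add: inv inv_into_f_f)
  next
   case False
   then show ?thesis using cyc_label_outside[OF that(1) False] by simp
  qed
 qed
 show ?thesis
  unfolding s'(1) transp_def split_conv ki_def[symmetric]
  using c[OF cyc_labelD(1)[OF S(1)]] c[OF S(3)] l[OF S(1) h(1)] l[OF S(2) h(2)] by simp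
qed

lemma svol_transp:
 assumes fin: "finite E" and b: "bij_betw fi E E'" and s: "s \<in> strs E {} Ip Iq" and h: "inj_on h Ip" "inj_on k Iq"
  and L: "!!i. i \<in> Ip ==> Lp' (h i) = Lp i" "!!i. i \<in> Iq ==> Lq' (k i) = Lq i"
 shows "svol E' Lp' Lq' (transp E fi E' h k s) = svol E Lp Lq s"
proof -
 obtain sg tu p q where s': "s = (sg, tu, p, q)" "(sg, tu, p, q) \<in> strs E {} Ip Iq" using s by (cases s) auto
 note S = strsD[OF s'(2)]
 have fiE: "fi e \<in> E'" "inv_into E fi (fi e) = e" if "e \<in> E" for e
  using b that by (auto simp: bij_betw_def inv_into_f_f)
 have "vol E p q Lp Lq = vol E' (\<lambda>x\<in>E'. h (p (inv_into E fi x))) (\<lambda>x\<in>E'. k (q (inv_into E fi x))) Lp' Lq'"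
  using h L fiE cyc_labelD(3,6)[OF S(1)] cyc_labelD(3,6)[OF S(2)]
  by (intro vol_reindex[OF fin b, where h=h and k=k]) auto
 then show ?thesis by (simp add: s'(1) transp_def svol_def)
qed

lemma transp_bij:
 assumes b: "bij_betw fi E E'" and h: "inj_on h Ip" "inj_on k Iq"
 shows "bij_betw (transp E fi E' h k) (strs E {} Ip Iq) (strs E' {} (h ` Ip) (k ` Iq))"
proof (rule bij_betw_byWitness[where f'="transp E' (inv_into E fi) E (inv_into Ip h) (inv_into Iq k)"])
 have b': "bij_betw (inv_into E fi) E' E" by (rule bij_betw_inv_into[OF b])
 have hk: "inj_on (inv_into Ip h) (h ` Ip)" "inj_on (inv_into Iq k) (k ` Iq)"
  by (auto intro: inj_on_inv_into)
 have im: "inv_into Ip h ` h ` Ip = Ip" "inv_into Iq k ` k ` Iq = Iq" using h by auto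
 show "\<forall>s\<in>strs E {} Ip Iq. transp E' (inv_into E fi) E (inv_into Ip h) (inv_into Iq k) (transp E fi E' h k s) = s"
  using transp_inverse[OF b _ h] by blast
 show "transp E fi E' h k ` strs E {} Ip Iq \<subseteq> strs E' {} (h ` Ip) (k ` Iq)" using strs_transport[OF b _ h] by blast
 have 1: "transp E' (inv_into E fi) E (inv_into Ip h) (inv_into Iq k) s \<in> strs E {} Ip Iq" if "s \<in> strs E' {} (h ` Ip) (k ` Iq)" for s
  using strs_transport[OF b' that hk] unfolding im .
 then show "transp E' (inv_into E fi) E (inv_into Ip h) (inv_into Iq k) ` strs E' {} (h ` Ip) (k ` Iq) \<subseteq> strs E {} Ip Iq" by blast
 show "\<forall>s\<in>strs E' {} (h ` Ip) (k ` Iq). transp E fi E' h k (transp E' (inv_into E fi) E (inv_into Ip h) (inv_into Iq k) s) = s"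
 proof
  fix s assume s: "s \<in> strs E' {} (h ` Ip) (k ` Iq)"
  have 2: "transp E (inv_into E' (inv_into E fi)) E' (inv_into (h ` Ip) (inv_into Ip h)) (inv_into (k ` Iq) (inv_into Iq k))
   (transp E' (inv_into E fi) E (inv_into Ip h) (inv_into Iq k) s) = s"
   by (rule transp_inverse[OF b' s hk])
  \<comment> \<open>\<open>transp\<close> sees its maps only on edges and labels, where an inverse
    of an inverse is the original map.\<close>
  have 3: "transp E fi' E' h' k' t = transp E fi E' h k t"
   if eqs: "!!e. e \<in> E ==> fi' e = fi e" "!!i. i \<in> Ip ==> h' i = h i" "!!i. i \<in> Iq ==> k' i = k i" "t \<in> strs E {} Ip Iq" for fi' h' k' t
  proof -
   obtain sg tu p q where t: "t = (sg, tu, p, q)" "(sg, tu, p, q) \<in> strs E {} Ip Iq" using eqs(4) by (cases t) auto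
   note S = strsD[OF t(2)]
   have i: "inv_into E fi' x = inv_into E fi x" for x unfolding inv_into_def using eqs(1) by (intro arg_cong[where f=Eps]) auto
   have iE: "inv_into E fi x \<in> E" if "x \<in> E'" for x using b that by (auto simp: bij_betw_def inv_into_into)
   have "conjp E fi' E' pm = conjp E fi E' pm" if "!!e. e \<in> E ==> pm e \<in> E" for pm
    using that iE eqs(1) by (auto simp: conjp_def i)
   then show ?thesis
    using eqs(2,3) iE cyc_labelD(5,6)[OF S(1)] cyc_labelD(6)[OF S(2)] S(7)
    by (auto simp: t(1) transp_def i intro!: restrict_ext)
  qed
  have "inv_into E' (inv_into E fi) e = fi e" if "e \<in> E" for e
   using b b' that by (metis bij_betw_def bij_betw_inv_into_left inv_into_f_f imageI)
  moreover have "inv_into (h ` Ip) (inv_into Ip h) i = h i" if "i \<in> Ip" for i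
   using h(1) hk(1) that by (metis inv_into_f_f imageI)
  moreover have "inv_into (k ` Iq) (inv_into Iq k) i = k i" if "i \<in> Iq" for i
   using h(2) hk(2) that by (metis inv_into_f_f imageI)
  ultimately have "transp E (inv_into E' (inv_into E fi)) E' (inv_into (h ` Ip) (inv_into Ip h)) (inv_into (k ` Iq) (inv_into Iq k))
   (transp E' (inv_into E fi) E (inv_into Ip h) (inv_into Iq k) s) =
   transp E fi E' h k (transp E' (inv_into E fi) E (inv_into Ip h) (inv_into Iq k) s)"
   by (intro 3 1 s)
  then show "transp E fi E' h k (transp E' (inv_into E fi) E (inv_into Ip h) (inv_into Iq k) s) = s"
   unfolding 2 by (rule sym)
 qed
qed

lemma W_reindex:
 assumes fin: "finite E" and b: "bij_betw fi E E'" and h: "inj_on h Ip" "inj_on k Iq"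
  and L: "!!i. i \<in> Ip ==> Lp' (h i) = Lp i" "!!i. i \<in> Iq ==> Lq' (k i) = Lq i"
 shows "W E {} Ip Iq Lp Lq = W E' {} (h ` Ip) (k ` Iq) Lp' Lq'"
proof -
 have "W E {} Ip Iq Lp Lq = (\<Sum>s\<in>strs E {} Ip Iq. svol E' Lp' Lq' (transp E fi E' h k s))"
  unfolding W_def by (rule sum.cong[OF refl], rule svol_transp[OF fin b _ h, symmetric]) (use L in auto)
 also have "... = W E' {} (h ` Ip) (k ` Iq) Lp' Lq'"
  unfolding W_def by (rule sum.reindex_bij_betw[OF transp_bij[OF b h]])
 finally show ?thesis .
qed

lemma W_nonzeroD:
 assumes "finite E" "E ~= {}" and nz: "W E F Ip Iq Lp Lq ~= 0"
 shows "strs E F Ip Iq ~= {}" "!!i. i \<in> Ip ==> 0 < Lp i" "!!i. i \<in> Iq ==> 0 < Lq i" "sum Lp Ip = sum Lq Iq" "Ip ~= {}" "Iq ~= {}"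
proof -
 obtain s where s: "s \<in> strs E F Ip Iq" "svol E Lp Lq s ~= 0" using nz unfolding W_def by (meson sum.neutral)
 obtain sg tu p q where s': "s = (sg, tu, p, q)" by (cases s)
 have S: "(sg, tu, p, q) \<in> strs E F Ip Iq" "vol E p q Lp Lq ~= 0" using s by (auto simp: s' svol_def)
 have im: "p ` E = Ip" "q ` E = Iq" using cyc_labelD(3)[OF strsD(1)[OF S(1)]] cyc_labelD(3)[OF strsD(2)[OF S(1)]] by auto
 note V = vol_nonzero_pos[OF assms(1) S(2)]
 show "strs E F Ip Iq ~= {}" using s by auto
 show "Ip ~= {}" "Iq ~= {}" using im assms(2) by auto
 show "sum Lp Ip = sum Lq Iq" using V(3) im by simp
 show "0 < Lp i" if "i \<in> Ip" for i using V(1) that im by auto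
 show "0 < Lq i" if "i \<in> Iq" for i using V(2) that im by auto
qed

subsection \<open>The recursion for the weighted count\<close>

text \<open>The two marked points are forgotten one after the other; each contributes the length of
  its component.\<close>

lemma sum_strs_two:
 assumes fin: "finite E" and E: "E ~= {}" and ab: "a ~: E" "b ~: E" "a ~= b" and ik: "i \<in> I" "k \<in> I"
 shows "(\<Sum>s\<in>{(sg, tu, p, q)\<in>strs (insert b (insert a E)) {a, b} I J. p a = i & p b = k}. svol (insert b (insert a E)) Lp Lq s)
  = ennreal (Lp i) * ennreal (Lp k) * W E {} I J Lp Lq"
proof -
 have "{(sg, tu, p, q)\<in>strs (insert b (insert a E)) {a, b} I J. p a = i & p b = k} =
  {(sg, tu, p, q)\<in>strs (insert b (insert a E)) (insert b {a}) I J. p b = k & restrict p (insert a E) a = i}"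
  by (simp add: insert_commute) blast
 then have "(\<Sum>s\<in>{(sg, tu, p, q)\<in>strs (insert b (insert a E)) {a, b} I J. p a = i & p b = k}. svol (insert b (insert a E)) Lp Lq s) =
  (\<Sum>s\<in>{(sg, tu, p, q)\<in>strs (insert b (insert a E)) (insert b {a}) I J. p b = k & restrict p (insert a E) a = i}. svol (insert b (insert a E)) Lp Lq s)"
  by (rule arg_cong)
 also have "... = ennreal (Lp k) * (\<Sum>s\<in>{(sg, tu, p, q)\<in>strs (insert a E) {a} I J. p a = i}. svol (insert a E) Lp Lq s)"
  by (rule sum_strs_insert) (use assms in auto)
 also have "(\<Sum>s\<in>{(sg, tu, p, q)\<in>strs (insert a E) {a} I J. p a = i}. svol (insert a E) Lp Lq s) = ennreal (Lp i) * W E {} I J Lp Lq"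
  using sum_strs_insert[OF fin E ab(1) _ ik(1), where F="{}" and Iq=J and Q="%_. True" and Lp=Lp and Lq=Lq] by (simp add: W_def split_def)
 finally show ?thesis by (simp add: mult_ac)
qed

text \<open>The total contribution of the part with marked point \<open>a\<close> and further edges
  \<open>E\<close> when a graph separates. Its component \<open>i\<close> has the length forced by
  the balance of lengths.\<close>

definition stem :: "'e => 'e set => 'l => 'l set => 'l set => ('l => real) => ('l => real) => ennreal" where
 "stem a E i I J Lp Lq = (\<Sum>s\<in>{(sg, tu, p, q)\<in>strs (insert a E) {a} (insert i I) J. p a = i}. svol (insert a E) (Lp(i := sum Lq J - sum Lp I)) Lq s)"

lemma stem_nonempty:
 assumes "finite E" "E ~= {}" "a ~: E"
 shows "stem a E i I J Lp Lq = ennreal (sum Lq J - sum Lp I) * W E {} (insert i I) J (Lp(i := sum Lq J - sum Lp I)) Lq"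
 using sum_strs_insert[OF assms, where F="{}" and i=i and Ip="insert i I" and Iq=J and Q="%_. True" and Lp="Lp(i := sum Lq J - sum Lp I)" and Lq=Lq]
 by (simp add: W_def stem_def split_def)

text \<open>The trivial stem is a circle without vertices, joining a positive to a negative component.\<close>

lemma stem_empty:
 assumes i: "i ~: I" and pos: "!!j. j \<in> J ==> 0 < Lq j"
 shows "stem a {} i I J Lp Lq = (if I = {} & (\<exists>j. J = {j}) then 1 else 0)"
proof (cases "I = {} & (\<exists>j. J = {j})")
 case True
 then obtain j where j: "J = {j}" and I: "I = {}" by auto
 define p q where "p = (\<lambda>x\<in>{a}. i)" and "q = (\<lambda>x\<in>{a}. j)"
 have id1: "pm = id" if "pm permutes {a}" for pm using that by (simp add: permutes_sing)
 have c: "cyc_label {a} id (\<lambda>x\<in>{a}. l) {l}" for l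
  unfolding cyc_label_def by (auto simp: permutes_id)
 have "{(sg, tu, p, q)\<in>strs {a} {a} {i} {j}. p a = i} = {(id, id, p, q)}"
 proof
  show "{(sg, tu, p, q)\<in>strs {a} {a} {i} {j}. p a = i} \<subseteq> {(id, id, p, q)}"
  proof
   fix s assume s: "s \<in> {(sg, tu, p, q)\<in>strs {a} {a} {i} {j}. p a = i}"
   obtain sg tu p' q' where s': "s = (sg, tu, p', q')" by (cases s)
   have S: "(sg, tu, p', q') \<in> strs {a} {a} {i} {j}" using s s' by simp
   have "sg = id" "tu = id" using id1 cyc_labelD(1)[OF strsD(1)[OF S]] strsD(3)[OF S] by auto
   moreover have "p' = p"
    using cyc_labelD(6)[OF strsD(1)[OF S], of a] cyc_label_outside[OF strsD(1)[OF S]] by (auto simp: p_def fun_eq_iff)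
   moreover have "q' = q"
    using cyc_labelD(6)[OF strsD(2)[OF S], of a] cyc_label_outside[OF strsD(2)[OF S]] by (auto simp: q_def fun_eq_iff)
   ultimately show "s \<in> {(id, id, p, q)}" by (simp add: s')
  qed
  have "(id, id, p, q) \<in> strs {a} {a} {i} {j}"
   by (rule strsI) (use c in \<open>auto simp: p_def q_def conn_def permutes_id\<close>)
  then show "{(id, id, p, q)} \<subseteq> {(sg, tu, p, q)\<in>strs {a} {a} {i} {j}. p a = i}" by (auto simp: p_def)
 qed
 then have "stem a {} i I J Lp Lq = vol {a} p q (Lp(i := Lq j)) Lq"
  unfolding stem_def by (simp add: I j svol_def)
 also have "... = 1" by (rule vol_singleton) (use pos j in \<open>auto simp: p_def q_def\<close>)
 finally show ?thesis using True by simp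
next
 case False
 have "{(sg, tu, p, q)\<in>strs {a} {a} (insert i I) J. p a = i} = {}"
 proof (rule ccontr)
  assume "\<not> ?thesis"
  then obtain sg tu p q where S: "(sg, tu, p, q) \<in> strs {a} {a} (insert i I) J" "p a = i" by auto
  have "p ` {a} = insert i I" "q ` {a} = J" using cyc_labelD(3)[OF strsD(1)[OF S(1)]] cyc_labelD(3)[OF strsD(2)[OF S(1)]] by auto
  then have "I = {}" "J = {q a}" using S(2) i by auto
  then show False using False by auto
 qed
 then have "stem a {} i I J Lp Lq = 0" unfolding stem_def by (simp only: sum.empty)
 then show ?thesis by (simp only: False if_False)
qed

lemma finite_pres: "finite E ==> finite Ip ==> finite Iq ==> finite (pres E a b Ip Iq i k)"
proof -
 assume fin: "finite E" "finite Ip" "finite Iq"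
 have "pres E a b Ip Iq i k \<subseteq> {pm. pm permutes E} \<times> {pm. pm permutes E} \<times> (E \<rightarrow>\<^sub>E insert k Ip) \<times> (E \<rightarrow>\<^sub>E Iq)"
 proof
  fix s assume "s \<in> pres E a b Ip Iq i k"
  then obtain sg tu p q where s: "s = (sg, tu, p, q)" "(sg, tu, p, q) \<in> pres E a b Ip Iq i k" by (cases s) auto
  note C = cyc_labelD[OF presD(1)[OF s(2)]] and D = cyc_labelD[OF presD(2)[OF s(2)]]
  have "p \<in> E \<rightarrow>\<^sub>E insert k Ip" "q \<in> E \<rightarrow>\<^sub>E Iq" using C(2) C(6) D(2,6) unfolding PiE_iff by blast+
  then show "s \<in> {pm. pm permutes E} \<times> {pm. pm permutes E} \<times> (E \<rightarrow>\<^sub>E insert k Ip) \<times> (E \<rightarrow>\<^sub>E Iq)"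
   using C(1) presD(3)[OF s(2)] by (simp add: s(1))
 qed
 moreover have "finite ({pm. pm permutes E} \<times> {pm. pm permutes E} \<times> (E \<rightarrow>\<^sub>E insert k Ip) \<times> (E \<rightarrow>\<^sub>E Iq))"
  using fin by (intro finite_cartesian_product finite_permutations finite_PiE) auto
 ultimately show ?thesis by (rule finite_subset)
qed

lemma pres_conn_eq:
 "{(sg, tu, p, q)\<in>pres E a b Ip Iq i k. conn E sg tu} = {(sg, tu, p, q)\<in>strs E {a, b} (insert k Ip) Iq. p a = i & p b = k}"
 (is "?A = ?B")
proof (intro equalityI subsetI)
 fix s assume s: "s \<in> ?A"
 obtain sg tu p q where s': "s = (sg, tu, p, q)" by (cases s)
 have S: "(sg, tu, p, q) \<in> pres E a b Ip Iq i k" and c: "conn E sg tu" using s by (simp_all add: s')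
 note D = presD[OF S]
 show "s \<in> ?B" using strsI[OF D(1,2,3,4,5) c] D(6,7) by (simp add: s')
next
 fix s assume s: "s \<in> ?B"
 obtain sg tu p q where s': "s = (sg, tu, p, q)" by (cases s)
 have S: "(sg, tu, p, q) \<in> strs E {a, b} (insert k Ip) Iq" and p: "p a = i" "p b = k" using s by (simp_all add: s')
 note D = strsD[OF S]
 have "(sg, tu, p, q) \<in> pres E a b Ip Iq i k"
  by (rule presI[OF D(1,2,3,4,5) p]) (rule connD[OF D(6)])
 then show "s \<in> ?A" using D(6) by (simp add: s')
qed

lemma split_measurable:
 fixes E :: "'e set" and Ip Iq :: "'l set"
 assumes fin: "finite E" and E: "E ~= {}" and ab: "a ~: E" "b ~: E" "a ~= b" and i: "i \<in> Ip" and k: "k ~: Ip"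
 shows "(%x. ennreal x * ennreal (Lp i - x) * W E {} (insert k Ip) Iq (Lp(i := x, k := Lp i - x)) Lq) \<in> borel_measurable borel"
  and "(\<Sum>(sg, tu, p, q)\<in>{(sg, tu, p, q)\<in>pres (insert b (insert a E)) a b Ip Iq i k. conn (insert b (insert a E)) sg tu}.
   vol (insert b (insert a E)) (relabel k i p) q Lp Lq) =
  (\<integral>\<^sup>+x. ennreal x * ennreal (Lp i - x) * W E {} (insert k Ip) Iq (Lp(i := x, k := Lp i - x)) Lq \<partial>lborel)"
proof -
 let ?E = "insert b (insert a E)"
 let ?B = "{(sg, tu, p, q)\<in>strs ?E {a, b} (insert k Ip) Iq. p a = i & p b = k}"
 have ik: "i ~= k" using i k by auto
 have finE: "finite ?E" using fin by simp
 have eq: "ennreal x * ennreal (Lp i - x) * W E {} (insert k Ip) Iq (Lp(i := x, k := Lp i - x)) Lq =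
  (\<Sum>s\<in>?B. svol ?E (Lp(i := x, k := Lp i - x)) Lq s)" for x
  using sum_strs_two[OF fin E ab, where i=i and I="insert k Ip" and k=k and J=Iq and Lp="Lp(i := x, k := Lp i - x)" and Lq=Lq] i ik by simp
 have sp: "(%x. svol ?E (Lp(i := x, k := Lp i - x)) Lq s) \<in> borel_measurable borel"
  "(case s of (sg, tu, p, q) => vol ?E (relabel k i p) q Lp Lq) = (\<integral>\<^sup>+x. svol ?E (Lp(i := x, k := Lp i - x)) Lq s \<partial>lborel)"
  if s: "s \<in> ?B" for s
 proof -
  obtain sg tu p q where s': "s = (sg, tu, p, q)" by (cases s)
  have S: "(sg, tu, p, q) \<in> strs ?E {a, b} (insert k Ip) Iq" and p: "p a = i" "p b = k" using s by (simp_all add: s')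
  note V = vol_split_conn[OF finE S _ _ p ik, of Lp Lq]
  show "(%x. svol ?E (Lp(i := x, k := Lp i - x)) Lq s) \<in> borel_measurable borel"
   "(case s of (sg, tu, p, q) => vol ?E (relabel k i p) q Lp Lq) = (\<integral>\<^sup>+x. svol ?E (Lp(i := x, k := Lp i - x)) Lq s \<partial>lborel)"
   using V by (simp_all add: s' svol_def)
 qed
 show "(%x. ennreal x * ennreal (Lp i - x) * W E {} (insert k Ip) Iq (Lp(i := x, k := Lp i - x)) Lq) \<in> borel_measurable borel"
  unfolding eq by (rule borel_measurable_sum) (rule sp)
 show "(\<Sum>(sg, tu, p, q)\<in>{(sg, tu, p, q)\<in>pres ?E a b Ip Iq i k. conn ?E sg tu}.
   vol ?E (relabel k i p) q Lp Lq) =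
  (\<integral>\<^sup>+x. ennreal x * ennreal (Lp i - x) * W E {} (insert k Ip) Iq (Lp(i := x, k := Lp i - x)) Lq \<partial>lborel)"
  unfolding eq pres_conn_eq using sp by (subst nn_integral_sum) (auto intro!: sum.cong)
qed

definition Wpair :: "'e set => 'l set => 'l set => ('l => real) => ('l => real) => 'e => 'e => ennreal" where
 "Wpair E Ip Iq Lp Lq a b = (\<Sum>s\<in>{(sg, tu, p, q)\<in>strs E {} Ip Iq. tu a = b}. svol E Lp Lq s)"

lemma Wpair_recursion:
 fixes E :: "'e set" and Ip Iq :: "'l set"
 assumes fin: "finite E" and E: "E ~= {}" and ab: "a ~: E" "b ~: E" "a ~= b" and k: "k ~: Ip"
  and finI: "finite Ip" "finite Iq" and pos: "!!i. i \<in> Ip ==> 0 < Lp i" and bal: "sum Lp Ip = sum Lq Iq"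
 shows "Wpair (insert b (insert a E)) Ip Iq Lp Lq a b =
  (\<Sum>(i, j)\<in>{(i, j)\<in>Ip \<times> Ip. i ~= j}. ennreal (Lp i + Lp j) * W E {} (Ip - {j}) Iq (Lp(i := Lp i + Lp j)) Lq)
  + (\<Sum>i\<in>Ip. (\<integral>\<^sup>+x. ennreal x * ennreal (Lp i - x) * W E {} (insert k Ip) Iq (Lp(i := x, k := Lp i - x)) Lq \<partial>lborel))
  + (\<Sum>i\<in>Ip. \<Sum>(E1, I1, J1)\<in>Pow E \<times> Pow (Ip - {i}) \<times> Pow Iq. stem a E1 i I1 J1 Lp Lq * stem b (E - E1) k (Ip - {i} - I1) (Iq - J1) Lp Lq)"
proof -
 let ?E = "insert b (insert a E)"
 define S where "S = {(sg, tu, p, q)\<in>strs ?E {} Ip Iq. tu a = b}"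
 define g where "g = (%(sg :: 'e => 'e, tu :: 'e => 'e, p :: 'e => 'l, q :: 'e => 'l). (p a, p b))"
 define h where "h i j = (\<Sum>s\<in>{s\<in>S. g s = (i, j)}. svol ?E Lp Lq s)" for i j
 have finE: "finite ?E" using fin by simp
 have finS: "finite S" unfolding S_def by (rule finite_subset[OF _ finite_strs[OF finE, of "{}" Ip Iq]]) auto
 have gS: "g ` S \<subseteq> Ip \<times> Ip"
 proof
  fix t assume "t \<in> g ` S"
  then obtain s where s: "s \<in> S" "t = g s" by auto
  obtain sg tu p q where s': "s = (sg, tu, p, q)" by (cases s)
  have "(sg, tu, p, q) \<in> strs ?E {} Ip Iq" using s by (simp add: s' S_def)
  then show "t \<in> Ip \<times> Ip" using cyc_labelD(6)[OF strsD(1), of sg tu p q ?E "{}" Ip Iq] by (simp add: s s' g_def)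
 qed
 have "Wpair ?E Ip Iq Lp Lq a b = (\<Sum>t\<in>Ip \<times> Ip. \<Sum>s\<in>{s\<in>S. g s = t}. svol ?E Lp Lq s)"
  unfolding Wpair_def S_def[symmetric] using finS finI gS by (intro sum.group[symmetric]) auto
 also have "... = (\<Sum>(i, j)\<in>Ip \<times> Ip. h i j)" by (rule sum.cong) (auto simp: h_def)
 also have "... = (\<Sum>(i, j)\<in>{(i, j)\<in>Ip \<times> Ip. i ~= j} Un (%i. (i, i)) ` Ip. h i j)"
  by (rule arg_cong[where f="sum _"]) auto
 also have "... = (\<Sum>(i, j)\<in>{(i, j)\<in>Ip \<times> Ip. i ~= j}. h i j) + (\<Sum>(i, j)\<in>(%i. (i, i)) ` Ip. h i j)"
  by (rule sum.union_disjoint) (use finI in \<open>auto intro: finite_subset[OF _ finite_cartesian_product[OF finI(1) finI(1)]]\<close>)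
 also have "(\<Sum>(i, j)\<in>(%i. (i, i)) ` Ip. h i j) = (\<Sum>i\<in>Ip. h i i)"
  by (subst sum.reindex) (auto simp: inj_on_def)
 also have "(\<Sum>(i, j)\<in>{(i, j)\<in>Ip \<times> Ip. i ~= j}. h i j) =
  (\<Sum>(i, j)\<in>{(i, j)\<in>Ip \<times> Ip. i ~= j}. ennreal (Lp i + Lp j) * W E {} (Ip - {j}) Iq (Lp(i := Lp i + Lp j)) Lq)"
 proof (rule sum.cong[OF refl], clarify)
  fix i j assume ij: "i \<in> Ip" "j \<in> Ip" "i ~= j"
  have set: "{s\<in>S. g s = (i, j)} = {(sg, tu, p, q)\<in>strs ?E {} Ip Iq. tu a = b & p a = i & p b = j}"
   unfolding S_def g_def by auto
  have "h i j = (\<Sum>s\<in>{(sg, tu, p, q)\<in>strs (insert a E) {a} (Ip - {j}) Iq. p a = i}. svol (insert a E) (Lp(i := Lp i + Lp j)) Lq s)"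
   unfolding h_def set by (rule sum_merge) (use fin ab ij pos in auto)
  also have "... = ennreal (Lp i + Lp j) * W E {} (Ip - {j}) Iq (Lp(i := Lp i + Lp j)) Lq"
   using sum_strs_insert[OF fin E ab(1), where F="{}" and i=i and Ip="Ip - {j}" and Iq=Iq and Q="%_. True" and Lp="Lp(i := Lp i + Lp j)" and Lq=Lq] ij
   by (simp add: W_def split_def)
  finally show "h i j = ennreal (Lp i + Lp j) * W E {} (Ip - {j}) Iq (Lp(i := Lp i + Lp j)) Lq" .
 qed
 also have "(\<Sum>i\<in>Ip. h i i) = (\<Sum>i\<in>Ip. (\<integral>\<^sup>+x. ennreal x * ennreal (Lp i - x) * W E {} (insert k Ip) Iq (Lp(i := x, k := Lp i - x)) Lq \<partial>lborel) +
  (\<Sum>(E1, I1, J1)\<in>Pow E \<times> Pow (Ip - {i}) \<times> Pow Iq. stem a E1 i I1 J1 Lp Lq * stem b (E - E1) k (Ip - {i} - I1) (Iq - J1) Lp Lq))"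
 proof (rule sum.cong[OF refl])
  fix i assume i: "i \<in> Ip"
  define v where "v = (%(sg :: 'e => 'e, tu :: 'e => 'e, p, q). vol ?E (relabel k i p) q Lp Lq)"
  have set: "{s\<in>S. g s = (i, i)} = {(sg, tu, p, q)\<in>strs ?E {} Ip Iq. tu a = b & p a = i & p b = i}"
   unfolding S_def g_def by auto
  have "h i i = (\<Sum>s\<in>pres ?E a b Ip Iq i k. v s)"
   unfolding h_def set v_def by (rule sum_resolve) (use finE ab i k in auto)
  also have "pres ?E a b Ip Iq i k = {(sg, tu, p, q)\<in>pres ?E a b Ip Iq i k. conn ?E sg tu} Un {(sg, tu, p, q)\<in>pres ?E a b Ip Iq i k. \<not> conn ?E sg tu}"
   by auto
  also have "(\<Sum>s\<in>.... v s) = (\<Sum>s\<in>{(sg, tu, p, q)\<in>pres ?E a b Ip Iq i k. conn ?E sg tu}. v s) + (\<Sum>s\<in>{(sg, tu, p, q)\<in>pres ?E a b Ip Iq i k. \<not> conn ?E sg tu}. v s)"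
  proof (rule sum.union_disjoint)
   show "finite {(sg, tu, p, q)\<in>pres ?E a b Ip Iq i k. conn ?E sg tu}" "finite {(sg, tu, p, q)\<in>pres ?E a b Ip Iq i k. \<not> conn ?E sg tu}"
    by (rule finite_subset[OF _ finite_pres[OF finE finI, of a b i k]], auto)+
  qed auto
  also have "(\<Sum>s\<in>{(sg, tu, p, q)\<in>pres ?E a b Ip Iq i k. conn ?E sg tu}. v s) =
   (\<integral>\<^sup>+x. ennreal x * ennreal (Lp i - x) * W E {} (insert k Ip) Iq (Lp(i := x, k := Lp i - x)) Lq \<partial>lborel)"
   unfolding v_def by (rule split_measurable(2)[OF fin E ab i k])
  also have "(\<Sum>s\<in>{(sg, tu, p, q)\<in>pres ?E a b Ip Iq i k. \<not> conn ?E sg tu}. v s) =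
   (\<Sum>(E1, I1, J1)\<in>{E1. E1 \<subseteq> ?E & a \<in> E1 & b ~: E1} \<times> Pow (Ip - {i}) \<times> Pow Iq.
   (\<Sum>s\<in>{(sg, tu, p, q)\<in>strs E1 {a} (insert i I1) J1. p a = i}. svol E1 (Lp(i := sum Lq J1 - sum Lp I1)) Lq s) *
   (\<Sum>s\<in>{(sg, tu, p, q)\<in>strs (?E - E1) {b} (insert k (Ip - {i} - I1)) (Iq - J1). p b = k}.
    svol (?E - E1) (Lp(k := sum Lq (Iq - J1) - sum Lp (Ip - {i} - I1))) Lq s))"
   unfolding v_def by (rule sum_pres_disc) (use finE ab i k finI bal in auto)
  also have "... = (\<Sum>(E1, I1, J1)\<in>Pow E \<times> Pow (Ip - {i}) \<times> Pow Iq. stem a E1 i I1 J1 Lp Lq * stem b (E - E1) k (Ip - {i} - I1) (Iq - J1) Lp Lq)"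
  \<comment> \<open>The marked point \<open>a\<close> is removed from the first part, so that the
    sum runs over all subsets of \<open>E\<close>. The empty subset is included: it belongs to the
    circle.\<close>
  proof (rule sum.reindex_bij_witness[where j="%(E1, I1, J1). (E1 - {a}, I1, J1)" and i="%(E1, I1, J1). (insert a E1, I1, J1)"])
   fix t assume t: "t \<in> {E1. E1 \<subseteq> ?E & a \<in> E1 & b ~: E1} \<times> Pow (Ip - {i}) \<times> Pow Iq"
   obtain E1 I1 J1 where t': "t = (E1, I1, J1)" by (cases t)
   have E1: "E1 \<subseteq> ?E" "a \<in> E1" "b ~: E1" using t by (simp_all add: t')
   have e: "insert a (E1 - {a}) = E1" "insert b (E - (E1 - {a})) = ?E - E1" using E1 ab by auto
   show "(case case t of (E1, I1, J1) => (E1 - {a}, I1, J1) of (E1, I1, J1) => (insert a E1, I1, J1)) = t"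
    by (simp only: t' split_conv e)
   show "(case t of (E1, I1, J1) => (E1 - {a}, I1, J1)) \<in> Pow E \<times> Pow (Ip - {i}) \<times> Pow Iq"
    using t E1 by (auto simp: t')
   show "(case case t of (E1, I1, J1) => (E1 - {a}, I1, J1) of (E1, I1, J1) => stem a E1 i I1 J1 Lp Lq * stem b (E - E1) k (Ip - {i} - I1) (Iq - J1) Lp Lq) =
    (case t of (E1, I1, J1) =>
   (\<Sum>s\<in>{(sg, tu, p, q)\<in>strs E1 {a} (insert i I1) J1. p a = i}. svol E1 (Lp(i := sum Lq J1 - sum Lp I1)) Lq s) *
   (\<Sum>s\<in>{(sg, tu, p, q)\<in>strs (?E - E1) {b} (insert k (Ip - {i} - I1)) (Iq - J1). p b = k}.
    svol (?E - E1) (Lp(k := sum Lq (Iq - J1) - sum Lp (Ip - {i} - I1))) Lq s))"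
    unfolding t' split_conv stem_def e ..
  next
   fix t assume t: "t \<in> Pow E \<times> Pow (Ip - {i}) \<times> Pow Iq"
   obtain E1 I1 J1 where t': "t = (E1, I1, J1)" by (cases t)
   have "E1 \<subseteq> E" using t by (simp add: t')
   then have "insert a E1 - {a} = E1" "b ~: E1" using ab by auto
   then show "(case case t of (E1, I1, J1) => (insert a E1, I1, J1) of (E1, I1, J1) => (E1 - {a}, I1, J1)) = t"
    and "(case t of (E1, I1, J1) => (insert a E1, I1, J1)) \<in> {E1. E1 \<subseteq> ?E & a \<in> E1 & b ~: E1} \<times> Pow (Ip - {i}) \<times> Pow Iq"
    using t ab by (auto simp: t')
  qed
  finally show "h i i = (\<integral>\<^sup>+x. ennreal x * ennreal (Lp i - x) * W E {} (insert k Ip) Iq (Lp(i := x, k := Lp i - x)) Lq \<partial>lborel) +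
  (\<Sum>(E1, I1, J1)\<in>Pow E \<times> Pow (Ip - {i}) \<times> Pow Iq. stem a E1 i I1 J1 Lp Lq * stem b (E - E1) k (Ip - {i} - I1) (Iq - J1) Lp Lq)" .
 qed
 finally show ?thesis by (simp only: sum.distrib add.assoc)
qed

section \<open>Counts that depend only on the number of edges\<close>

definition Wn :: "nat => 'l set => 'l set => ('l => real) => ('l => real) => ennreal" where
 "Wn n Ip Iq Lp Lq = W {..<n} {} Ip Iq Lp Lq"

lemma W_eq_Wn: "finite E ==> W E {} Ip Iq Lp Lq = Wn (card E) Ip Iq Lp Lq"
proof -
 assume fin: "finite E"
 obtain fi where "bij_betw fi E {..<card E}" using fin by (metis card_lessThan finite_lessThan finite_same_card_bij)
 from W_reindex[OF fin this, of id Ip id Iq Lp Lp Lq Lq] show ?thesis by (simp add: Wn_def)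
qed

text \<open>For \<open>n = 0\<close> the part is the circle. It has weight 1 without a factor of
  length, since its only edge is the marked point and there is no position to choose.\<close>

definition stemn :: "nat => 'l => 'l set => 'l set => ('l => real) => ('l => real) => ennreal" where
 "stemn n i I J Lp Lq = (if n = 0 then (if I = {} & (\<exists>j. J = {j}) then 1 else 0)
  else ennreal (sum Lq J - sum Lp I) * Wn n (insert i I) J (Lp(i := sum Lq J - sum Lp I)) Lq)"

lemma stem_eq:
 assumes fin: "finite E" and a: "a ~: E" and ik: "i ~: I" "k ~: I" and pos: "!!j. j \<in> J ==> 0 < Lq j"
 shows "stem a E k I J Lp Lq = stemn (card E) i I J Lp Lq"
proof (cases "E = {}")
 case True
 then show ?thesis using stem_empty[of k I J Lq a Lp, OF ik(2)] pos by (simp add: stemn_def)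
next
 case False
 define x where "x = sum Lq J - sum Lp I"
 have "W E {} (insert k I) J (Lp(k := x)) Lq = W E {} ((%l. if l = k then i else l) ` insert k I) (id ` J) (Lp(i := x)) Lq"
  by (rule W_reindex[OF fin, of id]) (use ik in \<open>auto simp: inj_on_def\<close>)
 also have "(%l. if l = k then i else l) ` insert k I = insert i I" using ik by auto
 finally have "W E {} (insert k I) J (Lp(k := x)) Lq = W E {} (insert i I) J (Lp(i := x)) Lq" by (simp only: image_id id_apply image_ident)
 then show ?thesis using stem_nonempty[OF fin False a, of k I J Lp Lq] False fin
  unfolding stemn_def x_def[symmetric] by (simp add: W_eq_Wn)
qed

lemma sum_Pow_card:
 fixes f :: "nat => ennreal"
 assumes "finite E"
 shows "(\<Sum>A\<in>Pow E. f (card A)) = (\<Sum>n\<le>card E. of_nat (card E choose n) * f n)"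
proof -
 have "(\<Sum>A\<in>Pow E. f (card A)) = (\<Sum>n\<le>card E. \<Sum>A\<in>{A\<in>Pow E. card A = n}. f (card A))"
  using assms by (intro sum.group[symmetric]) (auto intro: card_mono)
 also have "... = (\<Sum>n\<le>card E. of_nat (card E choose n) * f n)"
 proof (rule sum.cong[OF refl])
  fix n
  have "card {A\<in>Pow E. card A = n} = card E choose n" using n_subsets[OF assms, of n] by simp
  then show "(\<Sum>A\<in>{A\<in>Pow E. card A = n}. f (card A)) = of_nat (card E choose n) * f n" by simp
 qed
 finally show ?thesis .
qed

text \<open>The vertex through the edge 0 is marked. Its other edge is one of \<open>Suc m\<close>,
  each with the same contribution, and the binomial coefficient counts the ways to share out the
  names of the remaining \<open>m\<close> edges. In the separated terms the auxiliary label
  \<open>k\<close> of the second part is renamed to \<open>i\<close>.\<close>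

theorem Wn_recursion:
 fixes Ip Iq :: "'l set"
 assumes m: "m > 0" and k: "k ~: Ip" and finI: "finite Ip" "finite Iq"
  and pos: "!!i. i \<in> Ip ==> 0 < Lp i" "!!i. i \<in> Iq ==> 0 < Lq i" and bal: "sum Lp Ip = sum Lq Iq"
 shows "Wn (Suc (Suc m)) Ip Iq Lp Lq = of_nat (Suc m) * (
  (\<Sum>(i, j)\<in>{(i, j)\<in>Ip \<times> Ip. i ~= j}. ennreal (Lp i + Lp j) * Wn m (Ip - {j}) Iq (Lp(i := Lp i + Lp j)) Lq)
  + (\<Sum>i\<in>Ip. (\<integral>\<^sup>+x. ennreal x * ennreal (Lp i - x) * Wn m (insert k Ip) Iq (Lp(i := x, k := Lp i - x)) Lq \<partial>lborel))
  + (\<Sum>i\<in>Ip. \<Sum>(I1, J1)\<in>Pow (Ip - {i}) \<times> Pow Iq. \<Sum>n\<le>m. of_nat (m choose n) *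
    (stemn n i I1 J1 Lp Lq * stemn (m - n) i (Ip - {i} - I1) (Iq - J1) Lp Lq)))" (is "_ = _ * ?R")
proof -
 define E :: "nat set" where "E = {..<Suc (Suc m)}"
 have finE: "finite E" by (simp add: E_def)
 have "Wn (Suc (Suc m)) Ip Iq Lp Lq = (\<Sum>s\<in>strs E {} Ip Iq. svol E Lp Lq s)" by (simp add: Wn_def W_def E_def)
 also have "... = (\<Sum>b\<in>E - {0}. \<Sum>s\<in>{s\<in>strs E {} Ip Iq. (case s of (sg, tu, p, q) => tu 0) = b}. svol E Lp Lq s)"
 proof (rule sum.group[symmetric])
  show "(%s. case s of (sg, tu, p, q) => tu 0) ` strs E {} Ip Iq \<subseteq> E - {0}"
  proof clarify
   fix sg tu p q assume s: "(sg, tu, p, q) \<in> strs E {} Ip Iq"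
   have "0 \<in> E" by (simp add: E_def)
   then show "tu 0 \<in> E - {0}" using strsD(5,7)[OF s] by auto
  qed
 qed (use finE finite_strs in auto)
 also have "... = (\<Sum>b\<in>E - {0}. Wpair E Ip Iq Lp Lq 0 b)"
  unfolding Wpair_def by (intro sum.cong arg_cong[where f="sum _"]) auto
 also have "... = (\<Sum>b\<in>E - {0}. ?R)"
 proof (rule sum.cong[OF refl])
  fix b assume b: "b \<in> E - {0}"
  define E0 where "E0 = E - {0, b}"
  have Eeq: "E = insert b (insert 0 E0)" using b by (auto simp: E0_def E_def)
  have fin0: "finite E0" using finE by (simp add: E0_def)
  have card0: "card E0 = m" using b finE unfolding E0_def by (subst card_Diff_subset) (auto simp: E_def)
  have ne: "E0 ~= {}" using card0 m by auto
  have b0: "0 ~: E0" "b ~: E0" "0 ~= b" using b by (auto simp: E0_def)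
  have "(\<Sum>(E1, I1, J1)\<in>Pow E0 \<times> Pow (Ip - {i}) \<times> Pow Iq. stem 0 E1 i I1 J1 Lp Lq * stem b (E0 - E1) k (Ip - {i} - I1) (Iq - J1) Lp Lq)
   = (\<Sum>(I1, J1)\<in>Pow (Ip - {i}) \<times> Pow Iq. \<Sum>n\<le>m. of_nat (m choose n) *
    (stemn n i I1 J1 Lp Lq * stemn (m - n) i (Ip - {i} - I1) (Iq - J1) Lp Lq))" for i
  proof -
   have "(\<Sum>(E1, I1, J1)\<in>Pow E0 \<times> Pow (Ip - {i}) \<times> Pow Iq. stem 0 E1 i I1 J1 Lp Lq * stem b (E0 - E1) k (Ip - {i} - I1) (Iq - J1) Lp Lq)
    = (\<Sum>E1\<in>Pow E0. \<Sum>(I1, J1)\<in>Pow (Ip - {i}) \<times> Pow Iq. stem 0 E1 i I1 J1 Lp Lq * stem b (E0 - E1) k (Ip - {i} - I1) (Iq - J1) Lp Lq)"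
    using sum.cartesian_product[of "%E1 (I1, J1). stem 0 E1 i I1 J1 Lp Lq * stem b (E0 - E1) k (Ip - {i} - I1) (Iq - J1) Lp Lq" "Pow (Ip - {i}) \<times> Pow Iq" "Pow E0"]
    by (simp add: split_def)
   also have "... = (\<Sum>(I1, J1)\<in>Pow (Ip - {i}) \<times> Pow Iq. \<Sum>E1\<in>Pow E0. stem 0 E1 i I1 J1 Lp Lq * stem b (E0 - E1) k (Ip - {i} - I1) (Iq - J1) Lp Lq)"
    by (subst sum.swap) (simp add: split_def)
   also have "... = (\<Sum>(I1, J1)\<in>Pow (Ip - {i}) \<times> Pow Iq. \<Sum>n\<le>m. of_nat (m choose n) *
    (stemn n i I1 J1 Lp Lq * stemn (m - n) i (Ip - {i} - I1) (Iq - J1) Lp Lq))"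
   proof (rule sum.cong[OF refl], clarify)
    fix I1 J1 assume IJ: "I1 \<subseteq> Ip - {i}" "J1 \<subseteq> Iq"
    have "(\<Sum>E1\<in>Pow E0. stem 0 E1 i I1 J1 Lp Lq * stem b (E0 - E1) k (Ip - {i} - I1) (Iq - J1) Lp Lq) =
     (\<Sum>E1\<in>Pow E0. stemn (card E1) i I1 J1 Lp Lq * stemn (m - card E1) i (Ip - {i} - I1) (Iq - J1) Lp Lq)"
    proof (rule sum.cong[OF refl])
     fix E1 assume E1: "E1 \<in> Pow E0"
     then have f1: "finite E1" using fin0 by (auto intro: finite_subset)
     have 1: "stem 0 E1 i I1 J1 Lp Lq = stemn (card E1) i I1 J1 Lp Lq"
      by (rule stem_eq[OF f1]) (use E1 b0 IJ pos in auto)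
     have 2: "stem b (E0 - E1) k (Ip - {i} - I1) (Iq - J1) Lp Lq = stemn (card (E0 - E1)) i (Ip - {i} - I1) (Iq - J1) Lp Lq"
      by (rule stem_eq) (use E1 b0 IJ pos fin0 k in auto)
     have 3: "card (E0 - E1) = m - card E1" using E1 f1 by (simp add: card_Diff_subset card0)
     show "stem 0 E1 i I1 J1 Lp Lq * stem b (E0 - E1) k (Ip - {i} - I1) (Iq - J1) Lp Lq =
      stemn (card E1) i I1 J1 Lp Lq * stemn (m - card E1) i (Ip - {i} - I1) (Iq - J1) Lp Lq" unfolding 1 2 3 ..
    qed
    also have "... = (\<Sum>n\<le>m. of_nat (m choose n) * (stemn n i I1 J1 Lp Lq * stemn (m - n) i (Ip - {i} - I1) (Iq - J1) Lp Lq))"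
     using sum_Pow_card[OF fin0, of "%n. stemn n i I1 J1 Lp Lq * stemn (m - n) i (Ip - {i} - I1) (Iq - J1) Lp Lq"]
     by (simp add: card0)
    finally show "(\<Sum>E1\<in>Pow E0. stem 0 E1 i I1 J1 Lp Lq * stem b (E0 - E1) k (Ip - {i} - I1) (Iq - J1) Lp Lq) =
     (\<Sum>n\<le>m. of_nat (m choose n) * (stemn n i I1 J1 Lp Lq * stemn (m - n) i (Ip - {i} - I1) (Iq - J1) Lp Lq))" .
   qed
   finally show ?thesis .
  qed
  moreover have "W E0 {} A B C D = Wn m A B C D" for A B :: "'l set" and C D using W_eq_Wn[OF fin0] card0 by simp
  ultimately show "Wpair E Ip Iq Lp Lq 0 b = ?R"
   unfolding Eeq using Wpair_recursion[OF fin0 ne b0 k finI pos(1) bal] by simp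
 qed
 also have "... = of_nat (card (E - {0})) * ?R" by simp
 also have "card (E - {0}) = Suc m" using finE by (simp add: E_def)
 finally show ?thesis .
qed

lemma Wn_split_measurable:
 assumes m: "m > 0" and i: "i \<in> Ip" and k: "k ~: Ip"
 shows "(%x. ennreal x * ennreal (Lp i - x) * Wn m (insert k Ip) Iq (Lp(i := x, k := Lp i - x)) Lq) \<in> borel_measurable borel"
proof -
 have "{..<m} ~= {}" using m by auto
 then show ?thesis unfolding Wn_def using i k by (intro split_measurable(1)[of "{..<m}" m "Suc m"]) auto
qed

subsection \<open>Four-valent directed ribbon graphs\<close>

lemma orbit_self:
 assumes "finite H" "f permutes H"
 shows "x \<in> orbit f x"
 using assms by (intro permutation_self_in_orbit) (auto simp: permutation_permutes)

lemma orbit_eq: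
 assumes f: "finite H" "f permutes H" and y: "y \<in> orbit f x"
 shows "orbit f y = orbit f x"
 using orbit_trans[OF _ y] orbit_trans[OF _ orbit_swap[OF orbit_self[OF f] y]] by blast

lemma orbit_invariant:
 assumes "y \<in> orbit f x" "x \<in> T" "!!z. z \<in> T ==> f z \<in> T"
 shows "y \<in> T"
 using assms(1) by induction (use assms(2,3) in auto)

text \<open>The cycle length is the least period; it is 4 exactly if 4 is a period and 2 is not.
  This turns the degree condition into equations for powers of \<open>perm0\<close>.\<close>

lemma card_orbit_4_iff:
 assumes f: "finite H" "f permutes H"
 shows "card (orbit f x) = 4 \<longleftrightarrow> f (f (f (f x))) = x & f (f x) ~= x"
proof -
 obtain n0 where n0: "0 < n0" "(f ^^ n0) x = x" using orbit_self[OF f, of x] by (auto simp: orbit_altdef)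
 define n where "n = (LEAST n. 0 < n & (f ^^ n) x = x)"
 have n: "0 < n" "(f ^^ n) x = x" unfolding n_def using LeastI[of "%n. 0 < n & (f ^^ n) x = x", OF conjI[OF n0]] by auto
 have least: "n \<le> m" if "0 < m" "(f ^^ m) x = x" for m unfolding n_def using that by (intro Least_le) auto
 have injf: "inj (f ^^ k)" for k using f(2) by (intro bij_is_inj bij_betw_funpow permutes_bij)
 have key: "i = j" if le: "i \<le> j" "j < n" "(f ^^ i) x = (f ^^ j) x" for i j
 proof (rule ccontr)
  assume "i ~= j"
  have "(f ^^ i) ((f ^^ (j - i)) x) = (f ^^ i) x" using le funpow_add[of i "j - i" f] by (simp add: fun_eq_iff)
  then have "(f ^^ (j - i)) x = x" using injf[of i] by (simp add: inj_eq)
  then show False using least[of "j - i"] le \<open>i ~= j\<close> n(1) by simp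
 qed
 have "inj_on (%i. (f ^^ i) x) {..<n}"
  by (rule inj_onI) (metis key lessThan_iff linorder_le_cases)
 moreover have "orbit f x = (%i. (f ^^ i) x) ` {..<n}" using orbit_altdef_bounded[OF n(2,1)] by auto
 ultimately have c: "card (orbit f x) = n" by (simp add: card_image)
 show ?thesis
  unfolding c
 proof
  assume "n = 4"
  then show "f (f (f (f x))) = x & f (f x) ~= x" using n(2) least[of 2] by (auto simp: numeral_eq_Suc)
 next
  assume a: "f (f (f (f x))) = x & f (f x) ~= x"
  then have "n \<le> 4" using least[of 4] by (simp add: numeral_eq_Suc)
  moreover have "n ~= 1" "n ~= 2" "n ~= 3" using a n(2) by (auto simp: numeral_eq_Suc)
  ultimately show "n = 4" using n(1) by linarith
 qed
qed

lemma card_orbits: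
 assumes f: "finite H" "f permutes H" and k: "!!x. x \<in> H ==> card (orbit f x) = k"
 shows "k * card (orbit f ` H) = card H"
proof -
 have sub: "orbit f x \<subseteq> H" if "x \<in> H" for x using that f(2) by (auto intro: orbit_invariant simp: permutes_in_image)
 have u: "\<Union> (orbit f ` H) = H" using sub orbit_self[OF f] by auto
 have d: "a Int b = {}" if ab: "a \<in> orbit f ` H" "b \<in> orbit f ` H" "a ~= b" for a b
 proof (rule ccontr)
  assume "a Int b ~= {}"
  then obtain z where "z \<in> a" "z \<in> b" by auto
  then have "a = orbit f z" "b = orbit f z" using ab orbit_eq[OF f] by auto
  then show False using ab by simp
 qed
 have "k * card (orbit f ` H) = card (\<Union> (orbit f ` H))"
  by (rule card_partition) (use f(1) u k d in auto)
 then show ?thesis unfolding u .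
qed

lemma perm_invariant_inv:
 assumes "finite T" "inj f" "!!x. x \<in> T ==> f x \<in> T" "f x \<in> T"
 shows "x \<in> T"
proof -
 have "f ` T = T" using assms(1-3) by (intro endo_inj_surj) (auto intro: inj_on_subset)
 then show ?thesis using assms(2,4) by (metis imageE injD)
qed

lemma rgD:
 assumes "is_ribbon_graph R"
 shows "finite (halfedges R)" "perm0 R permutes halfedges R" "perm1 R permutes halfedges R" "perm2 R permutes halfedges R"
  "!!x. x \<in> halfedges R ==> perm0 R x \<in> halfedges R" "!!x. x \<in> halfedges R ==> perm1 R x \<in> halfedges R"
  "!!x. x \<in> halfedges R ==> perm2 R x \<in> halfedges R"
  "!!x. perm1 R (perm1 R x) = x" "!!x. x \<in> halfedges R ==> perm1 R x ~= x"
  "!!x. perm2 R (perm1 R (perm0 R x)) = x" "!!x. perm0 R (perm2 R (perm1 R x)) = x"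
  "!!x. perm1 R (perm0 R (perm2 R x)) = x" "inj (perm0 R)" "inj (perm1 R)" "inj (perm2 R)"
proof -
 note A = assms[unfolded is_ribbon_graph_def]
 show p: "finite (halfedges R)" "perm0 R permutes halfedges R" "perm1 R permutes halfedges R" "perm2 R permutes halfedges R"
  using A by auto
 then show "inj (perm0 R)" "inj (perm1 R)" "inj (perm2 R)" by (auto simp: permutes_inj)
 show h: "!!x. x \<in> halfedges R ==> perm0 R x \<in> halfedges R" "!!x. x \<in> halfedges R ==> perm1 R x \<in> halfedges R"
  "!!x. x \<in> halfedges R ==> perm2 R x \<in> halfedges R" using p by (auto simp: permutes_in_image)
 show "!!x. x \<in> halfedges R ==> perm1 R x ~= x" using A by auto
 show 1: "!!x. perm1 R (perm1 R x) = x" using A p(3) by (metis permutes_not_in)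
 show 2: "!!x. perm2 R (perm1 R (perm0 R x)) = x" using A by (auto simp: fun_eq_iff)
 show 3: "!!x. perm0 R (perm2 R (perm1 R x)) = x"
  using 2 \<open>inj (perm2 R)\<close> \<open>inj (perm1 R)\<close> by (metis injD)
 show "!!x. perm1 R (perm0 R (perm2 R x)) = x" using 3 1 by metis
qed

lemma orbit_perm1: "is_ribbon_graph R ==> orbit (perm1 R) x = {x, perm1 R x}"
proof -
 assume r: "is_ribbon_graph R"
 have "(perm1 R ^^ 2) x = x" using rgD(8)[OF r] by (simp add: numeral_eq_Suc)
 from orbit_altdef_bounded[OF this] have "orbit (perm1 R) x = (%m. (perm1 R ^^ m) x) ` {..<2}" by auto
 also have "{..<2::nat} = {0, 1}" by auto
 finally show ?thesis by simp
qed

text \<open>The orbits of the generated group are the minimal invariant sets. Invariance under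
  \<open>perm1\<close> and \<open>perm2\<close> suffices because \<open>perm0\<close> is the inverse
  of \<open>perm2 o perm1\<close> and the sets are finite.\<close>

lemma connected_rg_iff:
 assumes r: "is_ribbon_graph R"
 shows "connected_rg R \<longleftrightarrow> (\<forall>T. T \<subseteq> halfedges R --> T ~= {} --> (\<forall>x\<in>T. perm1 R x \<in> T) --> (\<forall>x\<in>T. perm2 R x \<in> T) --> T = halfedges R)"
proof -
 note r' = rgD[OF r]
 let ?H = "halfedges R" and ?G = "BijGroup (halfedges R)"
 let ?S = "(%s. restrict s ?H) ` {perm0 R, perm1 R, perm2 R}"
 interpret G: group ?G by (rule group_BijGroup)
 have bij: "restrict s ?H \<in> Bij ?H" if "s permutes ?H" for s
  using permutes_imp_bij[OF that] by (simp add: Bij_def bij_betw_restrict_eq)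
 have S: "?S \<subseteq> Bij ?H" using bij r'(2-4) by auto
 have gen_sub: "h \<in> Bij ?H" if "h \<in> generate ?G ?S" for h
  using G.generate_in_carrier[of ?S h] that S by (simp add: BijGroup_def)
 show ?thesis
 proof (intro iffI allI impI)
  fix T assume c: "connected_rg R" and T: "T \<subseteq> ?H" "T ~= {}" "\<forall>x\<in>T. perm1 R x \<in> T" "\<forall>x\<in>T. perm2 R x \<in> T"
  have finT: "finite T" using T(1) r'(1) finite_subset by blast
  have T0: "perm0 R x \<in> T" if "x \<in> T" for x
  proof -
   have "perm1 R (perm0 R x) \<in> T"
    using perm_invariant_inv[OF finT r'(15)] T(4) that r'(10) by metis
   then show ?thesis using T(3) r'(8) by metis
  qed
  have gT: "h x \<in> T" if "h \<in> generate ?G ?S" "x \<in> T" for h x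
   using that
  proof (induction arbitrary: x rule: generate.induct)
   case one
   then show ?case using T(1) by (auto simp: BijGroup_def)
  next
   case (incl h)
   then show ?case using T T0 by auto
  next
   case (inv h)
   have hB: "h \<in> Bij ?H" using inv S by auto
   have x: "x \<in> ?H" using inv T(1) by auto
   have b: "bij_betw h ?H ?H" using hB by (simp add: Bij_def)
   have hT: "h ` T = T" using inv T T0 by (intro endo_inj_surj finT) (use b T(1) in \<open>auto simp: bij_betw_def intro: inj_on_subset\<close>)
   then obtain y where y: "y \<in> T" "h y = x" using inv(2) by (metis imageE)
   then have "inv_into ?H h x = y" using b T(1) by (auto simp: bij_betw_def intro!: inv_into_f_eq)
   then show ?case using x y by (simp add: inv_BijGroup[OF hB])
  next
   case (eng h1 h2)
   have "h1 \<in> Bij ?H" "h2 \<in> Bij ?H" using eng gen_sub by auto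
   moreover have "x \<in> ?H" using eng T(1) by auto
   ultimately show ?case using eng by (simp add: BijGroup_def compose_def)
  qed
  obtain x where x: "x \<in> T" using T by auto
  show "T = ?H"
  proof
   show "?H \<subseteq> T"
   proof
    fix y assume "y \<in> ?H"
    then obtain h where "h \<in> generate ?G ?S" "h x = y" using c x T(1) unfolding connected_rg_def by blast
    then show "y \<in> T" using gT x by auto
   qed
  qed (rule T(1))
 next
  assume a: "\<forall>T. T \<subseteq> ?H --> T ~= {} --> (\<forall>x\<in>T. perm1 R x \<in> T) --> (\<forall>x\<in>T. perm2 R x \<in> T) --> T = ?H"
  show "connected_rg R"
   unfolding connected_rg_def
  proof (intro ballI)
   fix x y assume x: "x \<in> ?H" and y: "y \<in> ?H"
   let ?T = "(%h. h x) ` generate ?G ?S"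
   have st: "s z \<in> ?T" if z: "z \<in> ?T" and s: "s \<in> {perm0 R, perm1 R, perm2 R}" for s z
   proof -
    obtain h where h: "h \<in> generate ?G ?S" "z = h x" using z by auto
    have s': "restrict s ?H \<in> generate ?G ?S" by (rule generate.incl) (use s in blast)
    have m1: "restrict s ?H \<otimes>\<^bsub>?G\<^esub> h \<in> generate ?G ?S" by (rule generate.eng[OF s' h(1)])
    have m2: "(restrict s ?H \<otimes>\<^bsub>?G\<^esub> h) x = s z"
    proof -
     have B: "restrict s ?H \<in> Bij ?H" "h \<in> Bij ?H" using gen_sub s' h by auto
     then have "h x \<in> ?H" using x by (auto simp: Bij_def bij_betw_def)
     then show ?thesis using B x h(2) by (simp add: BijGroup_def compose_def)
    qed
    show ?thesis by (rule image_eqI[where f="%h. h x", OF _ m1]) (rule m2[symmetric])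
   qed
   have "?T = ?H"
   proof (rule a[rule_format])
    show "?T \<subseteq> ?H" using gen_sub x by (auto simp: Bij_def bij_betw_def)
    show "?T ~= {}" using generate.one[of ?G ?S] by blast
   qed (use st in auto)
   then have "y \<in> ?T" using y by simp
   then show "\<exists>h\<in>generate ?G ?S. h x = y" by blast
  qed
 qed
qed

definition fv_rg :: "nat => nat => 'h directed_ribbon_graph => bool" where
 "fv_rg np nm R \<longleftrightarrow> is_ribbon_graph R & is_direction R (direction R) & four_valent R &
  bij_betw (label R) (signed_boundaries R 1) {..<np} & bij_betw (label R) (signed_boundaries R (-1)) {..<nm}"

text \<open>Every edge has exactly one positive half-edge, so this set stands for the set of
  edges.\<close>

definition Epos :: "'h directed_ribbon_graph => 'h set" where
 "Epos R = {e \<in> halfedges R. direction R e = 1}"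

lemma four_valent_iff:
 assumes "is_ribbon_graph R"
 shows "four_valent R \<longleftrightarrow> (\<forall>x\<in>halfedges R. perm0 R (perm0 R (perm0 R (perm0 R x))) = x & perm0 R (perm0 R x) ~= x)"
 using card_orbit_4_iff[OF rgD(1,2)[OF assms]] by (auto simp: four_valent_def vertices_def)

text \<open>The relation between the three permutations forces \<open>perm0\<close> to reverse the
  direction as well, so the signs alternate around a vertex.\<close>

lemma directionD:
 assumes r: "is_ribbon_graph R" and d: "is_direction R (direction R)" and x: "x \<in> halfedges R"
 shows "direction R x \<in> {1, -1}" "direction R (perm2 R x) = direction R x" "direction R (perm1 R x) = - direction R x"
  "direction R (perm0 R x) = - direction R x" "!!y. y \<in> orbit (perm2 R) x ==> direction R y = direction R x"
proof -
 have d': "direction R x \<in> {1, -1}" "direction R (perm2 R x) = direction R x" "direction R (perm1 R x) = - direction R x" if "x \<in> halfedges R" for x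
  using d that unfolding is_direction_def by blast+
 show "direction R x \<in> {1, -1}" "direction R (perm2 R x) = direction R x" "direction R (perm1 R x) = - direction R x" using d'[OF x] by auto
 have "direction R (perm0 R x) = - direction R (perm1 R (perm0 R x))" using d'(3)[OF rgD(5)[OF r x]] by simp
 also have "... = - direction R (perm2 R (perm1 R (perm0 R x)))" using d'(2) rgD(5,6)[OF r] x by simp
 finally show "direction R (perm0 R x) = - direction R x" by (simp add: rgD(10)[OF r])
 show "direction R y = direction R x" if "y \<in> orbit (perm2 R) x" for y
 proof -
  have "y \<in> {z \<in> halfedges R. direction R z = direction R x}"
   by (rule orbit_invariant[OF that]) (use x d' rgD(7)[OF r] in auto)
  then show ?thesis by simp
 qed
qed

lemma signed_boundaries_eq:
 assumes r: "is_ribbon_graph R" and d: "is_direction R (direction R)"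
 shows "signed_boundaries R 1 = orbit (perm2 R) ` Epos R" "signed_boundaries R (-1) = (%e. orbit (perm2 R) (perm1 R e)) ` Epos R"
  "boundaries R = signed_boundaries R 1 Un signed_boundaries R (-1)" "signed_boundaries R 1 Int signed_boundaries R (-1) = {}"
proof -
 note r' = rgD[OF r] and d' = directionD[OF r d]
 have self: "x \<in> orbit (perm2 R) x" for x by (rule orbit_self[OF r'(1,4)])
 have s: "signed_boundaries R s = orbit (perm2 R) ` {e \<in> halfedges R. direction R e = s}" for s
 proof
  show "signed_boundaries R s \<subseteq> orbit (perm2 R) ` {e \<in> halfedges R. direction R e = s}"
   using self by (auto simp: signed_boundaries_def boundaries_def)
  show "orbit (perm2 R) ` {e \<in> halfedges R. direction R e = s} \<subseteq> signed_boundaries R s"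
   using d'(5) by (auto simp: signed_boundaries_def boundaries_def)
 qed
 have im: "{e \<in> halfedges R. direction R e = -1} = perm1 R ` Epos R"
 proof (intro Set.set_eqI iffI)
  fix e assume e: "e \<in> {e \<in> halfedges R. direction R e = -1}"
  then have "perm1 R e \<in> Epos R" using r'(6) d'(3)[of e] by (simp add: Epos_def)
  then show "e \<in> perm1 R ` Epos R" using r'(8)[of e] by (metis imageI)
 qed (use r'(6) d'(3) in \<open>auto simp: Epos_def\<close>)
 show "signed_boundaries R 1 = orbit (perm2 R) ` Epos R" by (simp add: s Epos_def)
 show "signed_boundaries R (-1) = (%e. orbit (perm2 R) (perm1 R e)) ` Epos R" by (simp add: s im image_image)
 show "boundaries R = signed_boundaries R 1 Un signed_boundaries R (-1)"
  unfolding s boundaries_def image_Un[symmetric] using d'(1) by (intro arg_cong[where f="image _"]) auto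
 show "signed_boundaries R 1 Int signed_boundaries R (-1) = {}"
  using orbit_nonempty by (fastforce simp: signed_boundaries_def boundaries_def)
qed

lemma card_Epos:
 assumes r: "is_ribbon_graph R" and d: "is_direction R (direction R)"
 shows "card (halfedges R) = 2 * card (Epos R)" "finite (Epos R)"
proof -
 note r' = rgD[OF r] and d' = directionD[OF r d]
 show fin: "finite (Epos R)" using r'(1) by (simp add: Epos_def)
 have "halfedges R = Epos R Un perm1 R ` Epos R"
 proof (intro Set.set_eqI iffI)
  fix e assume e: "e \<in> halfedges R"
  have "e \<in> perm1 R ` Epos R" if "e ~: Epos R"
  proof -
   have "perm1 R e \<in> Epos R" using that e r'(6) d'(1,3)[OF e] by (auto simp: Epos_def)
   then show ?thesis using r'(8)[of e] by (metis imageI)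
  qed
  then show "e \<in> Epos R Un perm1 R ` Epos R" by blast
 qed (use r'(6) in \<open>auto simp: Epos_def\<close>)
 moreover have "Epos R Int perm1 R ` Epos R = {}"
 proof (rule ccontr)
  assume "Epos R Int perm1 R ` Epos R ~= {}"
  then obtain e where "e \<in> Epos R" "perm1 R e \<in> Epos R" by auto
  then show False using d'(3)[of e] by (simp add: Epos_def)
 qed
 ultimately show "card (halfedges R) = 2 * card (Epos R)"
  using fin card_image[of "perm1 R" "Epos R"] r'(14) by (simp add: card_Un_disjoint inj_on_subset)
qed

text \<open>N vertices of degree 4 have 4N half-edges, hence there are 2N edges and 2N positive
  half-edges. The definition of the genus then reads N = 2g-2+n.\<close>

lemma has_genus_iff:
 assumes "fv_rg np nm R"
 shows "has_genus R g \<longleftrightarrow> int (card (Epos R)) = 2 * (2 * g - 2 + int np + int nm)"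
proof -
 have r: "is_ribbon_graph R" and d: "is_direction R (direction R)" and f: "four_valent R"
  and b: "bij_betw (label R) (signed_boundaries R 1) {..<np}" "bij_betw (label R) (signed_boundaries R (-1)) {..<nm}"
  using assms by (auto simp: fv_rg_def)
 note r' = rgD[OF r]
 have "4 * card (vertices R) = card (halfedges R)"
  unfolding vertices_def by (rule card_orbits[OF r'(1,2)]) (use f in \<open>auto simp: four_valent_def vertices_def\<close>)
 moreover have "2 * card (edges R) = card (halfedges R)"
  unfolding edges_def by (rule card_orbits[OF r'(1,3)]) (use r'(9) in \<open>auto simp: orbit_perm1[OF r] card_2_iff\<close>)
 moreover have "card (boundaries R) = np + nm"
  unfolding signed_boundaries_eq(3)[OF r d]
  using bij_betw_same_card[OF b(1)] bij_betw_same_card[OF b(2)] signed_boundaries_eq(4)[OF r d]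
   bij_betw_finite[OF b(1)] bij_betw_finite[OF b(2)] by (simp add: card_Un_disjoint)
 ultimately have "int (card (edges R)) = 2 * int (card (vertices R))" "int (card (boundaries R)) = int np + int nm"
  "int (card (Epos R)) = 2 * int (card (vertices R))"
  using card_Epos(1)[OF r d] by linarith+
 moreover have "(2 - 2 * g = v - e + b) = (h = 2 * (2 * g - 2 + x + y))" if "e = 2 * v" "b = x + y" "h = 2 * v" for v e b h x y :: int
  using that by auto
 ultimately show ?thesis unfolding has_genus_def by blast
qed

lemma four_valent_graphs_iff:
 "R \<in> four_valent_graphs g np nm \<longleftrightarrow> fv_rg np nm R & connected_rg R & int (card (Epos R)) = 2 * (2 * g - 2 + int np + int nm)"
 using has_genus_iff[of np nm R g] by (auto simp: four_valent_graphs_def is_directed_rg_def fv_rg_def)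

subsection \<open>Isomorphisms\<close>

lemma iso_orbit:
 assumes "!!z. z \<in> H ==> s z \<in> H" "!!z. z \<in> H ==> f (s z) = s' (f z)" "x \<in> H"
 shows "f ` orbit s x = orbit s' (f x)"
proof (intro Set.set_eqI iffI)
 fix y assume "y \<in> f ` orbit s x"
 then obtain z where z: "y = f z" "z \<in> orbit s x" by auto
 from z(2) have "f z \<in> orbit s' (f x) & z \<in> H"
  by induction (use assms in \<open>auto intro: orbit.intros\<close>)
 then show "y \<in> orbit s' (f x)" using z(1) by simp
next
 fix y assume "y \<in> orbit s' (f x)"
 then have "\<exists>z\<in>orbit s x. z \<in> H & y = f z"
 proof induction
  case base
  then show ?case using assms by (metis orbit.base)
 next
  case (step y)
  then show ?case using assms by (metis orbit.step)
 qed
 then show "y \<in> f ` orbit s x" by blast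
qed

lemma isosD:
 assumes "f \<in> isos R R'"
 shows "f \<in> extensional (halfedges R)" "bij_betw f (halfedges R) (halfedges R')"
  "!!e. e \<in> halfedges R ==> f (perm0 R e) = perm0 R' (f e)" "!!e. e \<in> halfedges R ==> f (perm1 R e) = perm1 R' (f e)"
  "!!e. e \<in> halfedges R ==> f (perm2 R e) = perm2 R' (f e)" "!!e. e \<in> halfedges R ==> direction R' (f e) = direction R e"
  "!!\<beta>. \<beta> \<in> boundaries R ==> label R' (f ` \<beta>) = label R \<beta>" "!!e. e \<in> halfedges R ==> f e \<in> halfedges R'"
 using assms by (auto simp: isos_def bij_betw_def)

lemma isos_orbit:
 assumes r: "is_ribbon_graph R" and f: "f \<in> isos R R'" and x: "x \<in> halfedges R"
 shows "f ` orbit (perm2 R) x = orbit (perm2 R') (f x)" "label R' (orbit (perm2 R') (f x)) = label R (orbit (perm2 R) x)"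
proof -
 show 1: "f ` orbit (perm2 R) x = orbit (perm2 R') (f x)"
  by (rule iso_orbit[where H="halfedges R" and s="perm2 R" and s'="perm2 R'" and f=f, OF rgD(7)[OF r] isosD(5)[OF f] x])
 show "label R' (orbit (perm2 R') (f x)) = label R (orbit (perm2 R) x)"
  using isosD(7)[OF f] x unfolding 1[symmetric] boundaries_def by blast
qed

lemma isosI:
 assumes r: "is_ribbon_graph R" and "f \<in> extensional (halfedges R)" "bij_betw f (halfedges R) (halfedges R')"
  "!!e. e \<in> halfedges R ==> f (perm0 R e) = perm0 R' (f e)" "!!e. e \<in> halfedges R ==> f (perm1 R e) = perm1 R' (f e)"
  and 2: "!!e. e \<in> halfedges R ==> f (perm2 R e) = perm2 R' (f e)" and "!!e. e \<in> halfedges R ==> direction R' (f e) = direction R e"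
  and l: "!!x. x \<in> halfedges R ==> label R' (orbit (perm2 R') (f x)) = label R (orbit (perm2 R) x)"
 shows "f \<in> isos R R'"
proof -
 have "label R' (f ` \<beta>) = label R \<beta>" if "\<beta> \<in> boundaries R" for \<beta>
  using that l iso_orbit[where H="halfedges R" and s="perm2 R" and s'="perm2 R'" and f=f, OF rgD(7)[OF r] 2] by (auto simp: boundaries_def)
 then show ?thesis using assms by (simp add: isos_def)
qed

lemma isos_id: "is_ribbon_graph R ==> (\<lambda>x\<in>halfedges R. x) \<in> isos R R"
proof -
 assume r: "is_ribbon_graph R"
 note r' = rgD[OF r]
 show ?thesis
 proof (rule isosI[OF r])
  show "bij_betw (\<lambda>x\<in>halfedges R. x) (halfedges R) (halfedges R)"
   by (subst bij_betw_restrict_eq) (simp add: bij_betw_def)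
 qed (use r' in auto)
qed

lemma isos_compose:
 assumes r: "is_ribbon_graph R" and f: "f \<in> isos R R'" and r'': "is_ribbon_graph R'" and g: "g \<in> isos R' R''"
 shows "compose (halfedges R) g f \<in> isos R R''"
proof (rule isosI[OF r])
 note F = isosD[OF f] and G = isosD[OF g]
 show "bij_betw (compose (halfedges R) g f) (halfedges R) (halfedges R'')"
  using F(2) G(2) by (rule bij_betw_compose)
 fix x assume x: "x \<in> halfedges R"
 show "label R'' (orbit (perm2 R'') (compose (halfedges R) g f x)) = label R (orbit (perm2 R) x)"
  using x F(8)[OF x] isos_orbit(2)[OF r f x] isos_orbit(2)[OF r'' g, of "f x"] by (simp add: compose_def)
qed (use isosD[OF f] isosD[OF g] rgD(5-7)[OF r] in \<open>auto simp: compose_def\<close>)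

lemma isos_inverse:
 assumes r: "is_ribbon_graph R" and f: "f \<in> isos R R'" and r': "is_ribbon_graph R'"
 shows "(\<lambda>x\<in>halfedges R'. inv_into (halfedges R) f x) \<in> isos R' R"
proof -
 note F = isosD[OF f]
 let ?g = "\<lambda>x\<in>halfedges R'. inv_into (halfedges R) f x"
 have im: "halfedges R' = f ` halfedges R" using F(2) by (simp add: bij_betw_def)
 have g: "?g (f x) = x" if "x \<in> halfedges R" for x using F(2,8) that by (auto simp: bij_betw_def inv_into_f_f)
 show ?thesis
 proof (rule isosI[OF r'])
  show "bij_betw ?g (halfedges R') (halfedges R)"
   by (subst bij_betw_restrict_eq) (rule bij_betw_inv_into[OF F(2)])
  fix y assume "y \<in> halfedges R'"
  then obtain x where x: "y = f x" "x \<in> halfedges R" using im by auto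
  show "?g (perm0 R' y) = perm0 R (?g y)" "?g (perm1 R' y) = perm1 R (?g y)" "?g (perm2 R' y) = perm2 R (?g y)"
   "direction R (?g y) = direction R' y"
   unfolding x(1) g[OF x(2)] F(3-5)[OF x(2), symmetric] F(6)[OF x(2)] by (rule g rgD(5-7)[OF r x(2)] refl)+
  show "label R (orbit (perm2 R) (?g y)) = label R' (orbit (perm2 R') y)"
   unfolding x(1) g[OF x(2)] isos_orbit(2)[OF r f x(2)] ..
 qed simp
qed

text \<open>Composition with one isomorphism identifies the automorphisms of \<open>R'\<close> with
  all isomorphisms from \<open>R\<close> to \<open>R'\<close>.\<close>

lemma card_isos:
 assumes r: "is_ribbon_graph R" and f: "f \<in> isos R R'" and r': "is_ribbon_graph R'"
 shows "card (isos R R') = card (auts R')"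
proof -
 let ?g = "\<lambda>x\<in>halfedges R'. inv_into (halfedges R) f x"
 note F = isosD[OF f]
 note g = isos_inverse[OF assms]
 have gf: "?g (f x) = x" if "x \<in> halfedges R" for x using F(2,8) that by (auto simp: bij_betw_def inv_into_f_f)
 have fg: "f (?g y) = y" "?g y \<in> halfedges R" if "y \<in> halfedges R'" for y
  using F(2) that isosD(8)[OF g] by (auto simp: bij_betw_def f_inv_into_f)
 have "bij_betw (%h. compose (halfedges R) h f) (auts R') (isos R R')"
 proof (rule bij_betw_byWitness[where f'="%h. compose (halfedges R') h ?g"])
  show "\<forall>h\<in>auts R'. compose (halfedges R') (compose (halfedges R) h f) ?g = h"
  proof
   fix h assume h: "h \<in> auts R'"
   show "compose (halfedges R') (compose (halfedges R) h f) ?g = h"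
    by (rule extensionalityI[OF compose_extensional isosD(1)[OF h]]) (use fg in \<open>simp add: compose_def\<close>)
  qed
  show "\<forall>h\<in>isos R R'. compose (halfedges R) (compose (halfedges R') h ?g) f = h"
  proof
   fix h assume h: "h \<in> isos R R'"
   show "compose (halfedges R) (compose (halfedges R') h ?g) f = h"
    by (rule extensionalityI[OF compose_extensional isosD(1)[OF h]]) (use gf F(8) in \<open>simp add: compose_def\<close>)
  qed
  show "(%h. compose (halfedges R) h f) ` auts R' \<subseteq> isos R R'" using isos_compose[OF r f r'] by auto
  show "(%h. compose (halfedges R') h ?g) ` isos R R' \<subseteq> auts R'" using isos_compose[OF r' g r] by auto
 qed
 then show ?thesis by (simp add: bij_betw_same_card)
qed

subsection \<open>The structure on the positive half-edges\<close>

lemma permutes_if: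
 assumes "finite E" "inj_on f E" "!!e. e \<in> E ==> f e \<in> E"
 shows "(%e. if e \<in> E then f e else e) permutes E"
proof (rule bij_imp_permutes)
 have "f ` E = E" using assms by (intro endo_inj_surj) auto
 then have "bij_betw f E E" using assms(2) by (simp add: bij_betw_def)
 then show "bij_betw (%e. if e \<in> E then f e else e) E E" by (subst bij_betw_cong[where g=f]) auto
qed auto

text \<open>For a positive half-edge \<open>e\<close> the half-edge \<open>perm1 e\<close> is
  negative; the square of \<open>perm0\<close> leads to the opposite half-edge of its vertex, which
  is negative too, and \<open>perm1\<close> returns to a positive one. So \<open>tu\<close> pairs
  the two edges whose negative half-edges meet at a vertex. The composite of the two permutations is
  \<open>perm0 o perm1\<close>, conjugate under \<open>perm1\<close> to the inverse of
  \<open>perm2\<close> on negative half-edges; its cycles are the negative boundary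
  components.\<close>

definition str_of :: "'h directed_ribbon_graph => ('h, nat) rstruct" where
 "str_of R = (%e. if e \<in> Epos R then perm2 R e else e,
  %e. if e \<in> Epos R then perm1 R (perm0 R (perm0 R (perm1 R e))) else e,
  \<lambda>e\<in>Epos R. label R (orbit (perm2 R) e), \<lambda>e\<in>Epos R. label R (orbit (perm2 R) (perm1 R e)))"

lemma EposD:
 assumes "fv_rg np nm R" "e \<in> Epos R"
 shows "e \<in> halfedges R" "perm1 R e \<in> halfedges R" "perm2 R e \<in> Epos R" "perm0 R (perm1 R e) \<in> Epos R"
  "perm1 R (perm0 R (perm0 R (perm1 R e))) \<in> Epos R" "perm1 R (perm2 R (perm1 R e)) \<in> Epos R" "perm1 R e ~: Epos R"
proof -
 have r: "is_ribbon_graph R" and d: "is_direction R (direction R)" using assms by (auto simp: fv_rg_def)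
 note d' = directionD(2-4)[OF r d]
 show h: "e \<in> halfedges R" "perm1 R e \<in> halfedges R" using assms(2) rgD(6)[OF r] by (auto simp: Epos_def)
 show "perm2 R e \<in> Epos R" "perm0 R (perm1 R e) \<in> Epos R"
  "perm1 R (perm0 R (perm0 R (perm1 R e))) \<in> Epos R" "perm1 R (perm2 R (perm1 R e)) \<in> Epos R" "perm1 R e ~: Epos R"
  using assms(2) h rgD(5-7)[OF r] by (simp_all add: Epos_def d')
qed

lemma str_of_strs:
 assumes R: "fv_rg np nm R" "connected_rg R"
 shows "str_of R \<in> strs (Epos R) {} {..<np} {..<nm}"
proof -
 have r: "is_ribbon_graph R" and d: "is_direction R (direction R)" and f: "four_valent R"
  and b: "bij_betw (label R) (signed_boundaries R 1) {..<np}" "bij_betw (label R) (signed_boundaries R (-1)) {..<nm}"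
  using R by (auto simp: fv_rg_def)
 note r' = rgD[OF r] and E = EposD[OF R(1)] and sb = signed_boundaries_eq[OF r d]
 define sg tu rh where "sg = (%e. if e \<in> Epos R then perm2 R e else e)"
  and "tu = (%e. if e \<in> Epos R then perm1 R (perm0 R (perm0 R (perm1 R e))) else e)"
  and "rh = (%e. if e \<in> Epos R then perm0 R (perm1 R e) else e)"
 have fin: "finite (Epos R)" by (rule card_Epos(2)[OF r d])
 have inj: "perm0 R x = perm0 R y \<longleftrightarrow> x = y" "perm1 R x = perm1 R y \<longleftrightarrow> x = y" "perm2 R x = perm2 R y \<longleftrightarrow> x = y" for x y
  using r'(13-15) by (auto simp: inj_eq)
 have psg: "sg permutes Epos R" unfolding sg_def by (rule permutes_if[OF fin]) (use E inj in \<open>auto simp: inj_on_def\<close>)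
 have ptu: "tu permutes Epos R" unfolding tu_def by (rule permutes_if[OF fin]) (use E inj in \<open>auto simp: inj_on_def\<close>)
 have prh: "rh permutes Epos R" unfolding rh_def by (rule permutes_if[OF fin]) (use E inj in \<open>auto simp: inj_on_def\<close>)
 have sgtu: "sg o tu = rh" using E(5) r'(10) by (auto simp: sg_def tu_def rh_def fun_eq_iff)
 \<comment> \<open>The inverse of \<open>rh\<close> is \<open>perm1 o perm2 o perm1\<close>; a
   finite set closed under \<open>rh\<close> is closed under it.\<close>
 have rh_inv: "perm1 R (perm2 R (perm1 R z)) \<in> S" if S: "S \<subseteq> Epos R" "!!x. x \<in> S ==> rh x \<in> S" "z \<in> S" for S z
 proof (rule perm_invariant_inv[where f=rh])
  show "finite S" using S fin finite_subset by blast
  show "inj rh" by (rule permutes_inj[OF prh])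
  have "perm1 R (perm2 R (perm1 R z)) \<in> Epos R" using E(6) S by auto
  then show "rh (perm1 R (perm2 R (perm1 R z))) \<in> S" using S(3) by (simp add: rh_def r'(8,11))
 qed (use S in auto)
 have c1: "cyc_label (Epos R) sg (\<lambda>e\<in>Epos R. label R (orbit (perm2 R) e)) {..<np}"
  unfolding cyc_label_def
 proof (intro conjI allI impI)
  have "(\<lambda>e\<in>Epos R. label R (orbit (perm2 R) e)) ` Epos R = label R ` signed_boundaries R 1" by (simp add: sb(1) image_image)
  then show "(\<lambda>e\<in>Epos R. label R (orbit (perm2 R) e)) ` Epos R = {..<np}" using b(1) by (simp add: bij_betw_def)
  show "\<forall>x\<in>Epos R. (\<lambda>e\<in>Epos R. label R (orbit (perm2 R) e)) (sg x) = (\<lambda>e\<in>Epos R. label R (orbit (perm2 R) e)) x"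
   using E(3) orbit_eq[OF r'(1,4) orbit.base] by (simp add: sg_def)
  fix S x y assume S: "S \<subseteq> Epos R" "sg ` S \<subseteq> S" "x \<in> S" "y \<in> Epos R"
   and eq: "(\<lambda>e\<in>Epos R. label R (orbit (perm2 R) e)) y = (\<lambda>e\<in>Epos R. label R (orbit (perm2 R) e)) x"
  have "label R (orbit (perm2 R) y) = label R (orbit (perm2 R) x)" using eq S by auto
  then have "orbit (perm2 R) y = orbit (perm2 R) x"
   by (rule inj_onD[OF bij_betw_imp_inj_on[OF b(1)]]) (use S in \<open>auto simp: sb(1)\<close>)
  then have "y \<in> orbit (perm2 R) x" using orbit_self[OF r'(1,4), of y] by simp
  then show "y \<in> S" by (rule orbit_invariant) (use S(1-3) in \<open>fastforce simp: sg_def\<close>)+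
 qed (use psg in auto)
 have c2: "cyc_label (Epos R) rh (\<lambda>e\<in>Epos R. label R (orbit (perm2 R) (perm1 R e))) {..<nm}"
  unfolding cyc_label_def
 proof (intro conjI allI impI)
  have "(\<lambda>e\<in>Epos R. label R (orbit (perm2 R) (perm1 R e))) ` Epos R = label R ` signed_boundaries R (-1)" by (simp add: sb(2) image_image)
  then show "(\<lambda>e\<in>Epos R. label R (orbit (perm2 R) (perm1 R e))) ` Epos R = {..<nm}" using b(2) by (simp add: bij_betw_def)
  show "\<forall>x\<in>Epos R. (\<lambda>e\<in>Epos R. label R (orbit (perm2 R) (perm1 R e))) (rh x) = (\<lambda>e\<in>Epos R. label R (orbit (perm2 R) (perm1 R e))) x"
  proof
   fix x assume x: "x \<in> Epos R"
   have "orbit (perm2 R) (perm1 R (perm0 R (perm1 R x))) = orbit (perm2 R) (perm1 R x)"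
    using orbit_eq[OF r'(1,4) orbit.base, of "perm1 R (perm0 R (perm1 R x))"] by (simp add: r'(10))
   then show "(\<lambda>e\<in>Epos R. label R (orbit (perm2 R) (perm1 R e))) (rh x) = (\<lambda>e\<in>Epos R. label R (orbit (perm2 R) (perm1 R e))) x"
    using x E(4) by (simp add: rh_def)
  qed
  fix S x y assume S: "S \<subseteq> Epos R" "rh ` S \<subseteq> S" "x \<in> S" "y \<in> Epos R"
   and eq: "(\<lambda>e\<in>Epos R. label R (orbit (perm2 R) (perm1 R e))) y = (\<lambda>e\<in>Epos R. label R (orbit (perm2 R) (perm1 R e))) x"
  have "label R (orbit (perm2 R) (perm1 R y)) = label R (orbit (perm2 R) (perm1 R x))" using eq S by auto
  then have "orbit (perm2 R) (perm1 R y) = orbit (perm2 R) (perm1 R x)"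
   by (rule inj_onD[OF bij_betw_imp_inj_on[OF b(2)]]) (use S in \<open>auto simp: sb(2)\<close>)
  then have "perm1 R y \<in> orbit (perm2 R) (perm1 R x)" using orbit_self[OF r'(1,4), of "perm1 R y"] by simp
  then have "perm1 R y \<in> perm1 R ` S"
  proof (rule orbit_invariant)
   fix z assume "z \<in> perm1 R ` S"
   then obtain w where w: "z = perm1 R w" "w \<in> S" by auto
   have "perm1 R (perm2 R (perm1 R w)) \<in> S" by (rule rh_inv[OF S(1) _ w(2)]) (use S in auto)
   then show "perm2 R z \<in> perm1 R ` S" unfolding w(1) using r'(8) by (metis imageI)
  qed (use S in auto)
  then show "y \<in> S" using inj by auto
 qed (use prh in auto)
 show ?thesis
  unfolding str_of_def sg_def[symmetric] tu_def[symmetric]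
 proof (rule strsI[OF c1 _ ptu])
  show "cyc_label (Epos R) (sg o tu) (\<lambda>e\<in>Epos R. label R (orbit (perm2 R) (perm1 R e))) {..<nm}" unfolding sgtu by (rule c2)
  have 4: "perm0 R (perm0 R (perm0 R (perm0 R x))) = x" "perm0 R (perm0 R x) ~= x" if "x \<in> halfedges R" for x
   using f that by (auto simp: four_valent_iff[OF r])
  show "tu (tu x) = x" if "x \<in> Epos R" for x using that E(5)[OF that] 4(1)[OF E(2)[OF that]] by (simp add: tu_def r'(8))
  show "{x \<in> Epos R. tu x = x} = {}"
   using 4(2)[OF E(2)] r'(8) by (auto simp: tu_def) metis
  show "conn (Epos R) sg tu"
  proof (rule connI)
   fix S assume S: "S \<subseteq> Epos R" "S ~= {}" "!!x. x \<in> S ==> sg x \<in> S" "!!x. x \<in> S ==> tu x \<in> S"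
   have rhS: "rh x \<in> S" if "x \<in> S" for x using S that unfolding sgtu[symmetric] by simp
   have "S Un perm1 R ` S = halfedges R"
   proof (rule R(2)[unfolded connected_rg_iff[OF r], rule_format])
    show "S Un perm1 R ` S \<subseteq> halfedges R" using S(1) E(1,2) by auto
    show "S Un perm1 R ` S ~= {}" using S by auto
    show "perm1 R x \<in> S Un perm1 R ` S" if "x \<in> S Un perm1 R ` S" for x using that r'(8) by auto
    fix x assume "x \<in> S Un perm1 R ` S"
    then show "perm2 R x \<in> S Un perm1 R ` S"
    proof
     assume "x \<in> S"
     then show ?thesis using S(1) S(3)[of x] by (auto simp: sg_def split: if_splits)
    next
     assume "x \<in> perm1 R ` S"
     then obtain w where w: "x = perm1 R w" "w \<in> S" by auto
     have "perm1 R (perm2 R (perm1 R w)) \<in> S" by (rule rh_inv[OF S(1) rhS w(2)])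
     then show ?thesis unfolding w(1) using r'(8) by (metis imageI UnI2)
    qed
   qed
   then show "S = Epos R" using S(1) E(1,7) by blast
  qed
 qed
qed

subsection \<open>Volumes of spaces of metrics\<close>

text \<open>Every edge borders one positive and one negative boundary component, those of its two
  half-edges, so the boundary-length equations form a bipartite system. A lattice basis exists,
  hence the choices by \<open>SOME\<close> are genuine, and \<open>vol_eq\<close> allows any basis
  and any solution; if there are no metrics, both volumes vanish.\<close>

lemma vol_Met_eq:
 assumes R: "fv_rg np nm R"
 shows "ennreal (vol_Met R Lp Lm) = svol (Epos R) ((!) Lp) ((!) Lm) (str_of R)"
proof -
 have r: "is_ribbon_graph R" and d: "is_direction R (direction R)"
  and b: "bij_betw (label R) (signed_boundaries R 1) {..<np}" "bij_betw (label R) (signed_boundaries R (-1)) {..<nm}"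
  using R by (auto simp: fv_rg_def)
 note r' = rgD[OF r] and E = EposD[OF R] and sb = signed_boundaries_eq[OF r d] and d' = directionD[OF r d]
 have fin: "finite (Epos R)" by (rule card_Epos(2)[OF r d])
 let ?fi = "orbit (perm1 R)"
 note o1 = orbit_perm1[OF r]
 have fiinj: "inj_on ?fi (Epos R)" using E(7) by (auto simp: inj_on_def o1 doubleton_eq_iff)
 have other: "perm1 R x \<in> Epos R" if "x \<in> halfedges R" "x ~: Epos R" for x
  using that d'(1,3)[OF that(1)] r'(6) by (auto simp: Epos_def)
 have edges: "edges R = ?fi ` Epos R"
 proof
  show "?fi ` Epos R \<subseteq> edges R" using E(1) by (auto simp: edges_def)
  show "edges R \<subseteq> ?fi ` Epos R"
  proof
   fix a assume "a \<in> edges R"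
   then obtain x where x: "a = ?fi x" "x \<in> halfedges R" by (auto simp: edges_def)
   have "?fi (perm1 R x) = ?fi x" by (auto simp: o1 r'(8))
   then show "a \<in> ?fi ` Epos R" using x other[OF x(2)] by (metis imageI)
  qed
 qed
 have bfi: "bij_betw ?fi (Epos R) (edges R)" using fiinj edges by (simp add: bij_betw_def)
 have fine: "finite (edges R)" using edges fin by simp
 let ?ki = "inv_into (Epos R) ?fi"
 have ki: "?ki (?fi e) = e" if "e \<in> Epos R" for e using fiinj that by (simp add: inv_into_f_f)
 define P Q where "P a = label R (orbit (perm2 R) (?ki a))" and "Q a = label R (orbit (perm2 R) (perm1 R (?ki a)))" for a
 have sv: "svol (Epos R) ((!) Lp) ((!) Lm) (str_of R) = vol (edges R) P Q ((!) Lp) ((!) Lm)"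
  unfolding str_of_def svol_def split_conv
  by (rule vol_reindex[OF fin bfi, where h=id and k=id]) (auto simp: P_def Q_def ki)
 have injp: "inj_on (label R) (signed_boundaries R 1)" "inj_on (label R) (signed_boundaries R (-1))" using b by (auto simp: bij_betw_def)
 have sbe: "orbit (perm2 R) e \<in> signed_boundaries R 1" "orbit (perm2 R) (perm1 R e) \<in> signed_boundaries R (-1)" if "e \<in> Epos R" for e
  using that sb by auto
 have disj: "orbit (perm2 R) e ~= orbit (perm2 R) (perm1 R e')" if "e \<in> Epos R" "e' \<in> Epos R" for e e'
  using sbe(1)[OF that(1)] sbe(2)[OF that(2)] sb(4) by auto
 have bsum_eq: "bsum (edges R) F m i = (\<Sum>e\<in>{e\<in>Epos R. F (?fi e) = i}. m (?fi e))" for F :: "'a set => nat" and m i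
  unfolding bsum_def
 proof (rule sum.reindex_cong[where l="?fi"])
  show "inj_on ?fi {e\<in>Epos R. F (?fi e) = i}" using fiinj by (rule inj_on_subset) auto
 qed (auto simp: edges)
 have lp: "boundary_length R m (orbit (perm2 R) e) = bsum (edges R) P m (P (?fi e))" if e: "e \<in> Epos R" for m e
  unfolding boundary_length_def bsum_eq
 proof (rule sum.cong[OF _ refl])
  have "(x \<in> halfedges R & orbit (perm2 R) x = orbit (perm2 R) e) = (x \<in> Epos R & label R (orbit (perm2 R) x) = label R (orbit (perm2 R) e))" for x
  proof
   assume x: "x \<in> halfedges R & orbit (perm2 R) x = orbit (perm2 R) e"
   then have "x \<in> orbit (perm2 R) e" using orbit_self[OF r'(1,4), of x] by simp
   then have "direction R x = 1" using d'(5)[OF E(1)[OF e]] e by (simp add: Epos_def)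
   then show "x \<in> Epos R & label R (orbit (perm2 R) x) = label R (orbit (perm2 R) e)" using x by (simp add: Epos_def)
  next
   assume x: "x \<in> Epos R & label R (orbit (perm2 R) x) = label R (orbit (perm2 R) e)"
   then show "x \<in> halfedges R & orbit (perm2 R) x = orbit (perm2 R) e"
    using inj_onD[OF injp(1)] sbe(1)[OF e] sbe(1)[of x] E(1) by blast
  qed
  then show "{x. x \<in> halfedges R & orbit (perm2 R) x = orbit (perm2 R) e} = {x \<in> Epos R. P (?fi x) = P (?fi e)}"
   using e ki by (auto simp: P_def)
 qed
 \<comment> \<open>On the negative side the half-edges of a component are the
   \<open>perm1\<close>-images of positive ones, and both halves have the length of their common
   edge.\<close>
 have lq: "boundary_length R m (orbit (perm2 R) (perm1 R e)) = bsum (edges R) Q m (Q (?fi e))" if e: "e \<in> Epos R" for m e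
  unfolding boundary_length_def bsum_eq
 proof (rule sum.reindex_cong[where l="perm1 R"])
  show "inj_on (perm1 R) {x \<in> Epos R. Q (?fi x) = Q (?fi e)}" using r'(14) by (rule inj_on_subset) auto
  show "{x. x \<in> halfedges R & orbit (perm2 R) x = orbit (perm2 R) (perm1 R e)} = perm1 R ` {x \<in> Epos R. Q (?fi x) = Q (?fi e)}"
  proof (intro Set.set_eqI iffI)
   fix x assume "x \<in> {x. x \<in> halfedges R & orbit (perm2 R) x = orbit (perm2 R) (perm1 R e)}"
   then have x: "x \<in> halfedges R" "orbit (perm2 R) x = orbit (perm2 R) (perm1 R e)" by auto
   then have "x ~: Epos R" using disj e by metis
   then have "perm1 R x \<in> {x \<in> Epos R. Q (?fi x) = Q (?fi e)}" using other[OF x(1)] x e ki r'(8) by (simp add: Q_def)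
   then show "x \<in> perm1 R ` {x \<in> Epos R. Q (?fi x) = Q (?fi e)}" using r'(8) by (metis imageI)
  next
   fix x assume "x \<in> perm1 R ` {x \<in> Epos R. Q (?fi x) = Q (?fi e)}"
   then obtain y where y: "x = perm1 R y" "y \<in> Epos R" "label R (orbit (perm2 R) (perm1 R y)) = label R (orbit (perm2 R) (perm1 R e))"
    using e ki by (auto simp: Q_def)
   have "orbit (perm2 R) (perm1 R y) = orbit (perm2 R) (perm1 R e)"
    by (rule inj_onD[OF injp(2) y(3)]) (use sbe(2) y e in auto)
   then show "x \<in> {x. x \<in> halfedges R & orbit (perm2 R) x = orbit (perm2 R) (perm1 R e)}" using y E(2) by auto
  qed
  show "m (?fi (perm1 R x)) = m (?fi x)" for x by (simp add: o1 r'(8) insert_commute)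
 qed
 have be: "(\<forall>a\<in>edges R. G a) \<longleftrightarrow> (\<forall>e\<in>Epos R. G (?fi e))" for G by (rule bij_betw_ball[OF bfi])
 have PQ: "P (?fi e) = label R (orbit (perm2 R) e)" "Q (?fi e) = label R (orbit (perm2 R) (perm1 R e))" if "e \<in> Epos R" for e
  using that by (simp_all add: P_def Q_def ki)
 have ker: "kernel_space R = bker (edges R) P Q"
  by (auto simp: kernel_space_def edge_functions_def bker_def sb(1-3) lp lq ball_Un be)
 have met: "Met R Lp Lm = {m \<in> bsol (edges R) P Q ((!) Lp) ((!) Lm). \<forall>a\<in>edges R. 0 < m a}"
  using PQ by (auto simp: Met_def edge_functions_def bsol_def sb(1,2) lp lq be)
 show ?thesis
 proof (cases "Met R Lp Lm = {}")
  case True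
  have "vol (edges R) P Q ((!) Lp) ((!) Lm) = 0" using vol_nonzeroD[OF fine] True met by blast
  then show ?thesis using True by (simp add: sv vol_Met_def)
 next
  case False
  define B where "B = (SOME B. is_int_basis B (kernel_lattice R))"
  define m0 where "m0 = (SOME m. m \<in> Met R Lp Lm)"
  have m0: "m0 \<in> Met R Lp Lm" unfolding m0_def using False by (simp add: some_in_eq)
  have kl: "kernel_lattice R = {m \<in> bker (edges R) P Q. \<forall>x. m x \<in> \<int>}" by (simp add: kernel_lattice_def ker)
  obtain J :: "'a set set" and v d where u: "ubasis (edges R) (bker (edges R) P Q) J v d" using ubasis_bker_exists[OF fine] by blast
  have bker_sum': "(%x. \<Sum>j\<in>I. c j * w j x) \<in> bker (edges R) P Q"
   if "finite I" "!!j. j \<in> I ==> w j \<in> bker (edges R) P Q" for I :: "'i set" and c :: "'i => real" and w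
   by (rule bker_sum[OF fine]) (use that in auto)
  have "\<exists>B. is_int_basis B {m \<in> bker (edges R) P Q. \<forall>x. m x \<in> \<int>}"
   by (rule ubasis_is_int_basis[OF u]) (intro bker_sum' ubasisD(2)[OF u] ubasisD(3)[OF u]; assumption)
  then have B: "is_int_basis B {m \<in> bker (edges R) P Q. \<forall>x. m x \<in> \<int>}" unfolding B_def kl by (rule someI_ex)
  obtain d' where u': "ubasis (edges R) (bker (edges R) P Q) B (%b. b) d'" using is_int_basis_ubasis[OF u B] by blast
  have finB: "finite B" by (rule ubasisD(2)[OF u'])
  have m0': "m0 \<in> bsol (edges R) P Q ((!) Lp) ((!) Lm)" using m0 met by auto
  let ?f = "%t a. m0 a + (\<Sum>b\<in>B. t b * b a)"
  have sol: "?f t \<in> bsol (edges R) P Q ((!) Lp) ((!) Lm)" for t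
   by (intro bsol_add[OF m0'] bker_sum' finB ubasisD(3)[OF u'])
  define A where "A = {t \<in> B \<rightarrow>\<^sub>E UNIV. ?f t \<in> Met R Lp Lm}"
  have A: "A = {t \<in> space (PL B). posi (edges R) (?f t) = 1}"
   using sol by (auto simp: A_def met posi_def space_PiM)
  have meas: "(%t. posi (edges R) (?f t)) \<in> borel_measurable (PL B)"
   using measurable_compose[OF vcomb_measurable[OF finB, of m0 "%b. b"] posi_measurable[OF fine]] by simp
  have setA: "A \<in> sets (PL B)" unfolding A using meas by measurable
  have "vol (edges R) P Q ((!) Lp) ((!) Lm) = (\<integral>\<^sup>+t. posi (edges R) (?f t) \<partial>PL B)"
   unfolding vol_eq[OF u' m0'] vint_def ..
  also have "... = (\<integral>\<^sup>+t. indicator A t \<partial>PL B)"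
   by (rule nn_integral_cong) (auto simp: A posi_def indicator_def)
  also have "... = emeasure (PL B) A" using setA by simp
  finally have v: "vol (edges R) P Q ((!) Lp) ((!) Lm) = emeasure (PL B) A" .
  have "vol_Met R Lp Lm = measure (PL B) A" by (simp add: vol_Met_def Let_def B_def[symmetric] m0_def[symmetric] A_def)
  moreover have "emeasure (PL B) A < \<infinity>" using vol_finite[OF fine, of P Q] unfolding v[symmetric] .
  ultimately show ?thesis unfolding sv v by (simp add: emeasure_eq_ennreal_measure)
 qed
qed

subsection \<open>The ribbon graph of a structure\<close>

text \<open>The edge \<open>e\<close> has the positive half-edge \<open>2 * e\<close> and the negative half-edge \<open>2 * e + 1\<close>.\<close>

abbreviation pinv :: "('a => 'b) => 'b => 'a" where
 "pinv \<equiv> inv_into UNIV"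

definition rg_of :: "nat set => (nat, nat) rstruct => nat directed_ribbon_graph" where
 "rg_of E = (%(sg, tu, p, q).
  \<lparr>halfedges = {x. x div 2 \<in> E},
   perm0 = (%x. if x div 2 \<in> E then if even x then Suc (2 * pinv sg (x div 2)) else 2 * sg (tu (x div 2)) else x),
   perm1 = (%x. if x div 2 \<in> E then if even x then Suc x else x - 1 else x),
   perm2 = (%x. if x div 2 \<in> E then if even x then 2 * sg (x div 2) else Suc (2 * tu (pinv sg (x div 2))) else x),
   direction = (%x. if even x then 1 else -1),
   label = (%\<beta>. let x = (SOME x. x \<in> \<beta>) in if even x then p (x div 2) else q (x div 2))\<rparr>)"

lemma half_cases:
 assumes "x div 2 \<in> (E :: nat set)"
 obtains e where "e \<in> E" "x = 2 * e" | e where "e \<in> E" "x = Suc (2 * e)"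
 using assms by (metis even_two_times_div_two odd_two_times_div_two_succ Suc_eq_plus1)

lemma rg_of_simps:
 assumes "e \<in> E"
 shows "perm0 (rg_of E (sg, tu, p, q)) (2 * e) = Suc (2 * pinv sg e)" "perm0 (rg_of E (sg, tu, p, q)) (Suc (2 * e)) = 2 * sg (tu e)"
  "perm1 (rg_of E (sg, tu, p, q)) (2 * e) = Suc (2 * e)" "perm1 (rg_of E (sg, tu, p, q)) (Suc (2 * e)) = 2 * e"
  "perm2 (rg_of E (sg, tu, p, q)) (2 * e) = 2 * sg e" "perm2 (rg_of E (sg, tu, p, q)) (Suc (2 * e)) = Suc (2 * tu (pinv sg e))"
  "direction (rg_of E (sg, tu, p, q)) (2 * e) = 1" "direction (rg_of E (sg, tu, p, q)) (Suc (2 * e)) = -1"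
 using assms by (auto simp: rg_of_def)

lemma halfedges_rg_of [simp]: "halfedges (rg_of E s) = {x. x div 2 \<in> E}"
 by (cases s) (simp add: rg_of_def)

lemma perm_outside_rg_of:
 "x div 2 ~: E ==> perm0 (rg_of E s) x = x" "x div 2 ~: E ==> perm1 (rg_of E s) x = x" "x div 2 ~: E ==> perm2 (rg_of E s) x = x"
 by (cases s; simp add: rg_of_def)+

lemma finite_half: "finite E ==> finite {x. x div 2 \<in> (E :: nat set)}"
proof -
 assume "finite E"
 then have "finite ((*) 2 ` E Un (%e. Suc (2 * e)) ` E)" by blast
 moreover have "{x. x div 2 \<in> E} \<subseteq> (*) 2 ` E Un (%e. Suc (2 * e)) ` E" by (auto elim!: half_cases)
 ultimately show ?thesis by (rule rev_finite_subset)
qed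

lemma Epos_rg_of: "Epos (rg_of E s) = (*) 2 ` E"
 by (cases s) (auto simp: Epos_def rg_of_def)

context
 fixes E :: "nat set" and sg tu p q np nm R
 assumes fin: "finite E" and S: "(sg, tu, p, q) \<in> strs E {} {..<np} {..<nm}"
 defines "R \<equiv> rg_of E (sg, tu, p, q)"
begin

lemma rg_of_perms:
 shows "e \<in> E ==> sg e \<in> E" "e \<in> E ==> pinv sg e \<in> E" "e \<in> E ==> tu e \<in> E" "pinv sg (sg e) = e" "sg (pinv sg e) = e" "tu (tu e) = e"
  "e \<in> E ==> tu e ~= e" "inj sg" "inj tu"
proof -
 note C = strsD[OF S] and D = cyc_labelD[OF strsD(1)[OF S]]
 show "e \<in> E ==> sg e \<in> E" "e \<in> E ==> tu e \<in> E" "tu (tu e) = e" "e \<in> E ==> tu e ~= e" "inj tu" using C D by auto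
 show "e \<in> E ==> pinv sg e \<in> E" using permutes_inv[OF D(1)] by (simp add: permutes_in_image)
 show "pinv sg (sg e) = e" "sg (pinv sg e) = e" "inj sg" using D(1) by (auto simp: permutes_inverses permutes_inj)
qed

lemma is_ribbon_graph_rg_of: "is_ribbon_graph R"
proof -
 note P = rg_of_perms
 have out: "x div 2 ~: E ==> perm0 R x = x" "x div 2 ~: E ==> perm1 R x = x" "x div 2 ~: E ==> perm2 R x = x" for x
  unfolding R_def by (rule perm_outside_rg_of; assumption)+
 have perm: "f permutes {x. x div 2 \<in> E}" if f: "!!x. x div 2 ~: E ==> f x = x" "!!x. x div 2 \<in> E ==> f x div 2 \<in> E"
   "!!x. x div 2 \<in> E ==> g (f x) = x" for f g :: "nat => nat"
 proof -
  have "(%x. if x \<in> {x. x div 2 \<in> E} then f x else x) permutes {x. x div 2 \<in> E}"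
  proof (rule permutes_if[OF finite_half[OF fin]])
   show "inj_on f {x. x div 2 \<in> E}" by (rule inj_on_inverseI[where g=g]) (use f(3) in auto)
  qed (use f(2) in auto)
  moreover have "(%x. if x \<in> {x. x div 2 \<in> E} then f x else x) = f" using f(1) by auto
  ultimately show ?thesis by simp
 qed
 note simps = rg_of_simps[where E=E and sg=sg and tu=tu and p=p and q=q, folded R_def]
 have "perm2 R (perm1 R (perm0 R x)) = x" for x
 proof (cases "x div 2 \<in> E")
  case True
  then show ?thesis by (rule half_cases) (simp_all add: simps P)
 qed (simp add: out)
 moreover have "perm0 R permutes {x. x div 2 \<in> E}"
 proof (rule perm[where g="%x. perm2 R (perm1 R x)"])
  fix x assume "x div 2 \<in> E"
  then show "perm0 R x div 2 \<in> E" "perm2 R (perm1 R (perm0 R x)) = x" by (rule half_cases; simp add: simps P)+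
 qed (rule out)
 moreover have "perm1 R permutes {x. x div 2 \<in> E}"
 proof (rule perm[where g="perm1 R"])
  fix x assume "x div 2 \<in> E"
  then show "perm1 R x div 2 \<in> E" "perm1 R (perm1 R x) = x" by (rule half_cases; simp add: simps P)+
 qed (rule out)
 moreover have "perm2 R permutes {x. x div 2 \<in> E}"
 proof (rule perm[where g="%x. perm1 R (perm0 R x)"])
  fix x assume "x div 2 \<in> E"
  then show "perm2 R x div 2 \<in> E" "perm1 R (perm0 R (perm2 R x)) = x" by (rule half_cases; simp add: simps P)+
 qed (rule out)
 moreover have "perm1 R (perm1 R x) = x & perm1 R x ~= x" if "x div 2 \<in> E" for x
  using that by (rule half_cases) (simp_all add: simps)
 ultimately show ?thesis
  using finite_half[OF fin] by (simp add: is_ribbon_graph_def fun_eq_iff R_def)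
qed

lemma is_direction_rg_of: "is_direction R (direction R)"
 unfolding is_direction_def
proof
 note simps = rg_of_simps[where E=E and sg=sg and tu=tu and p=p and q=q, folded R_def]
 fix x assume "x \<in> halfedges R"
 then have "x div 2 \<in> E" by (simp add: R_def)
 then show "direction R x \<in> {1, - 1} & direction R (perm2 R x) = direction R x & direction R (perm1 R x) = - direction R x"
  by (rule half_cases) (simp_all add: simps rg_of_perms)
qed

lemma four_valent_rg_of: "four_valent R"
 unfolding four_valent_iff[OF is_ribbon_graph_rg_of]
proof
 note simps = rg_of_simps[where E=E and sg=sg and tu=tu and p=p and q=q, folded R_def]
 fix x assume "x \<in> halfedges R"
 then have "x div 2 \<in> E" by (simp add: R_def)
 then show "perm0 R (perm0 R (perm0 R (perm0 R x))) = x & perm0 R (perm0 R x) ~= x"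
 proof (rule half_cases)
  fix e assume e: "e \<in> E" "x = 2 * e"
  have "sg (tu (pinv sg e)) ~= e" using rg_of_perms(2,5,7)[of "e"] rg_of_perms(7)[of "pinv sg e"] rg_of_perms(4) e by metis
  then show ?thesis using e by (simp add: simps rg_of_perms)
 qed (simp add: simps rg_of_perms)
qed

lemma orbit_even_rg_of:
 assumes e: "e \<in> E" and x: "x \<in> orbit (perm2 R) (2 * e)"
 shows "\<exists>d\<in>E. x = 2 * d & p d = p e"
proof -
 note simps = rg_of_simps[where E=E and sg=sg and tu=tu and p=p and q=q, folded R_def]
 have "x \<in> {x. \<exists>d\<in>E. x = 2 * d & p d = p e}"
  by (rule orbit_invariant[OF x]) (use e cyc_labelD(4,5)[OF strsD(1)[OF S]] in \<open>auto simp: simps\<close>)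
 then show ?thesis by simp
qed

lemma orbit_odd_rg_of:
 assumes e: "e \<in> E" and x: "x \<in> orbit (perm2 R) (Suc (2 * e))"
 shows "\<exists>d\<in>E. x = Suc (2 * d) & q d = q e"
proof -
 note simps = rg_of_simps[where E=E and sg=sg and tu=tu and p=p and q=q, folded R_def]
 have qi: "q (tu (pinv sg d)) = q d" if "d \<in> E" for d
  using cyc_labelD(4)[OF strsD(2)[OF S], of "tu (pinv sg d)"] rg_of_perms that by simp
 have "x \<in> {x. \<exists>d\<in>E. x = Suc (2 * d) & q d = q e}"
  by (rule orbit_invariant[OF x]) (use e rg_of_perms qi in \<open>auto simp: simps\<close>)
 then show ?thesis by simp
qed

text \<open>The label reads an arbitrary half-edge of the component; parity and the value of
  \<open>p\<close> or \<open>q\<close> are constant along the cycle, so the choice is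
  harmless.\<close>

lemma label_rg_of:
 assumes e: "e \<in> E"
 shows "label R (orbit (perm2 R) (2 * e)) = p e" "label R (orbit (perm2 R) (Suc (2 * e))) = q e"
proof -
 have some: "(SOME x. x \<in> orbit (perm2 R) y) \<in> orbit (perm2 R) y" for y using orbit_nonempty[of "perm2 R" y] by (simp add: some_in_eq)
 obtain d where "(SOME x. x \<in> orbit (perm2 R) (2 * e)) = 2 * d" "p d = p e" using orbit_even_rg_of[OF e some] by blast
 then show "label R (orbit (perm2 R) (2 * e)) = p e" by (simp add: R_def rg_of_def)
 obtain d where "(SOME x. x \<in> orbit (perm2 R) (Suc (2 * e))) = Suc (2 * d)" "q d = q e" using orbit_odd_rg_of[OF e some] by blast
 then show "label R (orbit (perm2 R) (Suc (2 * e))) = q e" by (simp add: R_def rg_of_def)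
qed

lemma fv_rg_rg_of: "fv_rg np nm R"
proof -
 note simps = rg_of_simps[where E=E and sg=sg and tu=tu and p=p and q=q, folded R_def]
 note r = is_ribbon_graph_rg_of
 note r' = rgD[OF r] and d = is_direction_rg_of
 have Ep: "Epos R = (*) 2 ` E" by (simp add: R_def Epos_rg_of)
 have sb: "signed_boundaries R 1 = (%e. orbit (perm2 R) (2 * e)) ` E" "signed_boundaries R (-1) = (%e. orbit (perm2 R) (Suc (2 * e))) ` E"
  using signed_boundaries_eq(1,2)[OF r d] by (auto simp: Ep image_image simps)
 have p1: "orbit (perm2 R) (2 * d) = orbit (perm2 R) (2 * e)" if ed: "e \<in> E" "d \<in> E" "p d = p e" for d e
 proof -
  have "d \<in> {d\<in>E. 2 * d \<in> orbit (perm2 R) (2 * e)}"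
  proof (rule cyc_label_inv[OF strsD(1)[OF S], where x=e])
   fix z assume "z \<in> {d\<in>E. 2 * d \<in> orbit (perm2 R) (2 * e)}"
   then show "sg z \<in> {d\<in>E. 2 * d \<in> orbit (perm2 R) (2 * e)}" using simps(5)[of z] rg_of_perms(1) orbit.step[of "2 * z" "perm2 R"] by auto
  qed (use ed orbit_self[OF r'(1,4), of "2 * e"] in auto)
  then show ?thesis using orbit_eq[OF r'(1,4)] by auto
 qed
 have q1: "orbit (perm2 R) (Suc (2 * d)) = orbit (perm2 R) (Suc (2 * e))" if ed: "e \<in> E" "d \<in> E" "q d = q e" for d e
 proof -
  have "d \<in> {d\<in>E. orbit (perm2 R) (Suc (2 * d)) = orbit (perm2 R) (Suc (2 * e))}"
  proof (rule cyc_label_inv[OF strsD(2)[OF S], where x=e])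
   fix z assume z: "z \<in> {d\<in>E. orbit (perm2 R) (Suc (2 * d)) = orbit (perm2 R) (Suc (2 * e))}"
   \<comment> \<open>Along negative components \<open>perm2\<close> runs against
     \<open>sg o tu\<close>.\<close>
   have "perm2 R (Suc (2 * sg (tu z))) = Suc (2 * z)" using z by (simp add: simps rg_of_perms)
   then have "orbit (perm2 R) (Suc (2 * z)) = orbit (perm2 R) (Suc (2 * sg (tu z)))"
    using orbit_eq[OF r'(1,4) orbit.base, of "Suc (2 * sg (tu z))"] by simp
   then show "(sg o tu) z \<in> {d\<in>E. orbit (perm2 R) (Suc (2 * d)) = orbit (perm2 R) (Suc (2 * e))}" using z rg_of_perms by simp
  qed (use ed in auto)
  then show ?thesis by auto
 qed
 have im: "p ` E = {..<np}" "q ` E = {..<nm}" using cyc_labelD(3)[OF strsD(1)[OF S]] cyc_labelD(3)[OF strsD(2)[OF S]] by auto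
 have "bij_betw (label R) (signed_boundaries R 1) {..<np}"
  unfolding bij_betw_def sb(1) image_image
 proof
  show "inj_on (label R) ((%e. orbit (perm2 R) (2 * e)) ` E)"
  proof (rule inj_onI, elim imageE)
   fix a b e d assume "label R a = label R b" "a = orbit (perm2 R) (2 * e)" "e \<in> E" "b = orbit (perm2 R) (2 * d)" "d \<in> E"
   then show "a = b" using p1[of e d] label_rg_of by metis
  qed
  show "(%e. label R (orbit (perm2 R) (2 * e))) ` E = {..<np}" unfolding im(1)[symmetric] by (rule image_cong[OF refl label_rg_of(1)])
 qed
 moreover have "bij_betw (label R) (signed_boundaries R (-1)) {..<nm}"
  unfolding bij_betw_def sb(2) image_image
 proof
  show "inj_on (label R) ((%e. orbit (perm2 R) (Suc (2 * e))) ` E)"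
  proof (rule inj_onI, elim imageE)
   fix a b e d assume "label R a = label R b" "a = orbit (perm2 R) (Suc (2 * e))" "e \<in> E" "b = orbit (perm2 R) (Suc (2 * d))" "d \<in> E"
   then show "a = b" using q1[of e d] label_rg_of by metis
  qed
  show "(%e. label R (orbit (perm2 R) (Suc (2 * e)))) ` E = {..<nm}" unfolding im(2)[symmetric] by (rule image_cong[OF refl label_rg_of(2)])
 qed
 ultimately show ?thesis unfolding fv_rg_def using r d four_valent_rg_of by blast
qed

lemma connected_rg_of: "connected_rg R"
 unfolding connected_rg_iff[OF is_ribbon_graph_rg_of]
proof (intro allI impI)
 note simps = rg_of_simps[where E=E and sg=sg and tu=tu and p=p and q=q, folded R_def]
 fix T assume T: "T \<subseteq> halfedges R" "T ~= {}" "\<forall>x\<in>T. perm1 R x \<in> T" "\<forall>x\<in>T. perm2 R x \<in> T"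
 have H: "halfedges R = {x. x div 2 \<in> E}" by (simp add: R_def)
 define A where "A = {e\<in>E. 2 * e \<in> T}"
 have A: "2 * e \<in> T & Suc (2 * e) \<in> T" if "e \<in> A" for e using that bspec[OF T(3), of "2 * e"] simps(3)[of e] by (simp add: A_def)
 have A': "e \<in> A" if "e \<in> E" "Suc (2 * e) \<in> T" for e using that bspec[OF T(3) that(2)] simps(4)[of e] by (simp add: A_def)
 have sgA: "sg e \<in> A" if "e \<in> A" for e using that bspec[OF T(4), of "2 * e"] simps(5)[of e] rg_of_perms(1)[of e] by (simp add: A_def)
 have finA: "finite A" using fin by (simp add: A_def)
 have tuA: "tu e \<in> A" if "e \<in> A" for e
 proof -
  have e: "e \<in> E" using that by (simp add: A_def)
  \<comment> \<open>\<open>tu\<close> is reached through the negative half-edges: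
    \<open>perm2\<close> takes that of \<open>sg e\<close> to that of \<open>tu e\<close>.\<close>
  have "Suc (2 * tu (pinv sg (sg e))) \<in> T" using bspec[OF T(4) conjunct2[OF A[OF sgA[OF that]]]] simps(6)[of "sg e"] rg_of_perms(1)[OF e] by simp
  then show ?thesis using A'[of "tu e"] rg_of_perms e by simp
 qed
 have "A = E"
 proof (rule connD[OF strsD(6)[OF S]])
  obtain x where x: "x \<in> T" using T by auto
  then have "x div 2 \<in> E" using T(1) H by auto
  then show "A ~= {}" by (rule half_cases) (use x A' in \<open>auto simp: A_def\<close>)
 qed (use sgA tuA in \<open>auto simp: A_def\<close>)
 then have "x \<in> T" if "x div 2 \<in> E" for x using that A by (elim half_cases) auto
 then show "T = halfedges R" using T(1) H by auto
qed

end

lemma rg_of_four_valent_graphs: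
 assumes "finite E" "s \<in> strs E {} {..<np} {..<nm}" "int (card E) = 2 * (2 * g - 2 + int np + int nm)"
 shows "rg_of E s \<in> four_valent_graphs g np nm"
proof -
 obtain sg tu p q where s: "s = (sg, tu, p, q)" by (cases s)
 have "card ((*) 2 ` E) = card E" by (rule card_image) (auto simp: inj_on_def)
 then show ?thesis
  using fv_rg_rg_of[OF assms(1) assms(2)[unfolded s]] connected_rg_of[OF assms(1) assms(2)[unfolded s]] assms(3)
  by (simp add: four_valent_graphs_iff s Epos_rg_of)
qed

section \<open>Counting the structures that represent a given graph\<close>

lemma card_bij_betw:
 assumes "finite E" "card E = card F" "finite F"
 shows "card {fi \<in> extensional E. bij_betw fi E F} = fact (card E)"
proof -
 obtain fi0 where b: "bij_betw fi0 E F" using assms by (metis finite_same_card_bij)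
 let ?ki = "inv_into E fi0"
 have ki: "bij_betw ?ki F E" by (rule bij_betw_inv_into[OF b])
 have ki': "?ki (fi0 e) = e" if "e \<in> E" for e using b that by (simp add: bij_betw_def inv_into_f_f)
 have fi': "fi0 (?ki e) = e" if "e \<in> F" for e using b that by (auto simp: bij_betw_def f_inv_into_f)
 have "bij_betw (%pm. \<lambda>e\<in>E. fi0 (pm e)) {pm. pm permutes E} {fi \<in> extensional E. bij_betw fi E F}"
 proof (rule bij_betw_byWitness[where f'="%fi e. if e \<in> E then ?ki (fi e) else e"])
  show "\<forall>pm\<in>{pm. pm permutes E}. (%e. if e \<in> E then ?ki ((\<lambda>e\<in>E. fi0 (pm e)) e) else e) = pm"
   using ki' by (auto simp: fun_eq_iff permutes_in_image permutes_not_in)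
  show "\<forall>fi\<in>{fi \<in> extensional E. bij_betw fi E F}. (\<lambda>e\<in>E. fi0 (if e \<in> E then ?ki (fi e) else e)) = fi"
  proof
   fix fi assume "fi \<in> {fi \<in> extensional E. bij_betw fi E F}"
   then show "(\<lambda>e\<in>E. fi0 (if e \<in> E then ?ki (fi e) else e)) = fi"
    using fi' by (intro extensionalityI[where A=E]) (auto simp: bij_betw_def)
  qed
  have "bij_betw (\<lambda>e\<in>E. fi0 (pm e)) E F" if "pm permutes E" for pm
   using bij_betw_trans[OF permutes_imp_bij[OF that] b] by (subst bij_betw_restrict_eq) (simp add: comp_def)
  then show "(%pm. \<lambda>e\<in>E. fi0 (pm e)) ` {pm. pm permutes E} \<subseteq> {fi \<in> extensional E. bij_betw fi E F}" by auto
  have "(%e. if e \<in> E then ?ki (fi e) else e) permutes E" if "bij_betw fi E F" for fi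
   using bij_betw_trans[OF that ki] by (intro permutes_if assms(1)) (auto simp: bij_betw_def comp_def)
  then show "(%fi e. if e \<in> E then ?ki (fi e) else e) ` {fi \<in> extensional E. bij_betw fi E F} \<subseteq> {pm. pm permutes E}" by auto
 qed
 then have "card {pm. pm permutes E} = card {fi \<in> extensional E. bij_betw fi E F}" by (rule bij_betw_same_card)
 then show ?thesis using card_permutations[OF refl assms(1)] by simp
qed

text \<open>Isomorphisms commute with \<open>perm1\<close>, so their values on positive half-edges
  determine them by this formula.\<close>

definition extend_iso :: "nat set => (nat => 'h) => 'h directed_ribbon_graph => nat => 'h" where
 "extend_iso E fi R = (\<lambda>x\<in>{x. x div 2 \<in> E}. if even x then fi (x div 2) else perm1 R (fi (x div 2)))"

context
 fixes E :: "nat set" and np nm :: nat and R :: "'h directed_ribbon_graph" and s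
 assumes fin: "finite E" and R: "fv_rg np nm R" and s: "s \<in> strs E {} {..<np} {..<nm}"
begin

text \<open>Together with \<open>transp_iso\<close>: isomorphisms from the graph of \<open>s\<close>
  to \<open>R\<close> are the same as bijections of edges that carry \<open>s\<close> to
  \<open>str_of R\<close>. For the involution \<open>tu\<close> the commutation with
  \<open>perm0\<close> is used twice, to reach the opposite half-edge.\<close>

lemma iso_transp:
 assumes f: "f \<in> isos (rg_of E s) R"
 defines "fi \<equiv> \<lambda>e\<in>E. f (2 * e)"
 shows "bij_betw fi E (Epos R)" "transp E fi (Epos R) id id s = str_of R" "extend_iso E fi R = f"
proof -
 obtain sg tu p q where s': "s = (sg, tu, p, q)" by (cases s)
 note S = s[unfolded s']
 define G where "G = rg_of E (sg, tu, p, q)"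
 note simps = rg_of_simps[where E=E and sg=sg and tu=tu and p=p and q=q, folded G_def]
 note P = rg_of_perms[OF fin S]
 have r: "is_ribbon_graph R" and d: "is_direction R (direction R)" using R by (auto simp: fv_rg_def)
 have rG: "is_ribbon_graph G" unfolding G_def by (rule is_ribbon_graph_rg_of[OF fin S])
 have fG: "f \<in> isos G R" using f by (simp add: G_def s')
 note F = isosD[OF fG]
 have H: "x \<in> halfedges G \<longleftrightarrow> x div 2 \<in> E" for x by (simp add: G_def)
 have H2: "2 * e \<in> halfedges G" "Suc (2 * e) \<in> halfedges G" if "e \<in> E" for e using that by (simp_all add: H)
 have fi: "fi e = f (2 * e)" if "e \<in> E" for e using that by (simp add: fi_def)
 have fo: "f (Suc (2 * e)) = perm1 R (fi e)" if "e \<in> E" for e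
  using F(4)[OF H2(1)[OF that]] that by (simp add: simps fi)
 show b: "bij_betw fi E (Epos R)"
  unfolding bij_betw_def
 proof
  show "inj_on fi E"
  proof (rule inj_onI)
   fix e d assume "e \<in> E" "d \<in> E" "fi e = fi d"
   then have "2 * e = 2 * d" using F(2) H2(1) by (intro inj_onD[OF bij_betw_imp_inj_on[OF F(2)]]) (simp_all add: fi)
   then show "e = d" by simp
  qed
  show "fi ` E = Epos R"
  proof
   show "fi ` E \<subseteq> Epos R" using F(6,8)[OF H2(1)] by (auto simp: fi Epos_def simps)
   show "Epos R \<subseteq> fi ` E"
   proof
    fix y assume y: "y \<in> Epos R"
    then have "y \<in> f ` halfedges G" using F(2) by (simp add: bij_betw_def Epos_def)
    then obtain x where x: "y = f x" "x div 2 \<in> E" by (auto simp: H)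
    from x(2) show "y \<in> fi ` E"
    proof (rule half_cases)
     fix e assume "e \<in> E" "x = 2 * e"
     then show ?thesis using x(1) by (auto simp: fi)
    next
     fix e assume e: "e \<in> E" "x = Suc (2 * e)"
     then have "direction R y = -1" using F(6)[OF H2(2)[OF e(1)]] x(1) by (simp add: simps)
     then show ?thesis using y by (simp add: Epos_def)
    qed
   qed
  qed
 qed
 have im: "Epos R = fi ` E" using b by (simp add: bij_betw_def)
 have fiE: "fi e \<in> Epos R" "inv_into E fi (fi e) = e" if "e \<in> E" for e using b that by (auto simp: bij_betw_def inv_into_f_f)
 have 1: "fi (sg e) = perm2 R (fi e)" if "e \<in> E" for e
  using F(5)[OF H2(1)[OF that]] that P(1) by (simp add: simps fi)
 have 2: "fi (tu e) = perm1 R (perm0 R (perm0 R (perm1 R (fi e))))" if e: "e \<in> E" for e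
 proof -
  have "perm0 R (perm1 R (fi e)) = fi (sg (tu e))" using F(3)[OF H2(2)[OF e]] e P by (simp add: simps fi fo)
  moreover have "perm0 R (fi (sg (tu e))) = perm1 R (fi (tu e))"
   using F(3)[OF H2(1), of "sg (tu e)"] e P by (simp add: simps fi fo)
  ultimately show ?thesis by (simp add: rgD(8)[OF r])
 qed
 have 3: "label R (orbit (perm2 R) (fi e)) = p e" if e: "e \<in> E" for e
  using isos_orbit(2)[OF rG fG H2(1)[OF e]] label_rg_of(1)[OF fin S e] e by (simp add: fi G_def)
 have 4: "label R (orbit (perm2 R) (perm1 R (fi e))) = q e" if e: "e \<in> E" for e
  using isos_orbit(2)[OF rG fG H2(2)[OF e]] label_rg_of(2)[OF fin S e] e by (simp add: fo G_def)
 have "conjp E fi (Epos R) sg = (%e. if e \<in> Epos R then perm2 R e else e)"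
  using 1 fiE by (auto simp: conjp_def im fun_eq_iff)
 moreover have "conjp E fi (Epos R) tu = (%e. if e \<in> Epos R then perm1 R (perm0 R (perm0 R (perm1 R e))) else e)"
  using 2 fiE by (auto simp: conjp_def im fun_eq_iff)
 moreover have "(\<lambda>x\<in>Epos R. p (inv_into E fi x)) = (\<lambda>e\<in>Epos R. label R (orbit (perm2 R) e))"
  using 3 fiE by (auto simp: im intro!: restrict_ext)
 moreover have "(\<lambda>x\<in>Epos R. q (inv_into E fi x)) = (\<lambda>e\<in>Epos R. label R (orbit (perm2 R) (perm1 R e)))"
  using 4 fiE by (auto simp: im intro!: restrict_ext)
 ultimately show "transp E fi (Epos R) id id s = str_of R" by (simp add: s' transp_def str_of_def)
 show "extend_iso E fi R = f"
 proof (rule extensionalityI[where A="{x. x div 2 \<in> E}"])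
  show "f \<in> extensional {x. x div 2 \<in> E}" using F(1) by (simp add: G_def)
  fix x assume "x \<in> {x. x div 2 \<in> E}"
  then have x: "x div 2 \<in> E" by simp
  then show "extend_iso E fi R x = f x" by (rule half_cases) (simp_all add: extend_iso_def fi fo)
 qed (simp add: extend_iso_def)
qed

lemma transp_iso:
 assumes b: "bij_betw fi E (Epos R)" and t: "transp E fi (Epos R) id id s = str_of R"
 shows "extend_iso E fi R \<in> isos (rg_of E s) R"
proof -
 obtain sg tu p q where s': "s = (sg, tu, p, q)" by (cases s)
 note S = s[unfolded s']
 define G where "G = rg_of E (sg, tu, p, q)"
 note simps = rg_of_simps[where E=E and sg=sg and tu=tu and p=p and q=q, folded G_def]
 note P = rg_of_perms[OF fin S]
 have r: "is_ribbon_graph R" and d: "is_direction R (direction R)" using R by (auto simp: fv_rg_def)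
 note r' = rgD[OF r] and EE = EposD[OF R]
 have rG: "is_ribbon_graph G" unfolding G_def by (rule is_ribbon_graph_rg_of[OF fin S])
 define f where "f = extend_iso E fi R"
 have f: "f (2 * e) = fi e" "f (Suc (2 * e)) = perm1 R (fi e)" if "e \<in> E" for e using that by (simp_all add: f_def extend_iso_def)
 have im: "Epos R = fi ` E" using b by (simp add: bij_betw_def)
 have fiE: "fi e \<in> Epos R" "inv_into E fi (fi e) = e" if "e \<in> E" for e using b that by (auto simp: bij_betw_def inv_into_f_f)
 have t': "conjp E fi (Epos R) sg (fi e) = perm2 R (fi e)"
  "conjp E fi (Epos R) tu (fi e) = perm1 R (perm0 R (perm0 R (perm1 R (fi e))))"
  "label R (orbit (perm2 R) (fi e)) = p e" "label R (orbit (perm2 R) (perm1 R (fi e))) = q e" if e: "e \<in> E" for e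
  using t fiE[OF e] by (auto simp: s' transp_def str_of_def fun_eq_iff restrict_def dest!: spec[where x="fi e"])
 have 1: "fi (sg e) = perm2 R (fi e)" if "e \<in> E" for e using t'(1)[OF that] conjp_apply[OF b that] by simp
 have 2: "fi (sg (tu e)) = perm0 R (perm1 R (fi e))" if "e \<in> E" for e
  using 1[of "tu e"] t'(2)[OF that] conjp_apply[OF b that, of tu] P(3)[OF that] by (simp add: r'(10))
 have H: "x \<in> halfedges G \<longleftrightarrow> x div 2 \<in> E" for x by (simp add: G_def)
 have dir: "direction R (fi e) = 1" "direction R (perm1 R (fi e)) = -1" if "e \<in> E" for e
  using fiE(1)[OF that] directionD(3)[OF r d] by (auto simp: Epos_def)
 have "f \<in> isos G R"
 proof (rule isosI[OF rG])
  show "f \<in> extensional (halfedges G)" by (simp add: f_def extend_iso_def G_def)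
  show "bij_betw f (halfedges G) (halfedges R)"
   unfolding bij_betw_def
  proof
   have injfi: "fi e = fi d \<longleftrightarrow> e = d" if "e \<in> E" "d \<in> E" for e d using b that by (auto simp: bij_betw_def inj_on_def)
   have ne: "fi e ~= perm1 R (fi d)" if "e \<in> E" "d \<in> E" for e d using dir(1)[OF that(1)] dir(2)[OF that(2)] by auto
   show "inj_on f (halfedges G)"
   proof (rule inj_onI)
    fix x y assume "x \<in> halfedges G" "y \<in> halfedges G" and eq: "f x = f y"
    then have xy: "x div 2 \<in> E" "y div 2 \<in> E" by (simp_all add: H)
    show "x = y"
     by (rule half_cases[OF xy(1)]; rule half_cases[OF xy(2)])
      (use eq injfi ne ne[symmetric] r'(14) in \<open>auto simp: f inj_eq\<close>)
   qed
   show "f ` halfedges G = halfedges R"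
   proof
    show "f ` halfedges G \<subseteq> halfedges R"
     using EE(1,2)[OF fiE(1)] by (auto simp: H f elim!: half_cases)
    show "halfedges R \<subseteq> f ` halfedges G"
    proof
     fix y assume y: "y \<in> halfedges R"
     show "y \<in> f ` halfedges G"
     proof (cases "y \<in> Epos R")
      case True
      then obtain e where "e \<in> E" "y = fi e" using im by auto
      then have "y = f (2 * e)" "2 * e \<in> halfedges G" by (simp_all add: f H)
      then show ?thesis by blast
     next
      case False
      then have "perm1 R y \<in> Epos R" using y directionD(1,3)[OF r d y] r'(6) by (auto simp: Epos_def)
      then obtain e where e: "e \<in> E" "perm1 R y = fi e" using im by auto
      then have "y = f (Suc (2 * e))" "Suc (2 * e) \<in> halfedges G" using r'(8)[of y] by (simp_all add: f H)
      then show ?thesis by blast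
     qed
    qed
   qed
  qed
  fix x assume "x \<in> halfedges G"
  then have x: "x div 2 \<in> E" by (simp add: H)
  show "f (perm1 G x) = perm1 R (f x)" by (rule half_cases[OF x]) (simp_all add: f simps r'(8))
  show "direction R (f x) = direction G x" by (rule half_cases[OF x]) (simp_all add: f simps dir)
  show "f (perm0 G x) = perm0 R (f x)"
  proof (rule half_cases[OF x])
   fix e assume e: "e \<in> E" "x = 2 * e"
   have "perm1 R (fi (pinv sg e)) = perm0 R (fi e)"
    using 1[OF P(2)[OF e(1)]] r'(12)[of "fi (pinv sg e)"] P(5)[of e] by (metis r'(8))
   then show ?thesis using e P(2) by (simp add: f simps)
  qed (simp add: f simps 2 P)
  show "f (perm2 G x) = perm2 R (f x)"
  proof (rule half_cases[OF x])
   fix e assume e: "e \<in> E" "x = Suc (2 * e)"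
   have "fi e = perm0 R (perm1 R (fi (tu (pinv sg e))))" using 2[OF P(3)[OF P(2)[OF e(1)]]] P(5,6) by simp
   then have "perm2 R (perm1 R (fi e)) = perm1 R (fi (tu (pinv sg e)))" using r'(10) by simp
   then show ?thesis using e P(2,3) by (simp add: f simps)
  qed (simp add: f simps 1 P)
  show "label R (orbit (perm2 R) (f x)) = label G (orbit (perm2 G) x)"
   by (rule half_cases[OF x]) (simp_all add: f t'(3,4) label_rg_of[OF fin S, folded G_def])
 qed
 then show ?thesis by (simp add: f_def G_def s')
qed

end

lemma finite_isos: "finite (halfedges R) ==> finite (halfedges R') ==> finite (isos R R')"
proof (rule finite_subset)
 show "isos R R' \<subseteq> halfedges R \<rightarrow>\<^sub>E halfedges R'" 
 proof
  fix f assume f: "f \<in> isos R R'"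
  show "f \<in> halfedges R \<rightarrow>\<^sub>E halfedges R'"
   by (rule PiE_I) (erule isosD(8)[OF f], erule extensional_arb[OF isosD(1)[OF f]])
 qed
qed (intro finite_PiE)

lemma four_valent_graphsD:
 assumes "R \<in> four_valent_graphs g np nm"
 shows "fv_rg np nm R" "connected_rg R" "is_ribbon_graph R" "finite (halfedges R)" "finite (Epos R)" "card (auts R) > 0"
proof -
 show R: "fv_rg np nm R" "connected_rg R" using assms by (auto simp: four_valent_graphs_iff)
 then show r: "is_ribbon_graph R" by (simp add: fv_rg_def)
 show fin: "finite (halfedges R)" by (rule rgD(1)[OF r])
 show "finite (Epos R)" using fin by (simp add: Epos_def)
 show "card (auts R) > 0" using isos_id[OF r] finite_isos[OF fin fin] by (auto simp: card_gt_0_iff)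
qed

abbreviation iso_rel :: "int => nat => nat => nat directed_ribbon_graph rel" where
 "iso_rel g np nm \<equiv> {(R, R'). R \<in> four_valent_graphs g np nm & R' \<in> four_valent_graphs g np nm & isos R R' ~= {}}"

lemma equiv_iso_rel: "equiv (four_valent_graphs g np nm) (iso_rel g np nm)"
proof (rule equivI)
 note D = four_valent_graphsD(3)[of _ g np nm]
 show "iso_rel g np nm \<subseteq> four_valent_graphs g np nm \<times> four_valent_graphs g np nm" by auto
 show "refl_on (four_valent_graphs g np nm) (iso_rel g np nm)" using isos_id[OF D] by (auto simp: refl_on_def)
 show "sym (iso_rel g np nm)"
 proof (rule symI)
  fix R R' assume a: "(R, R') \<in> iso_rel g np nm"
  then obtain f where "f \<in> isos R R'" by auto
  then have "isos R' R ~= {}" using isos_inverse[of R f R'] D a by blast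
  then show "(R', R) \<in> iso_rel g np nm" using a by simp
 qed
 show "trans (iso_rel g np nm)"
 proof (rule transI)
  fix R R' R'' assume a: "(R, R') \<in> iso_rel g np nm" "(R', R'') \<in> iso_rel g np nm"
  then obtain f h where "f \<in> isos R R'" "h \<in> isos R' R''" by auto
  then have "isos R R'' ~= {}" using isos_compose[of R f R' h R''] D a by blast
  then show "(R, R'') \<in> iso_rel g np nm" using a by simp
 qed
qed

context
 fixes g :: int and np nm N :: nat
 assumes N: "int N = 2 * g - 2 + int np + int nm"
begin

lemma card_Epos_N: "R \<in> four_valent_graphs g np nm ==> card (Epos R) = 2 * N"
 using N by (simp add: four_valent_graphs_iff)

text \<open>Double counting of pairs of a structure and an isomorphism from its graph to
  \<open>R\<close>. A bijection from the names to the positive half-edges determines both, whence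
  (2N)! pairs; and each structure concerned has as many isomorphisms to \<open>R\<close> as
  \<open>R\<close> has automorphisms.\<close>

lemma card_strs_iso:
 assumes R: "R \<in> four_valent_graphs g np nm"
 shows "card {s \<in> strs {..<2*N} {} {..<np} {..<nm}. isos (rg_of {..<2*N} s) R ~= {}} * card (auts R) = fact (2 * N)"
proof -
 note D = four_valent_graphsD[OF R]
 let ?E = "{..<2*N}" and ?S = "strs {..<2*N} {} {..<np} {..<nm}"
 have finE: "finite ?E" by simp
 have G: "rg_of ?E s \<in> four_valent_graphs g np nm" if "s \<in> ?S" for s
  by (rule rg_of_four_valent_graphs[OF finE that]) (use N in simp)
 have fini: "finite (isos (rg_of ?E s) R)" if "s \<in> ?S" for s
  by (rule finite_isos[OF four_valent_graphsD(4)[OF G[OF that]] D(4)])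
 note it = iso_transp[OF finE D(1)] and ti = transp_iso[OF finE D(1)]
 have id: "inj_on id A" for A :: "nat set" by simp
 have "bij_betw (%(s, f). \<lambda>e\<in>?E. f (2 * e)) (SIGMA s:?S. isos (rg_of ?E s) R) {fi \<in> extensional ?E. bij_betw fi ?E (Epos R)}"
 proof (rule bij_betw_imageI)
  show "inj_on (%(s, f). \<lambda>e\<in>?E. f (2 * e)) (SIGMA s:?S. isos (rg_of ?E s) R)"
  proof (rule inj_onI)
   fix x y assume x: "x \<in> (SIGMA s:?S. isos (rg_of ?E s) R)" and y: "y \<in> (SIGMA s:?S. isos (rg_of ?E s) R)"
    and xy: "(%(s, f). \<lambda>e\<in>?E. f (2 * e)) x = (%(s, f). \<lambda>e\<in>?E. f (2 * e)) y"
   obtain s f s' f' where sf: "x = (s, f)" "y = (s', f')" by (cases x, cases y)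
   have s: "s \<in> ?S" "s' \<in> ?S" and f: "f \<in> isos (rg_of ?E s) R" "f' \<in> isos (rg_of ?E s') R" using x y sf by auto
   have eq: "(\<lambda>e\<in>?E. f (2 * e)) = (\<lambda>e\<in>?E. f' (2 * e))" using xy unfolding sf split_conv .
   have "f = f'" by (rule trans[OF it(3)[OF s(1) f(1), symmetric] it(3)[OF s(2) f(2), folded eq]])
   moreover have "s = s'"
   proof -
    have "inj_on (transp ?E (\<lambda>e\<in>?E. f (2 * e)) (Epos R) id id) ?S"
     by (rule bij_betw_imp_inj_on[OF transp_bij[OF it(1)[OF s(1) f(1)] id id]])
    from inj_onD[OF this trans[OF it(2)[OF s(1) f(1)] it(2)[OF s(2) f(2), folded eq, symmetric]] s]
    show ?thesis .
   qed
   ultimately show "x = y" by (simp add: sf)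
  qed
  show "(%(s, f). \<lambda>e\<in>?E. f (2 * e)) ` (SIGMA s:?S. isos (rg_of ?E s) R) = {fi \<in> extensional ?E. bij_betw fi ?E (Epos R)}"
  proof
   show "(%(s, f). \<lambda>e\<in>?E. f (2 * e)) ` (SIGMA s:?S. isos (rg_of ?E s) R) \<subseteq> {fi \<in> extensional ?E. bij_betw fi ?E (Epos R)}"
    using it(1) by auto
   show "{fi \<in> extensional ?E. bij_betw fi ?E (Epos R)} \<subseteq> (%(s, f). \<lambda>e\<in>?E. f (2 * e)) ` (SIGMA s:?S. isos (rg_of ?E s) R)"
   proof
    fix fi assume "fi \<in> {fi \<in> extensional ?E. bij_betw fi ?E (Epos R)}"
    then have fi: "fi \<in> extensional ?E" "bij_betw fi ?E (Epos R)" by auto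
    have "str_of R \<in> transp ?E fi (Epos R) id id ` ?S"
     using transp_bij[OF fi(2) id id, of "{..<np}" "{..<nm}"] str_of_strs[OF D(1,2)] by (simp add: bij_betw_def)
    then obtain s where s: "s \<in> ?S" "transp ?E fi (Epos R) id id s = str_of R" by auto
    have "(\<lambda>e\<in>?E. extend_iso ?E fi R (2 * e)) = fi"
     by (rule extensionalityI[OF _ fi(1)]) (auto simp: extend_iso_def)
    then show "fi \<in> (%(s, f). \<lambda>e\<in>?E. f (2 * e)) ` (SIGMA s:?S. isos (rg_of ?E s) R)"
     using ti[OF s(1) fi(2) s(2)] s(1) by (intro image_eqI[where x="(s, extend_iso ?E fi R)"]) auto
   qed
  qed
 qed
 then have "card (SIGMA s:?S. isos (rg_of ?E s) R) = card {fi \<in> extensional ?E. bij_betw fi ?E (Epos R)}" by (rule bij_betw_same_card)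
 also have "... = fact (2 * N)" using card_bij_betw[OF finE _ D(5)] card_Epos_N[OF R] by simp
 finally have 1: "card (SIGMA s:?S. isos (rg_of ?E s) R) = fact (2 * N)" .
 have "card (SIGMA s:?S. isos (rg_of ?E s) R) = (\<Sum>s\<in>?S. card (isos (rg_of ?E s) R))"
  by (rule card_SigmaI) (use fini finite_strs[OF finE] in auto)
 also have "... = (\<Sum>s\<in>{s \<in> ?S. isos (rg_of ?E s) R ~= {}}. card (isos (rg_of ?E s) R))"
  by (rule sum.mono_neutral_right) (auto simp: finite_strs[OF finE])
 also have "... = (\<Sum>s\<in>{s \<in> ?S. isos (rg_of ?E s) R ~= {}}. card (auts R))"
  using card_isos[OF four_valent_graphsD(3)[OF G] _ D(3)] by (intro sum.cong) auto
 finally show ?thesis using 1 by simp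
qed

lemma svol_iso:
 assumes R: "R \<in> four_valent_graphs g np nm" and s: "s \<in> strs {..<2*N} {} {..<np} {..<nm}" and i: "isos (rg_of {..<2*N} s) R ~= {}"
 shows "svol {..<2*N} ((!) Lp) ((!) Lm) s = ennreal (vol_Met R Lp Lm)"
proof -
 note D = four_valent_graphsD[OF R]
 have finE: "finite {..<2*N}" by simp
 obtain f where f: "f \<in> isos (rg_of {..<2*N} s) R" using i by auto
 note it = iso_transp[OF finE D(1) s f]
 show ?thesis
  unfolding vol_Met_eq[OF D(1)] it(2)[symmetric] by (rule svol_transp[OF finE it(1) s, symmetric]) auto
qed

text \<open>When the structures are grouped by the class of their graph, each class has the
  multiplicity of \<open>card_strs_iso\<close> and a constant volume; this is where the weight
  1/#Aut arises. As the multiplicity is never 0, every class is reached, so there are finitely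
  many.\<close>

lemma sum_iso_classes:
 shows "finite (iso_classes g np nm)"
  "ennreal (fact (2 * N) * (\<Sum>C\<in>iso_classes g np nm. let R = (SOME R. R \<in> C) in 1 / real (card (auts R)) * vol_Met R Lp Lm)) =
   Wn (2 * N) {..<np} {..<nm} ((!) Lp) ((!) Lm)"
proof -
 let ?E = "{..<2*N}" and ?S = "strs {..<2*N} {} {..<np} {..<nm}" and ?G = "four_valent_graphs g np nm"
 let ?r = "iso_rel g np nm"
 have finE: "finite ?E" by simp
 have finS: "finite ?S" by (rule finite_strs[OF finE])
 have G: "rg_of ?E s \<in> ?G" if "s \<in> ?S" for s
  by (rule rg_of_four_valent_graphs[OF finE that]) (use N in simp)
 let ?c = "%s. ?r `` {rg_of ?E s}"
 have cC: "?c s \<in> iso_classes g np nm" if "s \<in> ?S" for s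
  unfolding iso_classes_def using G[OF that] by (rule quotientI)
 have rep: "(SOME R. R \<in> C) \<in> C" "(SOME R. R \<in> C) \<in> ?G" if C: "C \<in> iso_classes g np nm" for C
 proof -
  have "C ~= {}" by (rule in_quotient_imp_non_empty[OF equiv_iso_rel C[unfolded iso_classes_def]])
  then show 1: "(SOME R. R \<in> C) \<in> C" by (simp add: some_in_eq)
  show "(SOME R. R \<in> C) \<in> ?G" by (rule subsetD[OF in_quotient_imp_subset[OF equiv_iso_rel C[unfolded iso_classes_def]] 1])
 qed
 have iff: "?c s = C \<longleftrightarrow> isos (rg_of ?E s) (SOME R. R \<in> C) ~= {}" if s: "s \<in> ?S" and C: "C \<in> iso_classes g np nm" for s C
 proof -
  obtain R where R: "C = ?r `` {R}" using C unfolding iso_classes_def by (rule quotientE)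
  then have "(R, SOME R. R \<in> C) \<in> ?r" using rep(1)[OF C] by blast
  then have "C = ?r `` {SOME R. R \<in> C}" by (rule trans[OF R equiv_class_eq[OF equiv_iso_rel]])
  then have "?c s = C \<longleftrightarrow> ?c s = ?r `` {SOME R. R \<in> C}" by (rule arg_cong)
  also have "... \<longleftrightarrow> (rg_of ?E s, SOME R. R \<in> C) \<in> ?r"
   using eq_equiv_class_iff[OF equiv_iso_rel G[OF s] rep(2)[OF C]] .
  finally show ?thesis using G[OF s] rep(2)[OF C] by simp
 qed
 have surj: "iso_classes g np nm = ?c ` ?S"
 proof
  show "?c ` ?S \<subseteq> iso_classes g np nm" using cC by auto
  show "iso_classes g np nm \<subseteq> ?c ` ?S"
  proof
   fix C assume C: "C \<in> iso_classes g np nm"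
   have "card {s \<in> ?S. isos (rg_of ?E s) (SOME R. R \<in> C) ~= {}} ~= 0"
    using card_strs_iso[OF rep(2)[OF C]] by (metis fact_nonzero mult_eq_0_iff)
   then have "{s \<in> ?S. isos (rg_of ?E s) (SOME R. R \<in> C) ~= {}} ~= {}" by (metis card.empty)
   then obtain s where "s \<in> ?S" "isos (rg_of ?E s) (SOME R. R \<in> C) ~= {}" by blast
   then show "C \<in> ?c ` ?S" using iff[OF _ C] by blast
  qed
 qed
 show finC: "finite (iso_classes g np nm)" unfolding surj using finS by blast
 have nn: "0 \<le> vol_Met R Lp Lm" for R :: "nat directed_ribbon_graph" by (simp add: vol_Met_def Let_def)
 let ?a = "%C. card (auts (SOME R. R \<in> C))" and ?v = "%C. vol_Met (SOME R. R \<in> C) Lp Lm"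
 have "Wn (2 * N) {..<np} {..<nm} ((!) Lp) ((!) Lm) = (\<Sum>s\<in>?S. svol ?E ((!) Lp) ((!) Lm) s)" by (simp add: Wn_def W_def)
 also have "... = (\<Sum>C\<in>iso_classes g np nm. \<Sum>s\<in>{s. s \<in> ?S & ?c s = C}. svol ?E ((!) Lp) ((!) Lm) s)"
  by (rule sum.group[OF finS finC, symmetric]) (use cC in auto)
 also have "... = (\<Sum>C\<in>iso_classes g np nm. ennreal (fact (2 * N) * (1 / real (?a C) * ?v C)))"
 proof (rule sum.cong[OF refl])
  fix C assume C: "C \<in> iso_classes g np nm"
  let ?T = "{s \<in> ?S. isos (rg_of ?E s) (SOME R. R \<in> C) ~= {}}"
  have "(\<Sum>s\<in>{s. s \<in> ?S & ?c s = C}. svol ?E ((!) Lp) ((!) Lm) s) = (\<Sum>s\<in>?T. ennreal (?v C))"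
  proof (rule sum.cong)
   show "{s. s \<in> ?S & ?c s = C} = ?T" by (intro Collect_cong conj_cong refl iff[OF _ C])
   show "svol ?E ((!) Lp) ((!) Lm) s = ennreal (?v C)" if "s \<in> ?T" for s
    by (rule svol_iso[OF rep(2)[OF C]]) (use that in blast)+
  qed
  also have "... = of_nat (card ?T) * ennreal (?v C)" by simp
  also have "... = ennreal (real (card ?T) * ?v C)" using nn by (simp add: ennreal_mult ennreal_of_nat_eq_real_of_nat)
  also have "real (card ?T) = fact (2 * N) * (1 / real (?a C))"
  proof -
   have "real (card ?T) * real (?a C) = fact (2 * N)"
    using arg_cong[OF card_strs_iso[OF rep(2)[OF C]], of real] by simp
   moreover have "real (?a C) ~= 0" using four_valent_graphsD(6)[OF rep(2)[OF C]] by simp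
   ultimately show ?thesis by (simp add: field_simps)
  qed
  finally show "(\<Sum>s\<in>{s. s \<in> ?S & ?c s = C}. svol ?E ((!) Lp) ((!) Lm) s) = ennreal (fact (2 * N) * (1 / real (?a C) * ?v C))" by (simp add: mult.assoc)
 qed
 also have "... = ennreal (\<Sum>C\<in>iso_classes g np nm. fact (2 * N) * (1 / real (?a C) * ?v C))"
  by (rule sum_ennreal) (use nn in simp)
 finally show "ennreal (fact (2 * N) * (\<Sum>C\<in>iso_classes g np nm. let R = (SOME R. R \<in> C) in 1 / real (card (auts R)) * vol_Met R Lp Lm)) =
   Wn (2 * N) {..<np} {..<nm} ((!) Lp) ((!) Lm)"
  by (simp add: Let_def sum_distrib_left)
qed

end

lemma Wn_reindex:
 assumes "inj_on h Ip" "inj_on k Iq" "!!i. i \<in> Ip ==> Lp' (h i) = Lp i" "!!i. i \<in> Iq ==> Lq' (k i) = Lq i"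
 shows "Wn n Ip Iq Lp Lq = Wn n (h ` Ip) (k ` Iq) Lp' Lq'"
 unfolding Wn_def by (rule W_reindex[where fi=id]) (use assms in auto)

text \<open>The lists \<open>xs\<close> and \<open>ys\<close> name the arguments, so that equal
  lengths are kept apart. Where \<open>V\<close> is zero by convention \<open>Wn\<close> is zero as
  well, because a positive metric forces positive and balanced lengths.\<close>

lemma V_eq_Wn:
 assumes N: "int N = 2 * g - 2 + int (length xs) + int (length ys)" "N > 0" and g: "g \<ge> 0" and d: "distinct xs" "distinct ys"
 shows "ennreal (fact (2 * N) * V g (map L xs) (map L' ys)) = Wn (2 * N) (set xs) (set ys) L L'"
proof -
 let ?Lp = "map L xs" and ?Lm = "map L' ys"
 have im: "(!) xs ` {..<length xs} = set xs" "(!) ys ` {..<length ys} = set ys" by (auto simp: set_conv_nth)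
 have Wn: "Wn (2 * N) (set xs) (set ys) L L' = Wn (2 * N) {..<length xs} {..<length ys} ((!) ?Lp) ((!) ?Lm)"
  unfolding im[symmetric] by (rule Wn_reindex[symmetric]) (use d in \<open>auto simp: inj_on_def nth_eq_iff_index_eq\<close>)
 show ?thesis
 proof (cases "xs ~= [] & ys ~= [] & (?Lp, ?Lm) \<in> Lambda (length xs) (length ys)")
  case True
  then have "V g ?Lp ?Lm = (\<Sum>C\<in>iso_classes g (length xs) (length ys). let R = (SOME R. R \<in> C) in 1 / real (card (auts R)) * vol_Met R ?Lp ?Lm)"
   using N g by (simp add: V_def Suc_le_eq)
  then show ?thesis using sum_iso_classes(2)[OF N(1), of ?Lp ?Lm] Wn by simp
 next
  case False
  then have V: "V g ?Lp ?Lm = 0" by (auto simp: V_def Suc_le_eq)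
  have "Wn (2 * N) (set xs) (set ys) L L' = 0"
  proof (rule ccontr)
   assume nz: "Wn (2 * N) (set xs) (set ys) L L' ~= 0"
   have "{..<2 * N} ~= {}" using N(2) by (simp add: lessThan_empty_iff)
   note D = W_nonzeroD[OF finite_lessThan this nz[unfolded Wn_def]]
   have "sum_list ?Lp = sum_list ?Lm" using D(4) d by (simp add: sum_list_distinct_conv_sum_set)
   then have "xs ~= [] & ys ~= [] & (?Lp, ?Lm) \<in> Lambda (length xs) (length ys)"
    using D(2,3,5,6) by (auto simp: Lambda_def)
   then show False using False by simp
  qed
  then show ?thesis using V by simp
 qed
qed

subsection \<open>The genus\<close>

lemma strs_even:
 assumes fin: "finite E" and s: "strs E {} Ip Iq ~= {}"
 shows "even (card E)"
proof -
 obtain sg tu p q where S: "(sg, tu, p, q) \<in> strs E {} Ip Iq" using s by auto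
 note T = strsD[OF S]
 have "card (orbit tu x) = 2" if "x \<in> E" for x
 proof -
  have "orbit tu x = {(tu ^^ m) x |m. m < 2}" by (rule orbit_altdef_bounded) (simp_all add: numeral_eq_Suc T(4))
  also have "... = (%m. (tu ^^ m) x) ` {..<2}" by auto
  also have "{..<2::nat} = {0, 1}" by auto
  finally have "orbit tu x = {x, tu x}" by simp
  moreover have "tu x ~= x" using T(5) that by blast
  ultimately show ?thesis by simp
 qed
 from card_orbits[OF fin T(3) this] have "2 * card (orbit tu ` E) = card E" .
 then show ?thesis by (metis dvd_triv_left)
qed

text \<open>With a single vertex, \<open>tu\<close> exchanges the two edges. So one of
  \<open>sg\<close> and \<open>sg o tu\<close> is the identity with two cycles and the other is the
  exchange with one: these are the types (0,2,1) and (0,1,2).\<close>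

lemma strs_two:
 assumes s: "strs {..<2::nat} {} Ip Iq ~= {}"
 shows "card Ip + card Iq = 3"
proof -
 obtain sg tu p q where S: "(sg, tu, p, q) \<in> strs {..<2::nat} {} Ip Iq" using s by auto
 note T = strsD[OF S]
 have E: "{..<2::nat} = {0, 1}" by auto
 have tu: "tu 0 = 1" "tu 1 = 0" using T(5,7)[unfolded E] by auto
 have P: "p 0 = p 1 \<longleftrightarrow> pm 0 = 1" if c: "cyc_label {..<2::nat} pm p I" for pm p and I :: "'a set"
 proof
  note C = cyc_labelD[OF c]
  show "p 0 = p 1" if "pm 0 = 1" using C(4)[of 0] that by simp
  show "pm 0 = 1" if eq: "p 0 = p 1"
  proof (rule ccontr)
   assume "pm 0 ~= 1"
   then have "pm 0 = 0" using C(5)[of 0, unfolded E] by simp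
   then have "(1::nat) \<in> {0}" by (intro cyc_label_inv[OF c, of "{0}" 0 1]) (use eq in auto)
   then show False by simp
  qed
 qed
 have card: "card I = (if p 0 = p 1 then 1 else 2)" if c: "cyc_label {..<2::nat} pm p I" for pm p and I :: "'a set"
 proof -
  have "I = {p 0, p 1}" using cyc_labelD(3)[OF c] unfolding E by simp
  then show ?thesis by auto
 qed
 note C = cyc_labelD[OF T(1)]
 have "inj sg" using C(1) by (rule permutes_inj)
 then have "sg 0 ~= sg 1" by (simp add: inj_eq)
 moreover have "sg 0 = 0 \<or> sg 0 = 1" "sg 1 = 0 \<or> sg 1 = 1" using C(5)[of 0, unfolded E] C(5)[of 1, unfolded E] by simp_all
 ultimately have "sg 1 = 1 \<longleftrightarrow> sg 0 ~= 1" by metis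
 then show ?thesis using P[OF T(1)] P[OF T(2)] card[OF T(1)] card[OF T(2)] tu by simp
qed

text \<open>For n = 2N the conclusion is N = 2h - 2 + #Ip + #Iq with a natural number h, that is,
  Euler's formula with an integral and non-negative genus. It is read off from the recursion: a
  merger keeps h, a connected cut leaves h - 1, and for a separation the two values add up. It
  decides which terms vanish for lack of a genus.\<close>

lemma Wn_genus:
 fixes Ip Iq :: "nat set"
 assumes "Wn n Ip Iq Lp Lq ~= 0" "n > 0"
 shows "\<exists>h. n + 4 = 2 * (card Ip + card Iq + 2 * h)"
 using assms
proof (induction n arbitrary: Ip Lp Iq Lq rule: less_induct)
 case (less n)
 have ne: "{..<n} ~= {}" using less.prems(2) by (simp add: lessThan_empty_iff)
 note D = W_nonzeroD[OF finite_lessThan ne less.prems(1)[unfolded Wn_def]]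
 have even: "even n" using strs_even[OF _ D(1)] by simp
 obtain s where "s \<in> strs {..<n} {} Ip Iq" using D(1) by blast
 then obtain sg tu p q where S: "(sg, tu, p, q) \<in> strs {..<n} {} Ip Iq" by (cases s) auto
 have fin: "finite Ip" "finite Iq"
  using cyc_labelD(3)[OF strsD(1)[OF S]] cyc_labelD(3)[OF strsD(2)[OF S]] by auto
 show ?case
 proof (cases "n = 2")
  case True
  then show ?thesis using strs_two[OF D(1)[unfolded True]] by (intro exI[where x=0]) simp
 next
  case False
  have "n ~= 1" using even by auto
  then have "n = Suc (Suc (n - 2))" "n - 2 > 0" using False less.prems(2) by simp_all
  then obtain m where m: "n = Suc (Suc m)" "m > 0" by blast
  obtain k where k: "k ~: Ip" using ex_new_if_finite[OF infinite_UNIV_nat fin(1)] by blast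
  define A where "A = (\<Sum>(i, j)\<in>{(i, j)\<in>Ip \<times> Ip. i ~= j}. ennreal (Lp i + Lp j) * Wn m (Ip - {j}) Iq (Lp(i := Lp i + Lp j)) Lq)"
  define B where "B = (\<Sum>i\<in>Ip. \<integral>\<^sup>+x. ennreal x * ennreal (Lp i - x) * Wn m (insert k Ip) Iq (Lp(i := x, k := Lp i - x)) Lq \<partial>lborel)"
  define C where "C = (\<Sum>i\<in>Ip. \<Sum>(I1, J1)\<in>Pow (Ip - {i}) \<times> Pow Iq. \<Sum>n\<le>m. of_nat (m choose n) *
   (stemn n i I1 J1 Lp Lq * stemn (m - n) i (Ip - {i} - I1) (Iq - J1) Lp Lq))"
  have "Wn n Ip Iq Lp Lq = of_nat (Suc m) * (A + B + C)"
   unfolding m(1) A_def B_def C_def by (rule Wn_recursion[OF m(2) k fin D(2,3,4)])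
  then have "A ~= 0 \<or> B ~= 0 \<or> C ~= 0" using less.prems(1) by auto
  then show ?thesis
  proof (elim disjE)
   assume "A ~= 0"
   from sum.not_neutral_contains_not_neutral[OF this[unfolded A_def]]
   obtain z where z: "z \<in> {(i, j)\<in>Ip \<times> Ip. i ~= j}" "(case z of (i, j) => ennreal (Lp i + Lp j) * Wn m (Ip - {j}) Iq (Lp(i := Lp i + Lp j)) Lq) ~= 0" by blast
   obtain i j where "z = (i, j)" by (cases z)
   with z have ij: "i \<in> Ip" "j \<in> Ip" "i ~= j" "Wn m (Ip - {j}) Iq (Lp(i := Lp i + Lp j)) Lq ~= 0" by auto
   obtain h where "m + 4 = 2 * (card (Ip - {j}) + card Iq + 2 * h)" using less.IH[OF _ ij(4) m(2)] m(1) by auto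
   moreover have "card Ip = Suc (card (Ip - {j}))" by (rule card_Suc_Diff1[OF fin(1) ij(2), symmetric])
   ultimately show ?thesis using m(1) by (intro exI[where x=h]) simp
  next
   assume "B ~= 0"
   from sum.not_neutral_contains_not_neutral[OF this[unfolded B_def]]
   obtain i where i: "i \<in> Ip" "(\<integral>\<^sup>+x. ennreal x * ennreal (Lp i - x) * Wn m (insert k Ip) Iq (Lp(i := x, k := Lp i - x)) Lq \<partial>lborel) ~= 0"
    by blast
   have "\<exists>x. Wn m (insert k Ip) Iq (Lp(i := x, k := Lp i - x)) Lq ~= 0"
   proof (rule ccontr)
    assume "\<not> ?thesis"
    then show False using i(2) by simp
   qed
   then obtain x where x: "Wn m (insert k Ip) Iq (Lp(i := x, k := Lp i - x)) Lq ~= 0" by blast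
   obtain h where "m + 4 = 2 * (card (insert k Ip) + card Iq + 2 * h)" using less.IH[OF _ x m(2)] m(1) by auto
   then show ?thesis using m(1) k fin by (intro exI[where x="Suc h"]) simp
  next
   assume "C ~= 0"
   from sum.not_neutral_contains_not_neutral[OF this[unfolded C_def]]
   obtain i where i: "i \<in> Ip" and "(\<Sum>(I1, J1)\<in>Pow (Ip - {i}) \<times> Pow Iq. \<Sum>n\<le>m. of_nat (m choose n) *
    (stemn n i I1 J1 Lp Lq * stemn (m - n) i (Ip - {i} - I1) (Iq - J1) Lp Lq)) ~= 0" by blast
   from sum.not_neutral_contains_not_neutral[OF this(2)]
   obtain z where z: "z \<in> Pow (Ip - {i}) \<times> Pow Iq" "(case z of (I1, J1) => \<Sum>n\<le>m. of_nat (m choose n) *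
    (stemn n i I1 J1 Lp Lq * stemn (m - n) i (Ip - {i} - I1) (Iq - J1) Lp Lq)) ~= 0" by blast
   obtain I1 J1 where IJ: "z = (I1, J1)" by (cases z)
   from sum.not_neutral_contains_not_neutral[OF z(2)[unfolded IJ split_conv]]
   obtain l where l: "l \<in> {..m}" "of_nat (m choose l) *
    (stemn l i I1 J1 Lp Lq * stemn (m - l) i (Ip - {i} - I1) (Iq - J1) Lp Lq) ~= 0" by blast
   have i': "I1 \<subseteq> Ip - {i}" "J1 \<subseteq> Iq" "l \<le> m" using z(1) l(1) IJ by auto
   have nz: "stemn l i I1 J1 Lp Lq ~= 0" "stemn (m - l) i (Ip - {i} - I1) (Iq - J1) Lp Lq ~= 0"
    using l(2) by auto
   note i = i i'
   \<comment> \<open>The circle fits the formula as a part without edges and with h = 0: it has one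
     positive and one negative component.\<close>
   have st: "\<exists>h. l + 4 = 2 * (Suc (card I) + card J + 2 * h)"
    if h: "stemn l i I J Lp Lq ~= 0" "l \<le> m" "I \<subseteq> Ip - {i}" for l I J
   proof (cases "l = 0")
    case True
    then obtain j where "I = {}" "J = {j}" using h by (auto simp: stemn_def split: if_splits)
    then show ?thesis using True by simp
   next
    case False
    then have "Wn l (insert i I) J (Lp(i := sum Lq J - sum Lp I)) Lq ~= 0" using h by (auto simp: stemn_def)
    then have "\<exists>h. l + 4 = 2 * (card (insert i I) + card J + 2 * h)" using less.IH[of l] False h(2) m(1) by simp
    moreover have "card (insert i I) = Suc (card I)" using h(3) fin by (subst card_insert_disjoint) (auto intro: finite_subset)
    ultimately show ?thesis by simp
   qed
   obtain h1 where h1: "l + 4 = 2 * (Suc (card I1) + card J1 + 2 * h1)" using st[OF nz(1) i(4,2)] by blast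
   obtain h2 where h2: "(m - l) + 4 = 2 * (Suc (card (Ip - {i} - I1)) + card (Iq - J1) + 2 * h2)" using st[OF nz(2)] by auto
   have "card I1 + card (Ip - {i} - I1) = card (Ip - {i})" using i(2) fin by (metis card_Diff_subset card_mono finite_Diff finite_subset le_add_diff_inverse)
   moreover have "Suc (card (Ip - {i})) = card Ip" by (rule card_Suc_Diff1[OF fin(1) i(1)])
   moreover have "card J1 + card (Iq - J1) = card Iq" using i(3) fin by (metis card_Diff_subset card_mono finite_subset le_add_diff_inverse)
   ultimately have "n + 4 = 2 * (card Ip + card Iq + 2 * (h1 + h2))" using h1 h2 i(4) m(1) by simp
   then show ?thesis by blast
  qed
 qed
qed

subsection \<open>The recursion for the volumes\<close>

lemma nths_eq_map: "nths xs A = map ((!) xs) (filter (%j. j \<in> A) [0..<length xs])"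
proof -
 have "zip xs [0..<length xs] = map (%j. (xs ! j, j)) [0..<length xs]" by (rule nth_equalityI) auto
 then show ?thesis by (simp add: nths_def filter_map comp_def)
qed

lemma V_nonneg: "0 \<le> V g Lp Lm"
 unfolding V_def by (auto simp: Let_def vol_Met_def intro!: sum_nonneg)

lemma V_nonpos: "x \<in> set Lp ==> x \<le> 0 ==> V g Lp Lm = 0"
 unfolding V_def Lambda_def by force

text \<open>A volume with a non-positive argument vanishes; hence these products pass through
  \<open>ennreal\<close> whatever the sign of \<open>x\<close>.\<close>

lemma gapV_nonneg: "0 \<le> x * V h (x # As) Bs"
 using V_nonneg[of h "x # As" Bs] V_nonpos[of x "x # As" h Bs] by (cases "x \<le> 0") auto

text \<open>\<open>nths\<close> selects arguments by position. The positions serve as labels,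
  together with the labels \<open>is\<close> of newly created components.\<close>

lemma V_nths_Wn:
 fixes Lp Lm :: "real list" and A B
 defines "A' \<equiv> A Int {..<length Lp}" and "B' \<equiv> B Int {..<length Lm}"
 assumes a: "int a = 2 * g - 2 + int (length is) + int (card A') + int (card B')" "a > 0" "g \<ge> 0"
  and d: "distinct is" "set is Int A' = {}" and L: "!!j. j \<in> A' ==> L j = Lp ! j"
 shows "ennreal (fact (2 * a) * V g (map L is @ nths Lp A) (nths Lm B)) = Wn (2 * a) (set is Un A') B' L ((!) Lm)"
proof -
 let ?xs = "is @ filter (%j. j \<in> A) [0..<length Lp]" and ?ys = "filter (%j. j \<in> B) [0..<length Lm]"
 have A': "set (filter (%j. j \<in> A) [0..<length Lp]) = A'" and B': "set ?ys = B'" by (auto simp: A'_def B'_def)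
 have dd: "distinct (filter (%j. j \<in> A) [0..<length Lp])" "distinct ?ys" by auto
 have l: "length (filter (%j. j \<in> A) [0..<length Lp]) = card A'" "length ?ys = card B'"
  using distinct_card[OF dd(1)] distinct_card[OF dd(2)] A' B' by simp_all
 have m: "map L is @ nths Lp A = map L ?xs" "nths Lm B = map ((!) Lm) ?ys"
  using L by (auto simp: nths_eq_map A'_def)
 have dx: "distinct ?xs" using d(1) dd(1) d(2) A' by simp
 have N: "int a = 2 * g - 2 + int (length ?xs) + int (length ?ys)" using a(1) l by simp
 have "set ?xs = set is Un A'" using A' by (simp only: set_append)
 then show ?thesis unfolding m using V_eq_Wn[OF N a(2,3) dx dd(2), of L "(!) Lm"] B' by simp
qed

text \<open>For \<open>x \<le> 0\<close> both sides are 0: on the left by the convention for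
  \<open>V\<close>, on the right because \<open>ennreal\<close> truncates.\<close>

lemma V_cons_Wn:
 fixes Lp Lm :: "real list" and A B
 assumes a: "int a = 2 * g - 1 + int (card (A Int {..<length Lp})) + int (card (B Int {..<length Lm}))" "a > 0" "g \<ge> 0" and i: "i ~: A"
 shows "ennreal (fact (2 * a) * (x * V g (x # nths Lp A) (nths Lm B))) =
  ennreal x * Wn (2 * a) (insert i (A Int {..<length Lp})) (B Int {..<length Lm}) (((!) Lp)(i := x)) ((!) Lm)"
proof -
 have 1: "ennreal (fact (2 * a) * V g (x # nths Lp A) (nths Lm B)) =
   Wn (2 * a) (insert i (A Int {..<length Lp})) (B Int {..<length Lm}) (((!) Lp)(i := x)) ((!) Lm)"
 proof -
  have "ennreal (fact (2 * a) * V g (map (((!) Lp)(i := x)) [i] @ nths Lp A) (nths Lm B)) =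
   Wn (2 * a) (set [i] Un A Int {..<length Lp}) (B Int {..<length Lm}) (((!) Lp)(i := x)) ((!) Lm)"
   by (rule V_nths_Wn) (use a i in auto)
  then show ?thesis by simp
 qed
 show ?thesis
 proof (cases "x > 0")
  case True
  then show ?thesis unfolding 1[symmetric] by (subst ennreal_mult'[symmetric]) (simp_all add: mult.left_commute)
 next
  case False
  then have "V g (x # nths Lp A) (nths Lm B) = 0" by (intro V_nonpos[where x=x]) auto
  then show ?thesis unfolding 1[symmetric] by simp
 qed
qed

section \<open>The terms of the recursion expressed by volumes\<close>

text \<open>\<open>M\<close> is the number of vertices that remain when one of the 2g-2+n is
  resolved.\<close>

context
 fixes g np nm M :: nat and Lp Lm :: "real list"
 assumes np: "np \<ge> 1" and nm: "nm \<ge> 1" and M: "int M = 2 * int g - 3 + int np + int nm" "M > 0"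
  and L: "(Lp, Lm) \<in> Lambda np nm"
begin

lemma LD: "length Lp = np" "length Lm = nm" "!!i. i < np ==> 0 < Lp ! i" "!!i. i < nm ==> 0 < Lm ! i"
 "sum ((!) Lp) {..<np} = sum ((!) Lm) {..<nm}"
 using L by (auto simp: Lambda_def sum_list_sum_nth atLeast0LessThan)

lemma term_merge:
 assumes "i < np" "j < np" "i ~= j"
 shows "ennreal (Lp ! i + Lp ! j) * Wn (2 * M) ({..<np} - {j}) {..<nm} (((!) Lp)(i := Lp ! i + Lp ! j)) ((!) Lm) =
  ennreal (fact (2 * M) * ((Lp ! i + Lp ! j) * V (int g) ((Lp ! i + Lp ! j) # nths Lp (- {i, j})) Lm))"
proof -
 have s: "- {i, j} Int {..<np} = {..<np} - {i, j}" by auto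
 have c: "card ({..<np} - {i, j}) = np - 2" using assms by (subst card_Diff_subset) auto
 have np2: "np \<ge> 2" using assms by linarith
 have ins: "insert i ({..<np} - {i, j}) = {..<np} - {j}" using assms by auto
 show ?thesis
  using V_cons_Wn[where a=M and g="int g" and A="- {i, j}" and B=UNIV and i=i and x="Lp ! i + Lp ! j" and Lp=Lp and Lm=Lm] M np2
  by (simp add: LD(1,2) s c ins nths_all of_nat_diff)
qed

text \<open>The other part is the circle with component \<open>j\<close> on its negative side. It
  uses up the length \<open>Lm ! j\<close> of component \<open>i\<close>, and by balance
  \<open>Lp ! i - Lm ! j\<close> remains.\<close>

lemma term_gap:
 assumes "i < np" "j < nm"
 shows "stemn (2 * M) i ({..<np} - {i}) ({..<nm} - {j}) ((!) Lp) ((!) Lm) =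
  ennreal (fact (2 * M) * (pos_part (Lp ! i - Lm ! j) * V (int g) (pos_part (Lp ! i - Lm ! j) # nths Lp (- {i})) (nths Lm (- {j}))))"
proof -
 have s: "- {i} Int {..<np} = {..<np} - {i}" "- {j} Int {..<nm} = {..<nm} - {j}" by auto
 have c: "card ({..<np} - {i}) = np - 1" "card ({..<nm} - {j}) = nm - 1" using assms by simp_all
 have ins: "insert i ({..<np} - {i}) = {..<np}" using assms by auto
 have gap: "sum ((!) Lm) ({..<nm} - {j}) - sum ((!) Lp) ({..<np} - {i}) = Lp ! i - Lm ! j"
  using LD(5) assms by (simp add: sum_diff1)
 let ?x = "Lp ! i - Lm ! j"
 have 1: "stemn (2 * M) i ({..<np} - {i}) ({..<nm} - {j}) ((!) Lp) ((!) Lm) =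
  ennreal (fact (2 * M) * (?x * V (int g) (?x # nths Lp (- {i})) (nths Lm (- {j}))))"
  using V_cons_Wn[where a=M and g="int g" and A="- {i}" and B="- {j}" and i=i and x="?x" and Lp=Lp and Lm=Lm] M np nm
  by (simp add: LD(1,2) s c ins stemn_def gap of_nat_diff)
 show ?thesis
 proof (cases "?x > 0")
  case True
  then have "pos_part ?x = ?x" by (simp add: pos_part_def)
  then show ?thesis using 1 by simp
 next
  case False
  then have "pos_part ?x = 0" "V (int g) (?x # nths Lp (- {i})) (nths Lm (- {j})) = 0" by (auto simp: pos_part_def intro!: V_nonpos[where x="?x"])
  then show ?thesis using 1 by simp
 qed
qed

text \<open>In genus 0 the right-hand side is zero by convention and the left-hand side by
  \<open>Wn_genus\<close>. Finiteness is assumed because it turns the integral of a non-negative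
  function into a Lebesgue integral of a real one; the final proof supplies it.\<close>

lemma term_loop:
 assumes i: "i < np"
  and fin: "(\<integral>\<^sup>+x. ennreal x * ennreal (Lp ! i - x) * Wn (2 * M) (insert np {..<np}) {..<nm} (((!) Lp)(i := x, np := Lp ! i - x)) ((!) Lm) \<partial>lborel) < \<infinity>"
 shows "(\<integral>\<^sup>+x. ennreal x * ennreal (Lp ! i - x) * Wn (2 * M) (insert np {..<np}) {..<nm} (((!) Lp)(i := x, np := Lp ! i - x)) ((!) Lm) \<partial>lborel) =
  ennreal (fact (2 * M) * (LBINT x:{0..Lp ! i}. V (int g - 1) (x # (Lp ! i - x) # nths Lp (- {i})) Lm * x * (Lp ! i - x)))"
  "0 \<le> (LBINT x:{0..Lp ! i}. V (int g - 1) (x # (Lp ! i - x) # nths Lp (- {i})) Lm * x * (Lp ! i - x))"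
proof -
 let ?W = "%x. Wn (2 * M) (insert np {..<np}) {..<nm} (((!) Lp)(i := x, np := Lp ! i - x)) ((!) Lm)"
 let ?V = "%x. V (int g - 1) (x # (Lp ! i - x) # nths Lp (- {i})) Lm"
 let ?f = "%x. ?V x * x * (Lp ! i - x)"
 have W: "?W x = ennreal (fact (2 * M) * ?V x)" for x
 proof (cases "g = 0")
  case True
  have "?W x = 0"
  proof (rule ccontr)
   assume "?W x ~= 0"
   from Wn_genus[OF this] obtain h where "2 * M + 4 = 2 * (card (insert np {..<np}) + card {..<nm} + 2 * h)" using M by auto
   then show False using M True by simp
  qed
  then show ?thesis using True by (simp add: V_def)
 next
  case False
  have s: "- {i} Int {..<np} = {..<np} - {i}" by auto
  have c: "card ({..<np} - {i}) = np - 1" using i by simp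
  have ins: "insert i (insert np ({..<np} - {i})) = insert np {..<np}" using i by auto
  have "ennreal (fact (2 * M) * V (int g - 1) (map (((!) Lp)(i := x, np := Lp ! i - x)) [i, np] @ nths Lp (- {i})) (nths Lm UNIV)) =
   Wn (2 * M) (set [i, np] Un - {i} Int {..<length Lp}) (UNIV Int {..<length Lm}) (((!) Lp)(i := x, np := Lp ! i - x)) ((!) Lm)"
   by (rule V_nths_Wn) (use M np False i in \<open>auto simp: LD(1,2) s c of_nat_diff\<close>)
  then show ?thesis using i by (simp add: LD(1,2) s ins nths_all)
 qed
 \<comment> \<open>Outside the open interval one of the two arguments is not positive, so
   restricting the integral to the closed interval changes nothing.\<close>
 have z: "?f x = 0" if "\<not> (0 < x & x < Lp ! i)" for x
  using that V_nonpos[of x "x # (Lp ! i - x) # nths Lp (- {i})"] V_nonpos[of "Lp ! i - x" "x # (Lp ! i - x) # nths Lp (- {i})"] by auto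
 have nn: "0 \<le> ?f x" for x
  using z[of x] V_nonneg by (cases "0 < x & x < Lp ! i") auto
 have fW: "ennreal x * ennreal (Lp ! i - x) * ?W x = ennreal (fact (2 * M) * ?f x)" for x
 proof (cases "0 < x & x < Lp ! i")
  case True
  then show ?thesis unfolding W by (simp add: V_nonneg ac_simps flip: ennreal_mult)
 next
  case False
  then have "ennreal x * ennreal (Lp ! i - x) = 0" by (auto simp: ennreal_neg not_less)
  then show ?thesis using z[OF False] by (simp only: mult_zero_left mult_zero_right ennreal_0)
 qed
 have meas: "(%x. ennreal (fact (2 * M) * ?f x)) \<in> borel_measurable lborel"
  unfolding fW[symmetric] using Wn_split_measurable[of "2 * M" i "{..<np}" np] i M by simp
 \<comment> \<open>Measurability of the real function is recovered from that of the
   \<open>ennreal\<close>-valued count.\<close>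
 have measf: "?f \<in> borel_measurable lborel"
 proof -
  have "(%x. enn2real (ennreal (fact (2 * M) * ?f x)) / fact (2 * M)) \<in> borel_measurable lborel" using meas by measurable
  then show ?thesis using nn by simp
 qed
 have ind: "(LBINT x:{0..Lp ! i}. ?f x) = (\<integral>x. ?f x \<partial>lborel)"
 proof -
  have "indicator {0..Lp ! i} x *\<^sub>R ?f x = ?f x" for x
  proof (cases "0 < x & x < Lp ! i")
   case True
   then show ?thesis by simp
  next
   case False
   show ?thesis unfolding z[OF False] by simp
  qed
  then show ?thesis unfolding set_lebesgue_integral_def by (simp only:)
 qed
 have "integrable lborel (%x. fact (2 * M) * ?f x)"
  using measf nn fin unfolding fW by (intro integrableI_nonneg) auto
 then have "(\<integral>\<^sup>+x. ennreal (fact (2 * M) * ?f x) \<partial>lborel) = ennreal (\<integral>x. fact (2 * M) * ?f x \<partial>lborel)"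
  using nn by (intro nn_integral_eq_integral) auto
 then show "(\<integral>\<^sup>+x. ennreal x * ennreal (Lp ! i - x) * ?W x \<partial>lborel) = ennreal (fact (2 * M) * (LBINT x:{0..Lp ! i}. ?f x))"
  unfolding fW ind by simp
 show "0 \<le> (LBINT x:{0..Lp ! i}. ?f x)" unfolding ind using nn by simp
qed

lemma stemn_V:
 assumes i: "i < np" and IJ: "I \<subseteq> {..<np} - {i}" "J \<subseteq> {..<nm}" and a: "int a = 2 * int h - 1 + int (card I) + int (card J)" "a > 0"
 shows "stemn (2 * a) i I J ((!) Lp) ((!) Lm) =
  ennreal (fact (2 * a) * (gap Lp Lm I J * V (int h) (gap Lp Lm I J # nths Lp I) (nths Lm J)))"
proof -
 have "I Int {..<np} = I" "J Int {..<nm} = J" "i ~: I" using IJ by auto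
 then show ?thesis
  using V_cons_Wn[of a "int h" I Lp J Lm i "gap Lp Lm I J"] a by (simp add: LD(1,2) stemn_def gap_def)
qed

lemma stemn_genus:
 assumes nz: "stemn n i I J ((!) Lp) ((!) Lm) ~= 0" and n: "n > 0" and I: "I \<subseteq> {..<np} - {i}"
 shows "\<exists>h. n = 2 * (2 * h + card I + card J - 1) & 2 * h + card I + card J \<ge> 2"
proof -
 have "Wn n (insert i I) J (((!) Lp)(i := sum ((!) Lm) J - sum ((!) Lp) I)) ((!) Lm) ~= 0"
  using nz n by (auto simp: stemn_def)
 from Wn_genus[OF this n] obtain h where "n + 4 = 2 * (card (insert i I) + card J + 2 * h)" by blast
 moreover have "card (insert i I) = Suc (card I)"
  using I by (intro card_insert_disjoint) (auto intro: finite_subset)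
 ultimately have "n = 2 * (2 * h + card I + card J - 1) & 2 * h + card I + card J \<ge> 2" using n by auto
 then show ?thesis by blast
qed

text \<open>By \<open>Wn_genus\<close> a part with \<open>n\<close> edges contributes only if
  \<open>n\<close> is twice the number of vertices for some genus \<open>h\<close>; as the part also
  has the new component, this is \<open>2 * (2 * h + card I + card J - 1)\<close>. The factorials of
  the two parts cancel against the binomial coefficient.\<close>

lemma term_split:
 assumes i: "i < np" and IJ: "I \<subseteq> {..<np} - {i}" "J \<subseteq> {..<nm}"
 defines "I2 \<equiv> {..<np} - {i} - I" and "J2 \<equiv> {..<nm} - J"
 shows "(\<Sum>n\<in>{0<..<2 * M}. of_nat (2 * M choose n) * (stemn n i I J ((!) Lp) ((!) Lm) * stemn (2 * M - n) i I2 J2 ((!) Lp) ((!) Lm))) =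
  ennreal (fact (2 * M) * (\<Sum>h\<in>{h. h \<le> g & 2 * h + card I + card J \<ge> 2 & 2 * (g - h) + card I2 + card J2 \<ge> 2}.
   gap Lp Lm I J * gap Lp Lm I2 J2 * V (int h) (gap Lp Lm I J # nths Lp I) (nths Lm J) *
    V (int (g - h)) (gap Lp Lm I2 J2 # nths Lp I2) (nths Lm J2)))"
proof -
 let ?H = "{h. h \<le> g & 2 * h + card I + card J \<ge> 2 & 2 * (g - h) + card I2 + card J2 \<ge> 2}"
 let ?n = "%h. 2 * (2 * h + card I + card J - 1)" and ?n2 = "%h. 2 * (2 * h + card I2 + card J2 - 1)"
 let ?F = "%n. of_nat (2 * M choose n) * (stemn n i I J ((!) Lp) ((!) Lm) * stemn (2 * M - n) i I2 J2 ((!) Lp) ((!) Lm))"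
 let ?X = "%h. gap Lp Lm I J * V (int h) (gap Lp Lm I J # nths Lp I) (nths Lm J)"
 let ?Y = "%h. gap Lp Lm I2 J2 * V (int h) (gap Lp Lm I2 J2 # nths Lp I2) (nths Lm J2)"
 have IJ2: "I2 \<subseteq> {..<np} - {i}" "J2 \<subseteq> {..<nm}" by (auto simp: I2_def J2_def)
 have c: "card I + card I2 + 1 = np" "card J + card J2 = nm"
 proof -
  have "card I + card I2 = card ({..<np} - {i})"
   unfolding I2_def using IJ(1) by (simp add: card_Diff_subset finite_subset[OF IJ(1)] card_mono[OF _ IJ(1), simplified] del: card_Diff_insert)
  then show "card I + card I2 + 1 = np" using i by simp
  show "card J + card J2 = nm"
   unfolding J2_def using IJ(2) card_mono[OF _ IJ(2)] by (simp add: card_Diff_subset finite_subset[OF IJ(2)])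
 qed
 have n2: "2 * M - ?n h = ?n2 (g - h)" "?n h + ?n2 (g - h) = 2 * M" if "h \<in> ?H" for h
 proof -
  have "int (?n h) + int (?n2 (g - h)) = 2 * int M" using that c M by (auto simp: of_nat_diff)
  then show "?n h + ?n2 (g - h) = 2 * M" by linarith
  then show "2 * M - ?n h = ?n2 (g - h)" by linarith
 qed
 have sub: "?n ` ?H \<subseteq> {0<..<2 * M}"
 proof
  fix n assume "n \<in> ?n ` ?H"
  then obtain h where h: "h \<in> ?H" "n = ?n h" by blast
  then show "n \<in> {0<..<2 * M}" using n2(2)[OF h(1)] by auto
 qed
 have inj: "inj_on ?n ?H" by (rule inj_onI) auto
 \<comment> \<open>If both parts contribute, each has a genus, and comparing the numbers of edges
   shows that the two add up to \<open>g\<close>.\<close>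
 have F0: "?F n = 0" if n: "n \<in> {0<..<2 * M} - ?n ` ?H" for n
 proof (rule ccontr)
  assume "?F n ~= 0"
  then have nz: "stemn n i I J ((!) Lp) ((!) Lm) ~= 0" "stemn (2 * M - n) i I2 J2 ((!) Lp) ((!) Lm) ~= 0" by auto
  obtain h where h: "n = ?n h" "2 * h + card I + card J \<ge> 2" using stemn_genus[OF nz(1) _ IJ(1)] n by auto
  obtain h' where h': "2 * M - n = ?n2 h'" "2 * h' + card I2 + card J2 \<ge> 2" using stemn_genus[OF nz(2) _ IJ2(1)] n by auto
  have "h + h' = g" using h h' n c M by auto
  then have "h \<in> ?H" using h h' by auto
  then show False using n h(1) by blast
 qed
 have F: "?F (?n h) = ennreal (fact (2 * M) * (?X h * ?Y (g - h)))" if h: "h \<in> ?H" for h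
 proof -
  have 1: "stemn (?n h) i I J ((!) Lp) ((!) Lm) = ennreal (fact (?n h) * ?X h)"
   by (rule stemn_V[OF i IJ]) (use h in auto)
  have 2: "stemn (2 * M - ?n h) i I2 J2 ((!) Lp) ((!) Lm) = ennreal (fact (?n2 (g - h)) * ?Y (g - h))"
   unfolding n2(1)[OF h] by (rule stemn_V[OF i IJ2]) (use h in auto)
  have "fact (?n h) * fact (2 * M - ?n h) * (2 * M choose ?n h) = fact (2 * M)"
   by (rule binomial_fact_lemma) (use n2(2)[OF h] in linarith)
  from arg_cong[OF this, of real] have b: "fact (?n h) * fact (?n2 (g - h)) * real (2 * M choose ?n h) = fact (2 * M)"
   unfolding of_nat_mult of_nat_fact n2(1)[OF h] .
  have mul: "ennreal r * (ennreal x * ennreal y) = ennreal (r * (x * y))" if "r \<ge> 0" "x \<ge> 0" "y \<ge> 0" for r x y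
   using that by (simp add: ennreal_mult)
  have "?F (?n h) = ennreal (real (2 * M choose ?n h) * ((fact (?n h) * ?X h) * (fact (?n2 (g - h)) * ?Y (g - h))))"
   unfolding 1 2 ennreal_of_nat_eq_real_of_nat
   by (rule mul) (intro of_nat_0_le_iff mult_nonneg_nonneg gapV_nonneg fact_ge_zero)+
  also have "real (2 * M choose ?n h) * ((fact (?n h) * ?X h) * (fact (?n2 (g - h)) * ?Y (g - h))) =
   (fact (?n h) * fact (?n2 (g - h)) * real (2 * M choose ?n h)) * (?X h * ?Y (g - h))" by (simp only: ac_simps)
  finally show ?thesis unfolding b .
 qed
 have "(\<Sum>n\<in>{0<..<2 * M}. ?F n) = (\<Sum>n\<in>?n ` ?H. ?F n)"
  by (rule sum.mono_neutral_right) (use sub F0 in auto)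
 also have "... = (\<Sum>h\<in>?H. ?F (?n h))" using sum.reindex[OF inj, of ?F] by simp
 also have "... = (\<Sum>h\<in>?H. ennreal (fact (2 * M) * (?X h * ?Y (g - h))))" by (rule sum.cong[OF refl F])
 also have "... = ennreal (\<Sum>h\<in>?H. fact (2 * M) * (?X h * ?Y (g - h)))"
  by (rule sum_ennreal) (intro mult_nonneg_nonneg gapV_nonneg, simp)
 also have "(\<Sum>h\<in>?H. fact (2 * M) * (?X h * ?Y (g - h))) = fact (2 * M) * (\<Sum>h\<in>?H. gap Lp Lm I J * gap Lp Lm I2 J2 *
   V (int h) (gap Lp Lm I J # nths Lp I) (nths Lm J) * V (int (g - h)) (gap Lp Lm I2 J2 # nths Lp I2) (nths Lm J2))"
  unfolding sum_distrib_left by (rule sum.cong[OF refl]) (simp only: ac_simps)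
 finally show ?thesis .
qed

end

text \<open>Stability of a part with its additional component,
  \<open>2 * h - 2 + (card I + 1) + card J > 0\<close>, is
  \<open>2 * h + card I + card J \<ge> 2\<close>; the second half of a splitting is the complement
  of the first.\<close>

lemma sum_splittings:
 fixes f :: "nat => nat => nat set => nat set => nat set => nat set => real"
 shows "(\<Sum>(g1, g2, I1p, I2p, I1m, I2m) \<in> stable_splittings g np nm i. f g1 g2 I1p I2p I1m I2m) =
  (\<Sum>(I, J)\<in>Pow ({..<np} - {i}) \<times> Pow {..<nm}.
   \<Sum>h\<in>{h. h \<le> g & 2 * h + card I + card J \<ge> 2 & 2 * (g - h) + card ({..<np} - {i} - I) + card ({..<nm} - J) \<ge> 2}.
    f h (g - h) I ({..<np} - {i} - I) J ({..<nm} - J))"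
proof -
 let ?K = "Pow ({..<np} - {i}) \<times> Pow {..<nm}"
 let ?H = "%(I, J). {h. h \<le> g & 2 * h + card I + card J \<ge> 2 & 2 * (g - h) + card ({..<np} - {i} - I) + card ({..<nm} - J) \<ge> 2}"
 have finH: "\<forall>z\<in>?K. finite (?H z)"
 proof
  fix z show "finite (?H z)" by (rule finite_subset[of _ "{..g}"]) (auto split: prod.splits)
 qed
 have "(\<Sum>(g1, g2, I1p, I2p, I1m, I2m) \<in> stable_splittings g np nm i. f g1 g2 I1p I2p I1m I2m) =
  (\<Sum>(z, h)\<in>Sigma ?K ?H. f h (g - h) (fst z) ({..<np} - {i} - fst z) (snd z) ({..<nm} - snd z))"
 proof (rule sum.reindex_bij_witness[where i="%((I, J), h). (h, g - h, I, {..<np} - {i} - I, J, {..<nm} - J)"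
    and j="%(g1, g2, I1p, I2p, I1m, I2m). ((I1p, I1m), g1)"])
  fix a assume a: "a \<in> stable_splittings g np nm i"
  obtain g1 g2 I1p I2p I1m I2m where a': "a = (g1, g2, I1p, I2p, I1m, I2m)" by (cases a)
  have s: "g1 + g2 = g" "I1p Un I2p = {..<np} - {i}" "I1p Int I2p = {}" "I1m Un I2m = {..<nm}" "I1m Int I2m = {}"
   "2 * int g1 - 2 + (int (card I1p) + 1) + int (card I1m) > 0" "2 * int g2 - 2 + (int (card I2p) + 1) + int (card I2m) > 0"
   using a unfolding a' stable_splittings_def by auto
  have e: "{..<np} - {i} - I1p = I2p" "{..<nm} - I1m = I2m" "g - g1 = g2" using s(1-5) by auto
  show "(%((I, J), h). (h, g - h, I, {..<np} - {i} - I, J, {..<nm} - J)) ((%(g1, g2, I1p, I2p, I1m, I2m). ((I1p, I1m), g1)) a) = a"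
   by (simp add: a' e)
  show "(%(g1, g2, I1p, I2p, I1m, I2m). ((I1p, I1m), g1)) a \<in> Sigma ?K ?H"
   using s by (auto simp: a' e)
  show "(case (%(g1, g2, I1p, I2p, I1m, I2m). ((I1p, I1m), g1)) a of (z, h) => f h (g - h) (fst z) ({..<np} - {i} - fst z) (snd z) ({..<nm} - snd z)) =
   (case a of (g1, g2, I1p, I2p, I1m, I2m) => f g1 g2 I1p I2p I1m I2m)"
   by (simp add: a' e)
 next
  fix b assume b: "b \<in> Sigma ?K ?H"
  obtain I J h where b': "b = ((I, J), h)" by (metis prod.exhaust)
  have s: "I \<subseteq> {..<np} - {i}" "J \<subseteq> {..<nm}" "h \<le> g" "2 * h + card I + card J \<ge> 2" "2 * (g - h) + card ({..<np} - {i} - I) + card ({..<nm} - J) \<ge> 2"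
   using b unfolding b' by auto
  show "(%(g1, g2, I1p, I2p, I1m, I2m). ((I1p, I1m), g1)) ((%((I, J), h). (h, g - h, I, {..<np} - {i} - I, J, {..<nm} - J)) b) = b"
   by (simp add: b')
  have "2 * int h - 2 + (int (card I) + 1) + int (card J) > 0" "2 * int (g - h) - 2 + (int (card ({..<np} - {i} - I)) + 1) + int (card ({..<nm} - J)) > 0"
   using s(4,5) by linarith+
  then show "(%((I, J), h). (h, g - h, I, {..<np} - {i} - I, J, {..<nm} - J)) b \<in> stable_splittings g np nm i"
   using s(1-3) unfolding b' stable_splittings_def by auto
 qed
 also have "... = (\<Sum>z\<in>?K. \<Sum>h\<in>?H z. f h (g - h) (fst z) ({..<np} - {i} - fst z) (snd z) ({..<nm} - snd z))"
  by (rule sum.Sigma[symmetric, OF _ finH]) simp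
 also have "... = (\<Sum>(I, J)\<in>?K. \<Sum>h\<in>?H (I, J). f h (g - h) I ({..<np} - {i} - I) J ({..<nm} - J))"
  by (intro sum.cong refl) auto
 finally show ?thesis by simp
qed

context
 fixes g np nm M :: nat and Lp Lm :: "real list"
 assumes np: "np \<ge> 1" and nm: "nm \<ge> 1" and M: "int M = 2 * int g - 3 + int np + int nm" "M > 0"
  and L: "(Lp, Lm) \<in> Lambda np nm"
begin

text \<open>The inner values of \<open>n\<close> give the stable splittings. The extreme values
  \<open>n = 0\<close> and \<open>n = 2 * M\<close> both describe a circle, as first or as second
  part, and exchanging the parts shows that they agree: hence the factor 2.\<close>

lemma term_separated:
 assumes i: "i < np"
 shows "(\<Sum>(I1, J1)\<in>Pow ({..<np} - {i}) \<times> Pow {..<nm}. \<Sum>n\<le>2 * M. of_nat (2 * M choose n) *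
   (stemn n i I1 J1 ((!) Lp) ((!) Lm) * stemn (2 * M - n) i ({..<np} - {i} - I1) ({..<nm} - J1) ((!) Lp) ((!) Lm))) =
  ennreal (fact (2 * M) * (2 * (\<Sum>j<nm. pos_part (Lp ! i - Lm ! j) *
     V (int g) (pos_part (Lp ! i - Lm ! j) # nths Lp (- {i})) (nths Lm (- {j}))) +
   (\<Sum>(g1, g2, I1p, I2p, I1m, I2m) \<in> stable_splittings g np nm i.
    let x1 = gap Lp Lm I1p I1m; x2 = gap Lp Lm I2p I2m in
     x1 * x2 * V (int g1) (x1 # nths Lp I1p) (nths Lm I1m) * V (int g2) (x2 # nths Lp I2p) (nths Lm I2m))))"
proof -
 let ?K = "Pow ({..<np} - {i}) \<times> Pow {..<nm}"
 define S where "S n I J = stemn n i I J ((!) Lp) ((!) Lm)" for n I J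
 define R where "R j = pos_part (Lp ! i - Lm ! j) * V (int g) (pos_part (Lp ! i - Lm ! j) # nths Lp (- {i})) (nths Lm (- {j}))" for j
 define Q where "Q g1 g2 I1p I2p I1m I2m = gap Lp Lm I1p I1m * gap Lp Lm I2p I2m *
  V (int g1) (gap Lp Lm I1p I1m # nths Lp I1p) (nths Lm I1m) * V (int g2) (gap Lp Lm I2p I2m # nths Lp I2p) (nths Lm I2m)" for g1 g2 I1p I2p I1m I2m
 define H where "H I J = {h. h \<le> g & 2 * h + card I + card J \<ge> 2 & 2 * (g - h) + card ({..<np} - {i} - I) + card ({..<nm} - J) \<ge> 2}" for I J :: "nat set"
 let ?c = "%I. {..<np} - {i} - I" and ?d = "%J. {..<nm} - J"
 have Q0: "0 \<le> Q g1 g2 I1p I2p I1m I2m" for g1 g2 I1p I2p I1m I2m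
 proof -
  have "Q g1 g2 I1p I2p I1m I2m = (gap Lp Lm I1p I1m * V (int g1) (gap Lp Lm I1p I1m # nths Lp I1p) (nths Lm I1m)) *
   (gap Lp Lm I2p I2m * V (int g2) (gap Lp Lm I2p I2m # nths Lp I2p) (nths Lm I2m))" unfolding Q_def by (simp only: ac_simps)
  then show ?thesis using gapV_nonneg by simp
 qed
 have R0: "0 \<le> R j" for j unfolding R_def by (rule gapV_nonneg)
 \<comment> \<open>A part without edges requires \<open>I\<close> empty and \<open>J\<close> a
   single label, so the double sum reduces to a sum over \<open>j\<close>.\<close>
 have sum0: "(\<Sum>(I, J)\<in>?K. S 0 I J * S (2 * M) (?c I) (?d J)) = ennreal (fact (2 * M) * (\<Sum>j<nm. R j))"
 proof -
  have inj: "inj_on (%j. ({} :: nat set, {j})) {..<nm}" by (auto simp: inj_on_def)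
  have "(\<Sum>(I, J)\<in>?K. S 0 I J * S (2 * M) (?c I) (?d J)) = (\<Sum>(I, J)\<in>(%j. ({}, {j})) ` {..<nm}. S 0 I J * S (2 * M) (?c I) (?d J))"
  proof (rule sum.mono_neutral_right)
   show "\<forall>z\<in>?K - (%j. ({}, {j})) ` {..<nm}. (case z of (I, J) => S 0 I J * S (2 * M) (?c I) (?d J)) = 0"
    by (auto simp: S_def stemn_def)
  qed auto
  also have "... = (\<Sum>j<nm. S (2 * M) ({..<np} - {i}) ({..<nm} - {j}))"
  proof -
   have "S 0 {} {j} = 1" for j by (simp add: S_def stemn_def)
   then show ?thesis unfolding sum.reindex[OF inj] by simp
  qed
  also have "... = (\<Sum>j<nm. ennreal (fact (2 * M) * R j))"
   unfolding S_def R_def by (intro sum.cong refl term_gap[OF np nm M L i]) simp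
  also have "... = ennreal (fact (2 * M) * (\<Sum>j<nm. R j))"
   unfolding sum_distrib_left by (rule sum_ennreal) (simp add: R0)
  finally show ?thesis .
 qed
 have sum2: "(\<Sum>(I, J)\<in>?K. S (2 * M) I J * S 0 (?c I) (?d J)) = (\<Sum>(I, J)\<in>?K. S 0 I J * S (2 * M) (?c I) (?d J))"
  by (rule sum.reindex_bij_witness[where i="%(I, J). (?c I, ?d J)" and j="%(I, J). (?c I, ?d J)"])
   (auto simp: double_diff mult.commute)
 have sum1: "(\<Sum>(I, J)\<in>?K. \<Sum>n\<in>{0<..<2 * M}. of_nat (2 * M choose n) * (S n I J * S (2 * M - n) (?c I) (?d J))) =
  ennreal (fact (2 * M) * (\<Sum>(I, J)\<in>?K. \<Sum>h\<in>H I J. Q h (g - h) I (?c I) J (?d J)))"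
 proof -
  have "(\<Sum>(I, J)\<in>?K. \<Sum>n\<in>{0<..<2 * M}. of_nat (2 * M choose n) * (S n I J * S (2 * M - n) (?c I) (?d J))) =
   (\<Sum>(I, J)\<in>?K. ennreal (fact (2 * M) * (\<Sum>h\<in>H I J. Q h (g - h) I (?c I) J (?d J))))"
  proof (rule sum.cong[OF refl])
   fix z assume z: "z \<in> ?K"
   obtain I J where IJ: "z = (I, J)" by (cases z)
   have "I \<subseteq> {..<np} - {i}" "J \<subseteq> {..<nm}" using z IJ by auto
   from term_split[OF np nm M L i this]
   show "(case z of (I, J) => \<Sum>n\<in>{0<..<2 * M}. of_nat (2 * M choose n) * (S n I J * S (2 * M - n) (?c I) (?d J))) =
    (case z of (I, J) => ennreal (fact (2 * M) * (\<Sum>h\<in>H I J. Q h (g - h) I (?c I) J (?d J))))"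
    unfolding IJ split_conv S_def H_def Q_def .
  qed
  also have "... = ennreal (\<Sum>(I, J)\<in>?K. fact (2 * M) * (\<Sum>h\<in>H I J. Q h (g - h) I (?c I) J (?d J)))"
   unfolding split_def by (rule sum_ennreal) (intro mult_nonneg_nonneg sum_nonneg Q0 fact_ge_zero)
  finally show ?thesis by (simp add: sum_distrib_left split_def)
 qed
 have E: "{..2 * M} = insert 0 (insert (2 * M) {0<..<2 * M})" using M(2) by auto
 have "(\<Sum>n\<le>2 * M. of_nat (2 * M choose n) * (S n I J * S (2 * M - n) (?c I) (?d J))) =
  S 0 I J * S (2 * M) (?c I) (?d J) + (S (2 * M) I J * S 0 (?c I) (?d J) +
   (\<Sum>n\<in>{0<..<2 * M}. of_nat (2 * M choose n) * (S n I J * S (2 * M - n) (?c I) (?d J))))" for I J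
  unfolding E using M(2) by (subst sum.insert; simp)+
 then have "(\<Sum>(I, J)\<in>?K. \<Sum>n\<le>2 * M. of_nat (2 * M choose n) * (S n I J * S (2 * M - n) (?c I) (?d J))) =
  (\<Sum>(I, J)\<in>?K. S 0 I J * S (2 * M) (?c I) (?d J)) + ((\<Sum>(I, J)\<in>?K. S (2 * M) I J * S 0 (?c I) (?d J)) +
   (\<Sum>(I, J)\<in>?K. \<Sum>n\<in>{0<..<2 * M}. of_nat (2 * M choose n) * (S n I J * S (2 * M - n) (?c I) (?d J))))"
  by (simp add: split_def sum.distrib)
 also have "... = ennreal (fact (2 * M) * (2 * (\<Sum>j<nm. R j) + (\<Sum>(I, J)\<in>?K. \<Sum>h\<in>H I J. Q h (g - h) I (?c I) J (?d J))))"
 proof -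
  have "0 \<le> (\<Sum>(I, J)\<in>?K. \<Sum>h\<in>H I J. Q h (g - h) I (?c I) J (?d J))" "0 \<le> (\<Sum>j<nm. R j)"
   by (auto intro!: sum_nonneg Q0 R0)
  then show ?thesis unfolding sum2 sum0 sum1 by (simp add: algebra_simps flip: ennreal_plus)
 qed
 also have "(\<Sum>(I, J)\<in>?K. \<Sum>h\<in>H I J. Q h (g - h) I (?c I) J (?d J)) =
  (\<Sum>(g1, g2, I1p, I2p, I1m, I2m) \<in> stable_splittings g np nm i. Q g1 g2 I1p I2p I1m I2m)"
  unfolding sum_splittings H_def ..
 finally show ?thesis unfolding S_def R_def Q_def Let_def .
qed

end

theorem theorem4:
  fixes g np nm :: nat and Lp Lm :: "real list"
  assumes "np \<ge> 1" and "nm \<ge> 1"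
    and "2 * int g - 2 + (int np + int nm) \<ge> 2"
    and "(Lp, Lm) \<in> Lambda np nm"
  shows "(2 * real g - 2 + (real np + real nm)) * V (int g) Lp Lm =
      1 / 2 * (\<Sum>(i, j) \<in> {(i, j). i < np \<and> j < np \<and> i \<noteq> j}.
        (Lp ! i + Lp ! j) * V (int g) ((Lp ! i + Lp ! j) # nths Lp (- {i, j})) Lm)
    + (\<Sum>i<np. \<Sum>j<nm.
        pos_part (Lp ! i - Lm ! j) *
          V (int g) (pos_part (Lp ! i - Lm ! j) # nths Lp (- {i})) (nths Lm (- {j})))
    + 1 / 2 * (\<Sum>i<np.
        (LBINT x:{0..Lp ! i}.
          V (int g - 1) (x # (Lp ! i - x) # nths Lp (- {i})) Lm * x * (Lp ! i - x)))
    + 1 / 2 * (\<Sum>i<np. \<Sum>(g1, g2, I1p, I2p, I1m, I2m) \<in> stable_splittings g np nm i.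
        let x1 = gap Lp Lm I1p I1m; x2 = gap Lp Lm I2p I2m in
          x1 * x2 *
            V (int g1) (x1 # nths Lp I1p) (nths Lm I1m) *
            V (int g2) (x2 # nths Lp I2p) (nths Lm I2m))"
  (is "_ = 1 / 2 * ?RA + (\<Sum>i<np. ?RG i) + 1 / 2 * (\<Sum>i<np. ?RB i) + 1 / 2 * (\<Sum>i<np. ?RC i)")
proof -
 note L = assms(4)
 define M where "M = nat (2 * int g - 3 + int np + int nm)"
 have M: "int M = 2 * int g - 3 + int np + int nm" "M > 0" using assms(3) by (auto simp: M_def)
 note D = LD[OF assms(1,2) M L]
 let ?W = "Wn (Suc (Suc (2 * M))) {..<np} {..<nm} ((!) Lp) ((!) Lm)"
 have V: "ennreal (fact (2 * Suc M) * V (int g) Lp Lm) = ?W"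
 proof -
  have "ennreal (fact (2 * Suc M) * V (int g) (map ((!) Lp) [0..<np]) (map ((!) Lm) [0..<nm])) = Wn (2 * Suc M) (set [0..<np]) (set [0..<nm]) ((!) Lp) ((!) Lm)"
   by (rule V_eq_Wn) (use M in auto)
  then show ?thesis using map_nth[of Lp] map_nth[of Lm] by (simp add: D(1,2) atLeast0LessThan)
 qed
 define A where "A = (\<Sum>(i, j)\<in>{(i, j)\<in>{..<np} \<times> {..<np}. i ~= j}. ennreal (Lp ! i + Lp ! j) * Wn (2 * M) ({..<np} - {j}) {..<nm} (((!) Lp)(i := Lp ! i + Lp ! j)) ((!) Lm))"
 define B where "B i = (\<integral>\<^sup>+x. ennreal x * ennreal (Lp ! i - x) * Wn (2 * M) (insert np {..<np}) {..<nm} (((!) Lp)(i := x, np := Lp ! i - x)) ((!) Lm) \<partial>lborel)" for i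
 define C where "C i = (\<Sum>(I1, J1)\<in>Pow ({..<np} - {i}) \<times> Pow {..<nm}. \<Sum>n\<le>2 * M. of_nat (2 * M choose n) *
   (stemn n i I1 J1 ((!) Lp) ((!) Lm) * stemn (2 * M - n) i ({..<np} - {i} - I1) ({..<nm} - J1) ((!) Lp) ((!) Lm)))" for i
 have rec: "?W = of_nat (Suc (2 * M)) * (A + (\<Sum>i<np. B i) + (\<Sum>i<np. C i))"
  unfolding A_def B_def C_def by (rule Wn_recursion) (use M(2) D in auto)
 have fact0: "0 \<le> (fact (2 * M) :: real)" by simp
 have A: "A = ennreal (fact (2 * M) * ?RA)" and RA0: "0 \<le> ?RA"
 proof -
  have set: "{(i, j)\<in>{..<np} \<times> {..<np}. i ~= j} = {(i, j). i < np & j < np & i ~= j}" by auto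
  show "0 \<le> ?RA" by (rule sum_nonneg) (auto intro: gapV_nonneg)
  have "A = (\<Sum>(i, j)\<in>{(i, j). i < np & j < np & i ~= j}. ennreal (fact (2 * M) * ((Lp ! i + Lp ! j) * V (int g) ((Lp ! i + Lp ! j) # nths Lp (- {i, j})) Lm)))"
   unfolding A_def set by (rule sum.cong[OF refl]) (use term_merge[OF assms(1,2) M L] in auto)
  also have "... = ennreal (fact (2 * M) * ?RA)"
   unfolding sum_distrib_left split_def by (rule sum_ennreal) (intro mult_nonneg_nonneg fact0 gapV_nonneg)
  finally show "A = ennreal (fact (2 * M) * ?RA)" .
 qed
 \<comment> \<open>The left-hand side is a real number, so every summand on the right is
   finite.\<close>
 have fin: "B i < \<infinity>" if "i < np" for i
 proof -
  have "?W < \<infinity>" unfolding V[symmetric] by simp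
  then have "(\<Sum>i<np. B i) < \<infinity>" unfolding rec by (auto simp: ennreal_mult_less_top)
  moreover have "B i \<le> (\<Sum>i<np. B i)" using that by (intro member_le_sum) auto
  ultimately show ?thesis by (rule le_less_trans[rotated])
 qed
 have B: "(\<Sum>i<np. B i) = ennreal (fact (2 * M) * (\<Sum>i<np. ?RB i))" and RB0: "0 \<le> (\<Sum>i<np. ?RB i)"
 proof -
  have 1: "B i = ennreal (fact (2 * M) * ?RB i)" "0 \<le> ?RB i" if "i < np" for i
   unfolding B_def using term_loop[OF assms(1,2) M L that fin[OF that, unfolded B_def]] by blast+
  show "0 \<le> (\<Sum>i<np. ?RB i)" by (rule sum_nonneg) (use 1(2) in auto)
  have "(\<Sum>i<np. B i) = (\<Sum>i<np. ennreal (fact (2 * M) * ?RB i))" by (rule sum.cong[OF refl]) (use 1(1) in auto)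
  also have "... = ennreal (fact (2 * M) * (\<Sum>i<np. ?RB i))"
   unfolding sum_distrib_left by (rule sum_ennreal) (use 1(2) in \<open>auto intro!: mult_nonneg_nonneg\<close>)
  finally show "(\<Sum>i<np. B i) = ennreal (fact (2 * M) * (\<Sum>i<np. ?RB i))" .
 qed
 have RG0: "0 \<le> ?RG i" for i by (intro sum_nonneg gapV_nonneg)
 have RC0: "0 \<le> ?RC i" for i
 proof (rule sum_nonneg)
  fix z assume "z \<in> stable_splittings g np nm i"
  obtain g1 g2 I1p I2p I1m I2m where z: "z = (g1, g2, I1p, I2p, I1m, I2m)" by (cases z)
  have "0 \<le> (gap Lp Lm I1p I1m * V (int g1) (gap Lp Lm I1p I1m # nths Lp I1p) (nths Lm I1m)) *
   (gap Lp Lm I2p I2m * V (int g2) (gap Lp Lm I2p I2m # nths Lp I2p) (nths Lm I2m))"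
   by (intro mult_nonneg_nonneg gapV_nonneg)
  then show "0 \<le> (case z of (g1, g2, I1p, I2p, I1m, I2m) => let x1 = gap Lp Lm I1p I1m; x2 = gap Lp Lm I2p I2m in
   x1 * x2 * V (int g1) (x1 # nths Lp I1p) (nths Lm I1m) * V (int g2) (x2 # nths Lp I2p) (nths Lm I2m))"
   unfolding z split_conv Let_def by (simp only: ac_simps)
 qed
 have C: "(\<Sum>i<np. C i) = ennreal (fact (2 * M) * (2 * (\<Sum>i<np. ?RG i) + (\<Sum>i<np. ?RC i)))"
 proof -
  have "(\<Sum>i<np. C i) = (\<Sum>i<np. ennreal (fact (2 * M) * (2 * ?RG i + ?RC i)))"
   unfolding C_def by (rule sum.cong[OF refl]) (rule term_separated[OF assms(1,2) M L], simp)
  also have "... = ennreal (\<Sum>i<np. fact (2 * M) * (2 * ?RG i + ?RC i))"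
   by (rule sum_ennreal) (intro mult_nonneg_nonneg add_nonneg_nonneg RG0 RC0 fact0, simp)
  also have "(\<Sum>i<np. fact (2 * M) * (2 * ?RG i + ?RC i)) = fact (2 * M) * (2 * (\<Sum>i<np. ?RG i) + (\<Sum>i<np. ?RC i))"
   by (simp only: sum_distrib_left sum.distrib distrib_left)
  finally show ?thesis .
 qed
 \<comment> \<open>Real arithmetic with (2M+2)! = 2(M+1)(2M+1)(2M)!. The factor 2M+1 cancels against
   the choices of the second edge, and M+1 = 2g-2+n is the factor of the statement; dividing by the
   remaining 2 gives the halves on the right, which the coefficient of \<open>rg\<close>
   absorbs.\<close>
 have key: "v = ra / 2 + rg + rb / 2 + rc / 2"
  if eq: "ennreal (fact (2 * Suc M) * w) = of_nat (Suc (2 * M)) * (ennreal (fact (2 * M) * ra) + ennreal (fact (2 * M) * rb) + ennreal (fact (2 * M) * (2 * rg + rc)))"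
   and nn: "0 \<le> w" "0 \<le> ra" "0 \<le> rb" "0 \<le> rg" "0 \<le> rc" and v: "v = real (Suc M) * w" for v w ra rb rg rc :: real
 proof -
  let ?f = "fact (2 * M) :: real"
  have "of_nat (Suc (2 * M)) * (ennreal (?f * ra) + ennreal (?f * rb) + ennreal (?f * (2 * rg + rc))) =
   ennreal (real (Suc (2 * M)) * (?f * ra + ?f * rb + ?f * (2 * rg + rc)))"
  proof -
   have add: "ennreal x + ennreal y + ennreal z = ennreal (x + y + z)" if "x \<ge> 0" "y \<ge> 0" "z \<ge> 0" for x y z
    using that by (simp flip: ennreal_plus)
   have "ennreal (?f * ra) + ennreal (?f * rb) + ennreal (?f * (2 * rg + rc)) = ennreal (?f * ra + ?f * rb + ?f * (2 * rg + rc))"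
    by (rule add) (use nn in auto)
   then show ?thesis unfolding ennreal_of_nat_eq_real_of_nat by (simp only: ennreal_mult'[OF of_nat_0_le_iff])
  qed
  then have "fact (2 * Suc M) * w = real (Suc (2 * M)) * (?f * ra + ?f * rb + ?f * (2 * rg + rc))"
   using eq nn by simp
  moreover have "(fact (2 * Suc M) :: real) = (2 * real (Suc M)) * (real (Suc (2 * M)) * ?f)" by (simp add: algebra_simps)
  ultimately have "(real (Suc (2 * M)) * ?f) * (2 * real (Suc M) * w) = (real (Suc (2 * M)) * ?f) * (ra + rb + 2 * rg + rc)"
   by (simp only: algebra_simps)
  then have "2 * real (Suc M) * w = ra + rb + 2 * rg + rc"
   by (simp only: mult_cancel_left) simp
  then have "2 * (real (Suc M) * w) = ra + rb + 2 * rg + rc" by (simp only: mult.assoc)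
  then show ?thesis unfolding v by linarith
 qed
 have "real (Suc M) = 2 * real g - 2 + (real np + real nm)"
  using arg_cong[OF M(1), of real_of_int] by simp
 then have v: "(2 * real g - 2 + (real np + real nm)) * V (int g) Lp Lm = real (Suc M) * V (int g) Lp Lm" by simp
 have "(2 * real g - 2 + (real np + real nm)) * V (int g) Lp Lm = ?RA / 2 + (\<Sum>i<np. ?RG i) + (\<Sum>i<np. ?RB i) / 2 + (\<Sum>i<np. ?RC i) / 2"
  by (rule key[OF V[unfolded rec A B C] V_nonneg RA0 RB0 sum_nonneg[OF RG0] sum_nonneg[OF RC0] v])
 then show ?thesis by simp
qed

end
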